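(* Let $d\ge 1$, $T>0$, let $b:[0,T]\times\mathbb{R}^d\to\mathbb{R}^d$ be a vector field with $b\in L^2_{\mathrm{loc}}([0,T]\times\mathbb{R}^d)$ and $\operatorname{div} b\in L^1([0,T];L^\infty(\mathbb{R}^d))$, and let $u_0\in L^2(\mathbb{R}^d)\cap L^\infty(\mathbb{R}^d)$. Let $u$ be a quasiregular weak solution of the Cauchy problem $$\partial_t u(t,x,\omega)+\Big(b(t,x)+\frac{dB_t}{dt}(\omega)\Big)\cdot\nabla u(t,x,\omega)=0,\qquad u|_{t=0}=u_0,$$ (with the noise understood in the Stratonovich sense). Then for each $h\in L^2([0,T];\mathbb{R}^d)$, with associated stochastic exponential $$F=\exp\Big(\int_0^T h(s)\cdot dB_s-\tfrac12\int_0^T|h(s)|^2\,ds\Big)\in\mathcal{X},$$ the deterministic function $V(t,x):=\mathbb{E}[u(t,x)F]$ satisfies in the weak sense the parabolic equation $$\partial_t V(t,x)+\big(b(t,x)+h(t)\big)\cdot\nabla V(t,x)=\tfrac12\Delta V(t,x),$$ with initial condition $V(0,\cdot)=u_0$.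
   Context: Setting. A probability space $(\Omega,\mathcal{F},\mathbb{P})$ is fixed, carrying a standard $\mathbb{R}^d$-valued Brownian motion $B_t=(B^1_t,\dots,B^d_t)$, $t\in[0,T]$. The filtration $\mathcal{F}_t$ is the natural filtration of the Brownian motion, and $\mathcal{F}=\mathcal{F}_T$, augmented by the $\mathbb{P}$-negligible sets. $\operatorname{div}$, $\nabla$, $\Delta$ and $\partial_i$ are taken with respect to the space variable $x$ (distributional divergence of $b$). Summation over repeated indices is understood, and $\circ\, dB$ denotes Stratonovich integration. Stochastic exponentials. $$\mathcal{X}:=\Big\{F=\exp\Big(\int_0^T h(s)\cdot dB_s-\tfrac12\int_0^T|h(s)|^2\,ds\Big)\ \Big|\ h\in L^2([0,T];\mathbb{R}^d)\Big\}.$$ Definition (quasiregular weak solution). A stochastic process $u\in L^2\cap L^\infty(\Omega\times[0,T]\times\mathbb{R}^d)$ is a quasiregular weak solution of the Cauchy problem when: (1) (Weak solution) For any $\varphi\in C_c^\infty(\mathbb{R}^d)$, the real-valued process $\int_{\mathbb{R}^d} u(t,x)\varphi(x)\,dx$ has a continuous modification which is an $\mathcal{F}_t$-semimartingale, and for all $t\in[0,T]$, $\mathbb{P}$-almost surely $$\int_{\mathbb{R}^d}u(t,x)\varphi(x)\,dx=\int_{\mathbb{R}^d}u_0(x)\varphi(x)\,dx+\int_0^t\!\int_{\mathbb{R}^d}u(s,x)\,b^i(s,x)\,\partial_i\varphi(x)\,dx\,ds+\int_0^t\!\int_{\mathbb{R}^d}\operatorname{div}b(s,x)\,u(s,x)\,\varphi(x)\,dx\,ds+\int_0^t\!\int_{\mathbb{R}^d}u(s,x)\,\partial_i\varphi(x)\,dx\circ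 dB^i_s.$$ (2) (Regularity in mean) For each $F\in\mathcal{X}$, the deterministic function $V(t,x):=\mathbb{E}[u(t,x)F]$ is a measurable bounded function which belongs to $L^2([0,T];H^1(\mathbb{R}^d))\cap C([0,T];L^2(\mathbb{R}^d))$. Weak sense for the parabolic equation. $V$ satisfies the parabolic equation in the weak sense if for each $\varphi\in C_c^\infty(\mathbb{R}^d)$ and each $t\in[0,T]$ $$\int_{\mathbb{R}^d}V(t,x)\varphi(x)\,dx=\int_{\mathbb{R}^d}V(0,x)\varphi(x)\,dx+\int_0^t\!\int_{\mathbb{R}^d}V(s,x)\big(b(s,x)\cdot\nabla\varphi(x)+\varphi(x)\operatorname{div}b(s,x)\big)\,dx\,ds+\int_0^t\!\int_{\mathbb{R}^d}V(s,x)\,h(s)\cdot\nabla\varphi(x)\,dx\,ds-\tfrac12\int_0^t\!\int_{\mathbb{R}^d}\nabla V(s,x)\cdot\nabla\varphi(x)\,dx\,ds.$$ *)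

theory Defs
  imports "HOL-Probability.Probability"
begin

section \<open>Function spaces\<close>

text \<open>
  Elements of Lebesgue spaces are represented by measurable functions (Borel in the variables
  of time and space); equalities between them hold almost everywhere.
\<close>

definition time :: "real \<Rightarrow> real measure" where
  "time T = restrict_space lborel {0..T}"

definition square_integrable :: "'a measure \<Rightarrow> ('a \<Rightarrow> 'b::euclidean_space) \<Rightarrow> bool" where
  "square_integrable N f \<longleftrightarrow> f \<in> borel_measurable N \<and> integrable N (\<lambda>x. (norm (f x))\<^sup>2)"

definition essentially_bounded :: "'a measure \<Rightarrow> ('a \<Rightarrow> 'b::euclidean_space) \<Rightarrow> bool" where
  "essentially_bounded N f \<longleftrightarrow> f \<in> borel_measurable N \<and> (\<exists>C. AE x in N. norm (f x) \<le> C)"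

definition L2_loc :: "real \<Rightarrow> (real \<Rightarrow> real^'n \<Rightarrow> real^'n) \<Rightarrow> bool" where
  "L2_loc T b \<longleftrightarrow>
     (\<lambda>(t, x). b t x) \<in> borel_measurable (time T \<Otimes>\<^sub>M lborel) \<and>
     (\<forall>K. compact K \<longrightarrow>
        set_integrable (time T \<Otimes>\<^sub>M lborel) K (\<lambda>(t, x). (norm (b t x))\<^sup>2))"

definition L1_Linfty :: "real \<Rightarrow> (real \<Rightarrow> real^'n \<Rightarrow> real) \<Rightarrow> bool" where
  "L1_Linfty T f \<longleftrightarrow>
     (\<lambda>(t, x). f t x) \<in> borel_measurable (time T \<Otimes>\<^sub>M lborel) \<and>
     (\<integral>\<^sup>+t. esssup lborel (\<lambda>x. ennreal \<bar>f t x\<bar>) \<partial>time T) < \<infinity>"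

fun continuously_differentiable :: "nat \<Rightarrow> ('a::euclidean_space \<Rightarrow> real) \<Rightarrow> bool" where
  "continuously_differentiable 0 f \<longleftrightarrow> continuous_on UNIV f"
| "continuously_differentiable (Suc k) f \<longleftrightarrow>
     (\<forall>x. f differentiable (at x)) \<and>
     (\<forall>v. continuously_differentiable k (\<lambda>x. frechet_derivative f (at x) v))"

definition test_function :: "'a::euclidean_space set \<Rightarrow> ('a \<Rightarrow> real) \<Rightarrow> bool" where
  "test_function S \<phi> \<longleftrightarrow>
     (\<forall>k. continuously_differentiable k \<phi>) \<and>
     compact (closure {x. \<phi> x \<noteq> 0}) \<and> closure {x. \<phi> x \<noteq> 0} \<subseteq> S"

definition partial :: "'n \<Rightarrow> (real^'n \<Rightarrow> real) \<Rightarrow> real^'n \<Rightarrow> real" where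
  "partial i \<phi> x = frechet_derivative \<phi> (at x) (axis i 1)"

definition gradient :: "(real^'n \<Rightarrow> real) \<Rightarrow> real^'n \<Rightarrow> real^'n" where
  "gradient \<phi> x = (\<chi> i. partial i \<phi> x)"

text \<open>Divergence in the space variable, in the sense of distributions on \<open>(0,T) \<times> \<real>\<^sup>d\<close>.\<close>

definition distributional_divergence ::
    "real \<Rightarrow> (real \<Rightarrow> real^'n \<Rightarrow> real^'n) \<Rightarrow> (real \<Rightarrow> real^'n \<Rightarrow> real) \<Rightarrow> bool" where
  "distributional_divergence T b divb \<longleftrightarrow>
     (\<forall>\<psi>. test_function ({0<..<T} \<times> UNIV) \<psi> \<longrightarrow>
        (LINT (t, x)|(time T \<Otimes>\<^sub>M lborel). b t x \<bullet> gradient (\<lambda>y. \<psi> (t, y)) x) =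
        - (LINT (t, x)|(time T \<Otimes>\<^sub>M lborel). divb t x * \<psi> (t, x)))"

text \<open>\<open>f\<close> belongs to \<open>H\<^sup>1(\<real>\<^sup>d)\<close> and \<open>g\<close> is its weak gradient.\<close>

definition H1_gradient :: "(real^'n \<Rightarrow> real) \<Rightarrow> (real^'n \<Rightarrow> real^'n) \<Rightarrow> bool" where
  "H1_gradient f g \<longleftrightarrow>
     square_integrable lborel f \<and> square_integrable lborel g \<and>
     (\<forall>\<phi> i. test_function UNIV \<phi> \<longrightarrow>
        (LINT x|lborel. f x * partial i \<phi> x) = - (LINT x|lborel. g x $ i * \<phi> x))"

text \<open>\<open>V\<close> belongs to \<open>L\<^sup>2([0,T]; H\<^sup>1(\<real>\<^sup>d))\<close> and \<open>G\<close> is its spatial weak gradient.\<close>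

definition L2_H1_gradient ::
    "real \<Rightarrow> (real \<Rightarrow> real^'n \<Rightarrow> real) \<Rightarrow> (real \<Rightarrow> real^'n \<Rightarrow> real^'n) \<Rightarrow> bool" where
  "L2_H1_gradient T V G \<longleftrightarrow>
     square_integrable (time T \<Otimes>\<^sub>M lborel) (\<lambda>(t, x). V t x) \<and>
     square_integrable (time T \<Otimes>\<^sub>M lborel) (\<lambda>(t, x). G t x) \<and>
     (AE t in time T. H1_gradient (V t) (G t))"

definition continuous_in_L2 :: "real \<Rightarrow> (real \<Rightarrow> real^'n \<Rightarrow> real) \<Rightarrow> bool" where
  "continuous_in_L2 T V \<longleftrightarrow>
     (\<forall>t\<in>{0..T}. square_integrable lborel (V t) \<and>
        ((\<lambda>s. LINT x|lborel. (V s x - V t x)\<^sup>2) \<longlongrightarrow> 0) (at t within {0..T}))"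


section \<open>Brownian motion and its filtration\<close>

definition past_events :: "'w measure \<Rightarrow> (real \<Rightarrow> 'w \<Rightarrow> real^'n) \<Rightarrow> real \<Rightarrow> 'w set set" where
  "past_events M B t =
     sigma_sets (space M) {B s -` A \<inter> space M | s A. s \<in> {0..t} \<and> A \<in> sets borel}"

definition brownian_filtration ::
    "'w measure \<Rightarrow> (real \<Rightarrow> 'w \<Rightarrow> real^'n) \<Rightarrow> real \<Rightarrow> 'w measure" where
  "brownian_filtration M B t = sigma (space M) (past_events M B t \<union> null_sets M)"

locale brownian_space = prob_space M + complete_measure M
  for M :: "'w measure" and B :: "real \<Rightarrow> 'w \<Rightarrow> real^'n" and T :: real +
  assumes B_measurable: "t \<in> {0..T} \<Longrightarrow> B t \<in> borel_measurable M"
    and B_zero: "AE \<omega> in M. B 0 \<omega> = 0"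
    and B_continuous: "AE \<omega> in M. continuous_on {0..T} (\<lambda>t. B t \<omega>)"
    and B_increment_normal: "\<lbrakk>0 \<le> s; s < t; t \<le> T\<rbrakk> \<Longrightarrow>
          distributed M lborel (\<lambda>\<omega>. (B t \<omega> - B s \<omega>) $ i) (normal_density 0 (sqrt (t - s)))"
    and B_increment_components: "\<lbrakk>0 \<le> s; s < t; t \<le> T\<rbrakk> \<Longrightarrow>
          indep_vars (\<lambda>_. borel) (\<lambda>i \<omega>. (B t \<omega> - B s \<omega>) $ i) UNIV"
    and B_increment_past: "\<lbrakk>0 \<le> s; s < t; t \<le> T\<rbrakk> \<Longrightarrow>
          indep_set {(\<lambda>\<omega>. B t \<omega> - B s \<omega>) -` A \<inter> space M | A. A \<in> sets borel} (past_events M B s)"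
    and sets_final: "sets M = sets (brownian_filtration M B T)"


section \<open>Continuous semimartingales\<close>

definition is_partition :: "real \<Rightarrow> real \<Rightarrow> nat \<Rightarrow> (nat \<Rightarrow> real) \<Rightarrow> bool" where
  "is_partition a c n p \<longleftrightarrow> p 0 = a \<and> p n = c \<and> (\<forall>k<n. p k \<le> p (Suc k))"

definition adapted :: "(real \<Rightarrow> 'w measure) \<Rightarrow> real \<Rightarrow> (real \<Rightarrow> 'w \<Rightarrow> real) \<Rightarrow> bool" where
  "adapted F T X \<longleftrightarrow> (\<forall>t\<in>{0..T}. X t \<in> borel_measurable (F t))"

definition continuous_paths :: "'w measure \<Rightarrow> real \<Rightarrow> (real \<Rightarrow> 'w \<Rightarrow> real) \<Rightarrow> bool" where
  "continuous_paths M T X \<longleftrightarrow> (AE \<omega> in M. continuous_on {0..T} (\<lambda>t. X t \<omega>))"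

definition martingale ::
    "'w measure \<Rightarrow> (real \<Rightarrow> 'w measure) \<Rightarrow> real \<Rightarrow> (real \<Rightarrow> 'w \<Rightarrow> real) \<Rightarrow> bool" where
  "martingale M F T X \<longleftrightarrow>
     adapted F T X \<and> (\<forall>t\<in>{0..T}. integrable M (X t)) \<and>
     (\<forall>s t. 0 \<le> s \<and> s \<le> t \<and> t \<le> T \<longrightarrow> (AE \<omega> in M. real_cond_exp M (F s) (X t) \<omega> = X s \<omega>))"

definition local_martingale ::
    "'w measure \<Rightarrow> (real \<Rightarrow> 'w measure) \<Rightarrow> real \<Rightarrow> (real \<Rightarrow> 'w \<Rightarrow> real) \<Rightarrow> bool" where
  "local_martingale M F T X \<longleftrightarrow>
     adapted F T X \<and>
     (\<exists>\<tau> :: nat \<Rightarrow> 'w \<Rightarrow> real.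
        (\<forall>n. stopping_time F (\<tau> n)) \<and>
        (\<forall>n. \<forall>\<omega>\<in>space M. 0 \<le> \<tau> n \<omega> \<and> \<tau> n \<omega> \<le> \<tau> (Suc n) \<omega> \<and> \<tau> n \<omega> \<le> T) \<and>
        (AE \<omega> in M. \<exists>n. \<tau> n \<omega> = T) \<and>
        (\<forall>n. martingale M F T (\<lambda>t \<omega>. X (min t (\<tau> n \<omega>)) \<omega> - X 0 \<omega>)))"

definition finite_variation :: "'w measure \<Rightarrow> real \<Rightarrow> (real \<Rightarrow> 'w \<Rightarrow> real) \<Rightarrow> bool" where
  "finite_variation M T A \<longleftrightarrow>
     (AE \<omega> in M. \<exists>C. \<forall>n p. is_partition 0 T n p \<longrightarrow>
        (\<Sum>k<n. \<bar>A (p (Suc k)) \<omega> - A (p k) \<omega>\<bar>) \<le> C)"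

text \<open>
  For a semimartingale with continuous paths, both parts of the decomposition can be taken
  continuous.
\<close>

definition continuous_semimartingale ::
    "'w measure \<Rightarrow> (real \<Rightarrow> 'w measure) \<Rightarrow> real \<Rightarrow> (real \<Rightarrow> 'w \<Rightarrow> real) \<Rightarrow> bool" where
  "continuous_semimartingale M F T X \<longleftrightarrow>
     adapted F T X \<and> continuous_paths M T X \<and>
     (\<exists>N A. continuous_paths M T N \<and> local_martingale M F T N \<and>
        adapted F T A \<and> continuous_paths M T A \<and> finite_variation M T A \<and>
        (AE \<omega> in M. \<forall>t\<in>{0..T}. X t \<omega> = N t \<omega> + A t \<omega>))"


section \<open>Stochastic integrals\<close>

text \<open>
  \<open>stratonovich_integral M X Y t I\<close>: the random variable \<open>I\<close> is \<open>\<integral>\<^sub>0\<^sup>t X \<circ> dY\<close>, defined as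
  the limit in probability of the symmetric Riemann sums as the mesh of the partition
  tends to 0.  Each sum involves only finitely many times, so replacing \<open>X\<close> or \<open>Y\<close> by a
  modification does not change the integral.
\<close>

definition stratonovich_integral ::
    "'w measure \<Rightarrow> (real \<Rightarrow> 'w \<Rightarrow> real) \<Rightarrow> (real \<Rightarrow> 'w \<Rightarrow> real) \<Rightarrow> real \<Rightarrow> ('w \<Rightarrow> real) \<Rightarrow> bool" where
  "stratonovich_integral M X Y t I \<longleftrightarrow>
     I \<in> borel_measurable M \<and>
     (\<forall>\<epsilon>>0. \<exists>\<delta>>0. \<forall>n p. is_partition 0 t n p \<and> (\<forall>k<n. p (Suc k) - p k < \<delta>) \<longrightarrow>
        measure M {\<omega>\<in>space M.
          \<bar>(\<Sum>k<n. (X (p (Suc k)) \<omega> + X (p k) \<omega>) / 2 * (Y (p (Suc k)) \<omega> - Y (p k) \<omega>)) - I \<omega>\<bar> > \<epsilon>}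
        < \<epsilon>)"

text \<open>
  \<open>wiener_integral M B T h W\<close>: the random variable \<open>W\<close> is \<open>\<integral>\<^sub>0\<^sup>T h(s) \<cdot> dB\<^sub>s\<close>, the limit in
  \<open>L\<^sup>2(\<Omega>)\<close> of the elementary integrals of step functions converging to \<open>h\<close> in \<open>L\<^sup>2([0,T])\<close>.
\<close>

definition wiener_integral ::
    "'w measure \<Rightarrow> (real \<Rightarrow> 'w \<Rightarrow> real^'n) \<Rightarrow> real \<Rightarrow> (real \<Rightarrow> real^'n) \<Rightarrow> ('w \<Rightarrow> real) \<Rightarrow> bool" where
  "wiener_integral M B T h W \<longleftrightarrow>
     W \<in> borel_measurable M \<and>
     (\<exists>(n :: nat \<Rightarrow> nat) (p :: nat \<Rightarrow> nat \<Rightarrow> real) (c :: nat \<Rightarrow> nat \<Rightarrow> real^'n).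
        (\<forall>j. is_partition 0 T (n j) (p j)) \<and>
        (\<lambda>j. \<integral>\<^sup>+s. ennreal ((norm (h s -
            (\<Sum>k<n j. indicator {p j k<..p j (Suc k)} s *\<^sub>R c j k)))\<^sup>2) \<partial>time T) \<longlonglongrightarrow> 0 \<and>
        (\<lambda>j. \<integral>\<^sup>+\<omega>. ennreal ((W \<omega> -
            (\<Sum>k<n j. c j k \<bullet> (B (p j (Suc k)) \<omega> - B (p j k) \<omega>)))\<^sup>2) \<partial>M) \<longlonglongrightarrow> 0)"

definition stochastic_exponential ::
    "real \<Rightarrow> (real \<Rightarrow> real^'n) \<Rightarrow> ('w \<Rightarrow> real) \<Rightarrow> 'w \<Rightarrow> real" where
  "stochastic_exponential T h W \<omega> = exp (W \<omega> - 1/2 * (LINT s:{0..T}|lborel. (norm (h s))\<^sup>2))"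

definition stochastic_exponentials ::
    "'w measure \<Rightarrow> (real \<Rightarrow> 'w \<Rightarrow> real^'n) \<Rightarrow> real \<Rightarrow> ('w \<Rightarrow> real) set" where
  "stochastic_exponentials M B T =
     {stochastic_exponential T h W | h W.
        square_integrable (time T) h \<and> wiener_integral M B T h W}"


section \<open>The stochastic transport equation\<close>

definition weak_solution ::
    "'w measure \<Rightarrow> (real \<Rightarrow> 'w \<Rightarrow> real^'n) \<Rightarrow> real \<Rightarrow>
     (real \<Rightarrow> real^'n \<Rightarrow> real^'n) \<Rightarrow> (real \<Rightarrow> real^'n \<Rightarrow> real) \<Rightarrow>
     (real^'n \<Rightarrow> real) \<Rightarrow> (real \<Rightarrow> real^'n \<Rightarrow> 'w \<Rightarrow> real) \<Rightarrow> bool" where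
  "weak_solution M B T b divb u0 u \<longleftrightarrow>
     (\<forall>\<phi>. test_function UNIV \<phi> \<longrightarrow>
        (\<exists>Y. continuous_semimartingale M (brownian_filtration M B) T Y \<and>
           (\<forall>t\<in>{0..T}. AE \<omega> in M. Y t \<omega> = (LINT x|lborel. u t x \<omega> * \<phi> x))) \<and>
        (\<forall>t\<in>{0..T}. \<exists>I.
           (\<forall>i. stratonovich_integral M
              (\<lambda>s \<omega>. LINT x|lborel. u s x \<omega> * partial i \<phi> x) (\<lambda>s \<omega>. B s \<omega> $ i) t (I i)) \<and>
           (AE \<omega> in M.
              (LINT x|lborel. u t x \<omega> * \<phi> x) =
                (LINT x|lborel. u0 x * \<phi> x)
                + (LINT s:{0..t}|lborel. LINT x|lborel. u s x \<omega> * (b s x \<bullet> gradient \<phi> x))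
                + (LINT s:{0..t}|lborel. LINT x|lborel. divb s x * u s x \<omega> * \<phi> x)
                + (\<Sum>i\<in>UNIV. I i \<omega>))))"

text \<open>
  The process \<open>u\<close> is only bounded almost everywhere, so boundedness of its weighted mean \<open>V\<close>
  is meant up to null sets of \<open>x\<close>, uniformly over all times.
\<close>

definition regular_in_mean ::
    "'w measure \<Rightarrow> (real \<Rightarrow> 'w \<Rightarrow> real^'n) \<Rightarrow> real \<Rightarrow> (real \<Rightarrow> real^'n \<Rightarrow> 'w \<Rightarrow> real) \<Rightarrow> bool" where
  "regular_in_mean M B T u \<longleftrightarrow>
     (\<forall>F\<in>stochastic_exponentials M B T.
        let V = (\<lambda>t x. LINT \<omega>|M. u t x \<omega> * F \<omega>) in
          (\<lambda>(t, x). V t x) \<in> borel_measurable (time T \<Otimes>\<^sub>M lborel) \<and>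
          (\<exists>C. \<forall>t\<in>{0..T}. AE x in lborel. \<bar>V t x\<bar> \<le> C) \<and>
          (\<exists>G. L2_H1_gradient T V G) \<and>
          continuous_in_L2 T V)"

definition quasiregular_weak_solution ::
    "'w measure \<Rightarrow> (real \<Rightarrow> 'w \<Rightarrow> real^'n) \<Rightarrow> real \<Rightarrow>
     (real \<Rightarrow> real^'n \<Rightarrow> real^'n) \<Rightarrow> (real \<Rightarrow> real^'n \<Rightarrow> real) \<Rightarrow>
     (real^'n \<Rightarrow> real) \<Rightarrow> (real \<Rightarrow> real^'n \<Rightarrow> 'w \<Rightarrow> real) \<Rightarrow> bool" where
  "quasiregular_weak_solution M B T b divb u0 u \<longleftrightarrow>
     square_integrable (M \<Otimes>\<^sub>M (time T \<Otimes>\<^sub>M lborel)) (\<lambda>(\<omega>, t, x). u t x \<omega>) \<and>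
     essentially_bounded (M \<Otimes>\<^sub>M (time T \<Otimes>\<^sub>M lborel)) (\<lambda>(\<omega>, t, x). u t x \<omega>) \<and>
     weak_solution M B T b divb u0 u \<and>
     regular_in_mean M B T u"

text \<open>
  Weak sense of \<open>\<partial>\<^sub>t V + (b + h) \<cdot> \<nabla>V = \<Delta>V / 2\<close>; the weak gradient \<open>G = \<nabla>V\<close> is unique up to
  null sets.
\<close>

definition parabolic_weak_solution ::
    "real \<Rightarrow> (real \<Rightarrow> real^'n \<Rightarrow> real^'n) \<Rightarrow> (real \<Rightarrow> real^'n \<Rightarrow> real) \<Rightarrow>
     (real \<Rightarrow> real^'n) \<Rightarrow> (real \<Rightarrow> real^'n \<Rightarrow> real) \<Rightarrow> bool" where
  "parabolic_weak_solution T b divb h V \<longleftrightarrow>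
     (\<exists>G. L2_H1_gradient T V G \<and>
        (\<forall>\<phi>. test_function UNIV \<phi> \<longrightarrow> (\<forall>t\<in>{0..T}.
           (LINT x|lborel. V t x * \<phi> x) =
             (LINT x|lborel. V 0 x * \<phi> x)
             + (LINT s:{0..t}|lborel. LINT x|lborel.
                  V s x * (b s x \<bullet> gradient \<phi> x + \<phi> x * divb s x))
             + (LINT s:{0..t}|lborel. LINT x|lborel. V s x * (h s \<bullet> gradient \<phi> x))
             - 1/2 * (LINT s:{0..t}|lborel. LINT x|lborel. G s x \<bullet> gradient \<phi> x))))"

end

theory Submission
  imports Defs
begin

text \<open>
Write \<open>X\<^sup>\<phi>(t)\<close> for the spatial average of \<open>u(t)\<close> against a test function \<open>\<phi>\<close>. The weak form of the
transport equation says that \<open>X\<^sup>\<phi>\<close> is a constant plus a drift of bounded variation plus the sum over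
\<open>i\<close> of the Stratonovich integrals of \<open>X\<^sup>\<psi>\<close> against \<open>B\<^sup>i\<close>, where \<open>\<psi> = \<partial>\<^sub>i\<phi>\<close>. The equation for \<open>V\<close> is
obtained by multiplying with the stochastic exponential \<open>F\<close> and taking expectations. Two effects
appear. The Ito correction of each Stratonovich integral is half the covariation of \<open>X\<^sup>\<psi>\<close> with
\<open>B\<^sup>i\<close>; reading it off from the equation satisfied by \<open>X\<^sup>\<psi>\<close> itself, it is half the time
integral of the average against \<open>\<partial>\<^sub>i\<partial>\<^sub>i\<phi>\<close>, which is the source of the Laplacian. The remaining Ito
integral has, weighted by \<open>F\<close>, the expectation that Girsanov's theorem predicts: \<open>dB\<^sup>i\<close> is replaced
by \<open>h\<^sub>i ds\<close>, which is the source of the transport by \<open>h\<close>.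

Neither Ito integrals nor quadratic variations are constructed; everything is done with Riemann
sums along uniform grids. The lemmas that carry the argument are the following.

\<^item> \<open>tight_qvar_semimartingale\<close>: for a continuous semimartingale the sums of squared increments
  are bounded in probability. The decomposition of a semimartingale enters only here.
\<^item> \<open>covariation_tendsto\<close>: if the increments of \<open>X\<close> are those of a drift plus Stratonovich integrals
  of \<open>Z\<^sub>j\<close> against \<open>B\<^sup>j\<close>, then the covariation sums of \<open>X\<close> with \<open>B\<^sup>i\<close> approach the Riemann sums
  of \<open>Z\<^sub>i\<close> in probability.
\<^item> \<open>girsanov\<close>: \<open>F\<close> has a fourth moment and mean 1, and \<open>E[F G (B\<^sub>t - B\<^sub>s)]\<close> equals \<open>E[F G]\<close> times the
  integral of \<open>h\<close> over \<open>[s,t]\<close> for every bounded \<open>G\<close> known at time \<open>s\<close>.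
\<^item> \<open>expectation_stratonovich_integral\<close>: the combination of the previous two. Symmetric sums are
  Ito sums plus half the covariation sums. Convergence in probability passes to expectations
  because the Ito sums are bounded in mean square and the sum over \<open>i\<close> of the Stratonovich
  integrals is bounded: by the equation it is a difference of bounded quantities.
\<^item> \<open>mean_equation\<close>: Fubini's theorem turns the weighted averages into integrals of \<open>V\<close>.

The weighted averages of \<open>u\<close> are computed by Fubini only at almost every time, since \<open>u(t)\<close> may fail
to be bounded for exceptional \<open>t\<close>. Both sides of the resulting identity are continuous in \<open>t\<close>, which
extends it to all times. At \<open>t = 0\<close> the equation reduces to equality of \<open>V(0)\<close> and \<open>u\<^sub>0\<close> against all
test functions, and \<open>AE_zero_if_orthogonal_to_test_functions\<close> concludes.
\<close>

section \<open>Convergence in probability\<close>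

context prob_space
begin

text \<open>
Convergence in probability is convergence to 0 of this functional. In contrast to the probability
of exceeding a threshold it is subadditive, so that the errors of several approximations add up.
\<close>

definition prob_size :: "('a \<Rightarrow> real) \<Rightarrow> real" where
  "prob_size f = expectation (\<lambda>\<omega>. min 1 \<bar>f \<omega>\<bar>)"

lemma integrable_min_one:
  assumes [measurable]: "f \<in> borel_measurable M"
  shows "integrable M (\<lambda>\<omega>. min 1 \<bar>f \<omega> :: real\<bar>)"
  by (rule integrable_const_bound[where B = 1]) auto

lemma prob_size_nonneg: "0 \<le> prob_size f"
  unfolding prob_size_def by (rule Bochner_Integration.integral_nonneg) auto

lemma prob_size_mono_AE:
  assumes [measurable]: "f \<in> borel_measurable M" "g \<in> borel_measurable M"
    and "AE \<omega> in M. \<bar>f \<omega>\<bar> \<le> \<bar>g \<omega>\<bar>"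
  shows "prob_size f \<le> prob_size g"
  unfolding prob_size_def
  by (rule integral_mono_AE) (use assms(3) in \<open>auto intro!: integrable_min_one elim!: eventually_mono\<close>)

lemma prob_size_add:
  assumes [measurable]: "f \<in> borel_measurable M" "g \<in> borel_measurable M"
  shows "prob_size (\<lambda>\<omega>. f \<omega> + g \<omega>) \<le> prob_size f + prob_size g"
proof -
  have "prob_size (\<lambda>\<omega>. f \<omega> + g \<omega>) \<le> expectation (\<lambda>\<omega>. min 1 \<bar>f \<omega>\<bar> + min 1 \<bar>g \<omega>\<bar>)"
    unfolding prob_size_def
    by (rule integral_mono) (auto intro!: integrable_min_one Bochner_Integration.integrable_add)
  then show ?thesis
    unfolding prob_size_def
    by (subst (asm) Bochner_Integration.integral_add) (auto intro!: integrable_min_one)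
qed

lemma prob_size_sum:
  assumes "finite S" "\<And>i. i \<in> S \<Longrightarrow> f i \<in> borel_measurable M"
  shows "prob_size (\<lambda>\<omega>. \<Sum>i\<in>S. f i \<omega>) \<le> (\<Sum>i\<in>S. prob_size (f i))"
  using assms
proof (induction S)
  case empty
  then show ?case by (simp add: prob_size_def)
next
  case (insert i S)
  have "prob_size (\<lambda>\<omega>. f i \<omega> + (\<Sum>j\<in>S. f j \<omega>)) \<le> prob_size (f i) + prob_size (\<lambda>\<omega>. \<Sum>j\<in>S. f j \<omega>)"
    using insert.prems by (intro prob_size_add) auto
  with insert show ?case by simp
qed

lemma prob_size_le_expectation:
  assumes "integrable M f"
  shows "prob_size f \<le> expectation (\<lambda>\<omega>. \<bar>f \<omega>\<bar>)"
  unfolding prob_size_def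
  using assms by (intro integral_mono) (auto intro!: integrable_min_one)

lemma prob_size_le_prob:
  assumes [measurable]: "f \<in> borel_measurable M" and "0 \<le> e"
  shows "prob_size f \<le> e + prob {\<omega>\<in>space M. \<bar>f \<omega>\<bar> > e}"
proof -
  have "prob_size f \<le> expectation (\<lambda>\<omega>. e + indicator {\<omega>\<in>space M. \<bar>f \<omega>\<bar> > e} \<omega>)"
    unfolding prob_size_def using \<open>0 \<le> e\<close>
    by (intro integral_mono integrable_min_one Bochner_Integration.integrable_add
        integrable_real_indicator) (auto simp: less_top[symmetric] split: split_indicator)
  also have "\<dots> = e + prob {\<omega>\<in>space M. \<bar>f \<omega>\<bar> > e}"
    by (subst Bochner_Integration.integral_add) (auto simp: less_top[symmetric] prob_space)
  finally show ?thesis .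
qed

text \<open>
Cutting \<open>g\<close> at level \<open>L\<close>: a factor that tends to 0 in probability suppresses one that is only bounded
in probability (see \<open>prob_size_mult_tight\<close>).
\<close>

lemma prob_size_mult_le:
  assumes [measurable]: "f \<in> borel_measurable M" "g \<in> borel_measurable M" and "1 \<le> L"
  shows "prob_size (\<lambda>\<omega>. f \<omega> * g \<omega>) \<le> L * prob_size f + prob {\<omega>\<in>space M. \<bar>g \<omega>\<bar> > L}"
proof -
  have le: "min 1 \<bar>f \<omega> * g \<omega>\<bar> \<le> L * min 1 \<bar>f \<omega>\<bar> + indicator {\<omega>\<in>space M. \<bar>g \<omega>\<bar> > L} \<omega>"
    if "\<omega> \<in> space M" for \<omega>
  proof (cases "\<bar>g \<omega>\<bar> > L")
    case True
    have "0 \<le> L * min 1 \<bar>f \<omega>\<bar>" using \<open>1 \<le> L\<close> by auto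
    moreover have "min 1 \<bar>f \<omega> * g \<omega>\<bar> \<le> 1" by simp
    ultimately show ?thesis using True that by simp
  next
    case False
    have "\<bar>f \<omega> * g \<omega>\<bar> \<le> L * \<bar>f \<omega>\<bar>"
      using False mult_left_mono[of "\<bar>g \<omega>\<bar>" L "\<bar>f \<omega>\<bar>"] by (simp add: abs_mult mult.commute)
    then show ?thesis using False that \<open>1 \<le> L\<close> by (auto simp: min_def)
  qed
  have "prob_size (\<lambda>\<omega>. f \<omega> * g \<omega>)
      \<le> expectation (\<lambda>\<omega>. L * min 1 \<bar>f \<omega>\<bar> + indicator {\<omega>\<in>space M. \<bar>g \<omega>\<bar> > L} \<omega>)"
    unfolding prob_size_def using le
    by (intro integral_mono integrable_min_one Bochner_Integration.integrable_add
        Bochner_Integration.integrable_mult_right) (auto simp: less_top[symmetric])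
  also have "\<dots> = L * prob_size f + prob {\<omega>\<in>space M. \<bar>g \<omega>\<bar> > L}"
    unfolding prob_size_def
    by (subst Bochner_Integration.integral_add) (auto simp: less_top[symmetric] intro!: integrable_min_one)
  finally show ?thesis .
qed

lemma prob_size_tendsto_0_AE:
  assumes [measurable]: "\<And>n. f n \<in> borel_measurable M"
    and "AE \<omega> in M. (\<lambda>n. f n \<omega>) \<longlonglongrightarrow> 0"
  shows "(\<lambda>n::nat. prob_size (f n)) \<longlonglongrightarrow> 0"
proof -
  have "(\<lambda>n. expectation (\<lambda>\<omega>. min 1 \<bar>f n \<omega>\<bar>)) \<longlonglongrightarrow> expectation (\<lambda>\<omega>. 0)"
  proof (rule integral_dominated_convergence[where w = "\<lambda>_. 1"])
    show "AE \<omega> in M. (\<lambda>n. min 1 \<bar>f n \<omega>\<bar>) \<longlonglongrightarrow> 0"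
      using assms(2)
    proof eventually_elim
      case (elim \<omega>)
      have "(\<lambda>n. min 1 \<bar>f n \<omega>\<bar>) \<longlonglongrightarrow> min 1 \<bar>0\<bar>"
        by (intro tendsto_intros elim)
      then show ?case by simp
    qed
  qed auto
  then show ?thesis by (simp add: prob_size_def)
qed

text \<open>
Boundedness in probability, uniformly over the index set. Levels below 1 are excluded because
\<open>prob_size_mult_le\<close> cannot use them.
\<close>

definition tight_family :: "'i set \<Rightarrow> ('i \<Rightarrow> 'a \<Rightarrow> real) \<Rightarrow> bool" where
  "tight_family S f \<longleftrightarrow> (\<forall>e>0. \<exists>L\<ge>1. \<forall>i\<in>S. prob {\<omega>\<in>space M. \<bar>f i \<omega>\<bar> > L} < e)"

text \<open>
Over a countable index set the event that some member exceeds \<open>L\<close> is measurable, and its probability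
vanishes as \<open>L\<close> grows since almost every path is bounded. The supremum over the whole index set is
controlled here, which is more than tightness.
\<close>

lemma AE_bounded_uniform_tail:
  assumes "countable S" and f [measurable]: "\<And>i. i \<in> S \<Longrightarrow> f i \<in> borel_measurable M"
    and bdd: "AE \<omega> in M. \<exists>C::real. \<forall>i\<in>S. \<bar>f i \<omega>\<bar> \<le> C"
  shows "\<And>e. 0 < e \<Longrightarrow> \<exists>L\<ge>1. {\<omega>\<in>space M. \<exists>i\<in>S. \<bar>f i \<omega>\<bar> > L} \<in> events \<and>
    prob {\<omega>\<in>space M. \<exists>i\<in>S. \<bar>f i \<omega>\<bar> > L} < e"
proof -
  fix e :: real assume "0 < e"
  define E where "E n = {\<omega>\<in>space M. \<exists>i\<in>S. \<bar>f i \<omega>\<bar> > real (Suc n)}" for n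
  have E_sets: "E n \<in> events" for n
  proof -
    have "E n = (\<Union>i\<in>S. {\<omega>\<in>space M. \<bar>f i \<omega>\<bar> > real (Suc n)})" by (auto simp: E_def)
    also have "\<dots> \<in> events"
      by (rule sets.countable_UN''[OF \<open>countable S\<close>])
        (use f in \<open>auto intro!: borel_measurable_less measurable_sets_borel simp del: of_nat_Suc\<close>)
    finally show ?thesis .
  qed
  have "(\<lambda>n. prob (E n)) \<longlonglongrightarrow> 0"
  proof -
    have "(\<lambda>n. expectation (indicator (E n) :: 'a \<Rightarrow> real)) \<longlonglongrightarrow> expectation (\<lambda>\<omega>. 0)"
    proof (rule integral_dominated_convergence[where w = "\<lambda>_. 1"])
      show "AE \<omega> in M. (\<lambda>n. indicator (E n) \<omega> :: real) \<longlonglongrightarrow> 0"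
        using bdd
      proof eventually_elim
        case (elim \<omega>)
        then obtain C where C: "\<forall>i\<in>S. \<bar>f i \<omega>\<bar> \<le> C" by auto
        obtain N where N: "C \<le> real N" using real_arch_simple by blast
        have "eventually (\<lambda>n. (indicator (E n) \<omega> :: real) = 0) sequentially"
          using eventually_ge_at_top[of N]
        proof eventually_elim
          case (elim n)
          have "\<omega> \<notin> E n"
            using C N elim by (force simp: E_def)
          then show ?case by simp
        qed
        then show ?case by (rule tendsto_eventually)
      qed
    qed (use E_sets in \<open>auto simp: indicator_def\<close>)
    then show ?thesis using E_sets by simp
  qed
  then have "eventually (\<lambda>n. prob (E n) < e) sequentially"
    using \<open>0 < e\<close> by (rule order_tendstoD)
  then obtain n where "prob (E n) < e" by (auto simp: eventually_sequentially)
  then show "\<exists>L\<ge>1. {\<omega>\<in>space M. \<exists>i\<in>S. \<bar>f i \<omega>\<bar> > L} \<in> events \<and>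
    prob {\<omega>\<in>space M. \<exists>i\<in>S. \<bar>f i \<omega>\<bar> > L} < e"
    using E_sets[of n] by (intro exI[of _ "real (Suc n)"]) (auto simp: E_def)
qed

lemma tight_AE_bounded:
  assumes "countable S" and f: "\<And>i. i \<in> S \<Longrightarrow> f i \<in> borel_measurable M"
    and bdd: "AE \<omega> in M. \<exists>C. \<forall>i\<in>S. \<bar>f i \<omega>\<bar> \<le> C"
  shows "tight_family S f"
  unfolding tight_family_def
proof (intro allI impI)
  fix e :: real assume "0 < e"
  from AE_bounded_uniform_tail[OF assms this] obtain L where L: "1 \<le> L"
    "{\<omega>\<in>space M. \<exists>i\<in>S. \<bar>f i \<omega>\<bar> > L} \<in> events" "prob {\<omega>\<in>space M. \<exists>i\<in>S. \<bar>f i \<omega>\<bar> > L} < e" by blast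
  have "prob {\<omega>\<in>space M. \<bar>f i \<omega>\<bar> > L} < e" if "i \<in> S" for i
  proof -
    have "prob {\<omega>\<in>space M. \<bar>f i \<omega>\<bar> > L} \<le> prob {\<omega>\<in>space M. \<exists>i\<in>S. \<bar>f i \<omega>\<bar> > L}"
      using that L(2) by (intro finite_measure_mono) auto
    with L(3) show ?thesis by simp
  qed
  with L(1) show "\<exists>L\<ge>1. \<forall>i\<in>S. prob {\<omega> \<in> space M. L < \<bar>f i \<omega>\<bar>} < e" by blast
qed

lemma tight_family_const:
  assumes "f \<in> borel_measurable M"
  shows "tight_family S (\<lambda>_. f)"
proof -
  have "tight_family {()} (\<lambda>_. f)"
    by (rule tight_AE_bounded) (use assms in auto)
  then show ?thesis unfolding tight_family_def by auto
qed

lemma tight_family_mono: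
  assumes [measurable]: "\<And>i. i \<in> S \<Longrightarrow> g i \<in> borel_measurable M"
    and le: "\<And>i. i \<in> S \<Longrightarrow> AE \<omega> in M. \<bar>f i \<omega>\<bar> \<le> \<bar>g i \<omega>\<bar>"
    and "tight_family S g"
  shows "tight_family S f"
  unfolding tight_family_def
proof (intro allI impI)
  fix e :: real assume "0 < e"
  with \<open>tight_family S g\<close> obtain L where L: "1 \<le> L" "\<And>i. i \<in> S \<Longrightarrow> prob {\<omega>\<in>space M. \<bar>g i \<omega>\<bar> > L} < e"
    unfolding tight_family_def by blast
  have "prob {\<omega>\<in>space M. \<bar>f i \<omega>\<bar> > L} < e" if "i \<in> S" for i
  proof -
    have "prob {\<omega>\<in>space M. \<bar>f i \<omega>\<bar> > L} \<le> prob {\<omega>\<in>space M. \<bar>g i \<omega>\<bar> > L}"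
      by (rule finite_measure_mono_AE) (use le[OF that] that in \<open>auto elim!: eventually_mono\<close>)
    with L(2)[OF that] show ?thesis by simp
  qed
  with L(1) show "\<exists>L\<ge>1. \<forall>i\<in>S. prob {\<omega> \<in> space M. L < \<bar>f i \<omega>\<bar>} < e" by blast
qed

lemma tight_family_add:
  assumes [measurable]: "\<And>i. i \<in> S \<Longrightarrow> f i \<in> borel_measurable M" "\<And>i. i \<in> S \<Longrightarrow> g i \<in> borel_measurable M"
    and "tight_family S f" "tight_family S g"
  shows "tight_family S (\<lambda>i \<omega>. f i \<omega> + g i \<omega>)"
  unfolding tight_family_def
proof (intro allI impI)
  fix e :: real assume "0 < e"
  then have "0 < e / 2" by simp
  with assms obtain L1 L2 where L: "1 \<le> L1" "1 \<le> L2"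
    "\<And>i. i \<in> S \<Longrightarrow> prob {\<omega>\<in>space M. \<bar>f i \<omega>\<bar> > L1} < e / 2"
    "\<And>i. i \<in> S \<Longrightarrow> prob {\<omega>\<in>space M. \<bar>g i \<omega>\<bar> > L2} < e / 2"
    unfolding tight_family_def by meson
  have "prob {\<omega>\<in>space M. \<bar>f i \<omega> + g i \<omega>\<bar> > L1 + L2} < e" if i: "i \<in> S" for i
  proof -
    have "prob {\<omega>\<in>space M. \<bar>f i \<omega> + g i \<omega>\<bar> > L1 + L2} \<le>
      prob ({\<omega>\<in>space M. \<bar>f i \<omega>\<bar> > L1} \<union> {\<omega>\<in>space M. \<bar>g i \<omega>\<bar> > L2})"
      using i by (intro finite_measure_mono) auto
    also have "\<dots> \<le> prob {\<omega>\<in>space M. \<bar>f i \<omega>\<bar> > L1} + prob {\<omega>\<in>space M. \<bar>g i \<omega>\<bar> > L2}"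
      using i by (intro measure_Un_le) auto
    finally show ?thesis using L(3,4)[OF i] by linarith
  qed
  with L(1,2) show "\<exists>L\<ge>1. \<forall>i\<in>S. prob {\<omega> \<in> space M. L < \<bar>f i \<omega> + g i \<omega>\<bar>} < e"
    by (intro exI[of _ "L1 + L2"]) auto
qed

lemma tight_if_expectation_bounded:
  assumes int: "\<And>i. i \<in> S \<Longrightarrow> integrable M (f i)"
    and bd: "\<And>i. i \<in> S \<Longrightarrow> expectation (\<lambda>\<omega>. \<bar>f i \<omega>\<bar>) \<le> C"
  shows "tight_family S f"
  unfolding tight_family_def
proof (intro allI impI)
  fix e :: real assume "0 < e"
  define L where "L = max 1 ((\<bar>C\<bar> + 1) / e)"
  have L: "1 \<le> L" "(\<bar>C\<bar> + 1) \<le> e * L"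
    using \<open>0 < e\<close> unfolding L_def by (auto simp: max_def field_simps)
  have "prob {\<omega>\<in>space M. \<bar>f i \<omega>\<bar> > L} < e" if i: "i \<in> S" for i
  proof -
    have [measurable]: "f i \<in> borel_measurable M" using int[OF i] by auto
    have "prob {\<omega>\<in>space M. \<bar>f i \<omega>\<bar> > L} \<le> prob {\<omega>\<in>space M. \<bar>f i \<omega>\<bar> \<ge> L}"
      by (intro finite_measure_mono) auto
    also have "\<dots> \<le> expectation (\<lambda>\<omega>. \<bar>f i \<omega>\<bar>) / L"
      using L(1) int[OF i] by (intro integral_Markov_inequality_measure[where A = "{}"]) auto
    also have "\<dots> < e"
      using L bd[OF i] by (simp add: field_simps)
    finally show ?thesis .
  qed
  with L(1) show "\<exists>L\<ge>1. \<forall>i\<in>S. prob {\<omega> \<in> space M. L < \<bar>f i \<omega>\<bar>} < e" by blast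
qed

lemma prob_size_mult_tight:
  assumes [measurable]: "\<And>n. f n \<in> borel_measurable M" "\<And>n. g n \<in> borel_measurable M"
    and f: "(\<lambda>n::nat. prob_size (f n)) \<longlonglongrightarrow> 0" and g: "tight_family UNIV g"
  shows "(\<lambda>n. prob_size (\<lambda>\<omega>. f n \<omega> * g n \<omega>)) \<longlonglongrightarrow> 0"
proof (rule LIMSEQ_I)
  fix r :: real assume "0 < r"
  with g obtain L where L: "1 \<le> L" "\<And>n. prob {\<omega>\<in>space M. \<bar>g n \<omega>\<bar> > L} < r / 2"
    unfolding tight_family_def by (metis UNIV_I half_gt_zero)
  have "eventually (\<lambda>n. prob_size (f n) < r / (2 * L)) sequentially"
    using f \<open>0 < r\<close> L(1) by (intro order_tendstoD) auto
  then obtain N where N: "\<And>n. n \<ge> N \<Longrightarrow> prob_size (f n) < r / (2 * L)"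
    by (auto simp: eventually_sequentially)
  have "norm (prob_size (\<lambda>\<omega>. f n \<omega> * g n \<omega>) - 0) < r" if "n \<ge> N" for n
  proof -
    have "L * prob_size (f n) < r / 2"
      using N[OF that] L(1) by (simp add: field_simps)
    with prob_size_mult_le[of "f n" "g n" L] L(1) L(2)[of n] show ?thesis
      by (simp add: prob_size_nonneg)
  qed
  then show "\<exists>N. \<forall>n\<ge>N. norm (prob_size (\<lambda>\<omega>. f n \<omega> * g n \<omega>) - 0) < r" by blast
qed

end

section \<open>Increments of Brownian motion\<close>

subsection \<open>Exponential moments of the normal density\<close>

text \<open>
Completing the square: an exponential weight shifts the mean of a centred normal density.
\<close>

lemma normal_density_exp_tilt:
  assumes "0 < \<sigma>"
  shows "normal_density 0 \<sigma> x * exp (c * x) = exp (c\<^sup>2 * \<sigma>\<^sup>2 / 2) * normal_density (c * \<sigma>\<^sup>2) \<sigma> x"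
proof -
  have "- (x - 0)\<^sup>2 / (2 * \<sigma>\<^sup>2) + c * x = c\<^sup>2 * \<sigma>\<^sup>2 / 2 + - (x - c * \<sigma>\<^sup>2)\<^sup>2 / (2 * \<sigma>\<^sup>2)"
    using assms by (simp add: field_simps power2_eq_square)
  then have "exp (- (x - 0)\<^sup>2 / (2 * \<sigma>\<^sup>2)) * exp (c * x) =
      exp (c\<^sup>2 * \<sigma>\<^sup>2 / 2) * exp (- (x - c * \<sigma>\<^sup>2)\<^sup>2 / (2 * \<sigma>\<^sup>2))"
    by (metis exp_add)
  then show ?thesis unfolding normal_density_def by simp
qed

lemma (in prob_space) normal_exp_moments:
  assumes X: "distributed M lborel X (normal_density 0 \<sigma>)" and \<sigma>: "0 < \<sigma>"
  shows "integrable M (\<lambda>\<omega>. exp (c * X \<omega>))"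
    and "expectation (\<lambda>\<omega>. exp (c * X \<omega>)) = exp (c\<^sup>2 * \<sigma>\<^sup>2 / 2)"
    and "integrable M (\<lambda>\<omega>. X \<omega> * exp (c * X \<omega>))"
    and "expectation (\<lambda>\<omega>. X \<omega> * exp (c * X \<omega>)) = c * \<sigma>\<^sup>2 * exp (c\<^sup>2 * \<sigma>\<^sup>2 / 2)"
proof -
  note tilt = normal_density_exp_tilt[OF \<sigma>, of _ c]
  have tilt': "normal_density 0 \<sigma> x * (x * exp (c * x)) =
      exp (c\<^sup>2 * \<sigma>\<^sup>2 / 2) * (normal_density (c * \<sigma>\<^sup>2) \<sigma> x * x)" for x
    using tilt[of x] by (simp add: mult_ac)
  have "integrable lborel (\<lambda>x. normal_density 0 \<sigma> x * exp (c * x))"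
    using \<sigma> by (simp add: tilt)
  then show "integrable M (\<lambda>\<omega>. exp (c * X \<omega>))"
    by (subst (asm) distributed_integrable[OF X]) auto
  have "expectation (\<lambda>\<omega>. exp (c * X \<omega>)) = (\<integral>x. normal_density 0 \<sigma> x * exp (c * x) \<partial>lborel)"
    by (subst distributed_integral[OF X]) auto
  then show "expectation (\<lambda>\<omega>. exp (c * X \<omega>)) = exp (c\<^sup>2 * \<sigma>\<^sup>2 / 2)"
    using \<sigma> by (simp add: tilt)
  have "integrable lborel (\<lambda>x. normal_density 0 \<sigma> x * (x * exp (c * x)))"
    unfolding tilt' using \<sigma> by (intro Bochner_Integration.integrable_mult_right integrable_normal_moment_nz_1)
  then show "integrable M (\<lambda>\<omega>. X \<omega> * exp (c * X \<omega>))"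
    by (subst (asm) distributed_integrable[OF X]) auto
  have "expectation (\<lambda>\<omega>. X \<omega> * exp (c * X \<omega>)) =
      (\<integral>x. normal_density 0 \<sigma> x * (x * exp (c * x)) \<partial>lborel)"
    by (subst distributed_integral[OF X]) auto
  then show "expectation (\<lambda>\<omega>. X \<omega> * exp (c * X \<omega>)) = c * \<sigma>\<^sup>2 * exp (c\<^sup>2 * \<sigma>\<^sup>2 / 2)"
    unfolding tilt' using \<sigma> by (simp add: integral_normal_moment_nz_1)
qed

lemma (in prob_space) normal_even_moments:
  assumes X: "distributed M lborel X (normal_density 0 \<sigma>)" and \<sigma>: "0 < \<sigma>"
  shows "integrable M (\<lambda>\<omega>. (X \<omega>)^2)" and "expectation (\<lambda>\<omega>. (X \<omega>)^2) = \<sigma>\<^sup>2"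
    and "integrable M (\<lambda>\<omega>. (X \<omega>)^4)" and "expectation (\<lambda>\<omega>. (X \<omega>)^4) = 3 * (\<sigma>\<^sup>2)\<^sup>2"
proof -
  have m: "has_bochner_integral lborel (\<lambda>x. normal_density 0 \<sigma> x * x ^ (2 * k))
      (fact (2 * k) / ((2 / \<sigma>\<^sup>2)^k * fact k))" for k
    using normal_moment_even[OF \<sigma>, of 0 k] by simp
  have "integrable lborel (\<lambda>x. normal_density 0 \<sigma> x * x^2)" "integrable lborel (\<lambda>x. normal_density 0 \<sigma> x * x^4)"
    using m[of 1] m[of 2] by (auto simp: has_bochner_integral_iff)
  then show "integrable M (\<lambda>\<omega>. (X \<omega>)^2)" "integrable M (\<lambda>\<omega>. (X \<omega>)^4)"
    using distributed_integrable[OF X, of "\<lambda>x. x^2"] distributed_integrable[OF X, of "\<lambda>x. x^4"]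
    by simp_all
  have "expectation (\<lambda>\<omega>. (X \<omega>)^2) = (\<integral>x. normal_density 0 \<sigma> x * x^2 \<partial>lborel)"
    by (subst distributed_integral[OF X]) auto
  also have "\<dots> = \<sigma>\<^sup>2"
    using m[of 1] by (simp add: has_bochner_integral_iff)
  finally show "expectation (\<lambda>\<omega>. (X \<omega>)^2) = \<sigma>\<^sup>2" .
  have "expectation (\<lambda>\<omega>. (X \<omega>)^4) = (\<integral>x. normal_density 0 \<sigma> x * x^4 \<partial>lborel)"
    by (subst distributed_integral[OF X]) auto
  also have "\<dots> = fact 4 / ((2 / \<sigma>\<^sup>2)^2 * fact 2)"
    using m[of 2] by (simp add: has_bochner_integral_iff)
  also have "\<dots> = 3 * (\<sigma>\<^sup>2)\<^sup>2"
    using \<sigma> by (simp add: fact_numeral field_simps power2_eq_square)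
  finally show "expectation (\<lambda>\<omega>. (X \<omega>)^4) = 3 * (\<sigma>\<^sup>2)\<^sup>2" .
qed

subsection \<open>The augmented filtration\<close>

context brownian_space
begin

abbreviation past :: "real \<Rightarrow> 'w measure" where "past \<equiv> brownian_filtration M B"

lemma past_events_into: "past_events M B t \<subseteq> Pow (space M)"
  unfolding past_events_def
  using sigma_sets_into_sp[of "{B s -` A \<inter> space M | s A. s \<in> {0..t} \<and> A \<in> sets borel}" "space M"]
  by blast

lemma null_sets_into: "null_sets M \<subseteq> Pow (space M)"
  using sets.sets_into_space by (auto simp: null_sets_def)

lemma space_past [simp]: "space (past t) = space M"
  unfolding brownian_filtration_def by (simp add: space_measure_of_conv)

lemma sets_past: "sets (past t) = sigma_sets (space M) (past_events M B t \<union> null_sets M)"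
  unfolding brownian_filtration_def using past_events_into null_sets_into
  by (intro sets_measure_of) auto

lemma past_events_subset_events:
  assumes "t \<le> T"
  shows "past_events M B t \<subseteq> events"
proof -
  have "{B s -` A \<inter> space M | s A. s \<in> {0..t} \<and> A \<in> sets borel} \<subseteq> events"
    using B_measurable assms by (auto intro!: measurable_sets)
  then show ?thesis unfolding past_events_def by (rule sets.sigma_sets_subset)
qed

lemma sets_past_subset:
  assumes "t \<le> T"
  shows "sets (past t) \<subseteq> events"
  unfolding sets_past using past_events_subset_events[OF assms]
  by (intro sets.sigma_sets_subset) auto

lemma subalgebra_past: "t \<le> T \<Longrightarrow> subalgebra M (past t)"
  using sets_past_subset by (simp add: subalgebra_def)

lemma sets_past_mono:
  assumes "s \<le> t"
  shows "sets (past s) \<subseteq> sets (past t)"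
proof -
  have "past_events M B s \<subseteq> past_events M B t"
    unfolding past_events_def using atLeastatMost_subset_iff[of 0 s 0 t] assms
    by (intro sigma_sets_mono') blast
  then show ?thesis unfolding sets_past by (intro sigma_sets_mono') auto
qed

lemma measurable_past_mono:
  assumes "f \<in> borel_measurable (past s)" "s \<le> t"
  shows "f \<in> borel_measurable (past t)"
  using assms sets_past_mono[OF assms(2)]
  by (intro measurable_from_subalg[of "past t" "past s"]) (auto simp: subalgebra_def)

lemma measurable_past_imp_measurable:
  assumes "f \<in> borel_measurable (past s)" "s \<le> T"
  shows "f \<in> borel_measurable M"
  using measurable_from_subalg[OF subalgebra_past[OF assms(2)] assms(1)] .

lemma B_measurable_past:
  assumes "0 \<le> s" "s \<le> t"
  shows "B s \<in> borel_measurable (past t)"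
proof (rule measurableI)
  fix A :: "(real^'n) set" assume "A \<in> sets borel"
  then have "B s -` A \<inter> space M \<in> past_events M B t"
    unfolding past_events_def using assms by (intro sigma_sets.Basic) auto
  then show "B s -` A \<inter> space (past t) \<in> sets (past t)"
    by (auto simp: sets_past)
qed auto

text \<open>
The events that agree almost surely with an event of the past form a sigma-algebra that contains the
null sets. Hence augmentation does not affect probabilities of intersections, and independence of
the increments from the past carries over to the augmented filtration.
\<close>

lemma augmented_event_AE_eq:
  assumes "A \<in> sets (past s)" "s \<le> T"
  shows "\<exists>A'\<in>past_events M B s. AE \<omega> in M. \<omega> \<in> A \<longleftrightarrow> \<omega> \<in> A'"
proof -
  interpret P: sigma_algebra "space M" "past_events M B s"
    unfolding past_events_def by (rule sigma_algebra_sigma_sets) auto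
  from assms(1) have "A \<in> sigma_sets (space M) (past_events M B s \<union> null_sets M)"
    by (simp add: sets_past)
  then show ?thesis
  proof induction
    case (Basic a)
    then show ?case
    proof
      assume "a \<in> null_sets M"
      then have "AE \<omega> in M. \<omega> \<in> a \<longleftrightarrow> \<omega> \<in> {}" by (auto dest: AE_not_in)
      then show ?case using P.empty_sets by blast
    qed auto
  next
    case Empty
    then show ?case using P.empty_sets by auto
  next
    case (Compl a)
    then obtain a' where "a' \<in> past_events M B s" "AE \<omega> in M. \<omega> \<in> a \<longleftrightarrow> \<omega> \<in> a'" by blast
    then show ?case by (intro bexI[of _ "space M - a'"]) auto
  next
    case (Union a)
    then obtain a' where a': "\<And>i. a' i \<in> past_events M B s" "\<And>i. AE \<omega> in M. \<omega> \<in> a i \<longleftrightarrow> \<omega> \<in> a' i"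
      by metis
    then have "AE \<omega> in M. \<forall>i. \<omega> \<in> a i \<longleftrightarrow> \<omega> \<in> a' i" by (simp add: AE_all_countable)
    with a'(1) show ?case by (intro bexI[of _ "\<Union>i. a' i"]) (auto elim!: eventually_mono)
  qed
qed

lemma increment_measurable [measurable]:
  assumes "0 \<le> s" "s \<le> T" "0 \<le> t" "t \<le> T"
  shows "(\<lambda>\<omega>. B t \<omega> - B s \<omega>) \<in> borel_measurable M"
  using B_measurable assms by (intro borel_measurable_diff) auto

lemma indep_past_increment:
  assumes st: "0 \<le> s" "s < t" "t \<le> T"
    and G: "G \<in> borel_measurable (past s)" and f [measurable]: "f \<in> borel_measurable borel"
  shows "indep_var borel (G :: 'w \<Rightarrow> real) borel (\<lambda>\<omega>. f (B t \<omega> - B s \<omega>) :: real)"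
  unfolding indep_var_eq
proof (intro conjI)
  have [measurable]: "(\<lambda>\<omega>. B t \<omega> - B s \<omega>) \<in> borel_measurable M" using st by auto
  have GM [measurable]: "G \<in> borel_measurable M"
    using G st by (intro measurable_past_imp_measurable[of _ s]) auto
  show "random_variable borel G" "random_variable borel (\<lambda>\<omega>. f (B t \<omega> - B s \<omega>))" by simp_all
  have 1: "sigma_sets (space M) {G -` A \<inter> space M | A. A \<in> sets borel} \<subseteq> sets (past s)"
    using G by (intro sets.sigma_sets_subset[where M = "past s", simplified]) (auto dest: measurable_sets)
  let ?V = "vimage_algebra (space M) (\<lambda>\<omega>. B t \<omega> - B s \<omega>) borel"
  have V: "sets ?V = {(\<lambda>\<omega>. B t \<omega> - B s \<omega>) -` A \<inter> space M | A. A \<in> sets borel}"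
    by (rule sets_vimage_algebra2) auto
  have fV: "(\<lambda>\<omega>. f (B t \<omega> - B s \<omega>)) \<in> borel_measurable ?V"
    by (intro measurable_compose[OF measurable_vimage_algebra1 f]) auto
  have 2: "sigma_sets (space M) {(\<lambda>\<omega>. f (B t \<omega> - B s \<omega>)) -` A \<inter> space M | A. A \<in> sets borel} \<subseteq> sets ?V"
    using measurable_sets[OF fV]
    by (intro sets.sigma_sets_subset[where M = ?V, simplified]) auto
  have prod: "prob (a \<inter> e) = prob a * prob e" if "a \<in> sets (past s)" "e \<in> sets ?V" for a e
  proof -
    from augmented_event_AE_eq[OF that(1)] st obtain a' where a': "a' \<in> past_events M B s"
      "AE \<omega> in M. \<omega> \<in> a \<longleftrightarrow> \<omega> \<in> a'" by auto
    have ev: "a \<in> events" "a' \<in> events" "e \<in> events"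
      using that a' st sets_past_subset[of s] past_events_subset_events[of s]
      by (auto simp: V intro!: measurable_sets)
    have "prob (a \<inter> e) = prob (a' \<inter> e)"
      using a'(2) ev by (intro measure_eq_AE) (auto elim!: eventually_mono)
    also have "\<dots> = prob a' * prob e"
      using indep_setD[OF B_increment_past[OF st], of e a'] a'(1) that(2)
      by (simp add: V Int_commute mult.commute)
    also have "prob a' = prob a"
      using a'(2) ev by (intro measure_eq_AE) (auto elim!: eventually_mono)
    finally show ?thesis .
  qed
  show "indep_set (sigma_sets (space M) {G -` A \<inter> space M | A. A \<in> sets borel})
     (sigma_sets (space M) {(\<lambda>\<omega>. f (B t \<omega> - B s \<omega>)) -` A \<inter> space M | A. A \<in> sets borel})"
  proof (rule indep_setI)
    show "sigma_sets (space M) {G -` A \<inter> space M | A. A \<in> sets borel} \<subseteq> events"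
      using 1 sets_past_subset[of s] st by auto
    have "sets ?V \<subseteq> events" unfolding V by (auto intro!: measurable_sets)
    with 2 show "sigma_sets (space M) {(\<lambda>\<omega>. f (B t \<omega> - B s \<omega>)) -` A \<inter> space M | A. A \<in> sets borel} \<subseteq> events"
      by blast
  qed (use 1 2 prod in blast)
qed

text \<open>
The form in which independence of increments is used throughout. The degenerate case \<open>s = t\<close> is included
so that partitions may have repeated points.
\<close>

lemma past_times_increment:
  assumes st: "0 \<le> s" "s \<le> t" "t \<le> T"
    and G: "G \<in> borel_measurable (past s)" "integrable M G"
    and f: "f \<in> borel_measurable borel" "integrable M (\<lambda>\<omega>. f (B t \<omega> - B s \<omega>))"
  shows "integrable M (\<lambda>\<omega>. G \<omega> * f (B t \<omega> - B s \<omega>) :: real)"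
    and "expectation (\<lambda>\<omega>. G \<omega> * f (B t \<omega> - B s \<omega>)) = expectation G * expectation (\<lambda>\<omega>. f (B t \<omega> - B s \<omega>))"
proof -
  have "integrable M (\<lambda>\<omega>. G \<omega> * f (B t \<omega> - B s \<omega>)) \<and>
    expectation (\<lambda>\<omega>. G \<omega> * f (B t \<omega> - B s \<omega>)) = expectation G * expectation (\<lambda>\<omega>. f (B t \<omega> - B s \<omega>))"
  proof (cases "s = t")
    case True
    then show ?thesis using G by (simp add: prob_space)
  next
    case False
    with st have "s < t" by simp
    from indep_past_increment[OF st(1) this st(3) G(1) f(1)]
    show ?thesis using indep_var_integrable[OF _ G(2) f(2)] indep_var_lebesgue_integral[OF _ G(2) f(2)] by blast
  qed
  then show "integrable M (\<lambda>\<omega>. G \<omega> * f (B t \<omega> - B s \<omega>) :: real)"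
    "expectation (\<lambda>\<omega>. G \<omega> * f (B t \<omega> - B s \<omega>)) = expectation G * expectation (\<lambda>\<omega>. f (B t \<omega> - B s \<omega>))"
    by auto
qed

subsection \<open>Moments of the increments\<close>

abbreviation incr :: "real \<Rightarrow> real \<Rightarrow> 'n \<Rightarrow> 'w \<Rightarrow> real" where
  "incr s t i \<omega> \<equiv> (B t \<omega> - B s \<omega>) $ i"

lemma incr_component_moments:
  assumes st: "0 \<le> s" "s \<le> t" "t \<le> T"
  shows "integrable M (\<lambda>\<omega>. exp (c * incr s t i \<omega>))"
    and "expectation (\<lambda>\<omega>. exp (c * incr s t i \<omega>)) = exp (c\<^sup>2 * (t - s) / 2)"
    and "integrable M (\<lambda>\<omega>. incr s t i \<omega> * exp (c * incr s t i \<omega>))"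
    and "expectation (\<lambda>\<omega>. incr s t i \<omega> * exp (c * incr s t i \<omega>)) = c * (t - s) * exp (c\<^sup>2 * (t - s) / 2)"
    and "integrable M (\<lambda>\<omega>. (incr s t i \<omega>)^2)" and "expectation (\<lambda>\<omega>. (incr s t i \<omega>)^2) = t - s"
    and "integrable M (\<lambda>\<omega>. (incr s t i \<omega>)^4)" and "expectation (\<lambda>\<omega>. (incr s t i \<omega>)^4) = 3 * (t - s)\<^sup>2"
proof -
  let ?P = "integrable M (\<lambda>\<omega>. exp (c * incr s t i \<omega>)) \<and>
    expectation (\<lambda>\<omega>. exp (c * incr s t i \<omega>)) = exp (c\<^sup>2 * (t - s) / 2) \<and>
    integrable M (\<lambda>\<omega>. incr s t i \<omega> * exp (c * incr s t i \<omega>)) \<and>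
    expectation (\<lambda>\<omega>. incr s t i \<omega> * exp (c * incr s t i \<omega>)) = c * (t - s) * exp (c\<^sup>2 * (t - s) / 2) \<and>
    integrable M (\<lambda>\<omega>. (incr s t i \<omega>)^2) \<and> expectation (\<lambda>\<omega>. (incr s t i \<omega>)^2) = t - s \<and>
    integrable M (\<lambda>\<omega>. (incr s t i \<omega>)^4) \<and> expectation (\<lambda>\<omega>. (incr s t i \<omega>)^4) = 3 * (t - s)\<^sup>2"
  have ?P
  proof (cases "s = t")
    case True
    then show ?thesis by (simp add: prob_space)
  next
    case False
    with st have lt: "s < t" by simp
    then have pos: "0 < sqrt (t - s)" and sq: "(sqrt (t - s))\<^sup>2 = t - s" by auto
    note D = B_increment_normal[OF st(1) lt st(3), of i]
    show ?thesis
      using normal_exp_moments[OF D pos, of c] normal_even_moments[OF D pos] unfolding sq by blast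
  qed
  then show "integrable M (\<lambda>\<omega>. exp (c * incr s t i \<omega>))"
    "expectation (\<lambda>\<omega>. exp (c * incr s t i \<omega>)) = exp (c\<^sup>2 * (t - s) / 2)"
    "integrable M (\<lambda>\<omega>. incr s t i \<omega> * exp (c * incr s t i \<omega>))"
    "expectation (\<lambda>\<omega>. incr s t i \<omega> * exp (c * incr s t i \<omega>)) = c * (t - s) * exp (c\<^sup>2 * (t - s) / 2)"
    "integrable M (\<lambda>\<omega>. (incr s t i \<omega>)^2)" "expectation (\<lambda>\<omega>. (incr s t i \<omega>)^2) = t - s"
    "integrable M (\<lambda>\<omega>. (incr s t i \<omega>)^4)" "expectation (\<lambda>\<omega>. (incr s t i \<omega>)^4) = 3 * (t - s)\<^sup>2"
    by blast+
qed

lemma (in -) exp_inner_eq_prod: "exp (c \<bullet> (x :: real^'n)) = (\<Prod>j\<in>UNIV. exp (c $ j * x $ j))"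
  by (simp add: inner_vec_def exp_sum)

text \<open>
The components of an increment are independent, so both expectations factorise into one-dimensional
ones; in the second one a single factor carries the additional linear weight.
\<close>

lemma incr_exp_moments:
  assumes st: "0 \<le> s" "s \<le> t" "t \<le> T"
  shows "integrable M (\<lambda>\<omega>. exp (c \<bullet> (B t \<omega> - B s \<omega>)))"
    and "expectation (\<lambda>\<omega>. exp (c \<bullet> (B t \<omega> - B s \<omega>))) = exp ((norm c)\<^sup>2 * (t - s) / 2)"
    and "integrable M (\<lambda>\<omega>. incr s t i \<omega> * exp (c \<bullet> (B t \<omega> - B s \<omega>)))"
    and "expectation (\<lambda>\<omega>. incr s t i \<omega> * exp (c \<bullet> (B t \<omega> - B s \<omega>))) =
      c $ i * (t - s) * exp ((norm c)\<^sup>2 * (t - s) / 2)"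
proof -
  let ?P = "integrable M (\<lambda>\<omega>. exp (c \<bullet> (B t \<omega> - B s \<omega>))) \<and>
    expectation (\<lambda>\<omega>. exp (c \<bullet> (B t \<omega> - B s \<omega>))) = exp ((norm c)\<^sup>2 * (t - s) / 2) \<and>
    integrable M (\<lambda>\<omega>. incr s t i \<omega> * exp (c \<bullet> (B t \<omega> - B s \<omega>))) \<and>
    expectation (\<lambda>\<omega>. incr s t i \<omega> * exp (c \<bullet> (B t \<omega> - B s \<omega>))) =
      c $ i * (t - s) * exp ((norm c)\<^sup>2 * (t - s) / 2)"
  have ?P
  proof (cases "s = t")
    case True
    then show ?thesis by (simp add: prob_space)
  next
    case False
    with st have lt: "s < t" by simp
    note indep = B_increment_components[OF st(1) lt st(3)]
    note mom = incr_component_moments[OF st]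
    have n: "(norm c)\<^sup>2 = (\<Sum>j\<in>UNIV. (c $ j)\<^sup>2)"
      unfolding power2_norm_eq_inner inner_vec_def by (simp add: power2_eq_square)
    have prod: "(\<Prod>j\<in>UNIV. exp ((c $ j)\<^sup>2 * (t - s) / 2)) = exp ((norm c)\<^sup>2 * (t - s) / 2)"
      by (simp add: n sum_distrib_right sum_divide_distrib exp_sum)
    have 1: "indep_vars (\<lambda>_. borel) (\<lambda>j \<omega>. exp (c $ j * incr s t j \<omega>)) UNIV"
      by (rule indep_vars_compose2[OF indep, where Y = "\<lambda>j x. exp (c $ j * x)"]) auto
    have e1: "exp (c \<bullet> (B t \<omega> - B s \<omega>)) = (\<Prod>j\<in>UNIV. exp (c $ j * incr s t j \<omega>))" for \<omega>
      by (rule exp_inner_eq_prod)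
    define Y where "Y j x = (if j = i then x else 1) * exp (c $ j * x)" for j :: 'n and x :: real
    have [measurable]: "Y j \<in> borel_measurable borel" for j unfolding Y_def by auto
    have 2: "indep_vars (\<lambda>_. borel) (\<lambda>j \<omega>. Y j (incr s t j \<omega>)) UNIV"
      by (rule indep_vars_compose2[OF indep, where Y = Y]) auto
    have e2: "incr s t i \<omega> * exp (c \<bullet> (B t \<omega> - B s \<omega>)) = (\<Prod>j\<in>UNIV. Y j (incr s t j \<omega>))" for \<omega>
      unfolding Y_def prod.distrib e1 by simp
    have iY: "integrable M (\<lambda>\<omega>. Y j (incr s t j \<omega>))" for j
      unfolding Y_def using mom(1)[of "c $ j" j] mom(3)[of j "c $ j"] by (cases "j = i") auto
    have eY: "expectation (\<lambda>\<omega>. Y j (incr s t j \<omega>)) =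
        (if j = i then c $ i * (t - s) else 1) * exp ((c $ j)\<^sup>2 * (t - s) / 2)" for j
      unfolding Y_def using mom(2)[of "c $ j" j] mom(4)[of j "c $ j"] by (cases "j = i") auto
    have "(\<Prod>j\<in>UNIV. expectation (\<lambda>\<omega>. Y j (incr s t j \<omega>))) = c $ i * (t - s) * exp ((norm c)\<^sup>2 * (t - s) / 2)"
      unfolding eY prod.distrib prod by simp
    moreover have "(\<Prod>j\<in>UNIV. expectation (\<lambda>\<omega>. exp (c $ j * incr s t j \<omega>))) = exp ((norm c)\<^sup>2 * (t - s) / 2)"
      unfolding mom(2) prod ..
    ultimately show ?thesis
      unfolding e2 unfolding e1
      using indep_vars_integrable[OF _ 1 mom(1)] indep_vars_lebesgue_integral[OF _ 1 mom(1)]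
        indep_vars_integrable[OF _ 2 iY] indep_vars_lebesgue_integral[OF _ 2 iY]
      by simp
  qed
  then show "integrable M (\<lambda>\<omega>. exp (c \<bullet> (B t \<omega> - B s \<omega>)))"
    "expectation (\<lambda>\<omega>. exp (c \<bullet> (B t \<omega> - B s \<omega>))) = exp ((norm c)\<^sup>2 * (t - s) / 2)"
    "integrable M (\<lambda>\<omega>. incr s t i \<omega> * exp (c \<bullet> (B t \<omega> - B s \<omega>)))"
    "expectation (\<lambda>\<omega>. incr s t i \<omega> * exp (c \<bullet> (B t \<omega> - B s \<omega>))) =
      c $ i * (t - s) * exp ((norm c)\<^sup>2 * (t - s) / 2)"
    by blast+
qed

lemma incr_mean_zero:
  assumes st: "0 \<le> s" "s \<le> t" "t \<le> T"
  shows "integrable M (incr s t i)" "expectation (incr s t i) = 0"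
  using incr_component_moments(3,4)[OF st, of i 0] by auto

text \<open>
The centred product of two components of an increment over a time interval of length \<open>d\<close>.
\<close>

definition covariation_noise :: "real \<Rightarrow> 'n \<Rightarrow> 'n \<Rightarrow> real^'n \<Rightarrow> real" where
  "covariation_noise d i j x = x $ i * x $ j - (if i = j then d else 0)"

lemma covariation_noise_measurable [measurable]: "covariation_noise d i j \<in> borel_measurable borel"
  unfolding covariation_noise_def by measurable

text \<open>
The constant 8 comes from \<open>(ab - d)\<^sup>2 \<le> a\<^sup>4 + b\<^sup>4 + 2d\<^sup>2\<close> and the fourth moment \<open>3d\<^sup>2\<close> of each component.
\<close>

lemma covariation_noise_moments:
  fixes s t :: real and i j :: 'n
  assumes st: "0 \<le> s" "s \<le> t" "t \<le> T"
  defines "\<xi> \<equiv> \<lambda>\<omega>. covariation_noise (t - s) i j (B t \<omega> - B s \<omega>)"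
  shows "integrable M \<xi>" "expectation \<xi> = 0"
    "integrable M (\<lambda>\<omega>. (\<xi> \<omega>)\<^sup>2)" "expectation (\<lambda>\<omega>. (\<xi> \<omega>)\<^sup>2) \<le> 8 * (t - s)\<^sup>2"
proof -
  note mom = incr_component_moments[OF st]
  have [measurable]: "(\<lambda>\<omega>. B t \<omega> - B s \<omega>) \<in> borel_measurable M" using st by auto
  have [measurable]: "\<xi> \<in> borel_measurable M" unfolding \<xi>_def by measurable
  have [measurable]: "incr s t k \<in> borel_measurable M" for k
    using incr_mean_zero(1)[OF st] by (rule borel_measurable_integrable)
  have int: "integrable M (\<lambda>\<omega>. incr s t i \<omega> * incr s t j \<omega>)"
  proof (rule Bochner_Integration.integrable_bound)
    show "integrable M (\<lambda>\<omega>. (incr s t i \<omega>)\<^sup>2 + (incr s t j \<omega>)\<^sup>2)"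
      by (intro Bochner_Integration.integrable_add mom)
    have "\<bar>a * b\<bar> \<le> a\<^sup>2 + b\<^sup>2" for a b :: real
    proof -
      have "2 * (\<bar>a\<bar> * \<bar>b\<bar>) \<le> a\<^sup>2 + b\<^sup>2" using sum_squares_bound[of "\<bar>a\<bar>" "\<bar>b\<bar>"] by simp
      moreover have "0 \<le> \<bar>a\<bar> * \<bar>b\<bar>" by simp
      ultimately show ?thesis unfolding abs_mult by linarith
    qed
    then show "AE \<omega> in M. norm (incr s t i \<omega> * incr s t j \<omega>) \<le> norm ((incr s t i \<omega>)\<^sup>2 + (incr s t j \<omega>)\<^sup>2)"
      by auto
  qed measurable
  then show "integrable M \<xi>" unfolding \<xi>_def covariation_noise_def by auto
  have "expectation (\<lambda>\<omega>. incr s t i \<omega> * incr s t j \<omega>) = (if i = j then t - s else 0)"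
  proof (cases "i = j \<or> s = t")
    case True
    then show ?thesis using mom(6) by (auto simp: power2_eq_square)
  next
    case False
    with st have lt: "s < t" and ij: "i \<noteq> j" by auto
    have "indep_vars (\<lambda>_. borel) (\<lambda>k. incr s t k) {i, j}"
      by (rule indep_vars_subset[OF B_increment_components[OF st(1) lt st(3)]]) auto
    from indep_vars_lebesgue_integral[OF _ this] ij
    have "expectation (\<lambda>\<omega>. incr s t i \<omega> * incr s t j \<omega>) =
        expectation (incr s t i) * expectation (incr s t j)"
      using incr_mean_zero(1)[OF st] by simp
    then show ?thesis using ij incr_mean_zero[OF st] by simp
  qed
  then show "expectation \<xi> = 0"
    unfolding \<xi>_def covariation_noise_def using int by (simp add: prob_space)
  let ?b = "\<lambda>\<omega>. (incr s t i \<omega>)^4 + (incr s t j \<omega>)^4 + 2 * (t - s)\<^sup>2"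
  have le: "(\<xi> \<omega>)\<^sup>2 \<le> ?b \<omega>" for \<omega>
  proof -
    define a b d where "a = incr s t i \<omega>" "b = incr s t j \<omega>" "d = (if i = j then t - s else 0)"
    have "(a * b - d)\<^sup>2 \<le> 2 * (a\<^sup>2 * b\<^sup>2) + 2 * d\<^sup>2"
      using zero_le_power2[of "a * b + d"] by (simp add: power2_eq_square algebra_simps)
    also have "2 * (a\<^sup>2 * b\<^sup>2) \<le> a^4 + b^4"
      using zero_le_power2[of "a\<^sup>2 - b\<^sup>2"] by (simp add: power2_eq_square power4_eq_xxxx algebra_simps)
    also have "d\<^sup>2 \<le> (t - s)\<^sup>2" by (simp add: a_b_d_def)
    finally show ?thesis by (simp add: \<xi>_def covariation_noise_def a_b_d_def)
  qed
  have ib: "integrable M ?b" by (intro Bochner_Integration.integrable_add mom) auto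
  show i2: "integrable M (\<lambda>\<omega>. (\<xi> \<omega>)\<^sup>2)"
    by (rule Bochner_Integration.integrable_bound[OF ib]) (use le in \<open>auto intro: order_trans[OF le]\<close>)
  have "expectation (\<lambda>\<omega>. (\<xi> \<omega>)\<^sup>2) \<le> expectation ?b"
    by (rule integral_mono[OF i2 ib le])
  also have "\<dots> = 8 * (t - s)\<^sup>2"
    using mom(7,8) by (simp add: prob_space)
  finally show "expectation (\<lambda>\<omega>. (\<xi> \<omega>)\<^sup>2) \<le> 8 * (t - s)\<^sup>2" .
qed

end

section \<open>A discrete Ito isometry\<close>

context brownian_space
begin

text \<open>
In the square of the sum the mixed terms vanish: the later factor has mean zero and is independent of
everything that precedes it. The functions \<open>f k\<close> will be components of the increment or the noise of
their products.
\<close>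

lemma discrete_ito_isometry:
  fixes p :: "nat \<Rightarrow> real" and G :: "nat \<Rightarrow> 'w \<Rightarrow> real" and f :: "nat \<Rightarrow> real^'n \<Rightarrow> real"
  assumes p: "0 \<le> p 0" "\<And>k. k < n \<Longrightarrow> p k \<le> p (Suc k)" "p n \<le> T"
    and G: "\<And>k. k < n \<Longrightarrow> G k \<in> borel_measurable (past (p k))" "\<And>k \<omega>. k < n \<Longrightarrow> \<bar>G k \<omega>\<bar> \<le> C"
    and f: "\<And>k. k < n \<Longrightarrow> f k \<in> borel_measurable borel"
      "\<And>k. k < n \<Longrightarrow> integrable M (\<lambda>\<omega>. f k (B (p (Suc k)) \<omega> - B (p k) \<omega>))"
      "\<And>k. k < n \<Longrightarrow> expectation (\<lambda>\<omega>. f k (B (p (Suc k)) \<omega> - B (p k) \<omega>)) = 0"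
      "\<And>k. k < n \<Longrightarrow> integrable M (\<lambda>\<omega>. (f k (B (p (Suc k)) \<omega> - B (p k) \<omega>))\<^sup>2)"
  defines "S \<equiv> \<lambda>n \<omega>. \<Sum>k<n. G k \<omega> * f k (B (p (Suc k)) \<omega> - B (p k) \<omega>)"
  shows "S n \<in> borel_measurable (past (p n))" "integrable M (S n)" "integrable M (\<lambda>\<omega>. (S n \<omega>)\<^sup>2)"
    "expectation (\<lambda>\<omega>. (S n \<omega>)\<^sup>2) =
       (\<Sum>k<n. expectation (\<lambda>\<omega>. (G k \<omega>)\<^sup>2) * expectation (\<lambda>\<omega>. (f k (B (p (Suc k)) \<omega> - B (p k) \<omega>))\<^sup>2))"
proof -
  have "0 \<le> p n \<and> S n \<in> borel_measurable (past (p n)) \<and> integrable M (S n) \<and> integrable M (\<lambda>\<omega>. (S n \<omega>)\<^sup>2) \<and>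
    expectation (\<lambda>\<omega>. (S n \<omega>)\<^sup>2) =
       (\<Sum>k<n. expectation (\<lambda>\<omega>. (G k \<omega>)\<^sup>2) * expectation (\<lambda>\<omega>. (f k (B (p (Suc k)) \<omega> - B (p k) \<omega>))\<^sup>2))"
    using p G f
  proof (induction n)
    case 0
    then show ?case by (simp add: S_def)
  next
    case (Suc n)
    have pn: "p n \<le> p (Suc n)" "p (Suc n) \<le> T" "p n \<le> T"
      using Suc.prems(2)[of n] Suc.prems(3) by auto
    have "0 \<le> p n \<and> S n \<in> borel_measurable (past (p n)) \<and> integrable M (S n) \<and> integrable M (\<lambda>\<omega>. (S n \<omega>)\<^sup>2) \<and>
      expectation (\<lambda>\<omega>. (S n \<omega>)\<^sup>2) =
       (\<Sum>k<n. expectation (\<lambda>\<omega>. (G k \<omega>)\<^sup>2) * expectation (\<lambda>\<omega>. (f k (B (p (Suc k)) \<omega> - B (p k) \<omega>))\<^sup>2))"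
      by (rule Suc.IH) (use Suc.prems pn in \<open>auto simp: less_Suc_eq\<close>)
    then have p0: "0 \<le> p n" and Sm: "S n \<in> borel_measurable (past (p n))" and Si: "integrable M (S n)"
      and S2: "integrable M (\<lambda>\<omega>. (S n \<omega>)\<^sup>2)"
      and IH: "expectation (\<lambda>\<omega>. (S n \<omega>)\<^sup>2) =
       (\<Sum>k<n. expectation (\<lambda>\<omega>. (G k \<omega>)\<^sup>2) * expectation (\<lambda>\<omega>. (f k (B (p (Suc k)) \<omega> - B (p k) \<omega>))\<^sup>2))" by auto
    define \<xi> where "\<xi> \<omega> = f n (B (p (Suc n)) \<omega> - B (p n) \<omega>)" for \<omega>
    have Gm: "G n \<in> borel_measurable (past (p n))" and Gb: "\<bar>G n \<omega>\<bar> \<le> C" for \<omega>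
      using Suc.prems(4,5)[of n] by auto
    have GM [measurable]: "G n \<in> borel_measurable M" using measurable_past_imp_measurable[OF Gm pn(3)] .
    have SM [measurable]: "S n \<in> borel_measurable M" using Si by auto
    have Gi: "integrable M (G n)" "integrable M (\<lambda>\<omega>. (G n \<omega>)\<^sup>2)"
      by (rule integrable_const_bound[where B = C] integrable_const_bound[where B = "C\<^sup>2"];
          use Gb in \<open>auto simp: abs_le_square_iff[symmetric] intro!: abs_leI order_trans[OF Gb]\<close>)+
    have SGi: "integrable M (\<lambda>\<omega>. S n \<omega> * G n \<omega>)"
    proof (rule Bochner_Integration.integrable_bound)
      show "integrable M (\<lambda>\<omega>. C * S n \<omega>)" using Si by auto
      have "\<bar>S n \<omega> * G n \<omega>\<bar> \<le> \<bar>C * S n \<omega>\<bar>" for \<omega>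
        using mult_left_mono[OF order_trans[OF Gb abs_ge_self], of "\<bar>S n \<omega>\<bar>" \<omega>]
        by (simp add: abs_mult mult.commute)
      then show "AE \<omega> in M. norm (S n \<omega> * G n \<omega>) \<le> norm (C * S n \<omega>)" by auto
    qed auto
    note fn = Suc.prems(6)[of n] Suc.prems(7)[of n] Suc.prems(8)[of n] Suc.prems(9)[of n]
    have SGm: "(\<lambda>\<omega>. S n \<omega> * G n \<omega>) \<in> borel_measurable (past (p n))" using Sm Gm by simp
    have G2m: "(\<lambda>\<omega>. (G n \<omega>)\<^sup>2) \<in> borel_measurable (past (p n))" using Gm by simp
    have f2m: "(\<lambda>x. (f n x)\<^sup>2) \<in> borel_measurable borel" using fn(1) by simp
    have G\<xi>: "integrable M (\<lambda>\<omega>. G n \<omega> * \<xi> \<omega>)"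
      unfolding \<xi>_def by (rule past_times_increment[OF p0 pn(1,2) Gm Gi(1)]) (use fn in auto)
    have cross: "integrable M (\<lambda>\<omega>. (S n \<omega> * G n \<omega>) * \<xi> \<omega>)"
        "expectation (\<lambda>\<omega>. (S n \<omega> * G n \<omega>) * \<xi> \<omega>) = 0"
      unfolding \<xi>_def using past_times_increment[OF p0 pn(1,2) SGm SGi, of "f n"] fn by auto
    have sq: "integrable M (\<lambda>\<omega>. (G n \<omega>)\<^sup>2 * (\<xi> \<omega>)\<^sup>2)"
        "expectation (\<lambda>\<omega>. (G n \<omega>)\<^sup>2 * (\<xi> \<omega>)\<^sup>2) = expectation (\<lambda>\<omega>. (G n \<omega>)\<^sup>2) * expectation (\<lambda>\<omega>. (\<xi> \<omega>)\<^sup>2)"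
      unfolding \<xi>_def using past_times_increment[OF p0 pn(1,2) G2m Gi(2) f2m] fn by auto
    have expand: "(S (Suc n) \<omega>)\<^sup>2 = (S n \<omega>)\<^sup>2 + 2 * ((S n \<omega> * G n \<omega>) * \<xi> \<omega>) + (G n \<omega>)\<^sup>2 * (\<xi> \<omega>)\<^sup>2" for \<omega>
      unfolding S_def \<xi>_def by (simp add: power2_eq_square algebra_simps)
    have \<xi>m: "\<xi> \<in> borel_measurable (past (p (Suc n)))"
      unfolding \<xi>_def using p0 pn
      by (intro measurable_compose[OF _ fn(1)] borel_measurable_diff B_measurable_past) auto
    have "S (Suc n) = (\<lambda>\<omega>. S n \<omega> + G n \<omega> * \<xi> \<omega>)" by (simp add: S_def \<xi>_def)
    then have "S (Suc n) \<in> borel_measurable (past (p (Suc n)))" "integrable M (S (Suc n))"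
      using measurable_past_mono[OF Sm pn(1)] measurable_past_mono[OF Gm pn(1)] \<xi>m Si G\<xi> by auto
    moreover have "integrable M (\<lambda>\<omega>. (S (Suc n) \<omega>)\<^sup>2)"
      unfolding expand using S2 cross(1) sq(1) by auto
    moreover have "expectation (\<lambda>\<omega>. (S (Suc n) \<omega>)\<^sup>2) =
        expectation (\<lambda>\<omega>. (S n \<omega>)\<^sup>2) + expectation (\<lambda>\<omega>. (G n \<omega>)\<^sup>2) * expectation (\<lambda>\<omega>. (\<xi> \<omega>)\<^sup>2)"
      unfolding expand using S2 cross sq by simp
    ultimately show ?case using p0 pn IH by (simp add: \<xi>_def)
  qed
  then show "S n \<in> borel_measurable (past (p n))" "integrable M (S n)" "integrable M (\<lambda>\<omega>. (S n \<omega>)\<^sup>2)"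
    "expectation (\<lambda>\<omega>. (S n \<omega>)\<^sup>2) =
       (\<Sum>k<n. expectation (\<lambda>\<omega>. (G k \<omega>)\<^sup>2) * expectation (\<lambda>\<omega>. (f k (B (p (Suc k)) \<omega> - B (p k) \<omega>))\<^sup>2))"
    by auto
qed

end

section \<open>Quadratic variation of continuous semimartingales\<close>

text \<open>
Uniform grids have the advantage that the grid with \<open>n r\<close> cells refines the one with \<open>n\<close> cells. For
\<open>n = 0\<close> all points are 0.
\<close>

definition grid :: "real \<Rightarrow> nat \<Rightarrow> nat \<Rightarrow> real" where
  "grid t n k = t * (real k / real n)"

lemma grid_mono: "0 \<le> t \<Longrightarrow> k \<le> l \<Longrightarrow> grid t n k \<le> grid t n l"
  unfolding grid_def by (intro mult_left_mono divide_right_mono) auto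

lemma grid_0 [simp]: "grid t n 0 = 0"
  by (simp add: grid_def)

lemma grid_end: "0 < n \<Longrightarrow> grid t n n = t"
  by (simp add: grid_def)

lemma grid_bounds:
  assumes "0 \<le> t" "k \<le> n"
  shows "0 \<le> grid t n k" "grid t n k \<le> t"
proof -
  show "0 \<le> grid t n k" using assms by (simp add: grid_def)
  have "real k / real n \<le> 1" using assms by (auto simp: divide_le_eq_1)
  then show "grid t n k \<le> t" using assms mult_left_mono[of "real k / real n" 1 t] by (simp add: grid_def)
qed

lemma grid_step: "0 < n \<Longrightarrow> grid t n (Suc k) - grid t n k = t / n"
  by (simp add: grid_def field_simps)

definition qvar :: "real \<Rightarrow> nat \<Rightarrow> (real \<Rightarrow> 'w \<Rightarrow> real) \<Rightarrow> 'w \<Rightarrow> real" where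
  "qvar t n X \<omega> = (\<Sum>k<n. (X (grid t n (Suc k)) \<omega> - X (grid t n k) \<omega>)\<^sup>2)"

lemma qvar_nonneg: "0 \<le> qvar t n X \<omega>"
  unfolding qvar_def by (intro sum_nonneg) auto

text \<open>
The convex function that is \<open>x\<^sup>2\<close> on \<open>[-R, R]\<close> and continues linearly; its derivative is twice the
projection of \<open>x\<close> to \<open>[-R, R]\<close>.
\<close>

definition huber :: "real \<Rightarrow> real \<Rightarrow> real" where
  "huber R x = 2 * max (- R) (min R x) * x - (max (- R) (min R x))\<^sup>2"

text \<open>
Convexity is the third statement. By the last one, the error of the first-order expansion is exactly the
squared increment as long as both points stay in \<open>[-R, R]\<close>.
\<close>

lemma huber_props:
  assumes "0 \<le> R"
  shows "0 \<le> huber R x" "huber R x \<le> 2 * R * \<bar>x\<bar>"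
    "2 * max (- R) (min R x) * (y - x) \<le> huber R y - huber R x"
    "\<bar>x\<bar> \<le> R \<Longrightarrow> \<bar>y\<bar> \<le> R \<Longrightarrow> huber R y - huber R x - 2 * max (- R) (min R x) * (y - x) = (y - x)\<^sup>2"
proof -
  define c where "c x = max (- R) (min R x)" for x
  have tangent: "huber R y - huber R x - 2 * c x * (y - x) = (c y - c x) * ((y - c y) + (y - c x))" for x y
    unfolding huber_def c_def by (simp add: power2_eq_square algebra_simps)
  have nonneg: "0 \<le> (c y - c x) * ((y - c y) + (y - c x))" for x y
  proof (cases "c x" "c y" rule: linorder_cases)
    case less
    then have "c y \<le> y" "c x \<le> y" unfolding c_def by (auto simp: max_def min_def split: if_splits)
    with less show ?thesis by (intro mult_nonneg_nonneg) auto
  next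
    case greater
    then have "c y \<ge> y" "c x \<ge> y" using assms unfolding c_def by (auto simp: max_def min_def split: if_splits)
    with greater show ?thesis by (intro mult_nonpos_nonpos) auto
  qed simp
  show 3: "2 * max (- R) (min R x) * (y - x) \<le> huber R y - huber R x" for x y
    using tangent[where y = y and x = x] nonneg[where y = y and x = x] unfolding c_def by linarith
  show "0 \<le> huber R x"
  proof -
    have "max (- R) (min R 0) = 0" using assms by auto
    then show ?thesis using 3[of 0 x] by (simp add: huber_def[of R 0])
  qed
  have "c x * x \<le> R * \<bar>x\<bar>"
  proof -
    have "\<bar>c x * x\<bar> \<le> R * \<bar>x\<bar>"
      unfolding abs_mult using assms by (intro mult_right_mono) (auto simp: c_def)
    then show ?thesis by linarith
  qed
  then have "2 * c x * x - (c x)\<^sup>2 \<le> 2 * R * \<bar>x\<bar>"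
    using zero_le_power2[of "c x"] by linarith
  then show "huber R x \<le> 2 * R * \<bar>x\<bar>"
    unfolding huber_def c_def .
  assume "\<bar>x\<bar> \<le> R" "\<bar>y\<bar> \<le> R"
  then have "c x = x" "c y = y" unfolding c_def by auto
  with tangent[where y = y and x = x]
  show "huber R y - huber R x - 2 * max (- R) (min R x) * (y - x) = (y - x)\<^sup>2"
    unfolding c_def[symmetric] by (simp add: power2_eq_square)
qed

lemma huber_measurable [measurable]: "huber R \<in> borel_measurable borel"
  unfolding huber_def by measurable

context brownian_space
begin

lemma martingale_increment_orthogonal:
  assumes X: "martingale M past T X" and st: "0 \<le> s" "s \<le> t" "t \<le> T"
    and G: "G \<in> borel_measurable (past s)" "\<And>\<omega>. \<bar>G \<omega>\<bar> \<le> C"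
  shows "integrable M (\<lambda>\<omega>. G \<omega> * (X t \<omega> - X s \<omega>))" "expectation (\<lambda>\<omega>. G \<omega> * (X t \<omega> - X s \<omega>)) = 0"
proof -
  interpret finite_measure_subalgebra M "past s"
    by standard (use subalgebra_past[of s] st in auto)
  have int: "integrable M (X s)" "integrable M (X t)" using X st unfolding martingale_def by auto
  have ce: "AE \<omega> in M. real_cond_exp M (past s) (X t) \<omega> = X s \<omega>" using X st unfolding martingale_def by auto
  have GM [measurable]: "G \<in> borel_measurable M" by (rule measurable_past_imp_measurable[OF G(1)]) (use st in auto)
  have *: "integrable M (\<lambda>\<omega>. G \<omega> * Y \<omega>)" if "integrable M Y" for Y :: "'w \<Rightarrow> real"
  proof (rule Bochner_Integration.integrable_bound)
    show "integrable M (\<lambda>\<omega>. C * Y \<omega>)" using that by auto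
    have "\<bar>G \<omega> * Y \<omega>\<bar> \<le> \<bar>C * Y \<omega>\<bar>" for \<omega>
      using mult_right_mono[OF order_trans[OF G(2) abs_ge_self], of "\<bar>Y \<omega>\<bar>" \<omega>] by (simp add: abs_mult)
    then show "AE \<omega> in M. norm (G \<omega> * Y \<omega>) \<le> norm (C * Y \<omega>)" by auto
  qed (use that in auto)
  have "expectation (\<lambda>\<omega>. G \<omega> * X t \<omega>) = expectation (\<lambda>\<omega>. G \<omega> * real_cond_exp M (past s) (X t) \<omega>)"
    using real_cond_exp_intg(2)[OF *[OF int(2)] G(1)] int by auto
  also have "\<dots> = expectation (\<lambda>\<omega>. G \<omega> * X s \<omega>)"
    by (rule integral_cong_AE) (use ce int in \<open>auto elim!: eventually_mono\<close>)
  finally have "expectation (\<lambda>\<omega>. G \<omega> * X t \<omega>) = expectation (\<lambda>\<omega>. G \<omega> * X s \<omega>)" .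
  then show "expectation (\<lambda>\<omega>. G \<omega> * (X t \<omega> - X s \<omega>)) = 0"
    using *[OF int(1)] *[OF int(2)] by (simp add: right_diff_distrib)
  show "integrable M (\<lambda>\<omega>. G \<omega> * (X t \<omega> - X s \<omega>))"
    using * int by auto
qed

text \<open>
Summing the expansion of the Huber function along the grid, the first-order terms have mean zero by the
martingale property and the function values telescope. On the event that the path stays in \<open>[-R, R]\<close>
what remains is the quadratic variation. Since the Huber function grows linearly, only the first moment
of the martingale enters, which is all that the definition of a martingale provides.
\<close>

lemma martingale_qvar_bound:
  assumes X: "martingale M past T X" and t: "0 \<le> t" "t \<le> T" and "0 < n" "0 \<le> R"
  defines "E \<equiv> {\<omega>\<in>space M. \<forall>k\<le>n. \<bar>X (grid t n k) \<omega>\<bar> \<le> R}"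
  shows "integrable M (\<lambda>\<omega>. indicator E \<omega> * qvar t n X \<omega>)"
    "expectation (\<lambda>\<omega>. indicator E \<omega> * qvar t n X \<omega>) \<le> 2 * R * expectation (\<lambda>\<omega>. \<bar>X t \<omega>\<bar>)"
proof -
  let ?x = "\<lambda>k. X (grid t n k)"
  define D where "D k \<omega> = huber R (?x (Suc k) \<omega>) - huber R (?x k \<omega>)
      - 2 * max (- R) (min R (?x k \<omega>)) * (?x (Suc k) \<omega> - ?x k \<omega>)" for k \<omega>
  have gr: "0 \<le> grid t n k" "grid t n k \<le> t" "grid t n k \<le> T" if "k \<le> n" for k
    using grid_bounds[OF t(1) that] t by auto
  have xi: "integrable M (?x k)" if "k \<le> n" for k
    using X gr[OF that] unfolding martingale_def by auto
  have xm: "?x k \<in> borel_measurable M" if "k \<le> n" for k using xi[OF that] by auto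
  have hi: "integrable M (\<lambda>\<omega>. huber R (?x k \<omega>))" if "k \<le> n" for k
  proof (rule Bochner_Integration.integrable_bound)
    show "integrable M (\<lambda>\<omega>. 2 * R * \<bar>?x k \<omega>\<bar>)" using xi[OF that] by auto
    show "AE \<omega> in M. norm (huber R (?x k \<omega>)) \<le> norm (2 * R * \<bar>?x k \<omega>\<bar>)"
      using huber_props(1,2)[OF \<open>0 \<le> R\<close>] \<open>0 \<le> R\<close> by auto
  qed (use xm[OF that] in measurable)
  have Gb: "\<bar>2 * max (- R) (min R x)\<bar> \<le> 2 * R" for x using \<open>0 \<le> R\<close> by auto
  have mart: "integrable M (\<lambda>\<omega>. 2 * max (- R) (min R (?x k \<omega>)) * (?x (Suc k) \<omega> - ?x k \<omega>))"
    "expectation (\<lambda>\<omega>. 2 * max (- R) (min R (?x k \<omega>)) * (?x (Suc k) \<omega> - ?x k \<omega>)) = 0" if k: "k < n" for k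
  proof -
    have Gm: "(\<lambda>\<omega>. 2 * max (- R) (min R (?x k \<omega>))) \<in> borel_measurable (past (grid t n k))"
      using X gr[of k] k unfolding martingale_def adapted_def by (auto intro!: borel_measurable_times borel_measurable_max borel_measurable_min)
    show "integrable M (\<lambda>\<omega>. 2 * max (- R) (min R (?x k \<omega>)) * (?x (Suc k) \<omega> - ?x k \<omega>))"
    "expectation (\<lambda>\<omega>. 2 * max (- R) (min R (?x k \<omega>)) * (?x (Suc k) \<omega> - ?x k \<omega>)) = 0"
      using martingale_increment_orthogonal[OF X _ _ _ Gm Gb, of "grid t n (Suc k)"]
        gr[of k] gr[of "Suc k"] k grid_mono[OF t(1), of k "Suc k" n] by auto
  qed
  have Di: "integrable M (D k)" and De: "expectation (D k) =
      expectation (\<lambda>\<omega>. huber R (?x (Suc k) \<omega>)) - expectation (\<lambda>\<omega>. huber R (?x k \<omega>))" if k: "k < n" for k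
    unfolding D_def using mart[OF k] hi[of k] hi[of "Suc k"] k by auto
  have D0: "0 \<le> D k \<omega>" for k \<omega>
    unfolding D_def using huber_props(3)[OF \<open>0 \<le> R\<close>, of "?x k \<omega>" "?x (Suc k) \<omega>"] by linarith
  have sumD: "integrable M (\<lambda>\<omega>. \<Sum>k<n. D k \<omega>)" using Di by auto
  have le: "indicator E \<omega> * qvar t n X \<omega> \<le> (\<Sum>k<n. D k \<omega>)" if "\<omega> \<in> space M" for \<omega>
  proof (cases "\<omega> \<in> E")
    case True
    then have "qvar t n X \<omega> = (\<Sum>k<n. D k \<omega>)"
      unfolding qvar_def D_def E_def
      by (intro sum.cong refl huber_props(4)[OF \<open>0 \<le> R\<close>, symmetric]) auto
    then show ?thesis using True by simp
  qed (auto intro: sum_nonneg D0)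
  have "{\<omega>\<in>space M. \<bar>?x k \<omega>\<bar> \<le> R} \<in> events" if "k \<in> {..n}" for k
    by (rule borel_measurable_le) (use xm[of k] that in auto)
  then have "(\<Inter>k\<in>{..n}. {\<omega>\<in>space M. \<bar>?x k \<omega>\<bar> \<le> R}) \<in> events"
    by (intro sets.finite_INT) auto
  moreover have "E = (\<Inter>k\<in>{..n}. {\<omega>\<in>space M. \<bar>?x k \<omega>\<bar> \<le> R})" unfolding E_def by blast
  ultimately have Em: "E \<in> events" by metis
  have qm: "qvar t n X \<in> borel_measurable M"
    unfolding qvar_def using xm by (intro borel_measurable_sum borel_measurable_power borel_measurable_diff) auto
  show i: "integrable M (\<lambda>\<omega>. indicator E \<omega> * qvar t n X \<omega>)"
  proof (rule Bochner_Integration.integrable_bound[OF sumD])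
    show "AE \<omega> in M. norm (indicator E \<omega> * qvar t n X \<omega>) \<le> norm (\<Sum>k<n. D k \<omega>)"
      using le qvar_nonneg[of t n X] by (auto intro!: AE_I2 simp: abs_mult order_trans[OF le abs_ge_self])
  qed (use Em qm in auto)
  have "expectation (\<lambda>\<omega>. indicator E \<omega> * qvar t n X \<omega>) \<le> expectation (\<lambda>\<omega>. \<Sum>k<n. D k \<omega>)"
    by (rule integral_mono[OF i sumD le])
  also have "\<dots> = (\<Sum>k<n. expectation (\<lambda>\<omega>. huber R (?x (Suc k) \<omega>)) - expectation (\<lambda>\<omega>. huber R (?x k \<omega>)))"
    using Di De by simp
  also have "\<dots> = expectation (\<lambda>\<omega>. huber R (?x n \<omega>)) - expectation (\<lambda>\<omega>. huber R (?x 0 \<omega>))"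
    by (rule sum_lessThan_telescope)
  also have "\<dots> \<le> expectation (\<lambda>\<omega>. huber R (?x n \<omega>))"
    using huber_props(1)[OF \<open>0 \<le> R\<close>] by (simp add: Bochner_Integration.integral_nonneg)
  also have "\<dots> \<le> expectation (\<lambda>\<omega>. 2 * R * \<bar>?x n \<omega>\<bar>)"
    using huber_props(2)[OF \<open>0 \<le> R\<close>] hi[of n] xi[of n] by (intro integral_mono) auto
  finally show "expectation (\<lambda>\<omega>. indicator E \<omega> * qvar t n X \<omega>) \<le> 2 * R * expectation (\<lambda>\<omega>. \<bar>X t \<omega>\<bar>)"
    using grid_end[OF \<open>0 < n\<close>, of t] by simp
qed

lemma (in -) continuous_on_interval_bounded:
  fixes f :: "real \<Rightarrow> real"
  assumes "continuous_on {a..b} f"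
  shows "\<exists>C. \<forall>t\<in>{a..b}. \<bar>f t\<bar> \<le> C"
proof -
  have "bounded (f ` {a..b})" using assms by (intro compact_imp_bounded compact_continuous_image) auto
  then show ?thesis unfolding bounded_iff by auto
qed

lemma qvar_measurable:
  assumes "\<And>s. s \<in> {0..T} \<Longrightarrow> X s \<in> borel_measurable M" "0 \<le> t" "t \<le> T"
  shows "qvar t n X \<in> borel_measurable M"
proof -
  have "X (grid t n k) \<in> borel_measurable M" if "k \<le> n" for k
    using grid_bounds[OF assms(2) that] assms by auto
  then show ?thesis
    unfolding qvar_def by (intro borel_measurable_sum borel_measurable_power borel_measurable_diff) auto
qed

text \<open>
All grid points lie in a countable set of times, on which a continuous path is bounded; this makes the
previous bound applicable up to an event of small probability, uniformly in the grid.
\<close>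

lemma tight_qvar_martingale:
  assumes X: "martingale M past T X" and c: "continuous_paths M T X" and t: "0 \<le> t" "t \<le> T"
  shows "tight_family UNIV (\<lambda>n. qvar t n X)"
  unfolding tight_family_def
proof (intro allI impI)
  fix e :: real assume "0 < e"
  define S where "S = (\<lambda>q. t * q) ` (\<rat> \<inter> {0..1})"
  have S: "countable S" unfolding S_def by (intro countable_image countable_Int1 countable_rat)
  have ST: "S \<subseteq> {0..T}" unfolding S_def using t by (auto intro: order_trans[OF mult_left_le])
  have gridS: "grid t n k \<in> S" if "k \<le> n" for n k
    unfolding S_def grid_def using that by (intro imageI) (auto simp: divide_le_eq_1)
  have xi: "integrable M (X s)" if "s \<in> {0..T}" for s
    using X that unfolding martingale_def by auto
  have "AE \<omega> in M. \<exists>C. \<forall>i\<in>S. \<bar>X i \<omega>\<bar> \<le> C"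
    using c unfolding continuous_paths_def
  proof eventually_elim
    case (elim \<omega>)
    then show ?case using continuous_on_interval_bounded ST by blast
  qed
  moreover have "X s \<in> borel_measurable M" if "s \<in> S" for s
    using xi that ST by blast
  ultimately obtain R where R: "1 \<le> R"
    "{\<omega>\<in>space M. \<exists>i\<in>S. \<bar>X i \<omega>\<bar> > R} \<in> events" "prob {\<omega>\<in>space M. \<exists>i\<in>S. \<bar>X i \<omega>\<bar> > R} < e / 2"
    using AE_bounded_uniform_tail[of S X "e / 2"] S \<open>0 < e\<close> by auto
  define K where "K = 2 * R * expectation (\<lambda>\<omega>. \<bar>X t \<omega>\<bar>)"
  have "0 \<le> K" unfolding K_def using R(1) by (auto intro!: mult_nonneg_nonneg)
  define L where "L = max 1 (2 * (K + 1) / e)"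
  have L: "1 \<le> L" "2 * (K + 1) \<le> e * L"
    using \<open>0 < e\<close> by (auto simp: L_def max_def field_simps)
  have "prob {\<omega>\<in>space M. \<bar>qvar t n X \<omega>\<bar> > L} < e" for n
  proof (cases "n = 0")
    case True
    then show ?thesis using L(1) \<open>0 < e\<close> by (simp add: qvar_def)
  next
    case False
    define E where "E = {\<omega>\<in>space M. \<forall>k\<le>n. \<bar>X (grid t n k) \<omega>\<bar> \<le> R}"
    have b: "integrable M (\<lambda>\<omega>. indicator E \<omega> * qvar t n X \<omega>)"
      "expectation (\<lambda>\<omega>. indicator E \<omega> * qvar t n X \<omega>) \<le> K"
      unfolding E_def K_def using martingale_qvar_bound[OF X t, of n R] False R(1) by auto
    have qm [measurable]: "qvar t n X \<in> borel_measurable M"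
      by (rule qvar_measurable) (use xi t in auto)
    have "prob {\<omega>\<in>space M. \<bar>qvar t n X \<omega>\<bar> > L} \<le>
        prob ({\<omega>\<in>space M. \<exists>i\<in>S. \<bar>X i \<omega>\<bar> > R} \<union> {\<omega>\<in>space M. indicator E \<omega> * qvar t n X \<omega> \<ge> L})"
    proof (rule finite_measure_mono)
      show "{\<omega>\<in>space M. \<bar>qvar t n X \<omega>\<bar> > L} \<subseteq>
        {\<omega>\<in>space M. \<exists>i\<in>S. \<bar>X i \<omega>\<bar> > R} \<union> {\<omega>\<in>space M. indicator E \<omega> * qvar t n X \<omega> \<ge> L}"
      proof
        fix \<omega> assume w: "\<omega> \<in> {\<omega>\<in>space M. \<bar>qvar t n X \<omega>\<bar> > L}"
        show "\<omega> \<in> {\<omega>\<in>space M. \<exists>i\<in>S. \<bar>X i \<omega>\<bar> > R} \<union> {\<omega>\<in>space M. indicator E \<omega> * qvar t n X \<omega> \<ge> L}"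
        proof (cases "\<omega> \<in> E")
          case True
          then show ?thesis using w qvar_nonneg[of t n X \<omega>] by auto
        next
          case False
          then obtain k where "k \<le> n" "\<bar>X (grid t n k) \<omega>\<bar> > R" using w unfolding E_def by auto
          then show ?thesis using w gridS by blast
        qed
      qed
    qed (use R(2) b(1) in auto)
    also have "\<dots> \<le> prob {\<omega>\<in>space M. \<exists>i\<in>S. \<bar>X i \<omega>\<bar> > R} + prob {\<omega>\<in>space M. indicator E \<omega> * qvar t n X \<omega> \<ge> L}"
      using R(2) b(1) by (intro measure_Un_le) auto
    also have "prob {\<omega>\<in>space M. indicator E \<omega> * qvar t n X \<omega> \<ge> L} \<le> expectation (\<lambda>\<omega>. indicator E \<omega> * qvar t n X \<omega>) / L"
      using b(1) L(1) qvar_nonneg[of t n X] by (intro integral_Markov_inequality_measure[where A = "{}"]) auto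
    also have "\<dots> \<le> K / L" using b(2) L(1) by (intro divide_right_mono) auto
    also have "K / L < e / 2" using L \<open>0 \<le> K\<close> by (simp add: field_simps)
    finally show ?thesis using R(3) by linarith
  qed
  with L(1) show "\<exists>L\<ge>1. \<forall>i\<in>UNIV. prob {\<omega> \<in> space M. L < \<bar>qvar t i X \<omega>\<bar>} < e" by blast
qed

lemma adapted_measurable: "adapted past T X \<Longrightarrow> s \<in> {0..T} \<Longrightarrow> X s \<in> borel_measurable M"
  unfolding adapted_def by (rule measurable_past_imp_measurable[where s = s]) auto

text \<open>
Outside an event of small probability the localising time has already reached \<open>T\<close>, and there the process
has the increments of a true martingale.
\<close>

lemma tight_qvar_local_martingale:
  assumes N: "local_martingale M past T N" and c: "continuous_paths M T N" and t: "0 \<le> t" "t \<le> T"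
  shows "tight_family UNIV (\<lambda>n. qvar t n N)"
  unfolding tight_family_def
proof (intro allI impI)
  fix e :: real assume "0 < e"
  from N obtain \<tau> :: "nat \<Rightarrow> 'w \<Rightarrow> real" where ad: "adapted past T N"
    and st: "\<And>n. stopping_time past (\<tau> n)"
    and \<tau>: "\<And>n \<omega>. \<omega> \<in> space M \<Longrightarrow> 0 \<le> \<tau> n \<omega> \<and> \<tau> n \<omega> \<le> \<tau> (Suc n) \<omega> \<and> \<tau> n \<omega> \<le> T"
    and fin: "AE \<omega> in M. \<exists>n. \<tau> n \<omega> = T"
    and mart: "\<And>n. martingale M past T (\<lambda>t \<omega>. N (min t (\<tau> n \<omega>)) \<omega> - N 0 \<omega>)"
    unfolding local_martingale_def by blast
  define E where "E n = {\<omega>\<in>space M. \<tau> n \<omega> < T}" for n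
  have E: "E n \<in> events" for n
  proof -
    have "E n = (\<Union>k. {\<omega>\<in>space M. \<tau> n \<omega> \<le> T - 1 / Suc k})"
    proof (intro set_eqI iffI)
      fix \<omega> assume w: "\<omega> \<in> E n"
      then have "0 < T - \<tau> n \<omega>" by (simp add: E_def)
      then obtain k where "1 / Suc k < T - \<tau> n \<omega>" using nat_approx_posE by blast
      then have "\<tau> n \<omega> \<le> T - 1 / Suc k" by linarith
      then show "\<omega> \<in> (\<Union>k. {\<omega>\<in>space M. \<tau> n \<omega> \<le> T - 1 / Suc k})" using w by (auto simp: E_def)
    next
      fix \<omega> assume "\<omega> \<in> (\<Union>k. {\<omega>\<in>space M. \<tau> n \<omega> \<le> T - 1 / Suc k})"
      then obtain k where k: "\<omega> \<in> space M" "\<tau> n \<omega> \<le> T - 1 / Suc k" by blast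
      moreover have "0 < 1 / real (Suc k)" by simp
      ultimately have "\<tau> n \<omega> < T" by linarith
      with k show "\<omega> \<in> E n" by (simp add: E_def)
    qed
    moreover have "{\<omega>\<in>space M. \<tau> n \<omega> \<le> T - 1 / Suc k} \<in> events" for k
    proof -
      have "{\<omega>\<in>space M. \<tau> n \<omega> \<le> T - 1 / Suc k} \<in> sets (past (T - 1 / Suc k))"
        using stopping_timeD[OF st[of n], of "T - 1 / Suc k"] by (simp add: pred_def)
      moreover have "sets (past (T - 1 / Suc k)) \<subseteq> events"
        by (rule sets_past_subset) simp
      ultimately show ?thesis by blast
    qed
    ultimately show ?thesis by auto
  qed
  have "(\<lambda>n. expectation (indicator (E n) :: 'w \<Rightarrow> real)) \<longlonglongrightarrow> expectation (\<lambda>\<omega>. 0)"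
  proof (rule integral_dominated_convergence[where w = "\<lambda>_. 1"])
    show "AE \<omega> in M. (\<lambda>n. indicator (E n) \<omega> :: real) \<longlonglongrightarrow> 0"
      using fin AE_space
    proof eventually_elim
      case (elim \<omega>)
      then obtain n where n: "\<tau> n \<omega> = T" by auto
      have "\<tau> m \<omega> = T" if "n \<le> m" for m
        using that
      proof (induction rule: dec_induct)
        case base
        show ?case by (rule n)
      next
        case (step m)
        then show ?case using \<tau>[of \<omega> m] \<tau>[of \<omega> "Suc m"] elim by force
      qed
      then have "eventually (\<lambda>m. indicator (E m) \<omega> = (0::real)) sequentially"
        by (intro eventually_sequentiallyI[of n]) (simp add: E_def)
      then show ?case by (rule tendsto_eventually)
    qed
  qed (use E in \<open>auto simp: indicator_def\<close>)
  then have "(\<lambda>n. prob (E n)) \<longlonglongrightarrow> 0" using E by simp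
  then have "eventually (\<lambda>n. prob (E n) < e / 2) sequentially"
    using \<open>0 < e\<close> by (intro order_tendstoD) auto
  then obtain m where m: "prob (E m) < e / 2" by (auto simp: eventually_sequentially)
  define X where "X = (\<lambda>t \<omega>. N (min t (\<tau> m \<omega>)) \<omega> - N 0 \<omega>)"
  have X: "martingale M past T X" unfolding X_def by (rule mart)
  have "continuous_paths M T X"
    using c AE_space unfolding continuous_paths_def
  proof eventually_elim
    case (elim \<omega>)
    have "continuous_on {0..T} (\<lambda>t. N (min t (\<tau> m \<omega>)) \<omega>)"
      by (rule continuous_on_compose2[OF elim(1)]) (use \<tau>[OF elim(2)] in \<open>auto intro!: continuous_intros\<close>)
    then show ?case unfolding X_def by (intro continuous_intros)
  qed
  from tight_qvar_martingale[OF X this t] \<open>0 < e\<close> obtain L where L: "1 \<le> L"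
    "\<And>n. prob {\<omega>\<in>space M. \<bar>qvar t n X \<omega>\<bar> > L} < e / 2"
    unfolding tight_family_def by (metis UNIV_I half_gt_zero)
  have "prob {\<omega>\<in>space M. \<bar>qvar t n N \<omega>\<bar> > L} < e" for n
  proof -
    have Xm: "X s \<in> borel_measurable M" if "s \<in> {0..T}" for s
      using X that unfolding martingale_def by auto
    have [measurable]: "qvar t n X \<in> borel_measurable M"
      by (rule qvar_measurable[OF Xm t])
    have eq: "qvar t n X \<omega> = qvar t n N \<omega>" if "\<omega> \<in> space M - E m" for \<omega>
    proof -
      have "\<tau> m \<omega> = T" using that \<tau>[of \<omega> m] by (force simp: E_def)
      then have "X s \<omega> = N s \<omega> - N 0 \<omega>" if "s \<le> T" for s using that by (simp add: X_def)
      moreover have "grid t n k \<le> T" if "k \<le> n" for k using grid_bounds[OF t(1) that] t by auto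
      ultimately show ?thesis unfolding qvar_def by (intro sum.cong) auto
    qed
    have "prob {\<omega>\<in>space M. \<bar>qvar t n N \<omega>\<bar> > L} \<le> prob (E m \<union> {\<omega>\<in>space M. \<bar>qvar t n X \<omega>\<bar> > L})"
      using eq E by (intro finite_measure_mono) auto
    also have "\<dots> \<le> prob (E m) + prob {\<omega>\<in>space M. \<bar>qvar t n X \<omega>\<bar> > L}"
      using E by (intro measure_Un_le) auto
    finally show ?thesis using m L(2)[of n] by linarith
  qed
  with L(1) show "\<exists>L\<ge>1. \<forall>i\<in>UNIV. prob {\<omega> \<in> space M. L < \<bar>qvar t i N \<omega>\<bar>} < e" by blast
qed

lemma (in -) sum_squares_le_square_sum_abs: "(\<Sum>k<n. (a k :: real)\<^sup>2) \<le> (\<Sum>k<n. \<bar>a k\<bar>)\<^sup>2" for n :: nat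
proof -
  let ?S = "\<Sum>k<n. \<bar>a k\<bar>"
  have "(\<Sum>k<n. (a k)\<^sup>2) \<le> (\<Sum>k<n. \<bar>a k\<bar> * ?S)"
  proof (rule sum_mono)
    fix k assume k: "k \<in> {..<n}"
    have "\<bar>a k\<bar> \<le> ?S" by (rule member_le_sum[OF k]) auto
    then have "\<bar>a k\<bar> * \<bar>a k\<bar> \<le> \<bar>a k\<bar> * ?S" by (intro mult_left_mono) auto
    then show "(a k)\<^sup>2 \<le> \<bar>a k\<bar> * ?S" by (simp add: power2_eq_square)
  qed
  also have "\<dots> = ?S\<^sup>2" by (simp add: sum_distrib_right power2_eq_square)
  finally show ?thesis .
qed

lemma tight_qvar_finite_variation:
  assumes A: "finite_variation M T A" "adapted past T A" and t: "0 \<le> t" "t \<le> T"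
  shows "tight_family UNIV (\<lambda>n. qvar t n A)"
proof (rule tight_AE_bounded)
  show "qvar t n A \<in> borel_measurable M" for n
    by (rule qvar_measurable) (use t adapted_measurable[OF A(2)] in auto)
  show "AE \<omega> in M. \<exists>C. \<forall>n\<in>UNIV. \<bar>qvar t n A \<omega>\<bar> \<le> C"
    using A(1) unfolding finite_variation_def
  proof eventually_elim
    case (elim \<omega>)
    then obtain C where C: "\<And>n p. is_partition 0 T n p \<Longrightarrow>
        (\<Sum>k<n. \<bar>A (p (Suc k)) \<omega> - A (p k) \<omega>\<bar>) \<le> C" by blast
    have "\<bar>qvar t n A \<omega>\<bar> \<le> C\<^sup>2" for n
    proof (cases "n = 0")
      case True
      then show ?thesis by (simp add: qvar_def)
    next
      case False
      define p where "p k = (if k \<le> n then grid t n k else T)" for k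
      have "is_partition 0 T (Suc n) p"
        unfolding is_partition_def p_def
        using t False grid_mono[OF t(1)] order_trans[OF grid_bounds(2)[OF t(1)] t(2)] by auto
      from C[OF this] have "(\<Sum>k<n. \<bar>A (p (Suc k)) \<omega> - A (p k) \<omega>\<bar>) \<le> C"
        by (simp add: sum.lessThan_Suc)
      also have "(\<Sum>k<n. \<bar>A (p (Suc k)) \<omega> - A (p k) \<omega>\<bar>) =
          (\<Sum>k<n. \<bar>A (grid t n (Suc k)) \<omega> - A (grid t n k) \<omega>\<bar>)"
        by (intro sum.cong) (auto simp: p_def)
      finally have "(\<Sum>k<n. \<bar>A (grid t n (Suc k)) \<omega> - A (grid t n k) \<omega>\<bar>)\<^sup>2 \<le> C\<^sup>2"
        by (intro power_mono sum_nonneg) auto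
      then show ?thesis
        using sum_squares_le_square_sum_abs[of "\<lambda>k. A (grid t n (Suc k)) \<omega> - A (grid t n k) \<omega>" n] qvar_nonneg[of t n A \<omega>]
        unfolding qvar_def by linarith
    qed
    then show ?case by blast
  qed
qed simp

text \<open>
The squared increments of a sum are at most twice the sum of the squares.
\<close>

theorem tight_qvar_semimartingale:
  assumes X: "continuous_semimartingale M past T X" and t: "0 \<le> t" "t \<le> T"
  shows "tight_family UNIV (\<lambda>n. qvar t n X)"
proof -
  from X obtain N A where N: "continuous_paths M T N" "local_martingale M past T N"
    and A: "adapted past T A" "finite_variation M T A"
    and dec: "AE \<omega> in M. \<forall>t\<in>{0..T}. X t \<omega> = N t \<omega> + A t \<omega>"
    unfolding continuous_semimartingale_def by blast
  have Nad: "adapted past T N" using N unfolding local_martingale_def by blast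
  have m: "qvar t n N \<in> borel_measurable M" "qvar t n A \<in> borel_measurable M" for n
    by (rule qvar_measurable; use t adapted_measurable[OF A(1)] adapted_measurable[OF Nad] in auto)+
  note tN = tight_qvar_local_martingale[OF N(2,1) t] and tA = tight_qvar_finite_variation[OF A(2,1) t]
  show ?thesis
  proof (rule tight_family_mono[where g = "\<lambda>n \<omega>. (qvar t n N \<omega> + qvar t n N \<omega>) + (qvar t n A \<omega> + qvar t n A \<omega>)"])
    show "tight_family UNIV (\<lambda>n \<omega>. (qvar t n N \<omega> + qvar t n N \<omega>) + (qvar t n A \<omega> + qvar t n A \<omega>))"
      using m tN tA by (intro tight_family_add borel_measurable_add) auto
    show "AE \<omega> in M. \<bar>qvar t n X \<omega>\<bar> \<le> \<bar>(qvar t n N \<omega> + qvar t n N \<omega>) + (qvar t n A \<omega> + qvar t n A \<omega>)\<bar>" for n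
      using dec
    proof eventually_elim
      case (elim \<omega>)
      have sq: "(a + b)\<^sup>2 \<le> 2 * a\<^sup>2 + 2 * b\<^sup>2" for a b :: real
        using zero_le_power2[of "a - b"] by (simp add: power2_eq_square algebra_simps)
      have "qvar t n X \<omega> \<le> (\<Sum>k<n. 2 * (N (grid t n (Suc k)) \<omega> - N (grid t n k) \<omega>)\<^sup>2 +
          2 * (A (grid t n (Suc k)) \<omega> - A (grid t n k) \<omega>)\<^sup>2)"
        unfolding qvar_def
      proof (rule sum_mono)
        fix k assume "k \<in> {..<n}"
        then have "grid t n k \<in> {0..T}" "grid t n (Suc k) \<in> {0..T}"
          using grid_bounds[OF t(1), of k n] grid_bounds[OF t(1), of "Suc k" n] t by auto
        then have "X (grid t n (Suc k)) \<omega> - X (grid t n k) \<omega> =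
          (N (grid t n (Suc k)) \<omega> - N (grid t n k) \<omega>) + (A (grid t n (Suc k)) \<omega> - A (grid t n k) \<omega>)"
          using elim by simp
        then show "(X (grid t n (Suc k)) \<omega> - X (grid t n k) \<omega>)\<^sup>2 \<le>
          2 * (N (grid t n (Suc k)) \<omega> - N (grid t n k) \<omega>)\<^sup>2 +
          2 * (A (grid t n (Suc k)) \<omega> - A (grid t n k) \<omega>)\<^sup>2" using sq by metis
      qed
      also have "\<dots> = 2 * qvar t n N \<omega> + 2 * qvar t n A \<omega>"
        by (simp add: qvar_def sum.distrib sum_distrib_left)
      finally show ?case using qvar_nonneg[of t n X \<omega>] qvar_nonneg[of t n N \<omega>] qvar_nonneg[of t n A \<omega>]
        by linarith
    qed
  qed (use m in auto)
qed

end

section \<open>Covariation with the Brownian motion\<close>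

context brownian_space
begin

text \<open>
These are the properties of the averages of \<open>u\<close> against test functions, after passing to a continuous
modification and truncating it, that the stochastic calculus below relies on.
\<close>

definition tame_process :: "real \<Rightarrow> (real \<Rightarrow> 'w \<Rightarrow> real) \<Rightarrow> bool" where
  "tame_process C Z \<longleftrightarrow> adapted past T Z \<and> (\<forall>s \<omega>. \<bar>Z s \<omega>\<bar> \<le> C) \<and> continuous_paths M T Z \<and>
     (\<forall>t\<in>{0..T}. tight_family UNIV (\<lambda>n. qvar t n Z))"

lemma tame_processD:
  assumes "tame_process C Z"
  shows "adapted past T Z" "\<bar>Z s \<omega>\<bar> \<le> C" "continuous_paths M T Z"
    "0 \<le> t \<Longrightarrow> t \<le> T \<Longrightarrow> tight_family UNIV (\<lambda>n. qvar t n Z)"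
    "0 \<le> t \<Longrightarrow> t \<le> T \<Longrightarrow> Z t \<in> borel_measurable (past t)"
    "0 \<le> t \<Longrightarrow> t \<le> T \<Longrightarrow> Z t \<in> borel_measurable M"
  using assms adapted_measurable[of Z t] unfolding tame_process_def adapted_def by auto

lemma tame_process_second_moment:
  assumes Z: "tame_process C Z" and s: "0 \<le> s" "s \<le> T"
  shows "expectation (\<lambda>\<omega>. (Z s \<omega>)\<^sup>2) \<le> C\<^sup>2"
proof -
  have le: "(Z s \<omega>)\<^sup>2 \<le> C\<^sup>2" for \<omega>
    using power_mono[OF tame_processD(2)[OF Z, of s \<omega>], of 2] by simp
  have "expectation (\<lambda>\<omega>. (Z s \<omega>)\<^sup>2) \<le> expectation (\<lambda>_. C\<^sup>2)"
    using le tame_processD(6)[OF Z s] by (intro integral_mono integrable_const_bound[where B = "C\<^sup>2"]) auto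
  then show ?thesis by (simp add: prob_space)
qed

text \<open>
Pathwise uniform continuity becomes uniform continuity in mean square by dominated convergence along
sequences of pairs of times whose distance tends to 0.
\<close>

lemma tame_process_mean_square_modulus:
  assumes Z: "tame_process C Z" and "0 < e"
  shows "\<exists>d>0. \<forall>s\<in>{0..T}. \<forall>r\<in>{0..T}. \<bar>s - r\<bar> < d \<longrightarrow> expectation (\<lambda>\<omega>. (Z s \<omega> - Z r \<omega>)\<^sup>2) < e"
proof (rule ccontr)
  assume neg: "\<not> ?thesis"
  define P where "P n s r \<longleftrightarrow> s \<in> {0..T} \<and> r \<in> {0..T} \<and> \<bar>s - r\<bar> < 1 / real (Suc n) \<and>
      e \<le> expectation (\<lambda>\<omega>. (Z s \<omega> - Z r \<omega>)\<^sup>2)" for n s r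
  have "\<exists>s r. P n s r" for n
  proof -
    have "0 < 1 / real (Suc n)" by simp
    with neg show ?thesis unfolding P_def by (meson not_less)
  qed
  then obtain s r where "\<And>n. P n (s n) (r n)" by metis
  then have sr: "\<And>n. s n \<in> {0..T}" "\<And>n. r n \<in> {0..T}" "\<And>n. \<bar>s n - r n\<bar> < 1 / real (Suc n)"
    "\<And>n. e \<le> expectation (\<lambda>\<omega>. (Z (s n) \<omega> - Z (r n) \<omega>)\<^sup>2)" unfolding P_def by blast+
  have dist0: "(\<lambda>n. dist (s n) (r n)) \<longlonglongrightarrow> 0"
  proof (rule tendsto_sandwich[OF _ _ tendsto_const LIMSEQ_inverse_real_of_nat])
    have "dist (s n) (r n) \<le> inverse (real (Suc n))" for n
      using less_imp_le[OF sr(3)[of n]] by (simp only: dist_real_def inverse_eq_divide)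
    then show "eventually (\<lambda>n. dist (s n) (r n) \<le> inverse (real (Suc n))) sequentially"
      by (intro always_eventually allI)
  qed simp
  have m: "Z (s n) \<in> borel_measurable M" "Z (r n) \<in> borel_measurable M" for n
    using tame_processD(6)[OF Z] sr(1,2)[of n] by auto
  \<comment> \<open>The modulus fails along these sequences, although the mean squares tend to 0.\<close>
  have "(\<lambda>n. expectation (\<lambda>\<omega>. (Z (s n) \<omega> - Z (r n) \<omega>)\<^sup>2)) \<longlonglongrightarrow> expectation (\<lambda>\<omega>. 0)"
  proof (rule integral_dominated_convergence[where w = "\<lambda>_. (2 * C)\<^sup>2"])
    show "AE \<omega> in M. (\<lambda>n. (Z (s n) \<omega> - Z (r n) \<omega>)\<^sup>2) \<longlonglongrightarrow> 0"
      using tame_processD(3)[OF Z] unfolding continuous_paths_def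
    proof eventually_elim
      case (elim \<omega>)
      then have "uniformly_continuous_on {0..T} (\<lambda>t. Z t \<omega>)"
        by (rule compact_uniformly_continuous) auto
      then have "(\<lambda>n. dist (Z (s n) \<omega>) (Z (r n) \<omega>)) \<longlonglongrightarrow> 0"
        unfolding uniformly_continuous_on_sequentially using sr(1,2) dist0 by blast
      then have "(\<lambda>n. (dist (Z (s n) \<omega>) (Z (r n) \<omega>))\<^sup>2) \<longlonglongrightarrow> 0\<^sup>2" by (rule tendsto_power)
      then show ?case by (simp add: dist_real_def)
    qed
    show "AE \<omega> in M. norm ((Z (s n) \<omega> - Z (r n) \<omega>)\<^sup>2) \<le> (2 * C)\<^sup>2" for n
    proof (rule AE_I2)
      fix \<omega>
      have "\<bar>Z (s n) \<omega> - Z (r n) \<omega>\<bar> \<le> 2 * C"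
        using tame_processD(2)[OF Z, of "s n" \<omega>] tame_processD(2)[OF Z, of "r n" \<omega>] by linarith
      then have "\<bar>Z (s n) \<omega> - Z (r n) \<omega>\<bar>\<^sup>2 \<le> (2 * C)\<^sup>2" by (intro power_mono) auto
      then show "norm ((Z (s n) \<omega> - Z (r n) \<omega>)\<^sup>2) \<le> (2 * C)\<^sup>2" by simp
    qed
  qed (use m in auto)
  then have "e \<le> 0"
    using sr(4) by (intro LIMSEQ_le_const[where X = "\<lambda>n. expectation (\<lambda>\<omega>. (Z (s n) \<omega> - Z (r n) \<omega>)\<^sup>2)"]) auto
  with \<open>0 < e\<close> show False by simp
qed

text \<open>
The index \<open>n\<close>, with value 0, is included so that the maximum is over a nonempty set also for \<open>n = 0\<close>.
\<close>

definition max_incr :: "real \<Rightarrow> nat \<Rightarrow> 'n \<Rightarrow> 'w \<Rightarrow> real" where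
  "max_incr t n i \<omega> =
     Max ((\<lambda>k. if k < n then \<bar>incr (grid t n k) (grid t n (Suc k)) i \<omega>\<bar> else 0) ` {..n})"

lemma max_incr_nonneg: "0 \<le> max_incr t n i \<omega>"
  unfolding max_incr_def by (rule Max_ge) (auto intro!: image_eqI[of _ _ n])

lemma incr_le_max_incr: "k < n \<Longrightarrow> \<bar>incr (grid t n k) (grid t n (Suc k)) i \<omega>\<bar> \<le> max_incr t n i \<omega>"
  unfolding max_incr_def by (rule Max_ge) (auto intro!: image_eqI[of _ _ k])

lemma incr_measurable:
  assumes "0 \<le> s" "s \<le> t" "t \<le> T"
  shows "incr s t i \<in> borel_measurable M"
  using incr_mean_zero(1)[OF assms] by (rule borel_measurable_integrable)

lemma grid_in_range:
  assumes "0 \<le> t" "t \<le> T" "k \<le> n"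
  shows "0 \<le> grid t n k" "grid t n k \<le> t" "grid t n k \<le> T"
  using grid_bounds[OF assms(1,3)] assms by auto

lemma grid_incr_measurable:
  assumes "0 \<le> t" "t \<le> T" "k < n"
  shows "incr (grid t n k) (grid t n (Suc k)) i \<in> borel_measurable M"
  using grid_in_range[OF assms(1,2), of k n] grid_in_range[OF assms(1,2), of "Suc k" n] assms
    grid_mono[OF assms(1), of k "Suc k" n] by (intro incr_measurable) auto

lemma max_incr_measurable:
  assumes "0 \<le> t" "t \<le> T"
  shows "max_incr t n i \<in> borel_measurable M"
  unfolding max_incr_def[abs_def]
proof (rule borel_measurable_Max)
  show "(\<lambda>\<omega>. if k < n then \<bar>incr (grid t n k) (grid t n (Suc k)) i \<omega>\<bar> else 0) \<in> borel_measurable M" for k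
    using grid_incr_measurable[OF assms, of k n i] by (cases "k < n") auto
qed auto

lemma max_incr_tendsto_0:
  assumes t: "0 \<le> t" "t \<le> T"
  shows "(\<lambda>n. prob_size (max_incr t n i)) \<longlonglongrightarrow> 0"
proof (rule prob_size_tendsto_0_AE)
  show "AE \<omega> in M. (\<lambda>n. max_incr t n i \<omega>) \<longlonglongrightarrow> 0"
    using B_continuous
  proof eventually_elim
    case (elim \<omega>)
    then have uc: "uniformly_continuous_on {0..T} (\<lambda>t. B t \<omega>)"
      by (rule compact_uniformly_continuous) auto
    show ?case
    proof (rule LIMSEQ_I)
      fix e :: real assume "0 < e"
      with uc obtain d where d: "0 < d" "\<And>r s. r \<in> {0..T} \<Longrightarrow> s \<in> {0..T} \<Longrightarrow> dist r s < d \<Longrightarrow>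
          dist (B r \<omega>) (B s \<omega>) < e"
        unfolding uniformly_continuous_on_def by metis
      obtain N where N: "t / d < real N" using reals_Archimedean2 by blast
      have "norm (max_incr t n i \<omega> - 0) < e" if n: "Suc N \<le> n" for n
      proof -
        have "t / n < d"
        proof -
          have "t < real N * d" using N d(1) by (simp add: pos_divide_less_eq)
          also have "\<dots> \<le> real n * d" using n d(1) by (intro mult_right_mono) auto
          finally show ?thesis using n by (simp add: pos_divide_less_eq mult.commute)
        qed
        have sm: "(if k < n then \<bar>incr (grid t n k) (grid t n (Suc k)) i \<omega>\<bar> else 0) < e" if "k \<le> n" for k
        proof (cases "k < n")
          case True
          have "grid t n (Suc k) - grid t n k = t / n" using True by (intro grid_step) auto
          then have "dist (grid t n (Suc k)) (grid t n k) < d"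
            using t(1) \<open>t / n < d\<close> by (simp add: dist_real_def)
          then have "dist (B (grid t n (Suc k)) \<omega>) (B (grid t n k) \<omega>) < e"
            using True grid_in_range[OF t, of k n] grid_in_range[OF t, of "Suc k" n] by (intro d(2)) auto
          then have "\<bar>incr (grid t n k) (grid t n (Suc k)) i \<omega>\<bar> < e"
            using component_le_norm_cart[of "B (grid t n (Suc k)) \<omega> - B (grid t n k) \<omega>" i] by (simp add: dist_norm)
          then show ?thesis using True by simp
        qed (use \<open>0 < e\<close> in auto)
        then have "max_incr t n i \<omega> < e"
          unfolding max_incr_def using sm by (intro Max_less_iff[THEN iffD2]) ((simp; fail) | blast)+
        then show ?thesis using max_incr_nonneg[of t n i \<omega>] by simp
      qed
      then show "\<exists>N. \<forall>n\<ge>N. norm (max_incr t n i \<omega> - 0) < e" by blast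
    qed
  qed
qed (use max_incr_measurable[OF t] in auto)

lemma (in prob_space) tight_family_sum:
  assumes "finite J" "\<And>j n. j \<in> J \<Longrightarrow> f j n \<in> borel_measurable M" "\<And>j. j \<in> J \<Longrightarrow> tight_family UNIV (f j)"
  shows "tight_family UNIV (\<lambda>(n::nat) \<omega>. \<Sum>j\<in>J. f j n \<omega>)"
  using assms
proof (induction J)
  case empty
  show ?case using tight_family_const[of "\<lambda>_. 0" UNIV] by simp
next
  case (insert j J)
  have "tight_family UNIV (\<lambda>n \<omega>. f j n \<omega> + (\<Sum>j\<in>J. f j n \<omega>))"
    using insert by (intro tight_family_add) auto
  with insert show ?case by simp
qed

lemma tight_qvar_B:
  assumes t: "0 \<le> t" "t \<le> T"
  shows "tight_family UNIV (\<lambda>n. qvar t n (\<lambda>s \<omega>. B s \<omega> $ i))"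
    "qvar t n (\<lambda>s \<omega>. B s \<omega> $ i) \<in> borel_measurable M"
proof -
  have mom: "integrable M (\<lambda>\<omega>. (incr (grid t n k) (grid t n (Suc k)) i \<omega>)\<^sup>2)"
    "expectation (\<lambda>\<omega>. (incr (grid t n k) (grid t n (Suc k)) i \<omega>)\<^sup>2) = t / n" if "k < n" for n k
  proof -
    have *: "0 \<le> grid t n k" "grid t n k \<le> grid t n (Suc k)" "grid t n (Suc k) \<le> T"
      using that grid_in_range[OF t, of k n] grid_in_range[OF t, of "Suc k" n] grid_mono[OF t(1), of k "Suc k" n] by auto
    show "integrable M (\<lambda>\<omega>. (incr (grid t n k) (grid t n (Suc k)) i \<omega>)\<^sup>2)"
      "expectation (\<lambda>\<omega>. (incr (grid t n k) (grid t n (Suc k)) i \<omega>)\<^sup>2) = t / n"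
      using incr_component_moments(5,6)[OF *] grid_step[of n t k] that by auto
  qed
  have int: "integrable M (qvar t n (\<lambda>s \<omega>. B s \<omega> $ i))" for n
    unfolding qvar_def[abs_def] using mom(1) by (intro Bochner_Integration.integrable_sum) auto
  then show "qvar t n (\<lambda>s \<omega>. B s \<omega> $ i) \<in> borel_measurable M" by auto
  show "tight_family UNIV (\<lambda>n. qvar t n (\<lambda>s \<omega>. B s \<omega> $ i))"
  proof (rule tight_if_expectation_bounded[OF int])
    fix n
    have "expectation (\<lambda>\<omega>. \<bar>qvar t n (\<lambda>s \<omega>. B s \<omega> $ i) \<omega>\<bar>) = (\<Sum>k<n. t / n)"
      unfolding abs_of_nonneg[OF qvar_nonneg] unfolding qvar_def using mom
      by (subst Bochner_Integration.integral_sum) auto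
    also have "\<dots> \<le> t" using t by (cases "n = 0") auto
    finally show "expectation (\<lambda>\<omega>. \<bar>qvar t n (\<lambda>s \<omega>. B s \<omega> $ i) \<omega>\<bar>) \<le> t" .
  qed
qed

lemma (in prob_space) stratonovich_sums_tendsto:
  assumes I: "stratonovich_integral M X Y s I"
    and p: "\<And>r. is_partition 0 s (N r) (p r)"
    and mesh: "\<And>d. 0 < d \<Longrightarrow> eventually (\<lambda>r. \<forall>k<N r. p r (Suc k) - p r k < d) sequentially"
    and m: "\<And>r. (\<lambda>\<omega>. \<Sum>k<N r. (X (p r (Suc k)) \<omega> + X (p r k) \<omega>) / 2 * (Y (p r (Suc k)) \<omega> - Y (p r k) \<omega>)) \<in> borel_measurable M"
  shows "(\<lambda>r::nat. prob_size (\<lambda>\<omega>. (\<Sum>k<N r. (X (p r (Suc k)) \<omega> + X (p r k) \<omega>) / 2 * (Y (p r (Suc k)) \<omega> - Y (p r k) \<omega>)) - I \<omega>)) \<longlonglongrightarrow> 0"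
    (is "(\<lambda>r. prob_size (?S r)) \<longlonglongrightarrow> 0")
proof (rule LIMSEQ_I)
  fix e :: real assume "0 < e"
  then have e2: "0 < e / 2" by simp
  have Im: "I \<in> borel_measurable M" using I unfolding stratonovich_integral_def by blast
  from conjunct2[OF I[unfolded stratonovich_integral_def], THEN spec, THEN mp, OF e2]
  obtain d where d: "0 < d" "\<And>n p. is_partition 0 s n p \<and> (\<forall>k<n. p (Suc k) - p k < d) \<Longrightarrow>
        measure M {\<omega>\<in>space M.
          \<bar>(\<Sum>k<n. (X (p (Suc k)) \<omega> + X (p k) \<omega>) / 2 * (Y (p (Suc k)) \<omega> - Y (p k) \<omega>)) - I \<omega>\<bar> > e / 2}
        < e / 2"
    by blast
  from mesh[OF d(1)] obtain R where R: "\<And>r. R \<le> r \<Longrightarrow> \<forall>k<N r. p r (Suc k) - p r k < d"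
    unfolding eventually_sequentially by blast
  have "norm (prob_size (?S r) - 0) < e" if "R \<le> r" for r
  proof -
    have "prob {\<omega>\<in>space M. \<bar>?S r \<omega>\<bar> > e / 2} < e / 2" using d(2)[of "N r" "p r"] p[of r] R[OF that] by blast
    moreover have "prob_size (?S r) \<le> e / 2 + prob {\<omega>\<in>space M. \<bar>?S r \<omega>\<bar> > e / 2}"
      using m[of r] Im e2 by (intro prob_size_le_prob borel_measurable_diff) auto
    ultimately show ?thesis using prob_size_nonneg[of "?S r"] by simp
  qed
  then show "\<exists>R. \<forall>r\<ge>R. norm (prob_size (?S r) - 0) < e" by blast
qed

lemma (in prob_space) stratonovich_integral_measurable: "stratonovich_integral M X Y s I \<Longrightarrow> I \<in> borel_measurable M"
  unfolding stratonovich_integral_def by blast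

text \<open>
Integrate \<open>|f| \<le> a/2 + f\<^sup>2/(2a)\<close>.
\<close>

lemma (in prob_space) prob_size_le_L2:
  assumes [measurable]: "f \<in> borel_measurable M" and "integrable M (\<lambda>\<omega>. (f \<omega>)\<^sup>2)" "expectation (\<lambda>\<omega>. (f \<omega>)\<^sup>2) \<le> a\<^sup>2" "0 < a"
  shows "prob_size f \<le> a"
proof -
  have le: "min 1 \<bar>f \<omega>\<bar> \<le> a / 2 + (f \<omega>)\<^sup>2 / (2 * a)" for \<omega>
  proof -
    have "2 * a * \<bar>f \<omega>\<bar> \<le> a\<^sup>2 + (f \<omega>)\<^sup>2" using sum_squares_bound[of a "\<bar>f \<omega>\<bar>"] by simp
    then have "\<bar>f \<omega>\<bar> \<le> a / 2 + (f \<omega>)\<^sup>2 / (2 * a)"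
      using \<open>0 < a\<close> by (simp add: field_simps power2_eq_square)
    then show ?thesis by linarith
  qed
  have "prob_size f \<le> expectation (\<lambda>\<omega>. a / 2 + (f \<omega>)\<^sup>2 / (2 * a))"
    unfolding prob_size_def using assms le by (intro integral_mono integrable_min_one) auto
  also have "\<dots> = a / 2 + expectation (\<lambda>\<omega>. (f \<omega>)\<^sup>2) / (2 * a)"
    using assms(2) by (simp add: prob_space)
  also have "\<dots> \<le> a / 2 + a\<^sup>2 / (2 * a)" using assms(3,4) by (intro add_left_mono divide_right_mono) auto
  also have "\<dots> = a" using \<open>0 < a\<close> by (simp add: power2_eq_square)
  finally show ?thesis .
qed

text \<open>
First error in the covariation sums: the product of increments is replaced by its mean. By orthogonality
the second moment is of order \<open>1/n\<close>.
\<close>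

lemma tame_noise_bound:
  fixes i j :: 'n and n :: nat
  assumes Z: "tame_process C Z" and t: "0 \<le> t" "t \<le> T" and "0 < n"
  defines "U \<equiv> \<lambda>\<omega>. \<Sum>k<n. Z (grid t n k) \<omega> * covariation_noise (t / n) j i (B (grid t n (Suc k)) \<omega> - B (grid t n k) \<omega>)"
  shows "U \<in> borel_measurable M" "prob_size U \<le> 3 * (\<bar>C\<bar> + 1) * (t + 1) / sqrt n"
proof -
  have gr: "0 \<le> grid t n k" "grid t n k \<le> grid t n (Suc k)" "grid t n (Suc k) \<le> T"
    "grid t n (Suc k) - grid t n k = t / n" "grid t n k \<le> T" if "k < n" for k
    using that grid_in_range[OF t, of k n] grid_in_range[OF t, of "Suc k" n] grid_mono[OF t(1), of k "Suc k" n]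
      grid_step[OF \<open>0 < n\<close>] by auto
  have mom: "integrable M (\<lambda>\<omega>. covariation_noise (t / n) j i (B (grid t n (Suc k)) \<omega> - B (grid t n k) \<omega>))"
    "expectation (\<lambda>\<omega>. covariation_noise (t / n) j i (B (grid t n (Suc k)) \<omega> - B (grid t n k) \<omega>)) = 0"
    "integrable M (\<lambda>\<omega>. (covariation_noise (t / n) j i (B (grid t n (Suc k)) \<omega> - B (grid t n k) \<omega>))\<^sup>2)"
    "expectation (\<lambda>\<omega>. (covariation_noise (t / n) j i (B (grid t n (Suc k)) \<omega> - B (grid t n k) \<omega>))\<^sup>2) \<le> 8 * (t / n)\<^sup>2"
    if "k < n" for k
    using covariation_noise_moments[OF gr(1-3)[OF that], of j i] unfolding gr(4)[OF that] by blast+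
  have iso: "integrable M U" "integrable M (\<lambda>\<omega>. (U \<omega>)\<^sup>2)"
    "expectation (\<lambda>\<omega>. (U \<omega>)\<^sup>2) = (\<Sum>k<n. expectation (\<lambda>\<omega>. (Z (grid t n k) \<omega>)\<^sup>2) *
       expectation (\<lambda>\<omega>. (covariation_noise (t / n) j i (B (grid t n (Suc k)) \<omega> - B (grid t n k) \<omega>))\<^sup>2))"
    unfolding U_def
    by (rule discrete_ito_isometry[where p = "grid t n" and C = C and G = "\<lambda>k. Z (grid t n k)" and f = "\<lambda>k. covariation_noise (t / n) j i"];
      use gr mom grid_in_range[OF t, of n n] tame_processD(2,5)[OF Z] in \<open>auto simp: grid_mono\<close>)+
  show Um: "U \<in> borel_measurable M" using iso(1) by auto
  have Z2: "expectation (\<lambda>\<omega>. (Z (grid t n k) \<omega>)\<^sup>2) \<le> C\<^sup>2" if "k < n" for k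
    by (rule tame_process_second_moment[OF Z]) (use gr[OF that] in auto)
  have "expectation (\<lambda>\<omega>. (U \<omega>)\<^sup>2) \<le> (\<Sum>k<n. C\<^sup>2 * (8 * (t / n)\<^sup>2))"
    unfolding iso(3) using Z2 mom(4) by (intro sum_mono mult_mono) (auto intro!: Bochner_Integration.integral_nonneg)
  also have "\<dots> = 8 * C\<^sup>2 * t\<^sup>2 / n" using \<open>0 < n\<close> by (simp add: power2_eq_square field_simps)
  also have "\<dots> \<le> (3 * (\<bar>C\<bar> + 1) * (t + 1) / sqrt n)\<^sup>2"
  proof -
    have "\<bar>C\<bar> * t \<le> (\<bar>C\<bar> + 1) * (t + 1)" using t by (intro mult_mono) auto
    then have "(\<bar>C\<bar> * t)\<^sup>2 \<le> ((\<bar>C\<bar> + 1) * (t + 1))\<^sup>2" using t by (intro power_mono) auto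
    then have "8 * (C\<^sup>2 * t\<^sup>2) \<le> 9 * ((\<bar>C\<bar> + 1)\<^sup>2 * (t + 1)\<^sup>2)"
      unfolding power_mult_distrib power2_abs
      by (smt (verit, ccfv_threshold) mult_nonneg_nonneg zero_le_power2)
    then have "8 * (C\<^sup>2 * t\<^sup>2) / n \<le> 9 * ((\<bar>C\<bar> + 1)\<^sup>2 * (t + 1)\<^sup>2) / n"
      by (intro divide_right_mono) auto
    moreover have "(3 * (\<bar>C\<bar> + 1) * (t + 1) / sqrt n)\<^sup>2 = 9 * ((\<bar>C\<bar> + 1)\<^sup>2 * (t + 1)\<^sup>2) / n"
      unfolding power_divide power_mult_distrib by simp
    ultimately show ?thesis by (simp add: mult.assoc)
  qed
  finally show "prob_size U \<le> 3 * (\<bar>C\<bar> + 1) * (t + 1) / sqrt n"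
    using Um iso(2) t \<open>0 < n\<close> by (intro prob_size_le_L2) auto
qed

lemma grid_refine:
  assumes "0 < r"
  shows "grid t (n * r) (k * r) = grid t n k"
  using assms by (simp add: grid_def)

text \<open>
Second error in the covariation sums: within each coarse cell the integrand of an Ito sum along a finer
grid is frozen at the left end point. The bound does not depend on the refinement \<open>r\<close>, which is what
allows \<open>r\<close> to tend to infinity before \<open>n\<close>.
\<close>

lemma tame_block_error:
  fixes i j :: 'n and n r :: nat
  assumes Z: "tame_process C Z" and t: "0 \<le> t" "t \<le> T" and n: "0 < n" "0 < r" and "0 < a"
    and modulus: "\<And>s u. s \<in> {0..T} \<Longrightarrow> u \<in> {0..T} \<Longrightarrow> \<bar>s - u\<bar> \<le> t / n \<Longrightarrow> expectation (\<lambda>\<omega>. (Z s \<omega> - Z u \<omega>)\<^sup>2) \<le> a\<^sup>2"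
  defines "\<rho> \<equiv> \<lambda>k \<omega>. \<Sum>l\<in>{k*r..<k*r+r}. (Z (grid t (n*r) l) \<omega> - Z (grid t n k) \<omega>) * incr (grid t (n*r) l) (grid t (n*r) (Suc l)) j \<omega>"
  defines "U \<equiv> \<lambda>\<omega>. \<Sum>k<n. incr (grid t n k) (grid t n (Suc k)) i \<omega> * \<rho> k \<omega>"
  shows "U \<in> borel_measurable M" "prob_size U \<le> a * t"
proof -
  have block: "integrable M (\<rho> k)" "integrable M (\<lambda>\<omega>. (\<rho> k \<omega>)\<^sup>2)" "expectation (\<lambda>\<omega>. (\<rho> k \<omega>)\<^sup>2) \<le> a\<^sup>2 * (t / n)" if k: "k < n" for k
  proof -
    have kr: "k * r + l \<le> n * r" if "l \<le> r" for l
    proof -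
      have "k * r + l \<le> Suc k * r" using that by simp
      also have "\<dots> \<le> n * r" using k by (intro mult_right_mono) auto
      finally show ?thesis .
    qed
    define p where "p l = grid t (n*r) (k*r+l)" for l
    have p0: "p 0 = grid t n k" unfolding p_def using grid_refine[OF n(2)] by simp
    have pr: "0 \<le> p l" "p l \<le> T" "p l - p 0 \<le> t / n" "p 0 \<le> p l" if "l \<le> r" for l
    proof -
      show "0 \<le> p l" "p l \<le> T" unfolding p_def using grid_in_range[OF t kr[OF that]] by auto
      have "p l \<le> p r" unfolding p_def by (rule grid_mono[OF t(1)]) (use that in auto)
      also have "p r = grid t n (Suc k)"
        unfolding p_def using grid_refine[OF n(2), of t n "Suc k"] by (simp add: add.commute)
      finally show "p l - p 0 \<le> t / n" using grid_step[OF n(1), of t k] p0 by simp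
      show "p 0 \<le> p l" unfolding p_def by (rule grid_mono[OF t(1)]) auto
    qed
    have ps: "p l \<le> p (Suc l)" for l unfolding p_def by (rule grid_mono[OF t(1)]) auto
    have pstep: "p (Suc l) - p l = t / (n * r)" for l
      unfolding p_def using grid_step[of "n * r" t "k*r+l"] n by simp
    define G where "G l \<omega> = Z (p l) \<omega> - Z (p 0) \<omega>" for l \<omega>
    have \<rho>: "\<rho> k = (\<lambda>\<omega>. \<Sum>l<r. G l \<omega> * (\<lambda>x. x $ j) (B (p (Suc l)) \<omega> - B (p l) \<omega>))"
    proof
      fix \<omega>
      have "\<rho> k \<omega> = (\<Sum>l\<in>{0..<r}. (Z (grid t (n*r) (l+k*r)) \<omega> - Z (grid t n k) \<omega>) * incr (grid t (n*r) (l+k*r)) (grid t (n*r) (Suc (l+k*r))) j \<omega>)"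
        unfolding \<rho>_def using sum.shift_bounds_nat_ivl[of "\<lambda>l. (Z (grid t (n*r) l) \<omega> - Z (grid t n k) \<omega>) * incr (grid t (n*r) l) (grid t (n*r) (Suc l)) j \<omega>" 0 "k*r" r]
        by (simp add: add.commute)
      then show "\<rho> k \<omega> = (\<Sum>l<r. G l \<omega> * (\<lambda>x. x $ j) (B (p (Suc l)) \<omega> - B (p l) \<omega>))"
        unfolding G_def p0 unfolding p_def by (simp add: add.commute lessThan_atLeast0)
    qed
    have Gm: "G l \<in> borel_measurable (past (p l))" if "l < r" for l
      unfolding G_def using pr[of l] pr[of 0] that tame_processD(5)[OF Z, of "p l"]
        measurable_past_mono[OF tame_processD(5)[OF Z, of "p 0"], of "p l"]
      by (intro borel_measurable_diff) auto
    have Gb: "\<bar>G l \<omega>\<bar> \<le> 2 * C" for l \<omega>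
      unfolding G_def using tame_processD(2)[OF Z, of "p l" \<omega>] tame_processD(2)[OF Z, of "p 0" \<omega>] by linarith
    note mom = incr_component_moments(5,6)[OF pr(1) ps] incr_mean_zero[OF pr(1) ps]
    have iso: "integrable M (\<rho> k)" "integrable M (\<lambda>\<omega>. (\<rho> k \<omega>)\<^sup>2)"
      "expectation (\<lambda>\<omega>. (\<rho> k \<omega>)\<^sup>2) = (\<Sum>l<r. expectation (\<lambda>\<omega>. (G l \<omega>)\<^sup>2) *
         expectation (\<lambda>\<omega>. ((\<lambda>x. x $ j) (B (p (Suc l)) \<omega> - B (p l) \<omega>))\<^sup>2))"
      unfolding \<rho>
      by (rule discrete_ito_isometry[where p = p and C = "2 * C" and G = G and f = "\<lambda>_ x. x $ j"];
        use pr ps mom Gm Gb in auto)+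
    show "integrable M (\<rho> k)" "integrable M (\<lambda>\<omega>. (\<rho> k \<omega>)\<^sup>2)" by fact+
    have "expectation (\<lambda>\<omega>. (\<rho> k \<omega>)\<^sup>2) \<le> (\<Sum>l<r. a\<^sup>2 * (t / (n * r)))"
      unfolding iso(3)
    proof (intro sum_mono mult_mono)
      fix l assume l: "l \<in> {..<r}"
      show "expectation (\<lambda>\<omega>. (G l \<omega>)\<^sup>2) \<le> a\<^sup>2"
        unfolding G_def using pr[of l] pr[of 0] l by (intro modulus) auto
      show "expectation (\<lambda>\<omega>. ((\<lambda>x. x $ j) (B (p (Suc l)) \<omega> - B (p l) \<omega>))\<^sup>2) \<le> t / (n * r)"
        using incr_component_moments(6)[of "p l" "p (Suc l)" j] ps[of l] pr(1)[of l] pr(2)[of "Suc l"] l pstep[of l]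
        by simp
    qed (auto intro!: Bochner_Integration.integral_nonneg)
    also have "\<dots> = a\<^sup>2 * (t / n)" using n by simp
    finally show "expectation (\<lambda>\<omega>. (\<rho> k \<omega>)\<^sup>2) \<le> a\<^sup>2 * (t / n)" .
  qed
  have gr: "0 \<le> grid t n k" "grid t n k \<le> grid t n (Suc k)" "grid t n (Suc k) \<le> T"
    "grid t n (Suc k) - grid t n k = t / n" if "k < n" for k
    using that grid_in_range[OF t, of k n] grid_in_range[OF t, of "Suc k" n] grid_mono[OF t(1), of k "Suc k" n]
      grid_step[OF n(1)] by auto
  define d where "d k \<omega> = incr (grid t n k) (grid t n (Suc k)) i \<omega>" for k \<omega>
  have dmom: "integrable M (\<lambda>\<omega>. (d k \<omega>)\<^sup>2)" "expectation (\<lambda>\<omega>. (d k \<omega>)\<^sup>2) = t / n" if "k < n" for k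
    unfolding d_def using incr_component_moments(5,6)[OF gr(1-3)[OF that]] gr(4)[OF that] by auto
  have dm: "d k \<in> borel_measurable M" if "k < n" for k
    unfolding d_def using grid_incr_measurable[OF t that] .
  show Um: "U \<in> borel_measurable M"
    unfolding U_def using dm block(1) unfolding d_def
    by (intro borel_measurable_sum borel_measurable_times) auto
  define W where "W \<omega> = (\<Sum>k<n. a / 2 * (d k \<omega>)\<^sup>2 + (\<rho> k \<omega>)\<^sup>2 / (2 * a))" for \<omega>
  have Wi: "integrable M W"
    unfolding W_def using dmom block by (intro Bochner_Integration.integrable_sum Bochner_Integration.integrable_add) auto
  have UW: "\<bar>U \<omega>\<bar> \<le> W \<omega>" for \<omega>
  proof -
    have "\<bar>U \<omega>\<bar> \<le> (\<Sum>k<n. \<bar>d k \<omega> * \<rho> k \<omega>\<bar>)" unfolding U_def d_def by (rule sum_abs)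
    also have "\<dots> \<le> W \<omega>"
      unfolding W_def
    proof (rule sum_mono)
      fix k
      have "2 * (a * \<bar>d k \<omega>\<bar>) * \<bar>\<rho> k \<omega>\<bar> \<le> (a * \<bar>d k \<omega>\<bar>)\<^sup>2 + \<bar>\<rho> k \<omega>\<bar>\<^sup>2" by (rule sum_squares_bound)
      then show "\<bar>d k \<omega> * \<rho> k \<omega>\<bar> \<le> a / 2 * (d k \<omega>)\<^sup>2 + (\<rho> k \<omega>)\<^sup>2 / (2 * a)"
        using \<open>0 < a\<close> by (simp add: field_simps power2_eq_square abs_mult)
    qed
    finally show ?thesis .
  qed
  have Ui: "integrable M U"
    by (rule Bochner_Integration.integrable_bound[OF Wi Um]) (use order_trans[OF UW abs_ge_self] in auto)
  have "prob_size U \<le> expectation (\<lambda>\<omega>. \<bar>U \<omega>\<bar>)" by (rule prob_size_le_expectation[OF Ui])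
  also have "\<dots> \<le> expectation W" using Ui Wi UW by (intro integral_mono) auto
  also have "\<dots> = (\<Sum>k<n. a / 2 * (t / n) + expectation (\<lambda>\<omega>. (\<rho> k \<omega>)\<^sup>2) / (2 * a))"
    unfolding W_def using dmom block by (subst Bochner_Integration.integral_sum) (auto simp: mult.commute)
  also have "\<dots> \<le> (\<Sum>k<n. a / 2 * (t / n) + a\<^sup>2 * (t / n) / (2 * a))"
    using block(3) \<open>0 < a\<close> by (intro sum_mono add_left_mono divide_right_mono) auto
  also have "\<dots> = a * t" using n \<open>0 < a\<close> by (simp add: field_simps power2_eq_square)
  finally show "prob_size U \<le> a * t" .
qed

lemma stratonovich_grid_sums_tendsto:
  assumes Z: "tame_process C Z" and t: "0 \<le> t" "t \<le> T" and k: "k \<le> n" "0 < n"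
    and I: "stratonovich_integral M Z (\<lambda>s \<omega>. B s \<omega> $ j) (grid t n k) I"
  shows "(\<lambda>r. prob_size (\<lambda>\<omega>. (\<Sum>l<k * Suc r. (Z (grid t (n * Suc r) (Suc l)) \<omega> + Z (grid t (n * Suc r) l) \<omega>) / 2
      * incr (grid t (n * Suc r) l) (grid t (n * Suc r) (Suc l)) j \<omega>) - I \<omega>)) \<longlonglongrightarrow> 0"
proof -
  have kr: "k * Suc r \<le> n * Suc r" for r using k(1) by (intro mult_right_mono) auto
  have part: "is_partition 0 (grid t n k) (k * Suc r) (grid t (n * Suc r))" for r
    unfolding is_partition_def using grid_refine[of "Suc r" t n k] grid_mono[OF t(1)] by auto
  have mesh: "eventually (\<lambda>r. \<forall>l<k * Suc r. grid t (n * Suc r) (Suc l) - grid t (n * Suc r) l < d) sequentially"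
    if "0 < d" for d
  proof -
    obtain R where R: "t / d < real R" using reals_Archimedean2 by blast
    show ?thesis
    proof (rule eventually_sequentiallyI[of R])
      fix r assume "R \<le> r"
      have "t < real R * d" using R that by (simp add: pos_divide_less_eq)
      also have "\<dots> \<le> real (n * Suc r) * d"
      proof (intro mult_right_mono)
        have "R \<le> n * Suc r" using \<open>R \<le> r\<close> k(2) by (cases n) auto
        then show "real R \<le> real (n * Suc r)" by (rule of_nat_mono)
      qed (use that in auto)
      finally have "t < d * real (n * Suc r)" by (simp only: mult.commute)
      moreover have "0 < real (n * Suc r)" using k(2) by (simp only: of_nat_0_less_iff) simp
      ultimately have "t / real (n * Suc r) < d" by (simp only: pos_divide_less_eq)
      moreover have "grid t (n * Suc r) (Suc l) - grid t (n * Suc r) l = t / real (n * Suc r)" for l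
        using k(2) by (intro grid_step) auto
      ultimately show "\<forall>l<k * Suc r. grid t (n * Suc r) (Suc l) - grid t (n * Suc r) l < d" by simp
    qed
  qed
  have m: "(\<lambda>\<omega>. \<Sum>l<k * Suc r. (Z (grid t (n * Suc r) (Suc l)) \<omega> + Z (grid t (n * Suc r) l) \<omega>) / 2
      * (B (grid t (n * Suc r) (Suc l)) \<omega> $ j - B (grid t (n * Suc r) l) \<omega> $ j)) \<in> borel_measurable M" for r
  proof (rule borel_measurable_sum)
    fix l assume "l \<in> {..<k * Suc r}"
    then have l: "l < n * Suc r" using kr[of r] by auto
    show "(\<lambda>\<omega>. (Z (grid t (n * Suc r) (Suc l)) \<omega> + Z (grid t (n * Suc r) l) \<omega>) / 2
      * (B (grid t (n * Suc r) (Suc l)) \<omega> $ j - B (grid t (n * Suc r) l) \<omega> $ j)) \<in> borel_measurable M"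
      using grid_incr_measurable[OF t l, of j] tame_processD(6)[OF Z]
        grid_in_range[OF t, of l "n * Suc r"] grid_in_range[OF t, of "Suc l" "n * Suc r"] l
      by (intro borel_measurable_times borel_measurable_divide borel_measurable_add) auto
  qed
  show ?thesis
    using stratonovich_sums_tendsto[OF I part mesh m] by simp
qed

lemma (in -) sum_block: "(\<Sum>l<Suc k * r. f l) = (\<Sum>l<k * r. f l) + (\<Sum>l\<in>{k * r..<k * r + r}. f l)"
  for f :: "nat \<Rightarrow> real"
  using sum.nat_group[of f r k] sum.nat_group[of f r "Suc k"] by simp

text \<open>
The algebra in a single coarse cell \<open>L\<close>. An increment \<open>x\<close> is compared with the increments \<open>di j\<close> of the
Stratonovich integrals, these with their symmetric sums \<open>ds j\<close> over the fine grid, and a symmetric sum is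
the frozen value \<open>zk j\<close> times the increment \<open>db j\<close>, plus the freezing error, plus half a covariation sum.
\<close>

lemma (in -) covariation_decomposition:
  fixes x h :: real and z b :: "'n::finite \<Rightarrow> nat \<Rightarrow> real" and di ds zk db :: "'n \<Rightarrow> real"
  assumes ds: "\<And>j. ds j = (\<Sum>l\<in>L. (z j (Suc l) + z j l) / 2 * b j l)"
    and db: "\<And>j. db j = (\<Sum>l\<in>L. b j l)"
  shows "x * db i - zk i * h =
      (x - (\<Sum>j\<in>UNIV. di j)) * db i + (\<Sum>j\<in>UNIV. (di j - ds j) * db i)
    + (\<Sum>j\<in>UNIV. zk j * (db j * db i - (if j = i then h else 0)))
    + (\<Sum>j\<in>UNIV. db i * (\<Sum>l\<in>L. (z j l - zk j) * b j l))
    + (\<Sum>j\<in>UNIV. db i * (\<Sum>l\<in>L. (z j (Suc l) - z j l) / 2 * b j l))"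
proof -
  have *: "ds j * db i = zk j * (db j * db i) + db i * (\<Sum>l\<in>L. (z j l - zk j) * b j l)
      + db i * (\<Sum>l\<in>L. (z j (Suc l) - z j l) / 2 * b j l)" for j
  proof -
    define A where "A = (\<Sum>l\<in>L. (z j l - zk j) * b j l)"
    define E where "E = (\<Sum>l\<in>L. (z j (Suc l) - z j l) / 2 * b j l)"
    have "zk j * db j + A + E
        = (\<Sum>l\<in>L. zk j * b j l + (z j l - zk j) * b j l + (z j (Suc l) - z j l) / 2 * b j l)"
      unfolding A_def E_def by (simp add: db sum.distrib sum_distrib_left)
    also have "\<dots> = ds j" unfolding ds by (intro sum.cong refl) (simp add: field_simps)
    finally have "ds j = zk j * db j + A + E" ..
    then show ?thesis unfolding A_def[symmetric] E_def[symmetric] by (simp add: algebra_simps)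
  qed
  have "(\<Sum>j\<in>UNIV. zk j * (db j * db i - (if j = i then h else 0))) =
      (\<Sum>j\<in>UNIV. zk j * (db j * db i)) - (\<Sum>j\<in>UNIV. if j = i then zk j * h else 0)"
    unfolding sum_subtractf[symmetric] by (intro sum.cong refl) (simp add: algebra_simps)
  also have "(\<Sum>j\<in>UNIV. if j = i then zk j * h else 0) = zk i * h" by simp
  finally show ?thesis
    by (simp add: left_diff_distrib sum_subtractf * sum.distrib sum_distrib_right)
qed

text \<open>
With a coarse grid of \<open>n\<close> cells, each divided into \<open>r + 1\<close> cells, the decomposition above produces five
terms. The drift contributes at most the growth of \<open>\<alpha>\<close> times the largest increment of the Brownian
motion. The distance between the Stratonovich integrals and their symmetric sums vanishes for fixed \<open>n\<close> as
\<open>r\<close> grows. The third and fourth terms are the errors bounded before. The last one is a product of the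
largest coarse increment and of the fine covariation sums, and the latter are bounded in probability by
the quadratic variations of \<open>Z\<close> and \<open>B\<close>, uniformly in \<open>n\<close> and \<open>r\<close>. This term expresses that the
covariation of \<open>Z\<close> with \<open>B\<close>, being of finite variation, has no covariation with \<open>B\<close>.
\<close>

theorem covariation_tendsto:
  fixes X :: "real \<Rightarrow> 'w \<Rightarrow> real" and Z :: "'n \<Rightarrow> real \<Rightarrow> 'w \<Rightarrow> real" and I :: "'n \<Rightarrow> real \<Rightarrow> 'w \<Rightarrow> real"
    and \<alpha> :: "real \<Rightarrow> real"
  assumes t: "0 \<le> t" "t \<le> T"
    and Xm: "\<And>s. 0 \<le> s \<Longrightarrow> s \<le> t \<Longrightarrow> X s \<in> borel_measurable M"
    and Z: "\<And>j. tame_process (C j) (Z j)"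
    and I: "\<And>j s. 0 \<le> s \<Longrightarrow> s \<le> t \<Longrightarrow> stratonovich_integral M (Z j) (\<lambda>s \<omega>. B s \<omega> $ j) s (I j s)"
    and drift: "\<And>s r. 0 \<le> r \<Longrightarrow> r \<le> s \<Longrightarrow> s \<le> t \<Longrightarrow>
      AE \<omega> in M. \<bar>(X s \<omega> - X r \<omega>) - (\<Sum>j\<in>UNIV. I j s \<omega> - I j r \<omega>)\<bar> \<le> \<alpha> s - \<alpha> r"
  shows "(\<lambda>n. prob_size (\<lambda>\<omega>.
      (\<Sum>k<n. (X (grid t n (Suc k)) \<omega> - X (grid t n k) \<omega>) * incr (grid t n k) (grid t n (Suc k)) i \<omega>)
      - (\<Sum>k<n. Z i (grid t n k) \<omega> * (t / n)))) \<longlonglongrightarrow> 0"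
    (is "(\<lambda>n. prob_size (?K n)) \<longlonglongrightarrow> 0")
proof -
  define db where "db n k j \<omega> = incr (grid t n k) (grid t n (Suc k)) j \<omega>" for n k j \<omega>
  have dbm: "db n k j \<in> borel_measurable M" if "k < n" for n k j
    unfolding db_def using grid_incr_measurable[OF t that] .
  define z where "z m j l \<omega> = Z j (grid t m l) \<omega>" for m j l \<omega>
  have zm: "z m j l \<in> borel_measurable M" if "l \<le> m" for m j l
    unfolding z_def using grid_in_range[OF t that] tame_processD(6)[OF Z] by auto
  define S where "S n r j k \<omega> = (\<Sum>l<k * Suc r. (z (n * Suc r) j (Suc l) \<omega> + z (n * Suc r) j l \<omega>) / 2 * db (n * Suc r) l j \<omega>)"
    for n r j k \<omega>
  define D where "D n j k \<omega> = I j (grid t n (Suc k)) \<omega> - I j (grid t n k) \<omega>" for n j k \<omega>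
  define T1 where "T1 n \<omega> = (\<Sum>k<n. (X (grid t n (Suc k)) \<omega> - X (grid t n k) \<omega> - (\<Sum>j\<in>UNIV. D n j k \<omega>)) * db n k i \<omega>)" for n \<omega>
  define T2 where "T2 n r \<omega> = (\<Sum>k<n. \<Sum>j\<in>UNIV. (D n j k \<omega> - (S n r j (Suc k) \<omega> - S n r j k \<omega>)) * db n k i \<omega>)" for n r \<omega>
  define T3 where "T3 n j \<omega> = (\<Sum>k<n. z n j k \<omega> * covariation_noise (t / n) j i (B (grid t n (Suc k)) \<omega> - B (grid t n k) \<omega>))" for n j \<omega>
  define T4 where "T4 n r j \<omega> = (\<Sum>k<n. db n k i \<omega> * (\<Sum>l\<in>{k * Suc r..<k * Suc r + Suc r}.
      (z (n * Suc r) j l \<omega> - z n j k \<omega>) * db (n * Suc r) l j \<omega>))" for n r j \<omega>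
  define T5 where "T5 n r \<omega> = (\<Sum>k<n. \<Sum>j\<in>UNIV. db n k i \<omega> * (\<Sum>l\<in>{k * Suc r..<k * Suc r + Suc r}.
      (z (n * Suc r) j (Suc l) \<omega> - z (n * Suc r) j l \<omega>) / 2 * db (n * Suc r) l j \<omega>))" for n r \<omega>
  have gr: "0 \<le> grid t n k" "grid t n k \<le> grid t n (Suc k)" "grid t n (Suc k) \<le> t" "grid t n k \<le> t" "0 \<le> grid t n (Suc k)" if "k < n" for n k
    using that grid_in_range[OF t, of k n] grid_in_range[OF t, of "Suc k" n] grid_mono[OF t(1), of k "Suc k" n] by auto
  have Im: "I j s \<in> borel_measurable M" if "0 \<le> s" "s \<le> t" for j s
    using I[OF that] by (rule stratonovich_integral_measurable)
  have Dm: "D n j k \<in> borel_measurable M" if "k < n" for n j k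
    unfolding D_def using gr[OF that] by (intro borel_measurable_diff Im) auto
  have kl: "l < n * Suc r" if "l < k * Suc r" "k \<le> n" for k l n r
    using that by (metis less_le_trans mult_le_mono1)
  have kl2: "l < n * Suc r" if "l < k * Suc r + Suc r" "k < n" for k l n r
    using kl[of l "Suc k" r n] that by simp
  have Sm: "S n r j k \<in> borel_measurable M" if "k \<le> n" for n r j k
    unfolding S_def using kl[OF _ that]
    by (intro borel_measurable_sum borel_measurable_times borel_measurable_divide borel_measurable_add zm dbm) (auto intro: Suc_leI less_imp_le)
  have T1m: "T1 n \<in> borel_measurable M" for n
    unfolding T1_def using gr by (intro borel_measurable_sum borel_measurable_times borel_measurable_diff Xm dbm Dm) (auto intro: order_trans)
  have T2m: "T2 n r \<in> borel_measurable M" for n r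
    unfolding T2_def by (intro borel_measurable_sum borel_measurable_times borel_measurable_diff Sm dbm Dm) auto
  have zkm: "z n j k \<in> borel_measurable M" if "k < n" for n j k using zm[of k n j] that by simp
  have noise: "(\<lambda>\<omega>. covariation_noise h j i (B (grid t n (Suc k)) \<omega> - B (grid t n k) \<omega>)) \<in> borel_measurable M"
    if "k < n" for h n j k
    by (rule measurable_compose[OF increment_measurable covariation_noise_measurable]) (use gr[OF that] t in auto)
  have T3m: "T3 n j \<in> borel_measurable M" for n j
    unfolding T3_def by (intro borel_measurable_sum borel_measurable_times zkm noise) auto
  have T4m: "T4 n r j \<in> borel_measurable M" for n r j
    unfolding T4_def using kl2
    by (intro borel_measurable_sum borel_measurable_times borel_measurable_diff zkm dbm) auto
  have T5m: "T5 n r \<in> borel_measurable M" for n r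
    unfolding T5_def using kl2
    by (intro borel_measurable_sum borel_measurable_times borel_measurable_diff borel_measurable_divide zm dbm) (auto intro: Suc_leI less_imp_le)
  have decomp: "?K n \<omega> = T1 n \<omega> + T2 n r \<omega> + (\<Sum>j\<in>UNIV. T3 n j \<omega>) + (\<Sum>j\<in>UNIV. T4 n r j \<omega>) + T5 n r \<omega>" if "0 < n" for n r \<omega>
  proof -
    have "(X (grid t n (Suc k)) \<omega> - X (grid t n k) \<omega>) * db n k i \<omega> - z n i k \<omega> * (t / n) =
        (X (grid t n (Suc k)) \<omega> - X (grid t n k) \<omega> - (\<Sum>j\<in>UNIV. D n j k \<omega>)) * db n k i \<omega>
      + (\<Sum>j\<in>UNIV. (D n j k \<omega> - (S n r j (Suc k) \<omega> - S n r j k \<omega>)) * db n k i \<omega>)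
      + (\<Sum>j\<in>UNIV. z n j k \<omega> * (db n k j \<omega> * db n k i \<omega> - (if j = i then t / n else 0)))
      + (\<Sum>j\<in>UNIV. db n k i \<omega> * (\<Sum>l\<in>{k * Suc r..<k * Suc r + Suc r}.
          (z (n * Suc r) j l \<omega> - z n j k \<omega>) * db (n * Suc r) l j \<omega>))
      + (\<Sum>j\<in>UNIV. db n k i \<omega> * (\<Sum>l\<in>{k * Suc r..<k * Suc r + Suc r}.
          (z (n * Suc r) j (Suc l) \<omega> - z (n * Suc r) j l \<omega>) / 2 * db (n * Suc r) l j \<omega>))" if "k < n" for k
    proof (rule covariation_decomposition)
      fix j
      show "S n r j (Suc k) \<omega> - S n r j k \<omega> =
          (\<Sum>l\<in>{k * Suc r..<k * Suc r + Suc r}. (z (n * Suc r) j (Suc l) \<omega> + z (n * Suc r) j l \<omega>) / 2 * db (n * Suc r) l j \<omega>)"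
        unfolding S_def sum_block by simp
      have "(\<Sum>l\<in>{k * Suc r..<k * Suc r + Suc r}. db (n * Suc r) l j \<omega>) =
          (\<Sum>l\<in>{k * Suc r..<Suc k * Suc r}. B (grid t (n * Suc r) (Suc l)) \<omega> $ j - B (grid t (n * Suc r) l) \<omega> $ j)"
      proof -
        have e: "k * Suc r + Suc r = Suc k * Suc r" by simp
        show ?thesis unfolding e db_def by (simp only: vector_minus_component)
      qed
      also have "\<dots> = B (grid t (n * Suc r) (Suc k * Suc r)) \<omega> $ j - B (grid t (n * Suc r) (k * Suc r)) \<omega> $ j"
        by (rule sum_Suc_diff') simp
      also have "\<dots> = db n k j \<omega>"
        unfolding grid_refine[OF zero_less_Suc] by (simp add: db_def)
      finally show "db n k j \<omega> = (\<Sum>l\<in>{k * Suc r..<k * Suc r + Suc r}. db (n * Suc r) l j \<omega>)" ..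
    qed
    note dec = this
    have "?K n \<omega> = (\<Sum>k<n. (X (grid t n (Suc k)) \<omega> - X (grid t n k) \<omega>) * db n k i \<omega> - z n i k \<omega> * (t / n))"
      by (simp add: db_def z_def sum_subtractf)
    also have "\<dots> = T1 n \<omega> + T2 n r \<omega>
      + (\<Sum>k<n. \<Sum>j\<in>UNIV. z n j k \<omega> * (db n k j \<omega> * db n k i \<omega> - (if j = i then t / n else 0)))
      + (\<Sum>k<n. \<Sum>j\<in>UNIV. db n k i \<omega> * (\<Sum>l\<in>{k * Suc r..<k * Suc r + Suc r}.
          (z (n * Suc r) j l \<omega> - z n j k \<omega>) * db (n * Suc r) l j \<omega>)) + T5 n r \<omega>"
      unfolding T1_def T2_def T5_def sum.distrib[symmetric] using dec by (intro sum.cong refl) auto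
    also have "(\<Sum>k<n. \<Sum>j\<in>UNIV. z n j k \<omega> * (db n k j \<omega> * db n k i \<omega> - (if j = i then t / n else 0))) = (\<Sum>j\<in>UNIV. T3 n j \<omega>)"
      unfolding T3_def covariation_noise_def db_def by (rule sum.swap)
    also have "(\<Sum>k<n. \<Sum>j\<in>UNIV. db n k i \<omega> * (\<Sum>l\<in>{k * Suc r..<k * Suc r + Suc r}.
          (z (n * Suc r) j l \<omega> - z n j k \<omega>) * db (n * Suc r) l j \<omega>)) = (\<Sum>j\<in>UNIV. T4 n r j \<omega>)"
      unfolding T4_def by (rule sum.swap)
    finally show ?thesis .
  qed
  have size: "prob_size (?K n) \<le> prob_size (T1 n) + prob_size (T2 n r) + (\<Sum>j\<in>UNIV. prob_size (T3 n j))
      + (\<Sum>j\<in>UNIV. prob_size (T4 n r j)) + prob_size (T5 n r)" if "0 < n" for n r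
  proof -
    have s3: "(\<lambda>\<omega>. \<Sum>j\<in>UNIV. T3 n j \<omega>) \<in> borel_measurable M" and s4: "(\<lambda>\<omega>. \<Sum>j\<in>UNIV. T4 n r j \<omega>) \<in> borel_measurable M"
      using T3m T4m by auto
    have "prob_size (?K n) \<le> prob_size (\<lambda>\<omega>. T1 n \<omega> + T2 n r \<omega> + (\<Sum>j\<in>UNIV. T3 n j \<omega>) + (\<Sum>j\<in>UNIV. T4 n r j \<omega>)) + prob_size (T5 n r)"
      unfolding decomp[OF that, of _ r] by (rule prob_size_add) (use T1m T2m s3 s4 T5m in auto)
    also have "prob_size (\<lambda>\<omega>. T1 n \<omega> + T2 n r \<omega> + (\<Sum>j\<in>UNIV. T3 n j \<omega>) + (\<Sum>j\<in>UNIV. T4 n r j \<omega>)) \<le>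
        prob_size (\<lambda>\<omega>. T1 n \<omega> + T2 n r \<omega> + (\<Sum>j\<in>UNIV. T3 n j \<omega>)) + prob_size (\<lambda>\<omega>. \<Sum>j\<in>UNIV. T4 n r j \<omega>)"
      by (rule prob_size_add) (use T1m T2m s3 s4 in auto)
    also have "prob_size (\<lambda>\<omega>. T1 n \<omega> + T2 n r \<omega> + (\<Sum>j\<in>UNIV. T3 n j \<omega>)) \<le>
        prob_size (\<lambda>\<omega>. T1 n \<omega> + T2 n r \<omega>) + prob_size (\<lambda>\<omega>. \<Sum>j\<in>UNIV. T3 n j \<omega>)"
      by (rule prob_size_add) (use T1m T2m s3 in auto)
    also have "prob_size (\<lambda>\<omega>. T1 n \<omega> + T2 n r \<omega>) \<le> prob_size (T1 n) + prob_size (T2 n r)"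
      by (rule prob_size_add) (use T1m T2m in auto)
    also have "prob_size (\<lambda>\<omega>. \<Sum>j\<in>UNIV. T3 n j \<omega>) \<le> (\<Sum>j\<in>UNIV. prob_size (T3 n j))"
      by (rule prob_size_sum) (use T3m in auto)
    also have "prob_size (\<lambda>\<omega>. \<Sum>j\<in>UNIV. T4 n r j \<omega>) \<le> (\<Sum>j\<in>UNIV. prob_size (T4 n r j))"
      by (rule prob_size_sum) (use T4m in auto)
    finally show ?thesis by linarith
  qed
  have mm: "max_incr t n i \<in> borel_measurable M" for n by (rule max_incr_measurable[OF t])
  have lim1: "(\<lambda>n. prob_size (T1 n)) \<longlonglongrightarrow> 0"
  proof (rule tendsto_sandwich[OF _ _ tendsto_const])
    show "(\<lambda>n. prob_size (\<lambda>\<omega>. max_incr t n i \<omega> * (\<alpha> t - \<alpha> 0))) \<longlonglongrightarrow> 0"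
      by (rule prob_size_mult_tight[OF mm _ max_incr_tendsto_0[OF t] tight_family_const]) auto
    show "\<forall>\<^sub>F n in sequentially. prob_size (T1 n) \<le> prob_size (\<lambda>\<omega>. max_incr t n i \<omega> * (\<alpha> t - \<alpha> 0))"
    proof (rule eventually_sequentiallyI[of 1])
      fix n :: nat assume "1 \<le> n"
      show "prob_size (T1 n) \<le> prob_size (\<lambda>\<omega>. max_incr t n i \<omega> * (\<alpha> t - \<alpha> 0))"
      proof (rule prob_size_mono_AE[OF T1m])
        have "AE \<omega> in M. \<bar>X (grid t n (Suc k)) \<omega> - X (grid t n k) \<omega> - (\<Sum>j\<in>UNIV. D n j k \<omega>)\<bar> \<le> \<alpha> (grid t n (Suc k)) - \<alpha> (grid t n k)"
          if "k < n" for k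
          unfolding D_def using gr[OF that] by (intro drift) auto
        then have "AE \<omega> in M. \<forall>k\<in>{..<n}. \<bar>X (grid t n (Suc k)) \<omega> - X (grid t n k) \<omega> - (\<Sum>j\<in>UNIV. D n j k \<omega>)\<bar> \<le> \<alpha> (grid t n (Suc k)) - \<alpha> (grid t n k)"
          by (intro AE_finite_allI) auto
        then show "AE \<omega> in M. \<bar>T1 n \<omega>\<bar> \<le> \<bar>max_incr t n i \<omega> * (\<alpha> t - \<alpha> 0)\<bar>"
        proof eventually_elim
          case (elim \<omega>)
          have "\<bar>T1 n \<omega>\<bar> \<le> (\<Sum>k<n. (\<alpha> (grid t n (Suc k)) - \<alpha> (grid t n k)) * max_incr t n i \<omega>)"
            unfolding T1_def
          proof (rule order_trans[OF sum_abs sum_mono])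
            fix k assume k: "k \<in> {..<n}"
            have a: "\<bar>X (grid t n (Suc k)) \<omega> - X (grid t n k) \<omega> - (\<Sum>j\<in>UNIV. D n j k \<omega>)\<bar> \<le> \<alpha> (grid t n (Suc k)) - \<alpha> (grid t n k)"
              using elim k by blast
            show "\<bar>(X (grid t n (Suc k)) \<omega> - X (grid t n k) \<omega> - (\<Sum>j\<in>UNIV. D n j k \<omega>)) * db n k i \<omega>\<bar> \<le>
              (\<alpha> (grid t n (Suc k)) - \<alpha> (grid t n k)) * max_incr t n i \<omega>"
              unfolding abs_mult db_def using k
              by (intro mult_mono a incr_le_max_incr order_trans[OF abs_ge_zero a]) auto
          qed
          also have "\<dots> = (\<alpha> (grid t n n) - \<alpha> (grid t n 0)) * max_incr t n i \<omega>"
            unfolding sum_distrib_right[symmetric] by (subst sum_lessThan_telescope) simp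
          also have "\<dots> = max_incr t n i \<omega> * (\<alpha> t - \<alpha> 0)" using \<open>1 \<le> n\<close> by (simp add: grid_end mult.commute)
          finally show ?case by simp
        qed
      qed (use mm in auto)
    qed
  qed (use prob_size_nonneg in auto)
  have lim2: "(\<lambda>r. prob_size (T2 n r)) \<longlonglongrightarrow> 0" if n: "0 < n" for n
  proof -
    define f where "f r j k \<omega> = (I j (grid t n k) \<omega> - S n r j k \<omega>)" for r j k \<omega>
    have fm: "f r j k \<in> borel_measurable M" if "k \<le> n" for r j k
      unfolding f_def using that grid_in_range[OF t that] by (intro borel_measurable_diff Sm Im) auto
    have f0: "(\<lambda>r. prob_size (f r j k)) \<longlonglongrightarrow> 0" if "k \<le> n" for j k
    proof -
      have "prob_size (f r j k) = prob_size (\<lambda>\<omega>. S n r j k \<omega> - I j (grid t n k) \<omega>)" for r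
        unfolding prob_size_def f_def by (simp add: abs_minus_commute)
      then show ?thesis
        using stratonovich_grid_sums_tendsto[OF Z[of j] t that n I[of "grid t n k" j]] grid_in_range[OF t that]
        unfolding S_def z_def db_def by simp
    qed
    have prod: "(\<lambda>r. prob_size (\<lambda>\<omega>. f r j l \<omega> * db n k i \<omega>)) \<longlonglongrightarrow> 0" if "l \<le> n" "k < n" for j l k
      by (rule prob_size_mult_tight[OF fm[OF that(1)] dbm[OF that(2)] f0[OF that(1)] tight_family_const[OF dbm[OF that(2)]]])
    have le: "prob_size (T2 n r) \<le> (\<Sum>k<n. \<Sum>j\<in>UNIV. prob_size (\<lambda>\<omega>. f r j (Suc k) \<omega> * db n k i \<omega>) + prob_size (\<lambda>\<omega>. f r j k \<omega> * db n k i \<omega>))" for r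
    proof -
      have "prob_size (T2 n r) \<le> (\<Sum>k<n. prob_size (\<lambda>\<omega>. \<Sum>j\<in>UNIV. (D n j k \<omega> - (S n r j (Suc k) \<omega> - S n r j k \<omega>)) * db n k i \<omega>))"
        unfolding T2_def
        by (rule prob_size_sum) (auto intro!: borel_measurable_sum borel_measurable_times borel_measurable_diff Sm dbm Dm)
      also have "\<dots> \<le> (\<Sum>k<n. \<Sum>j\<in>UNIV. prob_size (\<lambda>\<omega>. (D n j k \<omega> - (S n r j (Suc k) \<omega> - S n r j k \<omega>)) * db n k i \<omega>))"
        by (intro sum_mono prob_size_sum) (auto intro!: borel_measurable_times borel_measurable_diff Sm dbm Dm)
      also have "\<dots> \<le> (\<Sum>k<n. \<Sum>j\<in>UNIV. prob_size (\<lambda>\<omega>. f r j (Suc k) \<omega> * db n k i \<omega>) + prob_size (\<lambda>\<omega>. f r j k \<omega> * db n k i \<omega>))"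
      proof (intro sum_mono)
        fix k j assume k: "k \<in> {..<n}"
        have "prob_size (\<lambda>\<omega>. (D n j k \<omega> - (S n r j (Suc k) \<omega> - S n r j k \<omega>)) * db n k i \<omega>) =
            prob_size (\<lambda>\<omega>. f r j (Suc k) \<omega> * db n k i \<omega> + (- f r j k \<omega>) * db n k i \<omega>)"
          by (rule arg_cong[where f = prob_size]) (auto simp: D_def f_def algebra_simps)
        also have "\<dots> \<le> prob_size (\<lambda>\<omega>. f r j (Suc k) \<omega> * db n k i \<omega>) + prob_size (\<lambda>\<omega>. (- f r j k \<omega>) * db n k i \<omega>)"
          using k fm dbm by (intro prob_size_add) auto
        also have "prob_size (\<lambda>\<omega>. (- f r j k \<omega>) * db n k i \<omega>) = prob_size (\<lambda>\<omega>. f r j k \<omega> * db n k i \<omega>)"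
          by (simp add: prob_size_def)
        finally show "prob_size (\<lambda>\<omega>. (D n j k \<omega> - (S n r j (Suc k) \<omega> - S n r j k \<omega>)) * db n k i \<omega>) \<le>
          prob_size (\<lambda>\<omega>. f r j (Suc k) \<omega> * db n k i \<omega>) + prob_size (\<lambda>\<omega>. f r j k \<omega> * db n k i \<omega>)" .
      qed
      finally show ?thesis .
    qed
    show ?thesis
    proof (rule tendsto_sandwich[OF _ _ tendsto_const])
      have "(\<lambda>r. \<Sum>k<n. \<Sum>j\<in>UNIV. prob_size (\<lambda>\<omega>. f r j (Suc k) \<omega> * db n k i \<omega>) + prob_size (\<lambda>\<omega>. f r j k \<omega> * db n k i \<omega>))
          \<longlonglongrightarrow> (\<Sum>k<n. \<Sum>j\<in>(UNIV::'n set). 0 + 0)"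
        by (intro tendsto_sum tendsto_add prod) auto
      then show "(\<lambda>r. \<Sum>k<n. \<Sum>j\<in>UNIV. prob_size (\<lambda>\<omega>. f r j (Suc k) \<omega> * db n k i \<omega>) + prob_size (\<lambda>\<omega>. f r j k \<omega> * db n k i \<omega>)) \<longlonglongrightarrow> 0"
        by simp
    qed (use le prob_size_nonneg in auto)
  qed
  have lim3: "(\<lambda>n. \<Sum>j\<in>UNIV. prob_size (T3 n j)) \<longlonglongrightarrow> 0"
  proof -
    have "(\<lambda>n. prob_size (T3 n j)) \<longlonglongrightarrow> 0" for j
    proof (rule tendsto_sandwich[OF _ _ tendsto_const])
      have "(\<lambda>n. 3 * (\<bar>C j\<bar> + 1) * (t + 1) * inverse (sqrt (real n))) \<longlonglongrightarrow> 3 * (\<bar>C j\<bar> + 1) * (t + 1) * 0"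
        by (intro tendsto_mult tendsto_const tendsto_inverse_0_at_top filterlim_compose[OF sqrt_at_top filterlim_real_sequentially])
      then show "(\<lambda>n. 3 * (\<bar>C j\<bar> + 1) * (t + 1) / sqrt (real n)) \<longlonglongrightarrow> 0"
        by (simp add: divide_inverse)
      show "\<forall>\<^sub>F n in sequentially. prob_size (T3 n j) \<le> 3 * (\<bar>C j\<bar> + 1) * (t + 1) / sqrt (real n)"
        using tame_noise_bound(2)[OF Z[of j] t, of _ j i] unfolding T3_def z_def
        by (intro eventually_sequentiallyI[of 1]) auto
    qed (use prob_size_nonneg in auto)
    then have "(\<lambda>n. \<Sum>j\<in>UNIV. prob_size (T3 n j)) \<longlonglongrightarrow> (\<Sum>j\<in>(UNIV::'n set). 0)"
      by (intro tendsto_sum)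
    then show ?thesis by simp
  qed
  have lim4: "\<exists>N>0. \<forall>n\<ge>N. \<forall>r. (\<Sum>j\<in>UNIV. prob_size (T4 n r j)) \<le> e" if "0 < e" for e
  proof -
    define a where "a = e / (real CARD('n) * (t + 1))"
    have ct: "0 < real CARD('n) * (t + 1)" using t by (intro mult_pos_pos) auto
    then have "0 < a" using \<open>0 < e\<close> unfolding a_def by simp
    then have "0 < a\<^sup>2" by simp
    from tame_process_mean_square_modulus[OF Z this]
    have "\<forall>j. \<exists>d>0. \<forall>s\<in>{0..T}. \<forall>r\<in>{0..T}. \<bar>s - r\<bar> < d \<longrightarrow> expectation (\<lambda>\<omega>. (Z j s \<omega> - Z j r \<omega>)\<^sup>2) < a\<^sup>2" by blast
    then obtain d where d: "\<And>j. 0 < d j" "\<And>j s r. s \<in> {0..T} \<Longrightarrow> r \<in> {0..T} \<Longrightarrow> \<bar>s - r\<bar> < d j \<Longrightarrow> expectation (\<lambda>\<omega>. (Z j s \<omega> - Z j r \<omega>)\<^sup>2) < a\<^sup>2"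
      using choice[of "\<lambda>j d. d > 0 \<and> (\<forall>s\<in>{0..T}. \<forall>r\<in>{0..T}. \<bar>s - r\<bar> < d \<longrightarrow> expectation (\<lambda>\<omega>. (Z j s \<omega> - Z j r \<omega>)\<^sup>2) < a\<^sup>2)"] by blast
    define d0 where "d0 = Min (range d)"
    have d0: "0 < d0" "d0 \<le> d j" for j unfolding d0_def using d(1) by auto
    obtain N where N: "t / d0 < real N" using reals_Archimedean2 by blast
    have "(\<Sum>j\<in>UNIV. prob_size (T4 n r j)) \<le> e" if "Suc N \<le> n" for n r
    proof -
      have "t < real N * d0" using N d0(1) by (simp add: pos_divide_less_eq)
      also have "\<dots> \<le> real n * d0" using that d0(1) by (intro mult_right_mono) auto
      finally have tn: "t / n < d0" using that by (simp add: pos_divide_less_eq mult.commute)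
      have "prob_size (T4 n r j) \<le> a * t" for j
        unfolding T4_def z_def db_def
      proof (rule tame_block_error(2)[OF Z[of j] t])
        fix s u assume su: "s \<in> {0..T}" "u \<in> {0..T}" "\<bar>s - u\<bar> \<le> t / n"
        then have "\<bar>s - u\<bar> < d j" using tn d0(2)[of j] by linarith
        then show "expectation (\<lambda>\<omega>. (Z j s \<omega> - Z j u \<omega>)\<^sup>2) \<le> a\<^sup>2"
          using d(2)[OF su(1,2)] by (intro less_imp_le)
      qed (use that \<open>0 < a\<close> in auto)
      then have "(\<Sum>j\<in>UNIV. prob_size (T4 n r j)) \<le> (\<Sum>j\<in>(UNIV::'n set). a * t)" by (intro sum_mono)
      also have "\<dots> = real CARD('n) * (a * t)" by simp
      also have "\<dots> \<le> real CARD('n) * (a * (t + 1))" using \<open>0 < a\<close> by (intro mult_left_mono) auto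
      also have "\<dots> = e" unfolding a_def using t(1) by (simp add: add_nonneg_eq_0_iff)
      finally show ?thesis .
    qed
    then show ?thesis by (intro exI[of _ "Suc N"]) auto
  qed
  define H where "H m \<omega> = (\<Sum>j\<in>UNIV. qvar t m (Z j) \<omega> + qvar t m (\<lambda>s \<omega>. B s \<omega> $ j) \<omega>)" for m \<omega>
  have qZm: "qvar t m (Z j) \<in> borel_measurable M" for m j
    by (rule qvar_measurable) (use tame_processD(6)[OF Z] t in auto)
  have Hm: "H m \<in> borel_measurable M" for m
    unfolding H_def using qZm tight_qvar_B(2)[OF t] by auto
  have Ht: "tight_family UNIV H"
  proof -
    have "tight_family UNIV (\<lambda>m \<omega>. \<Sum>j\<in>UNIV. (\<lambda>j m \<omega>. qvar t m (Z j) \<omega> + qvar t m (\<lambda>s \<omega>. B s \<omega> $ j) \<omega>) j m \<omega>)"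
      using tame_processD(4)[OF Z t] tight_qvar_B[OF t] qZm by (intro tight_family_sum tight_family_add borel_measurable_add) auto
    then show ?thesis unfolding H_def[abs_def] by simp
  qed
  have le5: "\<bar>T5 n r \<omega>\<bar> \<le> \<bar>max_incr t n i \<omega> * H (n * Suc r) \<omega>\<bar>" for n r \<omega>
  proof -
    let ?m = "n * Suc r"
    define q where "q j l = (z ?m j (Suc l) \<omega> - z ?m j l \<omega>)\<^sup>2 + (db ?m l j \<omega>)\<^sup>2" for j l
    have q: "\<bar>(z ?m j (Suc l) \<omega> - z ?m j l \<omega>) / 2 * db ?m l j \<omega>\<bar> \<le> q j l" for j l
    proof -
      define x y where "x = z ?m j (Suc l) \<omega> - z ?m j l \<omega>" "y = db ?m l j \<omega>"
      have "2 * \<bar>x\<bar> * \<bar>y\<bar> \<le> \<bar>x\<bar>\<^sup>2 + \<bar>y\<bar>\<^sup>2" by (rule sum_squares_bound)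
      moreover have "\<bar>x / 2 * y\<bar> = (\<bar>x\<bar> * \<bar>y\<bar>) / 2" by (simp add: abs_mult)
      moreover have "0 \<le> \<bar>x\<bar> * \<bar>y\<bar>" by simp
      ultimately have "\<bar>x / 2 * y\<bar> \<le> x\<^sup>2 + y\<^sup>2" unfolding power2_abs by linarith
      then show ?thesis unfolding q_def x_y_def .
    qed
    have "\<bar>T5 n r \<omega>\<bar> \<le> (\<Sum>k<n. \<Sum>j\<in>UNIV. max_incr t n i \<omega> * (\<Sum>l\<in>{k * Suc r..<k * Suc r + Suc r}. q j l))"
      unfolding T5_def
    proof (intro order_trans[OF sum_abs sum_mono])
      fix k j assume k: "k \<in> {..<n}"
      show "\<bar>db n k i \<omega> * (\<Sum>l\<in>{k * Suc r..<k * Suc r + Suc r}. (z ?m j (Suc l) \<omega> - z ?m j l \<omega>) / 2 * db ?m l j \<omega>)\<bar>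
          \<le> max_incr t n i \<omega> * (\<Sum>l\<in>{k * Suc r..<k * Suc r + Suc r}. q j l)"
        unfolding abs_mult[of "db n k i \<omega>"]
      proof (rule mult_mono)
        show "\<bar>db n k i \<omega>\<bar> \<le> max_incr t n i \<omega>" unfolding db_def using k by (intro incr_le_max_incr) auto
        show "\<bar>\<Sum>l\<in>{k * Suc r..<k * Suc r + Suc r}. (z ?m j (Suc l) \<omega> - z ?m j l \<omega>) / 2 * db ?m l j \<omega>\<bar>
          \<le> (\<Sum>l\<in>{k * Suc r..<k * Suc r + Suc r}. q j l)"
          by (rule order_trans[OF sum_abs sum_mono[OF q]])
      qed (auto simp: max_incr_nonneg)
    qed
    also have "\<dots> = max_incr t n i \<omega> * (\<Sum>j\<in>UNIV. \<Sum>k<n. \<Sum>l\<in>{k * Suc r..<k * Suc r + Suc r}. q j l)"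
      by (subst sum.swap) (simp add: sum_distrib_left)
    also have "(\<Sum>j\<in>UNIV. \<Sum>k<n. \<Sum>l\<in>{k * Suc r..<k * Suc r + Suc r}. q j l) = (\<Sum>j\<in>UNIV. \<Sum>l<?m. q j l)"
      unfolding sum.nat_group ..
    also have "\<dots> = H ?m \<omega>"
      unfolding H_def q_def z_def db_def qvar_def sum.distrib by simp
    finally show ?thesis by linarith
  qed
  show ?thesis
  proof (rule LIMSEQ_I)
    fix e :: real assume "0 < e"
    define c where "c = e / 6"
    have c: "0 < c" using \<open>0 < e\<close> by (simp add: c_def)
    from Ht c obtain L where L: "1 \<le> L" "\<And>m. prob {\<omega>\<in>space M. \<bar>H m \<omega>\<bar> > L} < c"
      unfolding tight_family_def by (meson UNIV_I)
    have cL: "0 < c / L" using c L(1) by simp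
    \<comment> \<open>The level \<open>L\<close> is chosen before \<open>n\<close>, which must make the largest increment small relative to \<open>L\<close>; \<open>r\<close> is chosen last.\<close>
    from order_tendstoD(2)[OF max_incr_tendsto_0[OF t, of i] cL] obtain N1 where
      N1: "\<And>n. N1 \<le> n \<Longrightarrow> prob_size (max_incr t n i) < c / L" unfolding eventually_sequentially by blast
    from order_tendstoD(2)[OF lim1 c] obtain N2 where
      N2: "\<And>n. N2 \<le> n \<Longrightarrow> prob_size (T1 n) < c" unfolding eventually_sequentially by blast
    from order_tendstoD(2)[OF lim3 c] obtain N3 where
      N3: "\<And>n. N3 \<le> n \<Longrightarrow> (\<Sum>j\<in>UNIV. prob_size (T3 n j)) < c" unfolding eventually_sequentially by blast
    from lim4[OF c] obtain N4 where N4: "0 < N4" "\<And>n r. N4 \<le> n \<Longrightarrow> (\<Sum>j\<in>UNIV. prob_size (T4 n r j)) \<le> c" by blast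
    have "norm (prob_size (?K n) - 0) < e" if "N1 + N2 + N3 + N4 \<le> n" for n
    proof -
      have n: "N1 \<le> n" "N2 \<le> n" "N3 \<le> n" "N4 \<le> n" "0 < n" using that N4(1) by auto
      from order_tendstoD(2)[OF lim2[OF n(5)] c] obtain r where r: "prob_size (T2 n r) < c"
        unfolding eventually_sequentially by blast
      have "prob_size (T5 n r) \<le> prob_size (\<lambda>\<omega>. max_incr t n i \<omega> * H (n * Suc r) \<omega>)"
        using le5 by (intro prob_size_mono_AE T5m borel_measurable_times mm Hm) auto
      also have "\<dots> \<le> L * prob_size (max_incr t n i) + prob {\<omega>\<in>space M. \<bar>H (n * Suc r) \<omega>\<bar> > L}"
        by (rule prob_size_mult_le[OF mm Hm L(1)])
      also have "\<dots> < 2 * c"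
      proof -
        have "L * prob_size (max_incr t n i) < c"
          using N1[OF n(1)] L(1) by (simp add: pos_less_divide_eq mult.commute)
        then show ?thesis using L(2)[of "n * Suc r"] by linarith
      qed
      finally have "prob_size (T5 n r) < 2 * c" .
      then have "prob_size (?K n) < 6 * c"
        using size[OF n(5), of r] r N2[OF n(2)] N3[OF n(3)] N4(2)[OF n(4), of r] by linarith
      then show ?thesis using prob_size_nonneg[of "?K n"] by (simp add: c_def)
    qed
    then show "\<exists>N. \<forall>n\<ge>N. norm (prob_size (?K n) - 0) < e" by blast
  qed
qed

end

section \<open>Stochastic exponentials\<close>

subsection \<open>Integrals over the time interval\<close>

lemma measurable_component:
  fixes f :: "'a \<Rightarrow> real^'n"
  assumes "f \<in> borel_measurable N"
  shows "(\<lambda>x. f x $ i) \<in> borel_measurable N"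
  by (rule measurable_compose[OF assms borel_measurable_continuous_onI]) (intro continuous_intros)

lemma space_time [simp]: "space (time T) = {0..T}"
  by (simp add: time_def)

lemma sets_time: "sets (time T) = sets (restrict_space borel {0..T})"
  unfolding time_def by (rule sets_restrict_space_cong) simp

lemma borel_measurable_time: "f \<in> borel_measurable borel \<Longrightarrow> f \<in> borel_measurable (time T)"
  unfolding time_def by (rule measurable_restrict_space1) simp

lemma finite_measure_time: "finite_measure (time T)"
  unfolding time_def by (intro finite_measureI) (simp add: emeasure_restrict_space space_restrict_space emeasure_lborel_Icc_eq)

lemma set_integral_time:
  fixes f :: "real \<Rightarrow> 'b::euclidean_space"
  assumes "A \<subseteq> {0..T}"
  shows "(LINT s:A|lborel. f s) = (LINT s|time T. indicator A s *\<^sub>R f s)"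
  unfolding set_lebesgue_integral_def time_def using assms
  by (subst integral_restrict_space) (auto intro!: Bochner_Integration.integral_cong split: split_indicator)

definition step_fun :: "nat \<Rightarrow> (nat \<Rightarrow> real) \<Rightarrow> (nat \<Rightarrow> real^'n) \<Rightarrow> real \<Rightarrow> real^'n" where
  "step_fun n p c s = (\<Sum>k<n. indicator {p k<..p (Suc k)} s *\<^sub>R c k)"

lemma step_fun_measurable [measurable]: "step_fun n p c \<in> borel_measurable borel"
  unfolding step_fun_def[abs_def] by measurable

text \<open>
Clipping the points of a partition to \<open>[s, t]\<close> restricts elementary integrals to this interval without
adding points to the partition.
\<close>

definition clip :: "real \<Rightarrow> real \<Rightarrow> real \<Rightarrow> real" where
  "clip s t x = max s (min t x)"

lemma partition_mono:
  assumes "is_partition a c n p" "k \<le> l" "l \<le> n"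
  shows "p k \<le> p l"
proof (rule lift_Suc_mono_le[of "\<lambda>i. p (min i n)" k l, simplified min_absorb1[OF \<open>l \<le> n\<close>] min_absorb1[OF order_trans[OF \<open>k \<le> l\<close> \<open>l \<le> n\<close>]]])
  show "p (min i n) \<le> p (min (Suc i) n)" for i
    using assms(1) unfolding is_partition_def by (cases "i < n") (auto simp: min_def)
qed fact

lemma partition_range:
  assumes "is_partition a c n p" "k \<le> n"
  shows "a \<le> p k" "p k \<le> c"
  using partition_mono[OF assms(1), of 0 k] partition_mono[OF assms(1), of k n] assms
  unfolding is_partition_def by auto

lemma integral_step_fun:
  assumes p: "is_partition 0 T n p" and st: "0 \<le> s" "s \<le> t" "t \<le> T"
  shows "(LINT x|time T. indicator {s<..t} x * step_fun n p c x $ i) =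
      (\<Sum>k<n. c k $ i * (clip s t (p (Suc k)) - clip s t (p k)))"
proof -
  have 1: "(LINT x|time T. indicator {s<..t} x * (indicator {p k<..p (Suc k)} x * c k $ i)) =
      c k $ i * (clip s t (p (Suc k)) - clip s t (p k))"
    and 2: "integrable (time T) (\<lambda>x. indicator {s<..t} x * (indicator {p k<..p (Suc k)} x * c k $ i))"
    if k: "k < n" for k
  proof -
    have pk: "0 \<le> p k" "p k \<le> p (Suc k)" "p (Suc k) \<le> T"
      using p k partition_range[OF p, of k] partition_range[OF p, of "Suc k"] unfolding is_partition_def by auto
    interpret finite_measure "time T" by (rule finite_measure_time)
    have m: "(\<lambda>x. indicator {s<..t} x * (indicator {p k<..p (Suc k)} x * c k $ i)) \<in> borel_measurable (time T)"
      by (intro borel_measurable_time) measurable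
    show "integrable (time T) (\<lambda>x. indicator {s<..t} x * (indicator {p k<..p (Suc k)} x * c k $ i))"
      by (rule integrable_const_bound[OF _ m, where B = "\<bar>c k $ i\<bar>"]) (auto split: split_indicator)
    have "(LINT x|time T. indicator {s<..t} x * (indicator {p k<..p (Suc k)} x * c k $ i)) =
        (LINT x|lborel. indicator {0..T} x *\<^sub>R (indicator {s<..t} x * (indicator {p k<..p (Suc k)} x * c k $ i)))"
      unfolding time_def by (rule integral_restrict_space) simp
    also have "\<dots> = (LINT x|lborel. indicator {max s (p k)<..min t (p (Suc k))} x *\<^sub>R c k $ i)"
      by (rule Bochner_Integration.integral_cong) (use pk st in \<open>auto split: split_indicator\<close>)
    also have "\<dots> = measure lborel {max s (p k)<..min t (p (Suc k))} * c k $ i"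
      by (simp add: measure_def)
    also have "measure lborel {max s (p k)<..min t (p (Suc k))} = clip s t (p (Suc k)) - clip s t (p k)"
      using pk st by (auto simp: clip_def measure_def max_def min_def)
    finally show "(LINT x|time T. indicator {s<..t} x * (indicator {p k<..p (Suc k)} x * c k $ i)) =
      c k $ i * (clip s t (p (Suc k)) - clip s t (p k))" by simp
  qed
  have "(LINT x|time T. indicator {s<..t} x * step_fun n p c x $ i) =
    (LINT x|time T. (\<Sum>k<n. indicator {s<..t} x * (indicator {p k<..p (Suc k)} x * c k $ i)))"
    unfolding step_fun_def
    by (simp only: sum_component vector_scaleR_component sum_distrib_left real_scaleR_def mult.assoc)
  also have "\<dots> = (\<Sum>k<n. c k $ i * (clip s t (p (Suc k)) - clip s t (p k)))"
    using 1 2 by (subst Bochner_Integration.integral_sum) auto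
  finally show ?thesis .
qed

text \<open>
The cells of the partition are disjoint, so at most one summand is nonzero at \<open>x\<close>.
\<close>

lemma norm_step_fun:
  assumes p: "is_partition 0 T n p"
  shows "(norm (step_fun n p c x))\<^sup>2 = (\<Sum>k<n. indicator {p k<..p (Suc k)} x * (norm (c k))\<^sup>2)"
proof (cases "\<exists>k<n. x \<in> {p k<..p (Suc k)}")
  case True
  then obtain k where k: "k < n" "x \<in> {p k<..p (Suc k)}" by blast
  have other: "x \<notin> {p l<..p (Suc l)}" if "l < n" "l \<noteq> k" for l
  proof (cases "l < k")
    case True
    then have "p (Suc l) \<le> p k" using k(1) by (intro partition_mono[OF p]) auto
    then show ?thesis using k(2) by auto
  next
    case False
    then have "p (Suc k) \<le> p l" using that by (intro partition_mono[OF p]) auto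
    then show ?thesis using k(2) by auto
  qed
  have "step_fun n p c x = (\<Sum>l<n. if l = k then c k else 0)"
    unfolding step_fun_def using k other by (intro sum.cong refl) auto
  moreover have "(\<Sum>l<n. indicator {p l<..p (Suc l)} x * (norm (c l))\<^sup>2) = (\<Sum>l<n. if l = k then (norm (c k))\<^sup>2 else 0)"
    using k other by (intro sum.cong refl) auto
  ultimately show ?thesis using k(1) by simp
next
  case False
  then have "indicator {p k<..p (Suc k)} x = (0::real)" if "k < n" for k using that by auto
  then show ?thesis by (simp add: step_fun_def)
qed

lemma integral_norm_step_fun:
  assumes p: "is_partition 0 T n p"
  shows "integrable (time T) (\<lambda>x. (norm (step_fun n p c x))\<^sup>2)"
    "(LINT x|time T. (norm (step_fun n p c x))\<^sup>2) = (\<Sum>k<n. (norm (c k))\<^sup>2 * (p (Suc k) - p k))"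
proof -
  have 1: "(LINT x|time T. indicator {p k<..p (Suc k)} x * (norm (c k))\<^sup>2) = (norm (c k))\<^sup>2 * (p (Suc k) - p k)"
    and 2: "integrable (time T) (\<lambda>x. indicator {p k<..p (Suc k)} x * (norm (c k))\<^sup>2)" if k: "k < n" for k
  proof -
    have pk: "0 \<le> p k" "p k \<le> p (Suc k)" "p (Suc k) \<le> T"
      using p k partition_range[OF p, of k] partition_range[OF p, of "Suc k"] unfolding is_partition_def by auto
    interpret finite_measure "time T" by (rule finite_measure_time)
    have m: "(\<lambda>x. indicator {p k<..p (Suc k)} x * (norm (c k))\<^sup>2) \<in> borel_measurable (time T)"
      by (intro borel_measurable_time) measurable
    show "integrable (time T) (\<lambda>x. indicator {p k<..p (Suc k)} x * (norm (c k))\<^sup>2)"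
      by (rule integrable_const_bound[OF _ m, where B = "(norm (c k))\<^sup>2"]) (auto split: split_indicator)
    have "(LINT x|time T. indicator {p k<..p (Suc k)} x * (norm (c k))\<^sup>2) =
        (LINT x|lborel. indicator {0..T} x *\<^sub>R (indicator {p k<..p (Suc k)} x * (norm (c k))\<^sup>2))"
      unfolding time_def by (rule integral_restrict_space) simp
    also have "\<dots> = (LINT x|lborel. indicator {p k<..p (Suc k)} x *\<^sub>R (norm (c k))\<^sup>2)"
      by (rule Bochner_Integration.integral_cong) (use pk in \<open>auto split: split_indicator\<close>)
    also have "\<dots> = measure lborel {p k<..p (Suc k)} * (norm (c k))\<^sup>2"
      by (simp add: measure_def)
    finally show "(LINT x|time T. indicator {p k<..p (Suc k)} x * (norm (c k))\<^sup>2) = (norm (c k))\<^sup>2 * (p (Suc k) - p k)"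
      using pk by (simp add: measure_def)
  qed
  show "integrable (time T) (\<lambda>x. (norm (step_fun n p c x))\<^sup>2)"
    unfolding norm_step_fun[OF p] by (intro Bochner_Integration.integrable_sum) (use 2 in blast)
  show "(LINT x|time T. (norm (step_fun n p c x))\<^sup>2) = (\<Sum>k<n. (norm (c k))\<^sup>2 * (p (Suc k) - p k))"
  proof -
    have "(LINT x|time T. (norm (step_fun n p c x))\<^sup>2) =
        (\<Sum>k<n. LINT x|time T. indicator {p k<..p (Suc k)} x * (norm (c k))\<^sup>2)"
      unfolding norm_step_fun[OF p] by (rule Bochner_Integration.integral_sum) (use 2 in blast)
    also have "\<dots> = (\<Sum>k<n. (norm (c k))\<^sup>2 * (p (Suc k) - p k))" by (intro sum.cong refl 1) simp
    finally show ?thesis .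
  qed
qed

lemma L2_tendsto_real:
  fixes f :: "nat \<Rightarrow> 'a \<Rightarrow> 'b::euclidean_space"
  assumes [measurable]: "\<And>j. f j \<in> borel_measurable N" "g \<in> borel_measurable N"
    and lim: "(\<lambda>j. \<integral>\<^sup>+x. ennreal ((norm (g x - f j x))\<^sup>2) \<partial>N) \<longlonglongrightarrow> 0"
    and fin: "\<And>j. (\<integral>\<^sup>+x. ennreal ((norm (g x - f j x))\<^sup>2) \<partial>N) < \<infinity>"
  shows "\<And>j. integrable N (\<lambda>x. (norm (g x - f j x))\<^sup>2)"
    "(\<lambda>j. LINT x|N. (norm (g x - f j x))\<^sup>2) \<longlonglongrightarrow> 0"
proof -
  show i: "integrable N (\<lambda>x. (norm (g x - f j x))\<^sup>2)" for j
    using fin[of j] by (intro integrableI_nonneg) auto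
  have "(\<integral>\<^sup>+x. ennreal ((norm (g x - f j x))\<^sup>2) \<partial>N) = ennreal (LINT x|N. (norm (g x - f j x))\<^sup>2)" for j
    using i[of j] by (rule nn_integral_eq_integral) auto
  with lim show "(\<lambda>j. LINT x|N. (norm (g x - f j x))\<^sup>2) \<longlonglongrightarrow> 0"
    by (simp flip: ennreal_0 add: tendsto_ennreal_iff del: ennreal_0)
qed

text \<open>
The scheme behind the applications of Young's inequality below: for every small \<open>l\<close> the quantity splits
into a part that vanishes in the limit and a part of size \<open>l\<close>.
\<close>

lemma tendsto_0_if_error_split:
  fixes a :: "nat \<Rightarrow> real" and e :: "nat \<Rightarrow> real \<Rightarrow> real"
  assumes bound: "\<And>j l. 0 < l \<Longrightarrow> l < 1 \<Longrightarrow> \<bar>a j\<bar> \<le> e j l + l * K"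
    and e: "\<And>l. 0 < l \<Longrightarrow> l < 1 \<Longrightarrow> (\<lambda>j. e j l) \<longlonglongrightarrow> 0" and "0 \<le> K"
  shows "a \<longlonglongrightarrow> 0"
proof (rule LIMSEQ_I)
  fix r :: real assume "0 < r"
  define l where "l = min (1 / 2) (r / 2 / (K + 1))"
  have l: "0 < l" "l < 1" using \<open>0 < r\<close> \<open>0 \<le> K\<close> by (auto simp: l_def)
  have lK: "l * K < r / 2"
  proof -
    have "l * K < l * (K + 1)" using l by simp
    also have "\<dots> \<le> r / 2 / (K + 1) * (K + 1)" using \<open>0 \<le> K\<close> by (intro mult_right_mono) (auto simp: l_def)
    also have "\<dots> = r / 2"
    proof -
      have *: "r / 2 / c * c = r / 2" if "0 < c" for c :: real using that by simp
      show ?thesis by (rule *) (use \<open>0 \<le> K\<close> in simp)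
    qed
    finally show ?thesis .
  qed
  have "0 < r / 2" using \<open>0 < r\<close> by simp
  from order_tendstoD(2)[OF e[OF l] this] obtain N where N: "\<And>j. N \<le> j \<Longrightarrow> e j l < r / 2"
    unfolding eventually_sequentially by blast
  have "norm (a j - 0) < r" if "N \<le> j" for j
    using bound[OF l, of j] N[OF that] lK unfolding diff_0_right real_norm_def by linarith
  then show "\<exists>N. \<forall>j\<ge>N. norm (a j - 0) < r" by blast
qed

lemma tendsto_0_if_young_bound:
  fixes a e :: "nat \<Rightarrow> real"
  assumes bound: "\<And>j l. 0 < l \<Longrightarrow> l < 1 \<Longrightarrow> \<bar>a j\<bar> \<le> e j / l + l * K" and e: "e \<longlonglongrightarrow> 0" and "0 \<le> K"
  shows "a \<longlonglongrightarrow> 0"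
proof (rule tendsto_0_if_error_split[where e = "\<lambda>j l. e j / l", OF bound _ \<open>0 \<le> K\<close>])
  fix l :: real assume "0 < l"
  then have "(\<lambda>j. e j / l) \<longlonglongrightarrow> 0 / l" by (intro tendsto_divide e tendsto_const) simp
  then show "(\<lambda>j. e j / l) \<longlonglongrightarrow> 0" by simp
qed auto

lemma L2_tendsto_integral:
  fixes f :: "nat \<Rightarrow> 'a \<Rightarrow> real^'n"
  assumes "finite_measure N" and fm [measurable]: "\<And>j. f j \<in> borel_measurable N" "g \<in> borel_measurable N"
    and g2: "integrable N (\<lambda>x. (norm (g x))\<^sup>2)" and f2: "\<And>j. integrable N (\<lambda>x. (norm (f j x))\<^sup>2)"
    and d: "\<And>j. integrable N (\<lambda>x. (norm (g x - f j x))\<^sup>2)" "(\<lambda>j. LINT x|N. (norm (g x - f j x))\<^sup>2) \<longlonglongrightarrow> 0"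
    and w [measurable]: "w \<in> borel_measurable N" "\<And>x. \<bar>w x\<bar> \<le> (1::real)"
  shows "(\<lambda>j. LINT x|N. (norm (f j x))\<^sup>2) \<longlonglongrightarrow> (LINT x|N. (norm (g x))\<^sup>2)"
    and "(\<lambda>j. LINT x|N. w x * f j x $ i) \<longlonglongrightarrow> (LINT x|N. w x * g x $ i)"
    and "integrable N (\<lambda>x. w x * g x $ i)"
proof -
  interpret finite_measure N by fact
  define e where "e j = (LINT x|N. (norm (g x - f j x))\<^sup>2)" for j
  define K where "K = (LINT x|N. (norm (g x))\<^sup>2)"
  have K: "0 \<le> K" unfolding K_def by simp
  have bound: "\<bar>(LINT x|N. (norm (f j x))\<^sup>2) - K\<bar> \<le> 2 * e j / l + l * K" if l: "0 < l" "l < 1" for j l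
  proof -
    have pw: "\<bar>(norm (f j x))\<^sup>2 - (norm (g x))\<^sup>2\<bar> \<le> (1 + 1 / l) * (norm (g x - f j x))\<^sup>2 + l * (norm (g x))\<^sup>2" for x
    proof -
      define F G D where "F = norm (f j x)" "G = norm (g x)" "D = norm (g x - f j x)"
      have FG: "\<bar>F - G\<bar> \<le> D" unfolding F_G_D_def by (metis abs_minus_commute norm_triangle_ineq3)
      have nn: "0 \<le> F" "0 \<le> G" "0 \<le> D" by (auto simp: F_G_D_def)
      have "\<bar>F\<^sup>2 - G\<^sup>2\<bar> = \<bar>F - G\<bar> * (F + G)"
        using nn by (simp add: power2_eq_square square_diff_square_factored abs_mult)
      also have "\<dots> \<le> D * (D + 2 * G)" using FG nn by (intro mult_mono) auto
      also have "\<dots> = D\<^sup>2 + 2 * (D * G)" by (simp add: power2_eq_square algebra_simps)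
      also have "2 * (D * G) \<le> D\<^sup>2 / l + l * G\<^sup>2"
      proof -
        have "2 * (l * G) * D \<le> (l * G)\<^sup>2 + D\<^sup>2" by (rule sum_squares_bound)
        then show ?thesis using l by (simp add: field_simps power2_eq_square)
      qed
      finally show ?thesis unfolding F_G_D_def by (simp add: algebra_simps)
    qed
    have "\<bar>(LINT x|N. (norm (f j x))\<^sup>2) - K\<bar> = \<bar>LINT x|N. (norm (f j x))\<^sup>2 - (norm (g x))\<^sup>2\<bar>"
      unfolding K_def using f2 g2 by simp
    also have "\<dots> \<le> (LINT x|N. \<bar>(norm (f j x))\<^sup>2 - (norm (g x))\<^sup>2\<bar>)" by (rule integral_abs_bound)
    also have "\<dots> \<le> (LINT x|N. (1 + 1 / l) * (norm (g x - f j x))\<^sup>2 + l * (norm (g x))\<^sup>2)"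
      using pw f2 g2 d(1) by (intro integral_mono) auto
    also have "\<dots> = (1 + 1 / l) * e j + l * K"
      unfolding e_def K_def using g2 d(1) by simp
    also have "\<dots> \<le> 2 / l * e j + l * K"
    proof (intro add_right_mono mult_right_mono)
      show "1 + 1 / l \<le> 2 / l" using l by (simp add: field_simps)
      show "0 \<le> e j" unfolding e_def by simp
    qed
    finally show ?thesis by simp
  qed
  have e0: "e \<longlonglongrightarrow> 0" using d(2) unfolding e_def[abs_def] .
  have e2: "(\<lambda>j. 2 * e j) \<longlonglongrightarrow> 0" using tendsto_mult_right_zero[OF e0] .
  have "(\<lambda>j. (LINT x|N. (norm (f j x))\<^sup>2) - K) \<longlonglongrightarrow> 0"
    by (rule tendsto_0_if_young_bound[OF _ e2 K]) (use bound in simp)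
  then show "(\<lambda>j. LINT x|N. (norm (f j x))\<^sup>2) \<longlonglongrightarrow> (LINT x|N. (norm (g x))\<^sup>2)"
    unfolding K_def by (simp add: LIM_zero_iff)
  have wi: "integrable N (\<lambda>x. w x * u x $ i)" if "integrable N (\<lambda>x. (norm (u x))\<^sup>2)" "u \<in> borel_measurable N" for u :: "'a \<Rightarrow> real^'n"
  proof (rule Bochner_Integration.integrable_bound)
    show "integrable N (\<lambda>x. 1 + (norm (u x))\<^sup>2)" using that by auto
    have "\<bar>w x * u x $ i\<bar> \<le> 1 + (norm (u x))\<^sup>2" for x
    proof -
      have "\<bar>w x * u x $ i\<bar> \<le> 1 * norm (u x)"
        unfolding abs_mult using w(2) component_le_norm_cart by (intro mult_mono) auto
      also have "\<dots> \<le> 1 + (norm (u x))\<^sup>2" using sum_squares_bound[of 1 "norm (u x)"] norm_ge_zero[of "u x"] by (simp del: norm_ge_zero)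
      finally show ?thesis .
    qed
    then show "AE x in N. norm (w x * u x $ i) \<le> norm (1 + (norm (u x))\<^sup>2)" by auto
    have [measurable]: "u \<in> borel_measurable N" by fact
    have "(\<lambda>x. u x $ i) \<in> borel_measurable N"
      by (rule measurable_component) fact
    then show "(\<lambda>x. w x * u x $ i) \<in> borel_measurable N" by auto
  qed
  show gi: "integrable N (\<lambda>x. w x * g x $ i)" using wi[OF g2] by simp
  have "(\<lambda>j. (LINT x|N. w x * f j x $ i) - (LINT x|N. w x * g x $ i)) \<longlonglongrightarrow> 0"
  proof (rule tendsto_0_if_young_bound[OF _ e0])
    fix j and l :: real assume l: "0 < l"
    have pw: "\<bar>w x * f j x $ i - w x * g x $ i\<bar> \<le> (norm (g x - f j x))\<^sup>2 / l + l" for x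
    proof -
      have "\<bar>w x * f j x $ i - w x * g x $ i\<bar> = \<bar>w x\<bar> * \<bar>(g x - f j x) $ i\<bar>"
        by (simp add: abs_mult[symmetric] algebra_simps)
      also have "\<dots> \<le> 1 * norm (g x - f j x)"
        by (intro mult_mono w(2) component_le_norm_cart) auto
      also have "\<dots> \<le> (norm (g x - f j x))\<^sup>2 / l + l"
      proof -
        have "2 * l * norm (g x - f j x) \<le> l\<^sup>2 + (norm (g x - f j x))\<^sup>2" by (rule sum_squares_bound)
        then have "2 * norm (g x - f j x) \<le> (norm (g x - f j x))\<^sup>2 / l + l"
          using l by (simp add: field_simps power2_eq_square)
        then show ?thesis using norm_ge_zero[of "g x - f j x"] by linarith
      qed
      finally show ?thesis .
    qed
    have "\<bar>(LINT x|N. w x * f j x $ i) - (LINT x|N. w x * g x $ i)\<bar> = \<bar>LINT x|N. w x * f j x $ i - w x * g x $ i\<bar>"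
      using gi wi[OF f2 fm(1)] by simp
    also have "\<dots> \<le> (LINT x|N. \<bar>w x * f j x $ i - w x * g x $ i\<bar>)" by (rule integral_abs_bound)
    also have "\<dots> \<le> (LINT x|N. (norm (g x - f j x))\<^sup>2 / l + l)"
      using pw gi wi[OF f2 fm(1)] d(1) by (intro integral_mono) auto
    also have "\<dots> = e j / l + l * measure N (space N)"
      unfolding e_def using d(1) by simp
    finally show "\<bar>(LINT x|N. w x * f j x $ i) - (LINT x|N. w x * g x $ i)\<bar> \<le> e j / l + l * measure N (space N)" .
  qed auto
  then show "(\<lambda>j. LINT x|N. w x * f j x $ i) \<longlonglongrightarrow> (LINT x|N. w x * g x $ i)"
    by (simp add: LIM_zero_iff)
qed

context brownian_space
begin

text \<open>
The stochastic exponential of the step function with values \<open>c\<close> on the cells of \<open>p\<close>.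
\<close>

definition elementary_exponential :: "nat \<Rightarrow> (nat \<Rightarrow> real) \<Rightarrow> (nat \<Rightarrow> real^'n) \<Rightarrow> 'w \<Rightarrow> real" where
  "elementary_exponential n p c \<omega> =
     exp (\<Sum>k<n. c k \<bullet> (B (p (Suc k)) \<omega> - B (p k) \<omega>) - (norm (c k))\<^sup>2 * (p (Suc k) - p k) / 2)"

text \<open>
Induction over the partition. Each new cell contributes an independent factor of mean 1, and together with
a component of the increment this factor has mean \<open>c k $ i\<close> times the length of the cell.
\<close>

lemma elementary_exponential_martingale:
  fixes p :: "nat \<Rightarrow> real" and c :: "nat \<Rightarrow> real^'n" and H :: "'w \<Rightarrow> real" and i :: 'n
  assumes p: "0 \<le> p 0" "\<And>k. k < n \<Longrightarrow> p k \<le> p (Suc k)" "p n \<le> T"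
    and H: "H \<in> borel_measurable (past (p 0))" "integrable M H"
  shows "(\<lambda>\<omega>. H \<omega> * elementary_exponential n p c \<omega>) \<in> borel_measurable (past (p n))"
    "integrable M (\<lambda>\<omega>. H \<omega> * elementary_exponential n p c \<omega>)"
    "expectation (\<lambda>\<omega>. H \<omega> * elementary_exponential n p c \<omega>) = expectation H"
    "integrable M (\<lambda>\<omega>. H \<omega> * elementary_exponential n p c \<omega> * incr (p 0) (p n) i \<omega>)"
    "expectation (\<lambda>\<omega>. H \<omega> * elementary_exponential n p c \<omega> * incr (p 0) (p n) i \<omega>) =
       expectation H * (\<Sum>k<n. c k $ i * (p (Suc k) - p k))"
proof -
  let ?E = "\<lambda>n \<omega>. H \<omega> * elementary_exponential n p c \<omega>"
  have "p 0 \<le> p n \<and> ?E n \<in> borel_measurable (past (p n)) \<and> integrable M (?E n) \<and> expectation (?E n) = expectation H \<and>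
    integrable M (\<lambda>\<omega>. ?E n \<omega> * incr (p 0) (p n) i \<omega>) \<and>
    expectation (\<lambda>\<omega>. ?E n \<omega> * incr (p 0) (p n) i \<omega>) = expectation H * (\<Sum>k<n. c k $ i * (p (Suc k) - p k))"
    using p
  proof (induction n)
    case 0
    then show ?case using H by (simp add: elementary_exponential_def)
  next
    case (Suc n)
    have pn: "p n \<le> p (Suc n)" "p (Suc n) \<le> T" "p n \<le> T"
      using Suc.prems(2)[of n] Suc.prems(3) by auto
    have IH: "p 0 \<le> p n" "?E n \<in> borel_measurable (past (p n))" "integrable M (?E n)" "expectation (?E n) = expectation H"
      "integrable M (\<lambda>\<omega>. ?E n \<omega> * incr (p 0) (p n) i \<omega>)"
      "expectation (\<lambda>\<omega>. ?E n \<omega> * incr (p 0) (p n) i \<omega>) = expectation H * (\<Sum>k<n. c k $ i * (p (Suc k) - p k))"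
      using Suc.IH Suc.prems pn by auto
    have p0: "0 \<le> p n" using IH(1) Suc.prems(1) by linarith
    define d where "d = p (Suc n) - p n"
    define f where "f x = exp (c n \<bullet> x - (norm (c n))\<^sup>2 * d / 2)" for x
    define D where "D \<omega> = B (p (Suc n)) \<omega> - B (p n) \<omega>" for \<omega>
    have fm: "f \<in> borel_measurable borel" "(\<lambda>x. x $ i * f x) \<in> borel_measurable borel"
      unfolding f_def by (auto intro!: borel_measurable_continuous_onI continuous_intros)
    have f_eq: "f x = exp (c n \<bullet> x) * exp (- ((norm (c n))\<^sup>2 * d / 2))" for x
      unfolding f_def by (simp only: exp_add[symmetric] add_uminus_conv_diff)
    note mom12 = incr_exp_moments(1,2)[OF p0 pn(1,2), where c = "c n"]
    note mom34 = incr_exp_moments(3,4)[OF p0 pn(1,2), where c = "c n" and i = i]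
    define q where "q = (norm (c n))\<^sup>2 * d / 2"
    have f_q: "f x = exp (- q) * exp (c n \<bullet> x)" "x $ i * f x = exp (- q) * (x $ i * exp (c n \<bullet> x))" for x
      by (simp_all only: f_eq q_def mult_ac)
    have qq: "exp (- q) * exp q = 1" by (simp add: exp_minus)
    have fi: "integrable M (\<lambda>\<omega>. f (D \<omega>))"
      unfolding f_q D_def by (rule Bochner_Integration.integrable_mult_right[OF mom12(1)])
    have "expectation (\<lambda>\<omega>. f (D \<omega>)) = exp (- q) * exp q"
      unfolding f_q D_def integral_mult_right_zero mom12(2) by (simp only: q_def d_def)
    then have fe: "expectation (\<lambda>\<omega>. f (D \<omega>)) = 1" using qq by simp
    have gi: "integrable M (\<lambda>\<omega>. D \<omega> $ i * f (D \<omega>))"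
      unfolding f_q(2) unfolding D_def by (rule Bochner_Integration.integrable_mult_right[OF mom34(1)])
    have "expectation (\<lambda>\<omega>. D \<omega> $ i * f (D \<omega>)) = exp (- q) * (c n $ i * d * exp q)"
      unfolding f_q(2) unfolding D_def integral_mult_right_zero mom34(2) by (simp only: q_def d_def)
    then have ge: "expectation (\<lambda>\<omega>. D \<omega> $ i * f (D \<omega>)) = c n $ i * d"
      using qq by (simp add: mult_ac)
    have E_Suc: "?E (Suc n) \<omega> = ?E n \<omega> * f (D \<omega>)" for \<omega>
      by (simp add: elementary_exponential_def f_def D_def d_def exp_add)
    have incm: "incr (p 0) (p n) i \<in> borel_measurable (past (p n))"
    proof -
      have "(\<lambda>\<omega>. B (p n) \<omega> - B (p 0) \<omega>) \<in> borel_measurable (past (p n))"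
        using Suc.prems(1) IH(1) p0 by (intro borel_measurable_diff B_measurable_past) auto
      then show ?thesis by (rule measurable_component)
    qed
    have EIm: "(\<lambda>\<omega>. ?E n \<omega> * incr (p 0) (p n) i \<omega>) \<in> borel_measurable (past (p n))"
      using IH(2) incm by simp
    have Dm: "(\<lambda>\<omega>. f (D \<omega>)) \<in> borel_measurable (past (p (Suc n)))"
      unfolding D_def using p0 pn
      by (intro measurable_compose[OF _ fm(1)] borel_measurable_diff B_measurable_past) auto
    note X1 = past_times_increment[OF p0 pn(1,2) IH(2,3) fm(1), folded D_def, OF fi]
    note X2 = past_times_increment[OF p0 pn(1,2) EIm IH(5) fm(1), folded D_def, OF fi]
    note X3 = past_times_increment[OF p0 pn(1,2) IH(2,3) fm(2), folded D_def, OF gi]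
    have split: "?E (Suc n) \<omega> * incr (p 0) (p (Suc n)) i \<omega> =
        (?E n \<omega> * incr (p 0) (p n) i \<omega>) * f (D \<omega>) + ?E n \<omega> * (D \<omega> $ i * f (D \<omega>))" for \<omega>
      unfolding E_Suc by (simp add: D_def algebra_simps)
    have "?E (Suc n) \<in> borel_measurable (past (p (Suc n)))"
      unfolding E_Suc using measurable_past_mono[OF IH(2) pn(1)] Dm by simp
    moreover have "integrable M (?E (Suc n))" "expectation (?E (Suc n)) = expectation H"
      unfolding E_Suc using X1 fe IH(4) by auto
    moreover have "integrable M (\<lambda>\<omega>. ?E (Suc n) \<omega> * incr (p 0) (p (Suc n)) i \<omega>)"
      unfolding split using X2(1) X3(1) by auto
    moreover have "expectation (\<lambda>\<omega>. ?E (Suc n) \<omega> * incr (p 0) (p (Suc n)) i \<omega>) =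
        expectation H * (\<Sum>k<n. c k $ i * (p (Suc k) - p k)) * 1 + expectation H * (c n $ i * d)"
      unfolding split using X2 X3 fe ge IH(4,6) by (subst Bochner_Integration.integral_add) auto
    ultimately show ?case using IH(1) pn(1) by (auto simp: d_def distrib_left)
  qed
  then show "(\<lambda>\<omega>. H \<omega> * elementary_exponential n p c \<omega>) \<in> borel_measurable (past (p n))"
    "integrable M (\<lambda>\<omega>. H \<omega> * elementary_exponential n p c \<omega>)"
    "expectation (\<lambda>\<omega>. H \<omega> * elementary_exponential n p c \<omega>) = expectation H"
    "integrable M (\<lambda>\<omega>. H \<omega> * elementary_exponential n p c \<omega> * incr (p 0) (p n) i \<omega>)"
    "expectation (\<lambda>\<omega>. H \<omega> * elementary_exponential n p c \<omega> * incr (p 0) (p n) i \<omega>) =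
       expectation H * (\<Sum>k<n. c k $ i * (p (Suc k) - p k))" by auto
qed

text \<open>
The fourth power is a constant times the exponential for \<open>4 c\<close>, which has mean 1.
\<close>

lemma elementary_exponential_moment4:
  assumes p: "is_partition 0 T n p"
  shows "integrable M (\<lambda>\<omega>. (elementary_exponential n p c \<omega>)^4)"
    "expectation (\<lambda>\<omega>. (elementary_exponential n p c \<omega>)^4) = exp (6 * (\<Sum>k<n. (norm (c k))\<^sup>2 * (p (Suc k) - p k)))"
proof -
  let ?S = "\<Sum>k<n. (norm (c k))\<^sup>2 * (p (Suc k) - p k)"
  \<comment> \<open>Quadrupling \<open>c\<close> multiplies the compensator by 16 instead of 4, which leaves \<open>16/2 - 4/2 = 6\<close>.\<close>
  have eq: "(elementary_exponential n p c \<omega>)^4 = exp (6 * ?S) * (1 * elementary_exponential n p (\<lambda>k. 4 *\<^sub>R c k) \<omega>)" for \<omega>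
  proof -
    have "4 * (\<Sum>k<n. c k \<bullet> (B (p (Suc k)) \<omega> - B (p k) \<omega>) - (norm (c k))\<^sup>2 * (p (Suc k) - p k) / 2) =
      6 * ?S + (\<Sum>k<n. (4 *\<^sub>R c k) \<bullet> (B (p (Suc k)) \<omega> - B (p k) \<omega>) - (norm (4 *\<^sub>R c k))\<^sup>2 * (p (Suc k) - p k) / 2)"
    proof -
      have alg: "4 * (x - N * d / 2) = 6 * (N * d) + (4 * x - 16 * N * d / 2)" for x N d :: real
        by (simp add: field_simps)
      have n16: "(norm (4 *\<^sub>R c k))\<^sup>2 = 16 * (norm (c k))\<^sup>2" for k
        by (simp add: power_mult_distrib)
      show ?thesis
        unfolding sum_distrib_left sum.distrib[symmetric] alg n16 inner_scaleR_left ..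
    qed
    then show ?thesis
      unfolding elementary_exponential_def exp_of_nat_mult[of 4, simplified, symmetric] by (simp add: exp_add)
  qed
  have pp: "0 \<le> p 0" "\<And>k. k < n \<Longrightarrow> p k \<le> p (Suc k)" "p n \<le> T"
    using p unfolding is_partition_def by auto
  note m = elementary_exponential_martingale(2,3)[where H = "\<lambda>_. 1" and c = "\<lambda>k. 4 *\<^sub>R c k",
      OF pp borel_measurable_const integrable_const]
  show "integrable M (\<lambda>\<omega>. (elementary_exponential n p c \<omega>)^4)"
    unfolding eq by (rule Bochner_Integration.integrable_mult_right[OF m(1)])
  show "expectation (\<lambda>\<omega>. (elementary_exponential n p c \<omega>)^4) = exp (6 * ?S)"
  proof -
    have "expectation (\<lambda>\<omega>. 1 * elementary_exponential n p (\<lambda>k. 4 *\<^sub>R c k) \<omega>) = 1"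
      using m(2) by (simp add: prob_space)
    then show ?thesis unfolding eq integral_mult_right_zero by simp
  qed
qed

lemma (in -) sum_clip:
  fixes f :: "real \<Rightarrow> 'b::real_vector"
  assumes "s \<le> t"
  shows "f y - f x = (f (min y s) - f (min x s)) + (f (clip s t y) - f (clip s t x)) + (f (max t y) - f (max t x))"
proof -
  have "f x = f (min x s) + f (clip s t x) + f (max t x) - f s - f t" for x
    using assms unfolding clip_def by (cases "x \<le> s"; cases "x \<le> t") (auto simp: min_def max_def)
  from this[of x] this[of y] show ?thesis by simp
qed

text \<open>
The exponential factorises into parts before \<open>s\<close>, on \<open>[s, t]\<close> and after \<open>t\<close>. The first is absorbed into \<open>G\<close>,
the last has conditional mean 1, and the middle one meets the increment.
\<close>

lemma elementary_girsanov:
  fixes c :: "nat \<Rightarrow> real^'n" and i :: 'n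
  assumes p: "is_partition 0 T n p" and st: "0 \<le> s" "s \<le> t" "t \<le> T"
    and G: "G \<in> borel_measurable (past s)" "\<And>\<omega>. \<bar>G \<omega>\<bar> \<le> C"
  shows "expectation (\<lambda>\<omega>. elementary_exponential n p c \<omega> * (G \<omega> * incr s t i \<omega>)) =
      expectation (\<lambda>\<omega>. elementary_exponential n p c \<omega> * G \<omega>) * (LINT x|time T. indicator {s<..t} x * step_fun n p c x $ i)"
proof -
  let ?p1 = "\<lambda>k. min (p k) s" and ?p2 = "\<lambda>k. clip s t (p k)" and ?p3 = "\<lambda>k. max t (p k)"
  let ?E1 = "elementary_exponential n ?p1 c" and ?E2 = "elementary_exponential n ?p2 c" and ?E3 = "elementary_exponential n ?p3 c"
  have pp: "p 0 = 0" "p n = T" "\<And>k. k < n \<Longrightarrow> p k \<le> p (Suc k)"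
    using p unfolding is_partition_def by auto
  have factor: "elementary_exponential n p c \<omega> = ?E1 \<omega> * ?E2 \<omega> * ?E3 \<omega>" for \<omega>
  proof -
    have "c k \<bullet> (B (p (Suc k)) \<omega> - B (p k) \<omega>) - (norm (c k))\<^sup>2 * (p (Suc k) - p k) / 2 =
      (c k \<bullet> (B (?p1 (Suc k)) \<omega> - B (?p1 k) \<omega>) - (norm (c k))\<^sup>2 * (?p1 (Suc k) - ?p1 k) / 2) +
      (c k \<bullet> (B (?p2 (Suc k)) \<omega> - B (?p2 k) \<omega>) - (norm (c k))\<^sup>2 * (?p2 (Suc k) - ?p2 k) / 2) +
      (c k \<bullet> (B (?p3 (Suc k)) \<omega> - B (?p3 k) \<omega>) - (norm (c k))\<^sup>2 * (?p3 (Suc k) - ?p3 k) / 2)" for k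
      unfolding sum_clip[OF st(2), of "\<lambda>x. B x \<omega>" "p (Suc k)" "p k"] sum_clip[OF st(2), of "\<lambda>x. x" "p (Suc k)" "p k"]
      by (simp add: inner_add_right inner_diff_right field_simps)
    then show ?thesis unfolding elementary_exponential_def exp_add[symmetric] sum.distrib[symmetric] by simp
  qed
  have p1: "?p1 0 = 0" "?p1 n = s" "\<And>k. k < n \<Longrightarrow> ?p1 k \<le> ?p1 (Suc k)"
    using pp st by (auto simp: min_def intro: order_trans)
  have p2: "?p2 0 = s" "?p2 n = t" "\<And>k. k < n \<Longrightarrow> ?p2 k \<le> ?p2 (Suc k)"
    using pp st unfolding clip_def by (auto simp: min_def max_def intro: order_trans)
  have p3: "?p3 0 = t" "?p3 n = T" "\<And>k. k < n \<Longrightarrow> ?p3 k \<le> ?p3 (Suc k)"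
    using pp st by (auto simp: max_def intro: order_trans)
  have GM: "G \<in> borel_measurable M" by (rule measurable_past_imp_measurable[OF G(1)]) (use st in auto)
  define H where "H \<omega> = G \<omega> * (1 * ?E1 \<omega>)" for \<omega>
  have sT: "s \<le> T" using st by simp
  note E1 = elementary_exponential_martingale(1,2)[where H = "\<lambda>_. 1" and p = ?p1 and n = n and c = c,
      unfolded p1(1,2), OF order_refl p1(3) sT borel_measurable_const integrable_const]
  have Hm: "H \<in> borel_measurable (past s)" unfolding H_def using E1(1) G(1) by simp
  have Hi: "integrable M H"
  proof (rule Bochner_Integration.integrable_bound)
    show "integrable M (\<lambda>\<omega>. C * (1 * ?E1 \<omega>))" using E1(2) by auto
    show "H \<in> borel_measurable M" by (rule measurable_past_imp_measurable[OF Hm sT])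
    have "\<bar>G \<omega>\<bar> * \<bar>?E1 \<omega>\<bar> \<le> \<bar>C\<bar> * \<bar>?E1 \<omega>\<bar>" for \<omega>
      by (intro mult_right_mono order_trans[OF G(2)]) auto
    then show "AE \<omega> in M. norm (H \<omega>) \<le> norm (C * (1 * ?E1 \<omega>))" unfolding H_def by (auto simp: abs_mult)
  qed
  note mid = elementary_exponential_martingale(1-3)[of ?p2 n H c, unfolded p2(1,2), OF st(1) p2(3) st(3) Hm Hi]
    elementary_exponential_martingale(4,5)[of ?p2 n H c i, unfolded p2(1,2), OF st(1) p2(3) st(3) Hm Hi]
  have incm: "incr s t i \<in> borel_measurable (past t)"
  proof -
    have "(\<lambda>\<omega>. B t \<omega> - B s \<omega>) \<in> borel_measurable (past t)"
      using st by (intro borel_measurable_diff B_measurable_past) auto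
    then show ?thesis by (rule measurable_component)
  qed
  have midm: "(\<lambda>\<omega>. H \<omega> * ?E2 \<omega> * incr s t i \<omega>) \<in> borel_measurable (past t)"
    using mid(1) incm by simp
  have t0: "0 \<le> t" using st by simp
  note last1 = elementary_exponential_martingale(2,3)[of ?p3 n "\<lambda>\<omega>. H \<omega> * ?E2 \<omega>" c, unfolded p3(1,2), OF t0 p3(3) order_refl mid(1,2)]
  note last2 = elementary_exponential_martingale(2,3)[of ?p3 n "\<lambda>\<omega>. H \<omega> * ?E2 \<omega> * incr s t i \<omega>" c, unfolded p3(1,2), OF t0 p3(3) order_refl midm mid(4)]
  have "expectation (\<lambda>\<omega>. elementary_exponential n p c \<omega> * (G \<omega> * incr s t i \<omega>)) =
      expectation (\<lambda>\<omega>. H \<omega> * ?E2 \<omega> * incr s t i \<omega> * ?E3 \<omega>)"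
    unfolding factor H_def by (simp add: mult_ac)
  also have "\<dots> = expectation H * (\<Sum>k<n. c k $ i * (?p2 (Suc k) - ?p2 k))" using last2(2) mid(5) by simp
  also have "expectation H = expectation (\<lambda>\<omega>. H \<omega> * ?E2 \<omega> * ?E3 \<omega>)" using last1(2) mid(3) by simp
  also have "\<dots> = expectation (\<lambda>\<omega>. elementary_exponential n p c \<omega> * G \<omega>)"
    unfolding factor H_def by (simp add: mult_ac)
  finally show ?thesis unfolding integral_step_fun[OF p st] .
qed

lemma (in -) abs_exp_diff_bound: "\<bar>exp x - exp y\<bar> \<le> \<bar>x - y\<bar> * (exp x + exp y)" for x y :: real
proof -
  have *: "exp b - exp a \<le> (b - a) * exp b" for a b :: real
  proof -
    have "1 + (a - b) \<le> exp (a - b)" by (rule exp_ge_add_one_self)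
    then have "(1 + (a - b)) * exp b \<le> exp (a - b) * exp b" by (intro mult_right_mono) auto
    also have "\<dots> = exp a" by (simp add: exp_diff)
    finally show ?thesis by (simp add: algebra_simps)
  qed
  show ?thesis
  proof (cases "x \<le> y")
    case True
    have "\<bar>exp x - exp y\<bar> = exp y - exp x" using True by simp
    also have "\<dots> \<le> (y - x) * exp y" by (rule *)
    also have "\<dots> \<le> \<bar>x - y\<bar> * (exp x + exp y)" using True by (intro mult_mono) auto
    finally show ?thesis .
  next
    case False
    have "\<bar>exp x - exp y\<bar> = exp x - exp y" using False by simp
    also have "\<dots> \<le> (x - y) * exp x" by (rule *)
    also have "\<dots> \<le> \<bar>x - y\<bar> * (exp x + exp y)" using False by (intro mult_mono) auto
    finally show ?thesis .
  qed
qed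

text \<open>
The inequality \<open>|exp x - exp y| \<le> |x - y| (exp x + exp y)\<close> separates the mean square distance of the exponents,
which tends to 0, from fourth moments, which stay bounded. The fourth moment of the limit is bounded by
Fatou's lemma along an almost surely convergent subsequence.
\<close>

lemma (in prob_space) exponential_approximation_tendsto:
  fixes Wj :: "nat \<Rightarrow> 'a \<Rightarrow> real" and \<kappa>j :: "nat \<Rightarrow> real"
  assumes Wm [measurable]: "\<And>j. Wj j \<in> borel_measurable M" "W \<in> borel_measurable M"
    and d: "\<And>j. integrable M (\<lambda>\<omega>. (W \<omega> - Wj j \<omega>)\<^sup>2)" "(\<lambda>j. expectation (\<lambda>\<omega>. (W \<omega> - Wj j \<omega>)\<^sup>2)) \<longlonglongrightarrow> 0"
    and \<kappa>: "\<kappa>j \<longlonglongrightarrow> \<kappa>"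
    and mom: "\<And>j. integrable M (\<lambda>\<omega>. (exp (Wj j \<omega> - \<kappa>j j))^4)" "\<And>j. expectation (\<lambda>\<omega>. (exp (Wj j \<omega> - \<kappa>j j))^4) \<le> K"
  defines "F \<equiv> \<lambda>\<omega>. exp (W \<omega> - \<kappa>)"
  shows "integrable M (\<lambda>\<omega>. (F \<omega>)^4)"
    and "\<And>Y. Y \<in> borel_measurable M \<Longrightarrow> integrable M (\<lambda>\<omega>. (Y \<omega>)^4) \<Longrightarrow>
      integrable M (\<lambda>\<omega>. F \<omega> * Y \<omega>) \<and>
      (\<lambda>j. expectation (\<lambda>\<omega>. exp (Wj j \<omega> - \<kappa>j j) * Y \<omega>)) \<longlonglongrightarrow> expectation (\<lambda>\<omega>. F \<omega> * Y \<omega>)"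
proof -
  define Fj where "Fj j \<omega> = exp (Wj j \<omega> - \<kappa>j j)" for j \<omega>
  have [measurable]: "Fj j \<in> borel_measurable M" "F \<in> borel_measurable M" for j
    unfolding Fj_def F_def by measurable
  have K: "0 \<le> K" using mom(2)[of 0] by (rule order_trans[rotated]) (auto intro!: Bochner_Integration.integral_nonneg)
  from tendsto_L1_AE_subseq[of M "\<lambda>j \<omega>. (W \<omega> - Wj j \<omega>)\<^sup>2"] d
  obtain r where r: "strict_mono r" "AE \<omega> in M. (\<lambda>j. (W \<omega> - Wj (r j) \<omega>)\<^sup>2) \<longlonglongrightarrow> 0" by auto
  have Flim: "AE \<omega> in M. (\<lambda>j. ennreal ((Fj (r j) \<omega>)^4)) \<longlonglongrightarrow> ennreal ((F \<omega>)^4)"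
    using r(2)
  proof eventually_elim
    case (elim \<omega>)
    have "(\<lambda>j. sqrt ((W \<omega> - Wj (r j) \<omega>)\<^sup>2)) \<longlonglongrightarrow> sqrt 0" by (rule tendsto_real_sqrt[OF elim])
    then have "(\<lambda>j. W \<omega> - Wj (r j) \<omega>) \<longlonglongrightarrow> 0" by (simp add: tendsto_rabs_zero_iff)
    from tendsto_diff[OF tendsto_const[of "W \<omega>"] this] have "(\<lambda>j. Wj (r j) \<omega>) \<longlonglongrightarrow> W \<omega>" by simp
    moreover have "(\<lambda>j. \<kappa>j (r j)) \<longlonglongrightarrow> \<kappa>" using LIMSEQ_subseq_LIMSEQ[OF \<kappa> r(1)] by (simp add: o_def)
    ultimately show ?case unfolding Fj_def F_def by (intro tendsto_ennrealI tendsto_power tendsto_exp tendsto_diff)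
  qed
  have "(\<integral>\<^sup>+\<omega>. ennreal ((F \<omega>)^4) \<partial>M) = (\<integral>\<^sup>+\<omega>. liminf (\<lambda>j. ennreal ((Fj (r j) \<omega>)^4)) \<partial>M)"
  proof (rule nn_integral_cong_AE)
    show "AE \<omega> in M. ennreal ((F \<omega>)^4) = liminf (\<lambda>j. ennreal ((Fj (r j) \<omega>)^4))"
      using Flim by eventually_elim (rule lim_imp_Liminf[OF trivial_limit_sequentially, symmetric])
  qed
  also have "\<dots> \<le> liminf (\<lambda>j. \<integral>\<^sup>+\<omega>. ennreal ((Fj (r j) \<omega>)^4) \<partial>M)"
    by (rule nn_integral_liminf) auto
  also have "\<dots> \<le> liminf (\<lambda>j. ennreal K)"
  proof (rule Liminf_mono, rule always_eventually, rule allI)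
    fix j
    have "(\<integral>\<^sup>+\<omega>. ennreal ((Fj (r j) \<omega>)^4) \<partial>M) = ennreal (expectation (\<lambda>\<omega>. (Fj (r j) \<omega>)^4))"
      using mom(1)[of "r j"] unfolding Fj_def by (intro nn_integral_eq_integral) auto
    also have "\<dots> \<le> ennreal K" using mom(2)[of "r j"] unfolding Fj_def by (intro ennreal_leI)
    finally show "(\<integral>\<^sup>+\<omega>. ennreal ((Fj (r j) \<omega>)^4) \<partial>M) \<le> ennreal K" .
  qed
  also have "\<dots> = ennreal K" by (simp add: Liminf_const)
  finally have nF: "(\<integral>\<^sup>+\<omega>. ennreal ((F \<omega>)^4) \<partial>M) \<le> ennreal K" .
  show F4: "integrable M (\<lambda>\<omega>. (F \<omega>)^4)"
    by (rule integrableI_nonneg) (use nF in \<open>auto intro: le_less_trans\<close>)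
  fix Y :: "'a \<Rightarrow> real" assume Ym [measurable]: "Y \<in> borel_measurable M" and Y4: "integrable M (\<lambda>\<omega>. (Y \<omega>)^4)"
  have ab: "a\<^sup>2 * b\<^sup>2 \<le> (a^4 + b^4) / 2" for a b :: real
    using zero_le_power2[of "a\<^sup>2 - b\<^sup>2"] by (simp add: power2_eq_square power4_eq_xxxx algebra_simps)
  have ab2: "2 * (a\<^sup>2 * b\<^sup>2) \<le> a^4 + b^4" for a b :: real using ab[of a b] by simp
  have ab1: "\<bar>a * b\<bar> \<le> 1 + (a^4 + b^4) / 2" for a b :: real
  proof -
    have "\<bar>a * b\<bar> \<le> 1 + (a * b)\<^sup>2" using sum_squares_bound[of 1 "\<bar>a * b\<bar>"] abs_ge_zero[of "a * b"] by (simp del: abs_ge_zero)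
    then show ?thesis using ab[of a b] unfolding power_mult_distrib by linarith
  qed
  have prodi: "integrable M (\<lambda>\<omega>. X \<omega> * Y \<omega>)" if "integrable M (\<lambda>\<omega>. (X \<omega>)^4)" "X \<in> borel_measurable M" for X :: "'a \<Rightarrow> real"
  proof (rule Bochner_Integration.integrable_bound)
    show "integrable M (\<lambda>\<omega>. 1 + ((X \<omega>)^4 + (Y \<omega>)^4) / 2)" using that Y4 by auto
    show "AE \<omega> in M. norm (X \<omega> * Y \<omega>) \<le> norm (1 + ((X \<omega>)^4 + (Y \<omega>)^4) / 2)"
      using ab1 by (auto intro!: order_trans[OF ab1 abs_ge_self])
  qed (use that in auto)
  have Fi: "integrable M (\<lambda>\<omega>. F \<omega> * Y \<omega>)" "integrable M (\<lambda>\<omega>. Fj j \<omega> * Y \<omega>)" for j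
    using prodi[OF F4] prodi[of "Fj j"] mom(1)[of j] unfolding Fj_def by auto
  \<comment> \<open>The two errors: of the Wiener integral and of the normalising constant.\<close>
  define e where "e j = expectation (\<lambda>\<omega>. (W \<omega> - Wj j \<omega>)\<^sup>2) + (\<kappa> - \<kappa>j j)\<^sup>2" for j
  define L where "L = K + expectation (\<lambda>\<omega>. (F \<omega>)^4) + 2 * expectation (\<lambda>\<omega>. (Y \<omega>)^4)"
  have "(\<lambda>j. expectation (\<lambda>\<omega>. Fj j \<omega> * Y \<omega>) - expectation (\<lambda>\<omega>. F \<omega> * Y \<omega>)) \<longlonglongrightarrow> 0"
  proof (rule tendsto_0_if_young_bound)
    have "e \<longlonglongrightarrow> 0 + (\<kappa> - \<kappa>)\<^sup>2" unfolding e_def by (intro tendsto_intros d(2) \<kappa>)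
    then show "e \<longlonglongrightarrow> 0" by simp
    show "0 \<le> L" unfolding L_def using K by (auto intro!: add_nonneg_nonneg Bochner_Integration.integral_nonneg)
    fix j and l :: real assume l: "0 < l" "l < 1"
    have pw: "\<bar>Fj j \<omega> * Y \<omega> - F \<omega> * Y \<omega>\<bar> \<le> ((W \<omega> - Wj j \<omega>)\<^sup>2 + (\<kappa> - \<kappa>j j)\<^sup>2) / l + l * ((Fj j \<omega>)^4 + (F \<omega>)^4 + 2 * (Y \<omega>)^4)" for \<omega>
    proof -
      define D A where "D = \<bar>(Wj j \<omega> - \<kappa>j j) - (W \<omega> - \<kappa>)\<bar>" "A = (Fj j \<omega> + F \<omega>) * \<bar>Y \<omega>\<bar>"
      have D2: "D\<^sup>2 \<le> 2 * ((W \<omega> - Wj j \<omega>)\<^sup>2 + (\<kappa> - \<kappa>j j)\<^sup>2)"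
      proof -
        have "(x - y)\<^sup>2 \<le> 2 * (x\<^sup>2 + y\<^sup>2)" for x y :: real
          using zero_le_power2[of "x + y"] by (simp add: power2_eq_square algebra_simps)
        from this[of "W \<omega> - Wj j \<omega>" "\<kappa> - \<kappa>j j"] show ?thesis
          unfolding D_A_def power2_abs by (simp add: power2_eq_square algebra_simps)
      qed
      have A2: "A\<^sup>2 \<le> 2 * ((Fj j \<omega>)^4 + (F \<omega>)^4 + 2 * (Y \<omega>)^4)"
      proof -
        have "(x + y)\<^sup>2 \<le> 2 * (x\<^sup>2 + y\<^sup>2)" for x y :: real
          using zero_le_power2[of "x - y"] by (simp add: power2_eq_square algebra_simps)
        then have "A\<^sup>2 \<le> 2 * ((Fj j \<omega>)\<^sup>2 + (F \<omega>)\<^sup>2) * (Y \<omega>)\<^sup>2"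
          unfolding D_A_def power_mult_distrib power2_abs by (intro mult_right_mono) auto
        also have "\<dots> = 2 * ((Fj j \<omega>)\<^sup>2 * (Y \<omega>)\<^sup>2) + 2 * ((F \<omega>)\<^sup>2 * (Y \<omega>)\<^sup>2)" by (simp add: algebra_simps)
        also have "\<dots> \<le> ((Fj j \<omega>)^4 + (Y \<omega>)^4) + ((F \<omega>)^4 + (Y \<omega>)^4)"
          by (intro add_mono ab2)
        also have "\<dots> \<le> 2 * ((Fj j \<omega>)^4 + (F \<omega>)^4 + 2 * (Y \<omega>)^4)"
          by (simp add: algebra_simps)
        finally show ?thesis .
      qed
      have "\<bar>Fj j \<omega> * Y \<omega> - F \<omega> * Y \<omega>\<bar> = \<bar>Fj j \<omega> - F \<omega>\<bar> * \<bar>Y \<omega>\<bar>"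
        by (simp add: abs_mult[symmetric] left_diff_distrib)
      also have "\<dots> \<le> (D * (Fj j \<omega> + F \<omega>)) * \<bar>Y \<omega>\<bar>"
        unfolding D_A_def Fj_def F_def by (intro mult_right_mono abs_exp_diff_bound) auto
      also have "\<dots> = D * A" by (simp add: D_A_def)
      also have "\<dots> \<le> D\<^sup>2 / (2 * l) + l * A\<^sup>2 / 2"
      proof -
        have "2 * D * (l * A) \<le> D\<^sup>2 + (l * A)\<^sup>2" by (rule sum_squares_bound)
        then show ?thesis using l by (simp add: field_simps power2_eq_square)
      qed
      also have "\<dots> \<le> 2 * ((W \<omega> - Wj j \<omega>)\<^sup>2 + (\<kappa> - \<kappa>j j)\<^sup>2) / (2 * l) +
          l * (2 * ((Fj j \<omega>)^4 + (F \<omega>)^4 + 2 * (Y \<omega>)^4)) / 2"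
        using l by (intro add_mono divide_right_mono mult_left_mono D2 A2) auto
      also have "\<dots> = ((W \<omega> - Wj j \<omega>)\<^sup>2 + (\<kappa> - \<kappa>j j)\<^sup>2) / l + l * ((Fj j \<omega>)^4 + (F \<omega>)^4 + 2 * (Y \<omega>)^4)"
      proof -
        have "2 * x / (2 * l) + l * (2 * z) / 2 = x / l + l * z" for x z :: real by simp
        then show ?thesis .
      qed
      finally show ?thesis .
    qed
    have int: "integrable M (\<lambda>\<omega>. ((W \<omega> - Wj j \<omega>)\<^sup>2 + (\<kappa> - \<kappa>j j)\<^sup>2) / l + l * ((Fj j \<omega>)^4 + (F \<omega>)^4 + 2 * (Y \<omega>)^4))"
      using d(1) F4 Y4 mom(1)[of j] unfolding Fj_def by auto
    have "\<bar>expectation (\<lambda>\<omega>. Fj j \<omega> * Y \<omega>) - expectation (\<lambda>\<omega>. F \<omega> * Y \<omega>)\<bar> = \<bar>expectation (\<lambda>\<omega>. Fj j \<omega> * Y \<omega> - F \<omega> * Y \<omega>)\<bar>"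
      using Fi by simp
    also have "\<dots> \<le> expectation (\<lambda>\<omega>. \<bar>Fj j \<omega> * Y \<omega> - F \<omega> * Y \<omega>\<bar>)" by (rule integral_abs_bound)
    also have "\<dots> \<le> expectation (\<lambda>\<omega>. ((W \<omega> - Wj j \<omega>)\<^sup>2 + (\<kappa> - \<kappa>j j)\<^sup>2) / l + l * ((Fj j \<omega>)^4 + (F \<omega>)^4 + 2 * (Y \<omega>)^4))"
      using pw Fi int by (intro integral_mono) auto
    also have "\<dots> = e j / l + l * (expectation (\<lambda>\<omega>. (Fj j \<omega>)^4) + expectation (\<lambda>\<omega>. (F \<omega>)^4) + 2 * expectation (\<lambda>\<omega>. (Y \<omega>)^4))"
      using d(1) F4 Y4 mom(1)[of j] unfolding Fj_def e_def by (simp add: prob_space)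
    also have "\<dots> \<le> e j / l + l * L"
      unfolding L_def using l mom(2)[of j] unfolding Fj_def by (intro add_left_mono mult_left_mono) auto
    finally show "\<bar>expectation (\<lambda>\<omega>. Fj j \<omega> * Y \<omega>) - expectation (\<lambda>\<omega>. F \<omega> * Y \<omega>)\<bar> \<le> e j / l + l * L" .
  qed
  then show "integrable M (\<lambda>\<omega>. F \<omega> * Y \<omega>) \<and>
      (\<lambda>j. expectation (\<lambda>\<omega>. exp (Wj j \<omega> - \<kappa>j j) * Y \<omega>)) \<longlonglongrightarrow> expectation (\<lambda>\<omega>. F \<omega> * Y \<omega>)"
    using Fi(1) unfolding Fj_def by (simp add: LIM_zero_iff)
qed

text \<open>
All assertions hold for elementary exponentials and pass to the limit by the previous lemma.
\<close>

theorem girsanov: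
  fixes h :: "real \<Rightarrow> real^'n" and i :: 'n
  assumes h: "square_integrable (time T) h" and W: "wiener_integral M B T h W"
  defines "F \<equiv> stochastic_exponential T h W"
  shows "F \<in> borel_measurable M" "integrable M (\<lambda>\<omega>. (F \<omega>)^4)" "expectation F = 1"
    "\<And>s t G C. \<lbrakk>0 \<le> s; s \<le> t; t \<le> T; G \<in> borel_measurable (past s); \<And>\<omega>. \<bar>G \<omega>\<bar> \<le> C\<rbrakk> \<Longrightarrow>
       integrable M (\<lambda>\<omega>. F \<omega> * (G \<omega> * incr s t i \<omega>)) \<and>
       expectation (\<lambda>\<omega>. F \<omega> * (G \<omega> * incr s t i \<omega>)) =
       expectation (\<lambda>\<omega>. F \<omega> * G \<omega>) * (LINT x|time T. indicator {s<..t} x * h x $ i)"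
proof -
  have hm: "h \<in> borel_measurable (time T)" and h2: "integrable (time T) (\<lambda>x. (norm (h x))\<^sup>2)"
    using h unfolding square_integrable_def by auto
  have Wm: "W \<in> borel_measurable M" using W unfolding wiener_integral_def by blast
  define SW where "SW n p c \<omega> = (\<Sum>k<n. c k \<bullet> (B (p (Suc k)) \<omega> - B (p k) \<omega>))" for n p and c :: "nat \<Rightarrow> real^'n" and \<omega>
  from W obtain n0 p0 c0 where part0: "\<And>j. is_partition 0 T (n0 j) (p0 j :: nat \<Rightarrow> real)"
    and lim0: "(\<lambda>j::nat. \<integral>\<^sup>+s. ennreal ((norm (h s - step_fun (n0 j) (p0 j) (c0 j) s))\<^sup>2) \<partial>time T) \<longlonglongrightarrow> 0"
      "(\<lambda>j. \<integral>\<^sup>+\<omega>. ennreal ((W \<omega> - SW (n0 j) (p0 j) (c0 j) \<omega>)\<^sup>2) \<partial>M) \<longlonglongrightarrow> 0"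
    unfolding wiener_integral_def step_fun_def SW_def by blast
  have "eventually (\<lambda>j. (\<integral>\<^sup>+s. ennreal ((norm (h s - step_fun (n0 j) (p0 j) (c0 j) s))\<^sup>2) \<partial>time T) < \<infinity> \<and>
      (\<integral>\<^sup>+\<omega>. ennreal ((W \<omega> - SW (n0 j) (p0 j) (c0 j) \<omega>)\<^sup>2) \<partial>M) < \<infinity>) sequentially"
    by (intro eventually_conj order_tendstoD(2)[OF lim0(1)] order_tendstoD(2)[OF lim0(2)]) auto
  then obtain J where J: "\<And>j. J \<le> j \<Longrightarrow> (\<integral>\<^sup>+s. ennreal ((norm (h s - step_fun (n0 j) (p0 j) (c0 j) s))\<^sup>2) \<partial>time T) < \<infinity> \<and>
      (\<integral>\<^sup>+\<omega>. ennreal ((W \<omega> - SW (n0 j) (p0 j) (c0 j) \<omega>)\<^sup>2) \<partial>M) < \<infinity>"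
    unfolding eventually_sequentially by blast
  \<comment> \<open>Dropping finitely many terms makes all distances finite.\<close>
  define n p c where "n j = n0 (j + J)" "p j = p0 (j + J)" "c j = c0 (j + J)" for j
  have part: "is_partition 0 T (n j) (p j)" for j unfolding n_p_c_def by (rule part0)
  define hj where "hj j = step_fun (n j) (p j) (c j)" for j
  define Wj where "Wj j = SW (n j) (p j) (c j)" for j
  have hjm: "hj j \<in> borel_measurable (time T)" for j unfolding hj_def by (rule borel_measurable_time) measurable
  have Wjm: "Wj j \<in> borel_measurable M" for j
  proof -
    have "B (p j k) \<in> borel_measurable M" if "k \<le> n j" for k
      using partition_range[OF part[of j] that] by (intro B_measurable) auto
    then show ?thesis unfolding Wj_def SW_def
      by (intro borel_measurable_sum borel_measurable_inner borel_measurable_diff) auto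
  qed
  note hL2 = L2_tendsto_real[OF hjm hm, unfolded hj_def n_p_c_def, OF LIMSEQ_ignore_initial_segment[OF lim0(1), of J] conjunct1[OF J[OF le_add2]], folded n_p_c_def, folded hj_def]
  have WL2: "integrable M (\<lambda>\<omega>. (W \<omega> - Wj j \<omega>)\<^sup>2)" "(\<lambda>j. expectation (\<lambda>\<omega>. (W \<omega> - Wj j \<omega>)\<^sup>2)) \<longlonglongrightarrow> 0" for j
    using L2_tendsto_real[OF Wjm Wm] LIMSEQ_ignore_initial_segment[OF lim0(2), of J] J[OF le_add2]
    unfolding Wj_def n_p_c_def by simp_all
  have hj2: "integrable (time T) (\<lambda>x. (norm (hj j x))\<^sup>2)" for j
    unfolding hj_def by (rule integral_norm_step_fun(1)[OF part])
  note L2 = L2_tendsto_integral[OF finite_measure_time hjm hm h2 hj2 hL2]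
  define \<kappa>j where "\<kappa>j j = (LINT x|time T. (norm (hj j x))\<^sup>2) / 2" for j
  define \<kappa> where "\<kappa> = (LINT x|time T. (norm (h x))\<^sup>2) / 2"
  have \<kappa>: "\<kappa>j \<longlonglongrightarrow> \<kappa>" unfolding \<kappa>j_def[abs_def] \<kappa>_def
    using L2(1)[of "\<lambda>_. 0"] by (intro tendsto_divide) auto
  have F: "F = (\<lambda>\<omega>. exp (W \<omega> - \<kappa>))"
  proof -
    have "(LINT s:{0..T}|lborel. (norm (h s))\<^sup>2) = (LINT x|time T. (norm (h x))\<^sup>2)"
      by (subst set_integral_time[of _ T]) (auto intro!: Bochner_Integration.integral_cong)
    then show ?thesis unfolding F_def \<kappa>_def stochastic_exponential_def[abs_def] by simp
  qed
  have elem: "exp (Wj j \<omega> - \<kappa>j j) = elementary_exponential (n j) (p j) (c j) \<omega>" for j \<omega>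
    unfolding elementary_exponential_def Wj_def SW_def \<kappa>j_def hj_def integral_norm_step_fun(2)[OF part]
    by (simp add: sum_subtractf sum_divide_distrib)
  obtain K0 where K0: "\<And>j. \<bar>\<kappa>j j\<bar> \<le> K0"
    using Bseq_eq_bounded convergent_imp_Bseq[OF convergentI[OF \<kappa>]] unfolding Bseq_def by (metis real_norm_def)
  have mom: "integrable M (\<lambda>\<omega>. (exp (Wj j \<omega> - \<kappa>j j))^4)" "expectation (\<lambda>\<omega>. (exp (Wj j \<omega> - \<kappa>j j))^4) \<le> exp (12 * K0)" for j
  proof -
    have "6 * (\<Sum>k<n j. (norm (c j k))\<^sup>2 * (p j (Suc k) - p j k)) = 12 * \<kappa>j j"
      unfolding \<kappa>j_def hj_def integral_norm_step_fun(2)[OF part] by simp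
    then show "integrable M (\<lambda>\<omega>. (exp (Wj j \<omega> - \<kappa>j j))^4)" "expectation (\<lambda>\<omega>. (exp (Wj j \<omega> - \<kappa>j j))^4) \<le> exp (12 * K0)"
      unfolding elem using elementary_exponential_moment4[OF part[of j], of "c j"] K0[of j] by auto
  qed
  have conv1: "integrable M (\<lambda>\<omega>. (F \<omega>)^4)"
    unfolding F by (rule exponential_approximation_tendsto(1)[OF Wjm Wm WL2 \<kappa> mom])
  have conv2: "integrable M (\<lambda>\<omega>. F \<omega> * Y \<omega>) \<and>
      (\<lambda>j. expectation (\<lambda>\<omega>. exp (Wj j \<omega> - \<kappa>j j) * Y \<omega>)) \<longlonglongrightarrow> expectation (\<lambda>\<omega>. F \<omega> * Y \<omega>)"
    if "Y \<in> borel_measurable M" "integrable M (\<lambda>\<omega>. (Y \<omega>)^4)" for Y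
    unfolding F by (rule exponential_approximation_tendsto(2)[OF Wjm Wm WL2 \<kappa> mom that])
  show Fm: "F \<in> borel_measurable M" unfolding F using Wm by simp
  show "integrable M (\<lambda>\<omega>. (F \<omega>)^4)" by (rule conv1)
  have "(\<lambda>j. expectation (\<lambda>\<omega>. exp (Wj j \<omega> - \<kappa>j j) * 1)) \<longlonglongrightarrow> expectation (\<lambda>\<omega>. F \<omega> * 1)"
    using conv2[of "\<lambda>_. 1"] by auto
  moreover have "expectation (\<lambda>\<omega>. exp (Wj j \<omega> - \<kappa>j j) * 1) = 1" for j
  proof -
    have "expectation (\<lambda>\<omega>. 1 * elementary_exponential (n j) (p j) (c j) \<omega>) = expectation (\<lambda>_. 1)"
      by (rule elementary_exponential_martingale(3)[OF _ _ _ borel_measurable_const integrable_const])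
        (use part[of j] in \<open>auto simp: is_partition_def\<close>)
    then show ?thesis unfolding elem by (simp add: prob_space)
  qed
  ultimately show "expectation F = 1" using LIMSEQ_unique[OF _ tendsto_const[of 1]] by simp
  fix s t C :: real and G assume st: "0 \<le> s" "s \<le> t" "t \<le> T" and G: "G \<in> borel_measurable (past s)" "\<And>\<omega>. \<bar>G \<omega>\<bar> \<le> C"
  have GM [measurable]: "G \<in> borel_measurable M" by (rule measurable_past_imp_measurable[OF G(1)]) (use st in auto)
  have incm [measurable]: "incr s t i \<in> borel_measurable M" using incr_measurable[OF st] .
  have C0: "0 \<le> C" using G(2) by (rule order_trans[OF abs_ge_zero])
  have G4: "(G \<omega>)^4 \<le> C^4" for \<omega>
  proof -
    have "\<bar>G \<omega>\<bar>^4 \<le> C^4" using G(2) by (intro power_mono) auto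
    then show ?thesis by simp
  qed
  have i1: "integrable M (\<lambda>\<omega>. (G \<omega>)^4)"
    by (rule integrable_const_bound[where B = "C^4"]) (use G4 in auto)
  have i2: "integrable M (\<lambda>\<omega>. (G \<omega> * incr s t i \<omega>)^4)"
  proof (rule Bochner_Integration.integrable_bound)
    show "integrable M (\<lambda>\<omega>. C^4 * (incr s t i \<omega>)^4)" using incr_component_moments(7)[OF st] by auto
    show "AE \<omega> in M. norm ((G \<omega> * incr s t i \<omega>)^4) \<le> norm (C^4 * (incr s t i \<omega>)^4)"
      using G4 C0 by (auto simp: power_mult_distrib abs_mult intro!: mult_right_mono)
  qed measurable
  define w where "w x = (indicator {s<..t} x :: real)" for x
  have w: "w \<in> borel_measurable (time T)" "\<bar>w x\<bar> \<le> 1" for x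
    unfolding w_def by (intro borel_measurable_time) (auto split: split_indicator)
  have c1: "(\<lambda>j. expectation (\<lambda>\<omega>. exp (Wj j \<omega> - \<kappa>j j) * (G \<omega> * incr s t i \<omega>))) \<longlonglongrightarrow> expectation (\<lambda>\<omega>. F \<omega> * (G \<omega> * incr s t i \<omega>))"
    "integrable M (\<lambda>\<omega>. F \<omega> * (G \<omega> * incr s t i \<omega>))"
    using conv2[OF borel_measurable_times[OF GM incm] i2] by blast+
  have c2: "(\<lambda>j. expectation (\<lambda>\<omega>. exp (Wj j \<omega> - \<kappa>j j) * G \<omega>)) \<longlonglongrightarrow> expectation (\<lambda>\<omega>. F \<omega> * G \<omega>)"
    using conv2[OF GM i1] by blast
  have "(\<lambda>j. expectation (\<lambda>\<omega>. exp (Wj j \<omega> - \<kappa>j j) * (G \<omega> * incr s t i \<omega>))) \<longlonglongrightarrow>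
      expectation (\<lambda>\<omega>. F \<omega> * G \<omega>) * (LINT x|time T. w x * h x $ i)"
    unfolding elem elementary_girsanov[OF part st G] unfolding elem[symmetric] hj_def[symmetric] w_def[symmetric]
    by (intro tendsto_mult c2 L2(2) w)
  from LIMSEQ_unique[OF c1(1) this] c1(2)
  show "integrable M (\<lambda>\<omega>. F \<omega> * (G \<omega> * incr s t i \<omega>)) \<and>
       expectation (\<lambda>\<omega>. F \<omega> * (G \<omega> * incr s t i \<omega>)) =
       expectation (\<lambda>\<omega>. F \<omega> * G \<omega>) * (LINT x|time T. indicator {s<..t} x * h x $ i)"
    unfolding w_def by blast
qed

end

section \<open>Stratonovich integrals weighted by a stochastic exponential\<close>

lemma sum_indicator_consecutive:
  fixes p :: "nat \<Rightarrow> real"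
  assumes "\<And>k. p k \<le> p (Suc k)"
  shows "(\<Sum>k<n. indicator {p k<..p (Suc k)} x) = (indicator {p 0<..p n} x :: real)"
proof (induction n)
  case (Suc n)
  have "p 0 \<le> p n" by (rule lift_Suc_mono_le[where f = p]) (use assms in auto)
  with Suc assms[of n] show ?case by (auto split: split_indicator)
qed auto

lemma continuous_on_time:
  assumes \<phi>: "continuous_on {0..T} (\<phi> :: real \<Rightarrow> real)"
  shows "\<phi> \<in> borel_measurable (time T)" "\<exists>C. \<forall>x\<in>{0..T}. \<bar>\<phi> x\<bar> \<le> C"
proof -
  show "\<phi> \<in> borel_measurable (time T)"
    using borel_measurable_continuous_on_restrict[OF \<phi>] sets_time[of T]
    by (simp add: measurable_def time_def space_restrict_space)
  show "\<exists>C. \<forall>x\<in>{0..T}. \<bar>\<phi> x\<bar> \<le> C" by (rule continuous_on_interval_bounded[OF \<phi>])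
qed

lemma integrable_times_continuous:
  assumes w: "integrable (time T) w" and \<phi>: "continuous_on {0..T} (\<phi> :: real \<Rightarrow> real)"
  shows "integrable (time T) (\<lambda>x. w x * \<phi> x)"
proof -
  from continuous_on_time(2)[OF \<phi>] obtain C where C: "\<And>x. x \<in> {0..T} \<Longrightarrow> \<bar>\<phi> x\<bar> \<le> C" by blast
  show ?thesis
  proof (rule Bochner_Integration.integrable_bound)
    show "integrable (time T) (\<lambda>x. C * w x)" using w by auto
    have "\<bar>w x\<bar> * \<bar>\<phi> x\<bar> \<le> \<bar>w x\<bar> * \<bar>C\<bar>" if "x \<in> {0..T}" for x
      by (intro mult_left_mono order_trans[OF C[OF that] abs_ge_self]) auto
    then show "AE x in time T. norm (w x * \<phi> x) \<le> norm (C * w x)"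
      by (intro AE_I2) (auto simp: abs_mult mult.commute)
  qed (use w continuous_on_time(1)[OF \<phi>] in auto)
qed

lemma integrable_component:
  fixes h :: "real \<Rightarrow> real^'n"
  assumes h: "square_integrable (time T) h"
  shows "integrable (time T) (\<lambda>x. h x $ i)"
proof (rule Bochner_Integration.integrable_bound)
  interpret tm: finite_measure "time T" by (rule finite_measure_time)
  show "integrable (time T) (\<lambda>x. 1 + (norm (h x))\<^sup>2)" using h unfolding square_integrable_def by auto
  show "(\<lambda>x. h x $ i) \<in> borel_measurable (time T)"
    by (rule measurable_component) (use h in \<open>auto simp: square_integrable_def\<close>)
  have "\<bar>h x $ i\<bar> \<le> 1 + (norm (h x))\<^sup>2" for x
  proof -
    have "\<bar>h x $ i\<bar> \<le> norm (h x)" by (rule component_le_norm_cart)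
    also have "\<dots> \<le> 1 + (norm (h x))\<^sup>2" using sum_squares_bound[of 1 "norm (h x)"] norm_ge_zero[of "h x"] by (simp del: norm_ge_zero)
    finally show ?thesis .
  qed
  then show "AE x in time T. norm (h x $ i) \<le> norm (1 + (norm (h x))\<^sup>2)" by (auto intro: order_trans)
qed

text \<open>
On each cell the continuous factor differs little from its value at the left end point; the total error is
this difference times the integral of \<open>|w|\<close>.
\<close>

lemma riemann_sums_tendsto:
  fixes w \<phi> :: "real \<Rightarrow> real"
  assumes w: "integrable (time T) w" and \<phi>: "continuous_on {0..T} \<phi>" and t: "0 \<le> t" "t \<le> T"
  shows "(\<lambda>n. \<Sum>k<n. \<phi> (grid t n k) * (LINT x|time T. indicator {grid t n k<..grid t n (Suc k)} x * w x))
      \<longlonglongrightarrow> (LINT x|time T. indicator {0<..t} x * (w x * \<phi> x))"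
proof (rule LIMSEQ_I)
  fix r :: real assume r: "0 < r"
  define K where "K = (LINT x|time T. \<bar>w x\<bar>)"
  have K: "0 \<le> K" unfolding K_def by simp
  define e where "e = r / (K + 1)"
  have e: "0 < e" using r K by (simp add: e_def)
  have "uniformly_continuous_on {0..T} \<phi>" using \<phi> by (rule compact_uniformly_continuous) simp
  with e obtain d where d: "0 < d" "\<And>x y. x \<in> {0..T} \<Longrightarrow> y \<in> {0..T} \<Longrightarrow> dist x y < d \<Longrightarrow> dist (\<phi> x) (\<phi> y) < e"
    unfolding uniformly_continuous_on_def by metis
  have wm [measurable]: "w \<in> borel_measurable (time T)" using w by auto
  have \<phi>m: "\<phi> \<in> borel_measurable (time T)" by (rule continuous_on_time(1)[OF \<phi>])
  have indm: "(indicator {a<..b} :: real \<Rightarrow> real) \<in> borel_measurable (time T)" for a b :: real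
    by (intro borel_measurable_time) measurable
  have wi: "integrable (time T) (\<lambda>x. indicator {a<..b} x * w x)" for a b
    by (rule Bochner_Integration.integrable_bound[OF w]) (use indm wm in \<open>auto split: split_indicator\<close>)
  have w\<phi>: "integrable (time T) (\<lambda>x. w x * \<phi> x)" by (rule integrable_times_continuous[OF w \<phi>])
  have w\<phi>i: "integrable (time T) (\<lambda>x. indicator {a<..b} x * (w x * \<phi> x))" for a b
    by (rule Bochner_Integration.integrable_bound[OF w\<phi>]) (use indm wm \<phi>m in \<open>auto split: split_indicator\<close>)
  obtain N where N: "t / d < real N" using reals_Archimedean2 by blast
  have "norm ((\<Sum>k<n. \<phi> (grid t n k) * (LINT x|time T. indicator {grid t n k<..grid t n (Suc k)} x * w x)) -
      (LINT x|time T. indicator {0<..t} x * (w x * \<phi> x))) < r" if n: "Suc N \<le> n" for n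
  proof -
    let ?i = "\<lambda>k x. indicator {grid t n k<..grid t n (Suc k)} x :: real"
    have "t < real N * d" using N d(1) by (simp add: pos_divide_less_eq)
    also have "\<dots> \<le> real n * d" using n d(1) by (intro mult_right_mono) auto
    finally have tn: "t / n < d" using n by (simp add: pos_divide_less_eq mult.commute)
    have ind: "(\<Sum>k<n. ?i k x) = indicator {0<..t} x" for x
      using sum_indicator_consecutive[of "grid t n" x n] grid_mono[OF t(1)] n by (simp add: grid_end)
    have "(\<Sum>k<n. \<phi> (grid t n k) * (LINT x|time T. ?i k x * w x)) - (LINT x|time T. indicator {0<..t} x * (w x * \<phi> x)) =
      (\<Sum>k<n. LINT x|time T. ?i k x * w x * (\<phi> (grid t n k) - \<phi> x))"
    proof -
      have "(LINT x|time T. indicator {0<..t} x * (w x * \<phi> x)) = (LINT x|time T. (\<Sum>k<n. ?i k x * (w x * \<phi> x)))"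
        unfolding ind[symmetric] by (simp only: sum_distrib_right)
      also have "\<dots> = (\<Sum>k<n. LINT x|time T. ?i k x * (w x * \<phi> x))"
        by (rule Bochner_Integration.integral_sum) (rule w\<phi>i)
      finally have 1: "(LINT x|time T. indicator {0<..t} x * (w x * \<phi> x)) = (\<Sum>k<n. LINT x|time T. ?i k x * (w x * \<phi> x))" .
      have 2: "(LINT x|time T. ?i k x * w x * (\<phi> (grid t n k) - \<phi> x)) =
          \<phi> (grid t n k) * (LINT x|time T. ?i k x * w x) - (LINT x|time T. ?i k x * (w x * \<phi> x))" for k
      proof -
        have "(LINT x|time T. ?i k x * w x * (\<phi> (grid t n k) - \<phi> x)) =
          (LINT x|time T. \<phi> (grid t n k) * (?i k x * w x) - ?i k x * (w x * \<phi> x))"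
          by (rule arg_cong[where f = "lebesgue_integral (time T)"]) (auto simp: algebra_simps)
        also have "\<dots> = (LINT x|time T. \<phi> (grid t n k) * (?i k x * w x)) - (LINT x|time T. ?i k x * (w x * \<phi> x))"
          by (rule Bochner_Integration.integral_diff) (intro Bochner_Integration.integrable_mult_right wi w\<phi>i)+
        finally show ?thesis by (simp only: integral_mult_right_zero)
      qed
      show ?thesis unfolding 1 2 sum_subtractf ..
    qed
    also have "norm \<dots> \<le> (\<Sum>k<n. LINT x|time T. ?i k x * \<bar>w x\<bar> * e)"
    proof (rule sum_norm_le)
      fix k assume k: "k \<in> {..<n}"
      have pw: "\<bar>?i k x * w x * (\<phi> (grid t n k) - \<phi> x)\<bar> \<le> ?i k x * \<bar>w x\<bar> * e" if "x \<in> {0..T}" for x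
      proof (cases "x \<in> {grid t n k<..grid t n (Suc k)}")
        case True
        have "grid t n (Suc k) - grid t n k = t / n" using n by (intro grid_step) auto
        then have "dist (grid t n k) x < d" using True tn by (auto simp: dist_real_def)
        moreover have "grid t n k \<in> {0..T}" using grid_bounds[OF t(1), of k n] k t by auto
        ultimately have "\<bar>\<phi> (grid t n k) - \<phi> x\<bar> \<le> e" using d(2) that by (fastforce simp: dist_real_def)
        then show ?thesis using True by (simp add: abs_mult mult_left_mono)
      qed simp
      have "norm (LINT x|time T. ?i k x * w x * (\<phi> (grid t n k) - \<phi> x)) \<le> (LINT x|time T. norm (?i k x * w x * (\<phi> (grid t n k) - \<phi> x)))"
        by (rule integral_norm_bound)
      also have "\<dots> \<le> (LINT x|time T. ?i k x * \<bar>w x\<bar> * e)"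
      proof (rule integral_mono')
        have "integrable (time T) (\<lambda>x. \<bar>?i k x * w x\<bar> * e)" using wi by (intro integrable_mult_left integrable_abs)
        then show "integrable (time T) (\<lambda>x. ?i k x * \<bar>w x\<bar> * e)" by (simp add: abs_mult)
      qed (use pw e in auto)
      finally show "norm (LINT x|time T. ?i k x * w x * (\<phi> (grid t n k) - \<phi> x)) \<le> (LINT x|time T. ?i k x * \<bar>w x\<bar> * e)" .
    qed
    also have "\<dots> = (LINT x|time T. (\<Sum>k<n. ?i k x * \<bar>w x\<bar> * e))"
    proof (rule Bochner_Integration.integral_sum[symmetric])
      fix k
      have "integrable (time T) (\<lambda>x. \<bar>?i k x * w x\<bar> * e)" using wi by (intro integrable_mult_left integrable_abs)
      then show "integrable (time T) (\<lambda>x. ?i k x * \<bar>w x\<bar> * e)" by (simp add: abs_mult)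
    qed
    also have "\<dots> = (LINT x|time T. indicator {0<..t} x * \<bar>w x\<bar> * e)"
      unfolding ind[symmetric] sum_distrib_right ..
    also have "\<dots> \<le> (LINT x|time T. \<bar>w x\<bar> * e)"
      by (rule integral_mono') (use w e in \<open>auto split: split_indicator\<close>)
    also have "\<dots> = K * e" by (simp add: K_def)
    also have "K * e < r"
    proof -
      have "K * e < (K + 1) * e" using e by simp
      also have "\<dots> = r" using K by (simp add: e_def add_nonneg_eq_0_iff)
      finally show ?thesis .
    qed
    finally show ?thesis .
  qed
  then show "\<exists>N. \<forall>n\<ge>N. norm ((\<Sum>k<n. \<phi> (grid t n k) * (LINT x|time T. indicator {grid t n k<..grid t n (Suc k)} x * w x)) -
      (LINT x|time T. indicator {0<..t} x * (w x * \<phi> x))) < r" by blast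
qed

context brownian_space
begin

text \<open>
A bound on second moments makes a sequence that tends to 0 in probability converge in mean after
multiplication with a weight having a fourth moment. Both truncations are contained in the pointwise
inequality at the beginning of the proof.
\<close>

lemma (in prob_space) weighted_expectation_tendsto_0:
  assumes F: "F \<in> borel_measurable M" "integrable M (\<lambda>\<omega>. (F \<omega>)^4)"
    and X: "\<And>n. X n \<in> borel_measurable M" "\<And>n. integrable M (\<lambda>\<omega>. (X n \<omega>)\<^sup>2)"
      "\<And>n. expectation (\<lambda>\<omega>. (X n \<omega>)\<^sup>2) \<le> K" "(\<lambda>n::nat. prob_size (X n)) \<longlonglongrightarrow> 0"
  shows "\<And>n. integrable M (\<lambda>\<omega>. F \<omega> * X n \<omega>)" "(\<lambda>n. expectation (\<lambda>\<omega>. F \<omega> * X n \<omega>)) \<longlonglongrightarrow> 0"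
proof -
  have [measurable]: "F \<in> borel_measurable M" "X n \<in> borel_measurable M" for n using F(1) X(1) by auto
  have pw: "\<bar>f * x\<bar> \<le> min 1 \<bar>x\<bar> / l^3 + l * (f^4 + 2 * x\<^sup>2)" if l: "0 < l" "l < 1" for f x l :: real
  proof -
    have l3: "0 < l^3" using l by simp
    have x1: "\<bar>x\<bar> / l \<le> min 1 \<bar>x\<bar> / l^3 + l * x\<^sup>2"
    proof (cases "\<bar>x\<bar> \<le> 1")
      case True
      have "\<bar>x\<bar> / l \<le> \<bar>x\<bar> / l^3"
        using l l3 by (intro divide_left_mono) (auto simp: power3_eq_cube mult_le_one mult_left_le)
      then show ?thesis using True l by (simp add: add_increasing2)
    next
      case False
      define y where "y = \<bar>x\<bar> * l\<^sup>2"
      have "y \<le> 1 + y\<^sup>2"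
      proof -
        have "0 \<le> y" by (simp add: y_def)
        then show ?thesis using sum_squares_bound[of 1 y] unfolding one_power2 by linarith
      qed
      then have "y / l^3 \<le> (1 + y\<^sup>2) / l^3" using l3 by (intro divide_right_mono) auto
      also have "y / l^3 = \<bar>x\<bar> / l" using l by (simp add: y_def power2_eq_square power3_eq_cube)
      also have "(1 + y\<^sup>2) / l^3 = 1 / l^3 + l * x\<^sup>2"
        using l by (simp add: y_def power2_eq_square power3_eq_cube field_simps)
      finally show ?thesis using False by simp
    qed
    have "\<bar>f * x\<bar> \<le> \<bar>x\<bar> / l + l * (f\<^sup>2 * \<bar>x\<bar>)"
    proof -
      have "\<bar>f\<bar> \<le> 1 / l + l * f\<^sup>2"
      proof -
        have "2 * 1 * (l * \<bar>f\<bar>) \<le> 1\<^sup>2 + (l * \<bar>f\<bar>)\<^sup>2" by (rule sum_squares_bound)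
        moreover have "0 \<le> l * \<bar>f\<bar>" using l by simp
        ultimately have "l * \<bar>f\<bar> \<le> 1 + (l * \<bar>f\<bar>)\<^sup>2" unfolding one_power2 by linarith
        then have "(l * \<bar>f\<bar>) / l \<le> (1 + (l * \<bar>f\<bar>)\<^sup>2) / l" using l by (intro divide_right_mono) auto
        moreover have "(1 + (l * \<bar>f\<bar>)\<^sup>2) / l = 1 / l + l * f\<^sup>2"
          using l by (simp add: add_divide_distrib power_mult_distrib) (simp add: power2_eq_square)
        ultimately show ?thesis using l by simp
      qed
      then have "\<bar>f\<bar> * \<bar>x\<bar> \<le> (1 / l + l * f\<^sup>2) * \<bar>x\<bar>" by (intro mult_right_mono) auto
      then show ?thesis by (simp add: abs_mult distrib_right mult.assoc)
    qed
    moreover have "f\<^sup>2 * \<bar>x\<bar> \<le> f^4 + x\<^sup>2"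
    proof -
      have "2 * f\<^sup>2 * \<bar>x\<bar> \<le> (f\<^sup>2)\<^sup>2 + \<bar>x\<bar>\<^sup>2" by (rule sum_squares_bound)
      moreover have "0 \<le> f\<^sup>2 * \<bar>x\<bar>" by simp
      moreover have "(f\<^sup>2)\<^sup>2 = f^4" by (simp flip: power_mult)
      ultimately show ?thesis unfolding power2_abs by linarith
    qed
    then have "l * (f\<^sup>2 * \<bar>x\<bar>) \<le> l * (f^4 + x\<^sup>2)" using l by (intro mult_left_mono) auto
    ultimately have "\<bar>f * x\<bar> \<le> min 1 \<bar>x\<bar> / l^3 + l * x\<^sup>2 + l * (f^4 + x\<^sup>2)" using x1 by linarith
    then show ?thesis by (simp add: algebra_simps)
  qed
  have bi: "integrable M (\<lambda>\<omega>. min 1 \<bar>X n \<omega>\<bar> / l^3 + l * ((F \<omega>)^4 + 2 * (X n \<omega>)\<^sup>2))" for n l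
    using F(2) X(2)[of n] integrable_min_one[of "X n"] by auto
  show FXi: "integrable M (\<lambda>\<omega>. F \<omega> * X n \<omega>)" for n
    by (rule Bochner_Integration.integrable_bound[OF bi[of n "1/2"]])
      (use order_trans[OF pw[of "1/2"] abs_ge_self] in auto)
  show "(\<lambda>n. expectation (\<lambda>\<omega>. F \<omega> * X n \<omega>)) \<longlonglongrightarrow> 0"
  proof (rule tendsto_0_if_error_split[where e = "\<lambda>n l. prob_size (X n) / l^3"])
    show "(\<lambda>n. prob_size (X n) / l^3) \<longlonglongrightarrow> 0" if "0 < l" "l < 1" for l
      using tendsto_divide[OF X(4) tendsto_const[of "l^3"]] that by simp
    show "0 \<le> expectation (\<lambda>\<omega>. (F \<omega>)^4) + 2 * \<bar>K\<bar>"
      by (intro add_nonneg_nonneg Bochner_Integration.integral_nonneg) auto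
    fix n and l :: real assume l: "0 < l" "l < 1"
    have "\<bar>expectation (\<lambda>\<omega>. F \<omega> * X n \<omega>)\<bar> \<le> expectation (\<lambda>\<omega>. \<bar>F \<omega> * X n \<omega>\<bar>)" by (rule integral_abs_bound)
    also have "\<dots> \<le> expectation (\<lambda>\<omega>. min 1 \<bar>X n \<omega>\<bar> / l^3 + l * ((F \<omega>)^4 + 2 * (X n \<omega>)\<^sup>2))"
      using FXi bi pw[OF l] by (intro integral_mono integrable_abs) auto
    also have "\<dots> = prob_size (X n) / l^3 + l * (expectation (\<lambda>\<omega>. (F \<omega>)^4) + 2 * expectation (\<lambda>\<omega>. (X n \<omega>)\<^sup>2))"
      using F(2) X(2)[of n] integrable_min_one[of "X n"] by (simp add: prob_size_def)
    also have "\<dots> \<le> prob_size (X n) / l^3 + l * (expectation (\<lambda>\<omega>. (F \<omega>)^4) + 2 * \<bar>K\<bar>)"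
      using l X(3)[of n] by (intro add_left_mono mult_left_mono) auto
    finally show "\<bar>expectation (\<lambda>\<omega>. F \<omega> * X n \<omega>)\<bar> \<le> prob_size (X n) / l^3 + l * (expectation (\<lambda>\<omega>. (F \<omega>)^4) + 2 * \<bar>K\<bar>)" .
  qed
qed

lemma (in prob_space) integrable_if_fourth_power:
  assumes "F \<in> borel_measurable M" "integrable M (\<lambda>\<omega>. (F \<omega> :: real)^4)"
  shows "integrable M F"
proof (rule Bochner_Integration.integrable_bound)
  show "integrable M (\<lambda>\<omega>. 1 + (F \<omega>)^4)" using assms by auto
  have "\<bar>x\<bar> \<le> 1 + x^4" for x :: real
  proof (cases "\<bar>x\<bar> \<le> 1")
    case True
    then show ?thesis by (intro add_increasing2) auto
  next
    case False
    then have "\<bar>x\<bar>^1 \<le> \<bar>x\<bar>^4" by (intro power_increasing) auto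
    then show ?thesis by simp
  qed
  then show "AE \<omega> in M. norm (F \<omega>) \<le> norm (1 + (F \<omega>)^4)" by (auto intro: order_trans)
qed (use assms in auto)

lemma weighted_mean_continuous:
  assumes F: "integrable M F" and Z: "tame_process C Z"
  shows "continuous_on {0..T} (\<lambda>s. expectation (\<lambda>\<omega>. F \<omega> * Z s \<omega>))"
  unfolding continuous_on_sequentially
proof (intro allI ballI impI)
  fix x :: "nat \<Rightarrow> real" and a assume a: "a \<in> {0..T}" and x: "(\<forall>n. x n \<in> {0..T}) \<and> x \<longlonglongrightarrow> a"
  have "(\<lambda>n. expectation (\<lambda>\<omega>. F \<omega> * Z (x n) \<omega>)) \<longlonglongrightarrow> expectation (\<lambda>\<omega>. F \<omega> * Z a \<omega>)"
  proof (rule integral_dominated_convergence[where w = "\<lambda>\<omega>. C * \<bar>F \<omega>\<bar>"])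
    show "AE \<omega> in M. (\<lambda>n. F \<omega> * Z (x n) \<omega>) \<longlonglongrightarrow> F \<omega> * Z a \<omega>"
      using tame_processD(3)[OF Z] unfolding continuous_paths_def
    proof eventually_elim
      case (elim \<omega>)
      then have "(\<lambda>n. Z (x n) \<omega>) \<longlonglongrightarrow> Z a \<omega>"
        using a x unfolding continuous_on_sequentially o_def by blast
      then show ?case by (intro tendsto_mult tendsto_const)
    qed
    show "AE \<omega> in M. norm (F \<omega> * Z (x n) \<omega>) \<le> C * \<bar>F \<omega>\<bar>" for n
    proof (rule AE_I2)
      fix \<omega>
      have "\<bar>F \<omega>\<bar> * \<bar>Z (x n) \<omega>\<bar> \<le> \<bar>F \<omega>\<bar> * C" by (intro mult_left_mono tame_processD(2)[OF Z]) auto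
      then show "norm (F \<omega> * Z (x n) \<omega>) \<le> C * \<bar>F \<omega>\<bar>" by (simp add: abs_mult mult.commute)
    qed
    show "(\<lambda>\<omega>. F \<omega> * Z (x n) \<omega>) \<in> borel_measurable M" "(\<lambda>\<omega>. F \<omega> * Z a \<omega>) \<in> borel_measurable M" for n
      using F tame_processD(6)[OF Z] a x by auto
  qed (use F in auto)
  then show "((\<lambda>s. expectation (\<lambda>\<omega>. F \<omega> * Z s \<omega>)) \<circ> x) \<longlonglongrightarrow> expectation (\<lambda>\<omega>. F \<omega> * Z a \<omega>)" by (simp add: o_def)
qed

lemma tame_ito_sum_L2:
  fixes i :: 'n
  assumes Z: "tame_process C Z" and t: "0 \<le> t" "t \<le> T"
  defines "J \<equiv> \<lambda>n \<omega>. \<Sum>k<n. Z (grid t n k) \<omega> * incr (grid t n k) (grid t n (Suc k)) i \<omega>"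
  shows "J n \<in> borel_measurable M" "integrable M (\<lambda>\<omega>. (J n \<omega>)\<^sup>2)" "expectation (\<lambda>\<omega>. (J n \<omega>)\<^sup>2) \<le> C\<^sup>2 * t"
proof -
  have gr: "0 \<le> grid t n k" "grid t n k \<le> grid t n (Suc k)" "grid t n (Suc k) \<le> T" "grid t n k \<le> T"
    "grid t n (Suc k) - grid t n k = t / n" if "k < n" for k
    using that grid_in_range[OF t, of k n] grid_in_range[OF t, of "Suc k" n] grid_mono[OF t(1), of k "Suc k" n]
      grid_step[of n t k] by auto
  have mom: "integrable M (incr (grid t n k) (grid t n (Suc k)) i)" "expectation (incr (grid t n k) (grid t n (Suc k)) i) = 0"
    "integrable M (\<lambda>\<omega>. (incr (grid t n k) (grid t n (Suc k)) i \<omega>)\<^sup>2)"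
    "expectation (\<lambda>\<omega>. (incr (grid t n k) (grid t n (Suc k)) i \<omega>)\<^sup>2) = t / n" if "k < n" for k
    using incr_mean_zero[OF gr(1-3)[OF that], of i] incr_component_moments(5,6)[OF gr(1-3)[OF that], of i] gr(5)[OF that] by auto
  have iso: "integrable M (J n)" "integrable M (\<lambda>\<omega>. (J n \<omega>)\<^sup>2)"
    "expectation (\<lambda>\<omega>. (J n \<omega>)\<^sup>2) = (\<Sum>k<n. expectation (\<lambda>\<omega>. (Z (grid t n k) \<omega>)\<^sup>2) *
       expectation (\<lambda>\<omega>. ((\<lambda>x. x $ i) (B (grid t n (Suc k)) \<omega> - B (grid t n k) \<omega>))\<^sup>2))"
    unfolding J_def
    by (rule discrete_ito_isometry[where p = "grid t n" and C = C and G = "\<lambda>k. Z (grid t n k)" and f = "\<lambda>k x. x $ i"];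
      use gr mom grid_in_range[OF t, of n n] tame_processD(2,5)[OF Z] in \<open>auto simp: grid_mono\<close>)+
  show "J n \<in> borel_measurable M" using iso(1) by auto
  show "integrable M (\<lambda>\<omega>. (J n \<omega>)\<^sup>2)" by fact
  have Z2: "expectation (\<lambda>\<omega>. (Z (grid t n k) \<omega>)\<^sup>2) \<le> C\<^sup>2" if "k < n" for k
    by (rule tame_process_second_moment[OF Z]) (use gr[OF that] in auto)
  have "expectation (\<lambda>\<omega>. (J n \<omega>)\<^sup>2) \<le> (\<Sum>k<n. C\<^sup>2 * (t / n))"
    unfolding iso(3) using Z2 mom(4) t by (intro sum_mono mult_mono) (auto intro!: Bochner_Integration.integral_nonneg)
  also have "\<dots> \<le> C\<^sup>2 * t" using t by (cases "n = 0") auto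
  finally show "expectation (\<lambda>\<omega>. (J n \<omega>)\<^sup>2) \<le> C\<^sup>2 * t" .
qed

text \<open>
The symmetric sums are Ito sums \<open>J\<close> plus half the covariation sums, and the latter may be replaced by the
Riemann sums \<open>R\<close> of \<open>Z'\<close>. So \<open>J + R/2\<close> minus the sum of the integrals tends to 0 in probability. This difference
is bounded in mean square, because the sum of the integrals is assumed to be bounded, and therefore its
expectation weighted by \<open>F\<close> tends to 0. Those of \<open>J\<close> and \<open>R\<close> are Riemann sums, for \<open>J\<close> by \<open>girsanov\<close>. Note
that only the sum over \<open>i\<close> of the integrals, and not each of them, is known to be bounded.
\<close>

theorem expectation_stratonovich_integral:
  fixes h :: "real \<Rightarrow> real^'n" and Z Z' :: "'n \<Rightarrow> real \<Rightarrow> 'w \<Rightarrow> real" and I :: "'n \<Rightarrow> 'w \<Rightarrow> real"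
  assumes h: "square_integrable (time T) h" and W: "wiener_integral M B T h W"
    and t: "0 \<le> t" "t \<le> T"
    and Z: "\<And>i. tame_process (C i) (Z i)" and Z': "\<And>i. tame_process (C' i) (Z' i)"
    and I: "\<And>i. stratonovich_integral M (Z i) (\<lambda>s \<omega>. B s \<omega> $ i) t (I i)"
    and cov: "\<And>i. (\<lambda>n. prob_size (\<lambda>\<omega>.
      (\<Sum>k<n. (Z i (grid t n (Suc k)) \<omega> - Z i (grid t n k) \<omega>) * incr (grid t n k) (grid t n (Suc k)) i \<omega>)
      - (\<Sum>k<n. Z' i (grid t n k) \<omega> * (t / n)))) \<longlonglongrightarrow> 0"
    and bdd: "AE \<omega> in M. \<bar>\<Sum>i\<in>UNIV. I i \<omega>\<bar> \<le> K"
  defines "F \<equiv> stochastic_exponential T h W"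
  shows "expectation (\<lambda>\<omega>. F \<omega> * (\<Sum>i\<in>UNIV. I i \<omega>)) =
      (\<Sum>i\<in>UNIV. LINT s|time T. indicator {0<..t} s * (h s $ i * expectation (\<lambda>\<omega>. F \<omega> * Z i s \<omega>)))
    + 1/2 * (\<Sum>i\<in>UNIV. LINT s|time T. indicator {0<..t} s * expectation (\<lambda>\<omega>. F \<omega> * Z' i s \<omega>))"
proof -
  note gir = girsanov[OF h W, folded F_def]
  have Fi: "integrable M F" by (rule integrable_if_fourth_power[OF gir(1,2)])
  define db where "db n k i \<omega> = incr (grid t n k) (grid t n (Suc k)) i \<omega>" for n k i \<omega>
  define J where "J n i \<omega> = (\<Sum>k<n. Z i (grid t n k) \<omega> * db n k i \<omega>)" for n i \<omega>
  define Kn where "Kn n i \<omega> = (\<Sum>k<n. (Z i (grid t n (Suc k)) \<omega> - Z i (grid t n k) \<omega>) * db n k i \<omega>)" for n i \<omega>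
  define R where "R n i \<omega> = (\<Sum>k<n. Z' i (grid t n k) \<omega> * (t / n))" for n i \<omega>
  define S where "S n i \<omega> = (\<Sum>k<n. (Z i (grid t n (Suc k)) \<omega> + Z i (grid t n k) \<omega>) / 2 * db n k i \<omega>)" for n i \<omega>
  define X where "X n \<omega> = (\<Sum>i\<in>UNIV. J (Suc n) i \<omega> + R (Suc n) i \<omega> / 2 - I i \<omega>)" for n \<omega>
  have gr: "grid t n k \<in> {0..T}" if "k \<le> n" for n k using grid_in_range[OF t that] by auto
  have Zm: "Z i (grid t n k) \<in> borel_measurable M" "Z' i (grid t n k) \<in> borel_measurable M" if "k \<le> n" for i n k
    using gr[OF that] tame_processD(6)[OF Z[of i]] tame_processD(6)[OF Z'[of i]] by auto
  have dbm: "db n k i \<in> borel_measurable M" if "k < n" for n k i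
    unfolding db_def using grid_incr_measurable[OF t that] .
  have Im: "I i \<in> borel_measurable M" for i using I by (rule stratonovich_integral_measurable)
  have Jn: "J n i \<in> borel_measurable M" "integrable M (\<lambda>\<omega>. (J n i \<omega>)\<^sup>2)"
    "expectation (\<lambda>\<omega>. (J n i \<omega>)\<^sup>2) \<le> (C i)\<^sup>2 * t" for n i
    using tame_ito_sum_L2[OF Z[of i] t, of n i] unfolding J_def[abs_def] db_def by blast+
  have Km: "Kn n i \<in> borel_measurable M" for n i
    unfolding Kn_def by (intro borel_measurable_sum borel_measurable_times borel_measurable_diff Zm dbm) auto
  have Sm: "S n i \<in> borel_measurable M" for n i
    unfolding S_def by (intro borel_measurable_sum borel_measurable_times borel_measurable_divide borel_measurable_add Zm dbm) auto
  have Rm: "R n i \<in> borel_measurable M" for n i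
    unfolding R_def by (intro borel_measurable_sum borel_measurable_times Zm) auto
  have Xm: "X n \<in> borel_measurable M" for n
    unfolding X_def by (intro borel_measurable_sum borel_measurable_diff borel_measurable_add borel_measurable_divide Jn Rm Im) auto
  have Rb: "\<bar>R (Suc n) i \<omega>\<bar> \<le> C' i * t" for n i \<omega>
  proof -
    have "\<bar>R (Suc n) i \<omega>\<bar> \<le> (\<Sum>k<Suc n. C' i * (t / Suc n))"
      unfolding R_def
    proof (rule order_trans[OF sum_abs sum_mono])
      fix k
      have "\<bar>Z' i (grid t (Suc n) k) \<omega>\<bar> * (t / Suc n) \<le> C' i * (t / Suc n)"
        by (intro mult_right_mono tame_processD(2)[OF Z']) (use t in auto)
      then show "\<bar>Z' i (grid t (Suc n) k) \<omega> * (t / Suc n)\<bar> \<le> C' i * (t / Suc n)"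
        using t by (simp add: abs_mult)
    qed
    also have "\<dots> = C' i * t" by (simp del: of_nat_Suc)
    finally show ?thesis .
  qed
  have X_eq: "X n \<omega> = (\<Sum>i\<in>UNIV. (S (Suc n) i \<omega> - I i \<omega>) + - (1/2) * (Kn (Suc n) i \<omega> - R (Suc n) i \<omega>))" for n \<omega>
  proof -
    have "S n i \<omega> = J n i \<omega> + Kn n i \<omega> / 2" for n i
      unfolding S_def J_def Kn_def sum_divide_distrib sum.distrib[symmetric]
      by (intro sum.cong refl) (simp add: field_simps)
    then show ?thesis unfolding X_def by (intro sum.cong refl) (simp add: field_simps)
  qed
  have S0: "(\<lambda>n. prob_size (\<lambda>\<omega>. S (Suc n) i \<omega> - I i \<omega>)) \<longlonglongrightarrow> 0" for i
  proof -
    have g1: "grid t 1 1 = t" by (simp add: grid_def)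
    have "stratonovich_integral M (Z i) (\<lambda>s \<omega>. B s \<omega> $ i) (grid t 1 1) (I i)" unfolding g1 by (rule I)
    from stratonovich_grid_sums_tendsto[OF Z t order_refl _ this] show ?thesis
      unfolding S_def db_def by simp
  qed
  have K0: "(\<lambda>n. prob_size (\<lambda>\<omega>. - (1/2) * (Kn (Suc n) i \<omega> - R (Suc n) i \<omega>))) \<longlonglongrightarrow> 0" for i
  proof (rule tendsto_sandwich[OF _ _ tendsto_const])
    show "(\<lambda>n. prob_size (\<lambda>\<omega>. Kn (Suc n) i \<omega> - R (Suc n) i \<omega>)) \<longlonglongrightarrow> 0"
      using LIMSEQ_Suc[OF cov[of i]] unfolding Kn_def R_def db_def .
    have "prob_size (\<lambda>\<omega>. - (1/2) * (Kn (Suc n) i \<omega> - R (Suc n) i \<omega>)) \<le> prob_size (\<lambda>\<omega>. Kn (Suc n) i \<omega> - R (Suc n) i \<omega>)" for n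
      by (rule prob_size_mono_AE) (use Km Rm in \<open>auto simp: abs_mult\<close>)
    then show "\<forall>\<^sub>F n in sequentially. prob_size (\<lambda>\<omega>. - (1/2) * (Kn (Suc n) i \<omega> - R (Suc n) i \<omega>)) \<le> prob_size (\<lambda>\<omega>. Kn (Suc n) i \<omega> - R (Suc n) i \<omega>)"
      by (intro always_eventually allI)
  qed (use prob_size_nonneg in auto)
  have X0: "(\<lambda>n. prob_size (X n)) \<longlonglongrightarrow> 0"
  proof (rule tendsto_sandwich[OF _ _ tendsto_const])
    have "(\<lambda>n. \<Sum>i\<in>UNIV. prob_size (\<lambda>\<omega>. S (Suc n) i \<omega> - I i \<omega>) + prob_size (\<lambda>\<omega>. - (1/2) * (Kn (Suc n) i \<omega> - R (Suc n) i \<omega>)))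
        \<longlonglongrightarrow> (\<Sum>i\<in>(UNIV::'n set). 0 + 0)"
      by (intro tendsto_sum tendsto_add S0 K0)
    then show "(\<lambda>n. \<Sum>i\<in>UNIV. prob_size (\<lambda>\<omega>. S (Suc n) i \<omega> - I i \<omega>) + prob_size (\<lambda>\<omega>. - (1/2) * (Kn (Suc n) i \<omega> - R (Suc n) i \<omega>))) \<longlonglongrightarrow> 0"
      by simp
    have "prob_size (X n) \<le> (\<Sum>i\<in>UNIV. prob_size (\<lambda>\<omega>. S (Suc n) i \<omega> - I i \<omega>) + prob_size (\<lambda>\<omega>. - (1/2) * (Kn (Suc n) i \<omega> - R (Suc n) i \<omega>)))" for n
    proof -
      have m: "(\<lambda>\<omega>. S (Suc n) i \<omega> - I i \<omega>) \<in> borel_measurable M"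
        "(\<lambda>\<omega>. - (1/2) * (Kn (Suc n) i \<omega> - R (Suc n) i \<omega>)) \<in> borel_measurable M" for i
        using Sm Im Km Rm by auto
      have "prob_size (X n) \<le> (\<Sum>i\<in>UNIV. prob_size (\<lambda>\<omega>. (S (Suc n) i \<omega> - I i \<omega>) + - (1/2) * (Kn (Suc n) i \<omega> - R (Suc n) i \<omega>)))"
        unfolding X_eq[abs_def] by (rule prob_size_sum) (use m in auto)
      also have "\<dots> \<le> (\<Sum>i\<in>UNIV. prob_size (\<lambda>\<omega>. S (Suc n) i \<omega> - I i \<omega>) + prob_size (\<lambda>\<omega>. - (1/2) * (Kn (Suc n) i \<omega> - R (Suc n) i \<omega>)))"
        by (intro sum_mono prob_size_add m)
      finally show ?thesis .
    qed
    then show "\<forall>\<^sub>F n in sequentially. prob_size (X n) \<le> (\<Sum>i\<in>UNIV. prob_size (\<lambda>\<omega>. S (Suc n) i \<omega> - I i \<omega>) + prob_size (\<lambda>\<omega>. - (1/2) * (Kn (Suc n) i \<omega> - R (Suc n) i \<omega>)))"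
      by (intro always_eventually allI)
  qed (use prob_size_nonneg in auto)
  define c where "c = real CARD('n)"
  define A where "A = (\<Sum>i\<in>UNIV. C' i * t / 2) + K"
  have X2: "AE \<omega> in M. (X n \<omega>)\<^sup>2 \<le> 2 * (c * (\<Sum>i\<in>UNIV. (J (Suc n) i \<omega>)\<^sup>2)) + 2 * A\<^sup>2" for n
    using bdd
  proof eventually_elim
    case (elim \<omega>)
    define a where "a = (\<Sum>i\<in>UNIV. J (Suc n) i \<omega>)"
    define b where "b = (\<Sum>i\<in>UNIV. R (Suc n) i \<omega> / 2) - (\<Sum>i\<in>UNIV. I i \<omega>)"
    have X_ab: "X n \<omega> = a + b" by (simp add: X_def a_def b_def sum.distrib sum_subtractf)
    have "(a + b)\<^sup>2 \<le> 2 * a\<^sup>2 + 2 * b\<^sup>2"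
      using zero_le_power2[of "a - b"] by (simp add: power2_eq_square algebra_simps)
    moreover have "b\<^sup>2 \<le> A\<^sup>2"
    proof -
      have "\<bar>\<Sum>i\<in>UNIV. R (Suc n) i \<omega> / 2\<bar> \<le> (\<Sum>i\<in>UNIV. C' i * t / 2)"
        using Rb by (intro order_trans[OF sum_abs sum_mono]) auto
      with elim have "\<bar>b\<bar> \<le> A" unfolding A_def b_def by linarith
      from power_mono[OF this, of 2] show ?thesis by simp
    qed
    moreover have "a\<^sup>2 \<le> c * (\<Sum>i\<in>UNIV. (J (Suc n) i \<omega>)\<^sup>2)"
      using Cauchy_Schwarz_ineq_sum[of "\<lambda>_. 1" "\<lambda>i. J (Suc n) i \<omega>" UNIV] by (simp add: a_def c_def)
    ultimately show "(X n \<omega>)\<^sup>2 \<le> 2 * (c * (\<Sum>i\<in>UNIV. (J (Suc n) i \<omega>)\<^sup>2)) + 2 * A\<^sup>2"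
      unfolding X_ab by linarith
  qed
  have Gi: "integrable M (\<lambda>\<omega>. 2 * (c * (\<Sum>i\<in>UNIV. (J (Suc n) i \<omega>)\<^sup>2)) + 2 * A\<^sup>2)" for n
    using Jn(2) by auto
  have X2i: "integrable M (\<lambda>\<omega>. (X n \<omega>)\<^sup>2)" for n
  proof (rule Bochner_Integration.integrable_bound[OF Gi[of n]])
    show "AE \<omega> in M. norm ((X n \<omega>)\<^sup>2) \<le> norm (2 * (c * (\<Sum>i\<in>UNIV. (J (Suc n) i \<omega>)\<^sup>2)) + 2 * A\<^sup>2)"
      using X2[of n] by eventually_elim (auto intro: order_trans)
  qed (use Xm in auto)
  have X2e: "expectation (\<lambda>\<omega>. (X n \<omega>)\<^sup>2) \<le> 2 * (c * (\<Sum>i\<in>UNIV. (C i)\<^sup>2 * t)) + 2 * A\<^sup>2" for n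
  proof -
    have "expectation (\<lambda>\<omega>. (X n \<omega>)\<^sup>2) \<le> expectation (\<lambda>\<omega>. 2 * (c * (\<Sum>i\<in>UNIV. (J (Suc n) i \<omega>)\<^sup>2)) + 2 * A\<^sup>2)"
      by (rule integral_mono_AE[OF X2i Gi X2])
    also have "\<dots> = 2 * (c * (\<Sum>i\<in>UNIV. expectation (\<lambda>\<omega>. (J (Suc n) i \<omega>)\<^sup>2))) + 2 * A\<^sup>2"
      using Jn(2) by (simp add: prob_space)
    also have "\<dots> \<le> 2 * (c * (\<Sum>i\<in>UNIV. (C i)\<^sup>2 * t)) + 2 * A\<^sup>2"
      using Jn(3) by (intro add_right_mono mult_left_mono sum_mono) (auto simp: c_def)
    finally show ?thesis .
  qed
  note lim = weighted_expectation_tendsto_0[OF gir(1,2) Xm X2i X2e X0]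
  define H where "H i k n = (LINT x|time T. indicator {grid t n k<..grid t n (Suc k)} x * h x $ i)" for i k n
  have incrs: "integrable M (\<lambda>\<omega>. F \<omega> * (Z i (grid t n k) \<omega> * db n k i \<omega>))"
      "expectation (\<lambda>\<omega>. F \<omega> * (Z i (grid t n k) \<omega> * db n k i \<omega>)) = expectation (\<lambda>\<omega>. F \<omega> * Z i (grid t n k) \<omega>) * H i k n"
    if "k < n" for n k i
  proof -
    have g: "0 \<le> grid t n k" "grid t n k \<le> grid t n (Suc k)" "grid t n (Suc k) \<le> T" "grid t n k \<le> T"
      using that grid_in_range[OF t, of k n] grid_in_range[OF t, of "Suc k" n] grid_mono[OF t(1), of k "Suc k" n] by auto
    show "integrable M (\<lambda>\<omega>. F \<omega> * (Z i (grid t n k) \<omega> * db n k i \<omega>))"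
      "expectation (\<lambda>\<omega>. F \<omega> * (Z i (grid t n k) \<omega> * db n k i \<omega>)) = expectation (\<lambda>\<omega>. F \<omega> * Z i (grid t n k) \<omega>) * H i k n"
      unfolding db_def H_def using gir(4)[OF g(1-3) tame_processD(5)[OF Z g(1,4)] tame_processD(2)[OF Z], of i] by blast+
  qed
  have FZi: "integrable M (\<lambda>\<omega>. F \<omega> * Z' i (grid t n k) \<omega>)" if "k \<le> n" for i n k
  proof (rule Bochner_Integration.integrable_bound)
    show "integrable M (\<lambda>\<omega>. C' i * F \<omega>)" using Fi by auto
    have "\<bar>F \<omega>\<bar> * \<bar>Z' i (grid t n k) \<omega>\<bar> \<le> \<bar>F \<omega>\<bar> * \<bar>C' i\<bar>" for \<omega>
      by (intro mult_left_mono order_trans[OF tame_processD(2)[OF Z'] abs_ge_self]) auto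
    then show "AE \<omega> in M. norm (F \<omega> * Z' i (grid t n k) \<omega>) \<le> norm (C' i * F \<omega>)" by (auto simp: abs_mult mult.commute)
  qed (use gir(1) Zm[OF that] in auto)
  have FJ: "integrable M (\<lambda>\<omega>. F \<omega> * J n i \<omega>)"
    "expectation (\<lambda>\<omega>. F \<omega> * J n i \<omega>) = (\<Sum>k<n. expectation (\<lambda>\<omega>. F \<omega> * Z i (grid t n k) \<omega>) * H i k n)" for n i
    unfolding J_def sum_distrib_left using incrs by auto
  have FR: "integrable M (\<lambda>\<omega>. F \<omega> * R n i \<omega>)"
    "expectation (\<lambda>\<omega>. F \<omega> * R n i \<omega>) = (\<Sum>k<n. expectation (\<lambda>\<omega>. F \<omega> * Z' i (grid t n k) \<omega>) * (t / n))" for n i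
    unfolding R_def sum_distrib_left mult.assoc[symmetric] using FZi by auto
  have FI: "integrable M (\<lambda>\<omega>. F \<omega> * (\<Sum>i\<in>UNIV. I i \<omega>))"
  proof (rule Bochner_Integration.integrable_bound)
    show "integrable M (\<lambda>\<omega>. K * F \<omega>)" using Fi by auto
    show "AE \<omega> in M. norm (F \<omega> * (\<Sum>i\<in>UNIV. I i \<omega>)) \<le> norm (K * F \<omega>)"
      using bdd
    proof eventually_elim
      case (elim \<omega>)
      have "\<bar>F \<omega>\<bar> * \<bar>\<Sum>i\<in>UNIV. I i \<omega>\<bar> \<le> \<bar>F \<omega>\<bar> * \<bar>K\<bar>"
        by (intro mult_left_mono order_trans[OF elim abs_ge_self]) auto
      then show ?case by (simp add: abs_mult mult.commute)
    qed
  qed (use gir(1) Im in auto)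
  have EX: "expectation (\<lambda>\<omega>. F \<omega> * X n \<omega>) = (\<Sum>i\<in>UNIV. expectation (\<lambda>\<omega>. F \<omega> * J (Suc n) i \<omega>)) +
      1/2 * (\<Sum>i\<in>UNIV. expectation (\<lambda>\<omega>. F \<omega> * R (Suc n) i \<omega>)) - expectation (\<lambda>\<omega>. F \<omega> * (\<Sum>i\<in>UNIV. I i \<omega>))" for n
  proof -
    have "F \<omega> * X n \<omega> = (\<Sum>i\<in>UNIV. F \<omega> * J (Suc n) i \<omega>) + 1/2 * (\<Sum>i\<in>UNIV. F \<omega> * R (Suc n) i \<omega>) - F \<omega> * (\<Sum>i\<in>UNIV. I i \<omega>)" for \<omega>
      by (simp add: X_def sum.distrib sum_subtractf sum_distrib_left sum_divide_distrib right_diff_distrib distrib_left)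
    then show ?thesis using FJ(1) FR(1) FI by simp
  qed
  interpret tm: finite_measure "time T" by (rule finite_measure_time)
  have hi: "integrable (time T) (\<lambda>x. h x $ i)" for i by (rule integrable_component[OF h])
  have limJ: "(\<lambda>n. expectation (\<lambda>\<omega>. F \<omega> * J (Suc n) i \<omega>)) \<longlonglongrightarrow>
      (LINT s|time T. indicator {0<..t} s * (h s $ i * expectation (\<lambda>\<omega>. F \<omega> * Z i s \<omega>)))" for i
    unfolding FJ(2) H_def
    using LIMSEQ_Suc[OF riemann_sums_tendsto[OF hi weighted_mean_continuous[OF Fi Z] t]] .
  have limR: "(\<lambda>n. expectation (\<lambda>\<omega>. F \<omega> * R (Suc n) i \<omega>)) \<longlonglongrightarrow>
      (LINT s|time T. indicator {0<..t} s * expectation (\<lambda>\<omega>. F \<omega> * Z' i s \<omega>))" for i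
  proof -
    have meas: "(LINT x|time T. indicator {grid t (Suc n) k<..grid t (Suc n) (Suc k)} x * 1) = t / Suc n" if "k < Suc n" for n k
    proof -
      have g: "0 \<le> grid t (Suc n) k" "grid t (Suc n) k \<le> grid t (Suc n) (Suc k)" "grid t (Suc n) (Suc k) \<le> T"
        using that grid_in_range[OF t, of k "Suc n"] grid_in_range[OF t, of "Suc k" "Suc n"] grid_mono[OF t(1), of k "Suc k" "Suc n"] by auto
      have "(LINT x|time T. indicator {grid t (Suc n) k<..grid t (Suc n) (Suc k)} x * 1) =
        (LINT x|lborel. indicator {0..T} x *\<^sub>R (indicator {grid t (Suc n) k<..grid t (Suc n) (Suc k)} x * (1::real)))"
        unfolding time_def by (rule integral_restrict_space) simp
      also have "\<dots> = (LINT x|lborel. indicator {grid t (Suc n) k<..grid t (Suc n) (Suc k)} x)"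
        by (rule Bochner_Integration.integral_cong) (use g in \<open>auto split: split_indicator\<close>)
      also have "\<dots> = grid t (Suc n) (Suc k) - grid t (Suc n) k" using g by (simp add: measure_def)
      also have "\<dots> = t / Suc n" by (rule grid_step) simp
      finally show ?thesis .
    qed
    have "(\<lambda>n. \<Sum>k<Suc n. expectation (\<lambda>\<omega>. F \<omega> * Z' i (grid t (Suc n) k) \<omega>) *
        (LINT x|time T. indicator {grid t (Suc n) k<..grid t (Suc n) (Suc k)} x * 1)) \<longlonglongrightarrow>
      (LINT s|time T. indicator {0<..t} s * (1 * expectation (\<lambda>\<omega>. F \<omega> * Z' i s \<omega>)))"
      using LIMSEQ_Suc[OF riemann_sums_tendsto[OF _ weighted_mean_continuous[OF Fi Z'] t, of "\<lambda>_. 1"]] by simp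
    moreover have "(\<Sum>k<Suc n. expectation (\<lambda>\<omega>. F \<omega> * Z' i (grid t (Suc n) k) \<omega>) *
        (LINT x|time T. indicator {grid t (Suc n) k<..grid t (Suc n) (Suc k)} x * 1)) = expectation (\<lambda>\<omega>. F \<omega> * R (Suc n) i \<omega>)" for n
      unfolding FR(2) using meas by (intro sum.cong refl) auto
    ultimately show ?thesis by simp
  qed
  have "(\<lambda>n. (\<Sum>i\<in>UNIV. expectation (\<lambda>\<omega>. F \<omega> * J (Suc n) i \<omega>)) +
      1/2 * (\<Sum>i\<in>UNIV. expectation (\<lambda>\<omega>. F \<omega> * R (Suc n) i \<omega>)) - expectation (\<lambda>\<omega>. F \<omega> * (\<Sum>i\<in>UNIV. I i \<omega>))) \<longlonglongrightarrow>
    (\<Sum>i\<in>UNIV. LINT s|time T. indicator {0<..t} s * (h s $ i * expectation (\<lambda>\<omega>. F \<omega> * Z i s \<omega>))) +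
      1/2 * (\<Sum>i\<in>UNIV. LINT s|time T. indicator {0<..t} s * expectation (\<lambda>\<omega>. F \<omega> * Z' i s \<omega>)) - expectation (\<lambda>\<omega>. F \<omega> * (\<Sum>i\<in>UNIV. I i \<omega>))"
    by (intro tendsto_diff tendsto_add tendsto_mult tendsto_sum tendsto_const limJ limR)
  from LIMSEQ_unique[OF lim(2)[unfolded EX] this] show ?thesis by simp
qed

end

section \<open>Test functions\<close>

subsection \<open>Smooth functions\<close>

lemma continuously_differentiable_Suc_imp:
  "continuously_differentiable (Suc k) f \<Longrightarrow> continuously_differentiable k f"
proof (induction k arbitrary: f)
  case 0
  then show ?case by (auto intro!: continuous_at_imp_continuous_on differentiable_imp_continuous_within)
next
  case (Suc k)
  then show ?case by (simp (no_asm_use)) blast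
qed

lemma continuously_differentiable_const: "continuously_differentiable k (\<lambda>_. c)"
  by (induction k arbitrary: c) auto

lemma continuously_differentiable_add:
  "continuously_differentiable k f \<Longrightarrow> continuously_differentiable k g \<Longrightarrow> continuously_differentiable k (\<lambda>x. f x + g x)"
proof (induction k arbitrary: f g)
  case 0
  then show ?case by (auto intro: continuous_intros)
next
  case (Suc k)
  then have d: "f differentiable at x" "g differentiable at x" for x by auto
  then have "frechet_derivative (\<lambda>x. f x + g x) (at x) v = frechet_derivative f (at x) v + frechet_derivative g (at x) v" for x v
    by (subst frechet_derivative_at[OF has_derivative_add[OF d[unfolded frechet_derivative_works], of x], symmetric]) simp
  with Suc d show ?case by (auto intro: differentiable_add)
qed

lemma continuously_differentiable_mult:
  "continuously_differentiable k f \<Longrightarrow> continuously_differentiable k g \<Longrightarrow> continuously_differentiable k (\<lambda>x. f x * g x)"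
proof (induction k arbitrary: f g)
  case 0
  then show ?case by (auto intro: continuous_intros)
next
  case (Suc k)
  then have d: "f differentiable at x" "g differentiable at x" for x by auto
  then have "frechet_derivative (\<lambda>x. f x * g x) (at x) v = f x * frechet_derivative g (at x) v + frechet_derivative f (at x) v * g x" for x v
    by (subst frechet_derivative_at[OF has_derivative_mult[OF d[unfolded frechet_derivative_works], of x], symmetric]) simp
  moreover have "continuously_differentiable k f" "continuously_differentiable k g"
    using Suc.prems by (auto intro: continuously_differentiable_Suc_imp simp del: continuously_differentiable.simps)
  ultimately show ?case using Suc d by (auto intro!: differentiable_mult continuously_differentiable_add)
qed

lemma continuously_differentiable_prod:
  assumes "finite I" "\<And>i. i \<in> I \<Longrightarrow> continuously_differentiable k (f i)"
  shows "continuously_differentiable k (\<lambda>x. \<Prod>i\<in>I. f i x)"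
  using assms by (induction I) (auto intro: continuously_differentiable_const continuously_differentiable_mult)

text \<open>
Each partial derivative lowers \<open>k\<close> by one and passes to the next member of the family \<open>g\<close>, up to the constant
factor \<open>l v\<close>; for this reason the induction is over all members at once.
\<close>

lemma continuously_differentiable_affine_compose:
  fixes l :: "'a::euclidean_space \<Rightarrow> real" and g :: "nat \<Rightarrow> real \<Rightarrow> real"
  assumes l: "bounded_linear l" and g: "\<And>n x. (g n has_real_derivative g (Suc n) x) (at x)"
  shows "continuously_differentiable k (\<lambda>x. g n (l x + c))"
proof (induction k arbitrary: n)
  have d: "((\<lambda>x. g n (l x + c)) has_derivative (\<lambda>v. l v * g (Suc n) (l x + c))) (at x)" for n x
  proof -
    have "((\<lambda>x. l x + c) has_derivative l) (at x)"
      using bounded_linear_imp_has_derivative[OF l] by (auto intro!: derivative_eq_intros)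
    from DERIV_compose_FDERIV[OF g this] show ?thesis by simp
  qed
  {
    case 0
    show ?case using d by (auto intro!: continuous_at_imp_continuous_on has_derivative_continuous)
  next
    case (Suc k)
    have "frechet_derivative (\<lambda>x. g n (l x + c)) (at x) v = l v * g (Suc n) (l x + c)" for x v
      by (subst frechet_derivative_at[OF d, symmetric]) simp
    moreover have "(\<lambda>x. g n (l x + c)) differentiable at x" for x using d by (rule differentiableI)
    ultimately show ?case using Suc
      by (auto intro!: continuously_differentiable_mult continuously_differentiable_const)
  }
qed

text \<open>
The function that equals \<open>exp (- 1 / x)\<close> for positive \<open>x\<close> and vanishes elsewhere is smooth. Its derivatives are
the functions \<open>flat_exp n\<close>; the polynomials satisfy the recursion given by the product and the chain rule.
\<close>

fun flat_poly :: "nat \<Rightarrow> real poly" where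
  "flat_poly 0 = 1"
| "flat_poly (Suc n) = monom 1 2 * (flat_poly n - pderiv (flat_poly n))"

definition flat_exp :: "nat \<Rightarrow> real \<Rightarrow> real" where
  "flat_exp n x = (if 0 < x then poly (flat_poly n) (1 / x) * exp (- (1 / x)) else 0)"

lemma poly_times_exp_tendsto_0: "((\<lambda>y. poly p y * exp (- y)) \<longlongrightarrow> 0) at_top" for p :: "real poly"
proof -
  have "((\<lambda>y. \<Sum>i\<le>degree p. coeff p i * (y ^ i / exp y)) \<longlongrightarrow> (\<Sum>i\<le>degree p. coeff p i * 0)) at_top"
    by (intro tendsto_sum tendsto_mult tendsto_const tendsto_power_div_exp_0)
  then show ?thesis by (simp add: poly_altdef sum_distrib_right exp_minus divide_inverse mult.assoc)
qed

text \<open>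
At 0 the difference quotient from the right is a polynomial in \<open>1 / x\<close> times \<open>exp (- 1 / x)\<close>.
\<close>

lemma flat_exp_has_derivative: "(flat_exp n has_real_derivative flat_exp (Suc n) x) (at x)"
proof (cases x "0 :: real" rule: linorder_cases)
  case less
  have "(flat_exp n has_real_derivative 0) (at x)"
    by (rule has_field_derivative_transform_within_open[where f = "\<lambda>_. 0" and S = "{..<0}"])
      (use less in \<open>auto simp: flat_exp_def\<close>)
  then show ?thesis using less by (simp add: flat_exp_def)
next
  case greater
  define p where "p = flat_poly n"
  have "((\<lambda>x. poly p (1 / x) * exp (- (1 / x))) has_real_derivative
      (poly (pderiv p) (1 / x) * (- (1 / x\<^sup>2)) * exp (- (1 / x)) + poly p (1 / x) * (exp (- (1 / x)) * (1 / x\<^sup>2)))) (at x)"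
    using greater
    by (auto intro!: derivative_eq_intros DERIV_chain'[where g = "poly p", OF _ poly_DERIV] simp: power2_eq_square)
  also have "poly (pderiv p) (1 / x) * (- (1 / x\<^sup>2)) * exp (- (1 / x)) + poly p (1 / x) * (exp (- (1 / x)) * (1 / x\<^sup>2)) = flat_exp (Suc n) x"
    using greater by (simp add: flat_exp_def p_def poly_monom power_divide algebra_simps)
  finally have "((\<lambda>x. poly p (1 / x) * exp (- (1 / x))) has_real_derivative flat_exp (Suc n) x) (at x)" .
  then show ?thesis
    by (rule has_field_derivative_transform_within_open[where S = "{0<..}"])
      (use greater in \<open>auto simp: flat_exp_def p_def\<close>)
next
  case equal
  define p where "p = monom 1 1 * flat_poly n"
  have "((\<lambda>h. (flat_exp n h - flat_exp n 0) / (h - 0)) \<longlongrightarrow> 0) (at 0)"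
  proof (rule filterlim_split_at)
    have "eventually (\<lambda>h. (flat_exp n h - flat_exp n 0) / (h - 0) = 0) (at_left 0)"
      by (auto simp: eventually_at_filter flat_exp_def)
    then show "((\<lambda>h. (flat_exp n h - flat_exp n 0) / (h - 0)) \<longlongrightarrow> 0) (at_left 0)" by (rule tendsto_eventually)
    have "((\<lambda>h. poly p (inverse h) * exp (- inverse h)) \<longlongrightarrow> 0) (at_right 0)"
      by (rule filterlim_compose[OF poly_times_exp_tendsto_0 filterlim_inverse_at_top_right])
    moreover have "eventually (\<lambda>h. poly p (inverse h) * exp (- inverse h) = (flat_exp n h - flat_exp n 0) / (h - 0)) (at_right 0)"
      by (auto simp: eventually_at_filter flat_exp_def p_def poly_monom divide_inverse mult_ac)
    ultimately show "((\<lambda>h. (flat_exp n h - flat_exp n 0) / (h - 0)) \<longlongrightarrow> 0) (at_right 0)"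
      by (rule Lim_transform_eventually)
  qed
  then show ?thesis using equal by (simp add: has_field_derivative_iff flat_exp_def)
qed

text \<open>
As \<open>m\<close> grows, these test functions supported in the box from \<open>a\<close> to \<open>c\<close> increase to its indicator.
\<close>

definition box_bump :: "real \<Rightarrow> real^'n \<Rightarrow> real^'n \<Rightarrow> real^'n \<Rightarrow> real" where
  "box_bump m a c x = (\<Prod>i\<in>UNIV. flat_exp 0 (m * x $ i + - (m * a $ i)) * flat_exp 0 (- m * x $ i + m * c $ i))"

lemma flat_exp_0_bounds: "0 \<le> flat_exp 0 x" "flat_exp 0 x \<le> 1" "flat_exp 0 x = 0 \<longleftrightarrow> x \<le> 0"
  by (auto simp: flat_exp_def)

lemma box_bump_bounds: "0 \<le> box_bump m a c x" "box_bump m a c x \<le> 1"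
  unfolding box_bump_def using flat_exp_0_bounds
  by (auto intro!: prod_nonneg prod_le_1 mult_nonneg_nonneg mult_le_one)

lemma box_bump_nonzero: "0 < m \<Longrightarrow> box_bump m a c x \<noteq> 0 \<longleftrightarrow> x \<in> box a c"
proof -
  assume m: "0 < m"
  have "0 < m * x $ i + - (m * a $ i) \<longleftrightarrow> a $ i < x $ i" for i
    using m by (simp add: mult_less_cancel_left_pos)
  moreover have "0 < - m * x $ i + m * c $ i \<longleftrightarrow> x $ i < c $ i" for i
    using m by (simp add: mult_less_cancel_left_pos)
  ultimately show ?thesis
    unfolding box_bump_def mem_box_cart by (auto simp: flat_exp_0_bounds(3) not_le)
qed

lemma test_function_box_bump:
  assumes m: "0 < m"
  shows "test_function UNIV (box_bump m a c)"
proof -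
  have "continuously_differentiable k (box_bump m a c)" for k
    unfolding box_bump_def
    by (intro continuously_differentiable_prod continuously_differentiable_mult
        continuously_differentiable_affine_compose[where g = flat_exp] flat_exp_has_derivative
        bounded_linear_const_mult bounded_linear_vec_nth finite)
  moreover have "bounded (box a c)" by (rule bounded_box)
  then have "compact (closure {x. box_bump m a c x \<noteq> 0})"
    unfolding box_bump_nonzero[OF m] by (simp add: compact_closure)
  ultimately show ?thesis by (simp add: test_function_def)
qed

lemma box_bump_tendsto:
  fixes a c x :: "real^'n"
  shows "(\<lambda>m. box_bump (real (Suc m)) a c x) \<longlonglongrightarrow> indicator (box a c) x"
proof (cases "x \<in> box a c")
  case True
  have lim: "(\<lambda>m. flat_exp 0 (real (Suc m) * y)) \<longlonglongrightarrow> 1" if "0 < y" for y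
  proof -
    have "(\<lambda>m. exp (- (1 / y * inverse (real (Suc m))))) \<longlonglongrightarrow> exp (- (1 / y * 0))"
      by (intro tendsto_intros LIMSEQ_inverse_real_of_nat)
    moreover have "flat_exp 0 (real (Suc m) * y) = exp (- (1 / y * inverse (real (Suc m))))" for m
      using that by (simp add: flat_exp_def divide_inverse mult.commute del: of_nat_Suc)
    ultimately show ?thesis by simp
  qed
  have "(\<lambda>m. \<Prod>i\<in>UNIV. flat_exp 0 (real (Suc m) * (x $ i - a $ i)) * flat_exp 0 (real (Suc m) * (c $ i - x $ i))) \<longlonglongrightarrow> (\<Prod>i\<in>(UNIV::'n set). 1 * 1)"
    using True by (intro tendsto_prod tendsto_mult lim) (auto simp: mem_box_cart)
  moreover have "box_bump (real (Suc m)) a c x = (\<Prod>i\<in>UNIV. flat_exp 0 (real (Suc m) * (x $ i - a $ i)) * flat_exp 0 (real (Suc m) * (c $ i - x $ i)))" for m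
    unfolding box_bump_def by (intro prod.cong refl arg_cong2[where f = "(*)"] arg_cong[where f = "flat_exp 0"]) (simp_all add: algebra_simps)
  ultimately show ?thesis using True by simp
next
  case False
  then have "box_bump (real (Suc m)) a c x = 0" for m using box_bump_nonzero[of "real (Suc m)" a c x] by simp
  then show ?thesis using False by simp
qed

subsection \<open>Integrability and separation of functions\<close>

lemma test_functionD:
  assumes "test_function UNIV \<phi>"
  shows "continuous_on UNIV \<phi>" "\<phi> \<in> borel_measurable borel" "compact (closure {x. \<phi> x \<noteq> 0})" "\<phi> differentiable at x"
proof -
  have cd: "continuously_differentiable k \<phi>" for k using assms unfolding test_function_def by blast
  show c: "continuous_on UNIV \<phi>" using cd[of 0] by simp
  then show "\<phi> \<in> borel_measurable borel" by (rule borel_measurable_continuous_onI)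
  show "compact (closure {x. \<phi> x \<noteq> 0})" using assms unfolding test_function_def by blast
  show "\<phi> differentiable at x" using cd[of 1] by simp
qed

lemma integrable_continuous_compact_support:
  fixes f :: "real^'n \<Rightarrow> real"
  assumes "continuous_on UNIV f" "compact K" "\<And>x. x \<notin> K \<Longrightarrow> f x = 0"
  shows "integrable lborel f"
proof -
  have "integrable lborel (\<lambda>x. indicator K x *\<^sub>R f x)"
    by (intro borel_integrable_compact assms(2) continuous_on_subset[OF assms(1)]) auto
  moreover have "(\<lambda>x. indicator K x *\<^sub>R f x) = f" using assms(3) by (auto split: split_indicator)
  ultimately show ?thesis by simp
qed

lemma test_function_integrable:
  fixes \<phi> :: "real^'n \<Rightarrow> real"
  assumes "test_function UNIV \<phi>"
  shows "integrable lborel \<phi>" "integrable lborel (\<lambda>x. (\<phi> x)\<^sup>2)" "integrable lborel (\<lambda>x. \<bar>\<phi> x\<bar>)"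
proof -
  note t = test_functionD[OF assms]
  have out: "\<phi> x = 0" if "x \<notin> closure {x. \<phi> x \<noteq> 0}" for x
    using that closure_subset[of "{x. \<phi> x \<noteq> 0}"] by auto
  show "integrable lborel \<phi>"
    by (rule integrable_continuous_compact_support[OF t(1,3) out])
  then show "integrable lborel (\<lambda>x. \<bar>\<phi> x\<bar>)" by auto
  have "continuous_on UNIV (\<lambda>x. (\<phi> x)\<^sup>2)" by (intro continuous_intros t(1))
  then show "integrable lborel (\<lambda>x. (\<phi> x)\<^sup>2)"
    by (rule integrable_continuous_compact_support[OF _ t(3)]) (subst out; simp)
qed

lemma partial_eq_0_off_support:
  assumes x: "x \<notin> closure {x. \<phi> x \<noteq> 0}"
  shows "partial i \<phi> x = 0"
proof -
  have zero: "0 = \<phi> y" if "y \<in> - closure {x. \<phi> x \<noteq> 0}" for y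
    using that closure_subset[of "{x. \<phi> x \<noteq> 0}"] by auto
  have "((\<lambda>_. 0) has_derivative (\<lambda>_. 0)) (at x)" by (rule has_derivative_const)
  from has_derivative_transform_within_open[OF this open_Compl[OF closed_closure] ComplI[OF notE[OF x]] zero]
  have "(\<phi> has_derivative (\<lambda>_. 0)) (at x)" .
  then have "frechet_derivative \<phi> (at x) = (\<lambda>_. 0)" using frechet_derivative_at by metis
  then show ?thesis by (simp add: partial_def)
qed

lemma test_function_partial:
  assumes "test_function UNIV \<phi>"
  shows "test_function UNIV (partial i \<phi>)"
proof -
  have cd: "continuously_differentiable k \<phi>" for k using assms unfolding test_function_def by blast
  have "continuously_differentiable k (partial i \<phi>)" for k
    using cd[of "Suc k"] unfolding partial_def[abs_def] continuously_differentiable.simps by blast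
  moreover have "{x. partial i \<phi> x \<noteq> 0} \<subseteq> closure {x. \<phi> x \<noteq> 0}"
    using partial_eq_0_off_support[of _ \<phi> i] by blast
  then have "closure {x. partial i \<phi> x \<noteq> 0} \<subseteq> closure {x. \<phi> x \<noteq> 0}" by (intro closure_minimal) auto
  then have "compact (closure {x. partial i \<phi> x \<noteq> 0})"
    using compact_Int_closed[OF test_functionD(3)[OF assms] closed_closure[of "{x. partial i \<phi> x \<noteq> 0}"]]
    by (simp add: Int_absorb1)
  ultimately show ?thesis by (simp add: test_function_def)
qed

lemma integrable_square_product:
  fixes f g :: "'a \<Rightarrow> real"
  assumes "f \<in> borel_measurable N" "g \<in> borel_measurable N"
    and "integrable N (\<lambda>x. (f x)\<^sup>2)" "integrable N (\<lambda>x. (g x)\<^sup>2)"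
  shows "integrable N (\<lambda>x. f x * g x)"
proof (rule Bochner_Integration.integrable_bound)
  show "integrable N (\<lambda>x. (f x)\<^sup>2 + (g x)\<^sup>2)" using assms by auto
  have "\<bar>a * b\<bar> \<le> a\<^sup>2 + b\<^sup>2" for a b :: real
  proof -
    have "2 * (\<bar>a\<bar> * \<bar>b\<bar>) \<le> a\<^sup>2 + b\<^sup>2" using sum_squares_bound[of "\<bar>a\<bar>" "\<bar>b\<bar>"] by simp
    moreover have "0 \<le> \<bar>a\<bar> * \<bar>b\<bar>" by simp
    ultimately show ?thesis unfolding abs_mult by linarith
  qed
  then show "AE x in N. norm (f x * g x) \<le> norm ((f x)\<^sup>2 + (g x)\<^sup>2)" by auto
qed (use assms in auto)

text \<open>
Bump functions show that the integral of \<open>f\<close> over every box vanishes. So the measures whose densities are the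
positive and the negative part of \<open>f\<close> agree on boxes, hence everywhere, and the densities agree.
\<close>

lemma AE_zero_if_orthogonal_to_test_functions:
  fixes f :: "real^'n \<Rightarrow> real"
  assumes f [measurable]: "f \<in> borel_measurable lborel" and f2: "integrable lborel (\<lambda>x. (f x)\<^sup>2)"
    and orth: "\<And>\<phi>. test_function UNIV \<phi> \<Longrightarrow> (LINT x|lborel. f x * \<phi> x) = 0"
  shows "AE x in lborel. f x = 0"
proof -
  have fb: "integrable lborel (\<lambda>x. f x * indicator (box a c) x)" for a c
  proof (rule integrable_square_product[OF f _ f2])
    have "(indicator (box a c) x :: real)\<^sup>2 = indicator (box a c) x" for x by (auto split: split_indicator)
    moreover have "integrable lborel (indicator (box a c) :: real^'n \<Rightarrow> real)"
      by (rule integrable_real_indicator) (use emeasure_bounded_finite[OF bounded_box[of a c]] in auto)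
    ultimately show "integrable lborel (\<lambda>x. (indicator (box a c) x :: real)\<^sup>2)" by simp
  qed auto
  have box0: "(LINT x|lborel. f x * indicator (box a c) x) = 0" for a c :: "real^'n"
  proof -
    have "(\<lambda>m. LINT x|lborel. f x * box_bump (real (Suc m)) a c x) \<longlonglongrightarrow> (LINT x|lborel. f x * indicator (box a c) x)"
    proof (rule integral_dominated_convergence[where w = "\<lambda>x. \<bar>f x * indicator (box a c) x\<bar>"])
      show "AE x in lborel. (\<lambda>m. f x * box_bump (real (Suc m)) a c x) \<longlonglongrightarrow> f x * indicator (box a c) x"
        by (intro AE_I2 tendsto_mult tendsto_const box_bump_tendsto)
      show "AE x in lborel. norm (f x * box_bump (real (Suc m)) a c x) \<le> \<bar>f x * indicator (box a c) x\<bar>" for m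
      proof (rule AE_I2)
        fix x
        have "\<bar>box_bump (real (Suc m)) a c x\<bar> \<le> indicator (box a c) x"
          using box_bump_nonzero[of "real (Suc m)" a c x] box_bump_bounds[of "real (Suc m)" a c x]
          by (cases "x \<in> box a c") auto
        then have "\<bar>f x\<bar> * \<bar>box_bump (real (Suc m)) a c x\<bar> \<le> \<bar>f x\<bar> * indicator (box a c) x" by (intro mult_left_mono) auto
        then show "norm (f x * box_bump (real (Suc m)) a c x) \<le> \<bar>f x * indicator (box a c) x\<bar>" by (simp add: abs_mult)
      qed
      show "(\<lambda>x. f x * box_bump (real (Suc m)) a c x) \<in> borel_measurable lborel" for m
        using test_functionD(2)[OF test_function_box_bump[of "real (Suc m)" a c]] by auto
    qed (use fb in auto)
    moreover have "(LINT x|lborel. f x * box_bump (real (Suc m)) a c x) = 0" for m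
      by (rule orth[OF test_function_box_bump]) simp
    ultimately show ?thesis by (simp add: LIMSEQ_const_iff)
  qed
  \<comment> \<open>The embedding of the reals truncates at 0, so these are the positive and the negative part.\<close>
  define p q where "p x = ennreal (f x)" "q x = ennreal (- f x)" for x
  have [measurable]: "p \<in> borel_measurable lborel" "q \<in> borel_measurable lborel" unfolding p_q_def by auto
  have pos: "(\<integral>\<^sup>+x. p x * indicator (box a c) x \<partial>lborel) = (\<integral>\<^sup>+x. q x * indicator (box a c) x \<partial>lborel) \<and>
      (\<integral>\<^sup>+x. p x * indicator (box a c) x \<partial>lborel) < \<infinity>" for a c
  proof -
    let ?g = "\<lambda>x. f x * indicator (box a c) x"
    have i: "integrable lborel ?g" by (rule fb)
    have 1: "(\<integral>\<^sup>+x. p x * indicator (box a c) x \<partial>lborel) = (\<integral>\<^sup>+x. ennreal (?g x) \<partial>lborel)"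
      by (intro nn_integral_cong) (auto simp: p_q_def split: split_indicator)
    have 2: "(\<integral>\<^sup>+x. q x * indicator (box a c) x \<partial>lborel) = (\<integral>\<^sup>+x. ennreal (- ?g x) \<partial>lborel)"
      by (intro nn_integral_cong) (auto simp: p_q_def split: split_indicator)
    have fin: "(\<integral>\<^sup>+x. ennreal (?g x) \<partial>lborel) \<noteq> \<infinity>" "(\<integral>\<^sup>+x. ennreal (- ?g x) \<partial>lborel) \<noteq> \<infinity>"
      using i unfolding real_integrable_def by auto
    have diff0: "enn2real (\<integral>\<^sup>+x. ennreal (?g x) \<partial>lborel) - enn2real (\<integral>\<^sup>+x. ennreal (- ?g x) \<partial>lborel) = 0"
      using real_lebesgue_integral_def[OF i] box0[of a c] by simp
    have inj: "x = y" if "enn2real x - enn2real y = 0" "x < top" "y < top" for x y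
      using arg_cong[where f = ennreal, of "enn2real x" "enn2real y"] that by simp
    note fin' = fin[unfolded infinity_ennreal_def top.not_eq_extremum]
    show ?thesis unfolding 1 2 using inj[OF diff0 fin'] fin'(1) by simp
  qed
  have "density lborel p = density lborel q"
  proof (rule measure_eqI_generator_eq[where E = "range (\<lambda>(a, c). box a c)" and \<Omega> = UNIV and A = "\<lambda>i. box (- real i *\<^sub>R One) (real i *\<^sub>R One)"])
    show "Int_stable (range (\<lambda>(a, c). box a c :: (real^'n) set))"
      by (auto simp: Int_stable_def box_Int_box)
    show "sets (density lborel p) = sigma_sets UNIV (range (\<lambda>(a, c). box a c))"
      "sets (density lborel q) = sigma_sets UNIV (range (\<lambda>(a, c). box a c))"
      by (simp_all add: borel_eq_box)
    show "emeasure (density lborel p) X = emeasure (density lborel q) X" if "X \<in> range (\<lambda>(a, c). box a c)" for X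
      using that pos by (auto simp: emeasure_density)
    show "(\<Union>i. box (- real i *\<^sub>R One) (real i *\<^sub>R One)) = (UNIV :: (real^'n) set)" by (simp add: UN_box_eq_UNIV)
    show "emeasure (density lborel p) (box (- real i *\<^sub>R One) (real i *\<^sub>R One)) \<noteq> \<infinity>" for i
      using pos[of "- real i *\<^sub>R One" "real i *\<^sub>R One"] by (auto simp: emeasure_density)
  qed auto
  then have "AE x in lborel. p x = q x"
    by (subst (asm) sigma_finite_measure.density_unique_iff[OF lborel.sigma_finite_measure_axioms]) auto
  then show ?thesis
  proof eventually_elim
    case (elim x)
    show ?case
    proof (cases "0 \<le> f x")
      case True
      then have "q x = 0" by (simp add: p_q_def ennreal_neg)
      then have "ennreal (f x) = 0" using elim by (simp add: p_q_def)
      then show ?thesis using True by (simp add: ennreal_eq_0_iff)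
    next
      case False
      then have "p x = 0" by (simp add: p_q_def ennreal_neg)
      then have "ennreal (- f x) = 0" using elim by (simp add: p_q_def)
      then show ?thesis using False by (simp add: ennreal_eq_0_iff)
    qed
  qed
qed

section \<open>Spatial averages of a bounded random field\<close>

context prob_space
begin

text \<open>
This covers both spatial averages at a fixed time and integrals over time and space: \<open>N\<close> is the measure on the
variables other than \<open>\<omega>\<close>.
\<close>

lemma weighted_fubini:
  fixes N :: "'b measure" and v :: "'a \<Rightarrow> 'b \<Rightarrow> real"
  assumes N: "sigma_finite_measure N"
    and v: "(\<lambda>(\<omega>, y). v \<omega> y) \<in> borel_measurable (M \<Otimes>\<^sub>M N)"
    and bd: "AE \<omega> in M. AE y in N. \<bar>v \<omega> y\<bar> \<le> C"
    and F: "integrable M F" and \<psi>: "integrable N \<psi>"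
  shows "AE \<omega> in M. integrable N (\<lambda>y. v \<omega> y * \<psi> y) \<and> \<bar>LINT y|N. v \<omega> y * \<psi> y\<bar> \<le> C * (LINT y|N. \<bar>\<psi> y\<bar>)"
    "integrable N (\<lambda>y. (LINT \<omega>|M. v \<omega> y * F \<omega>) * \<psi> y)"
    "integrable M (\<lambda>\<omega>. F \<omega> * (LINT y|N. v \<omega> y * \<psi> y))"
    "(LINT \<omega>|M. F \<omega> * (LINT y|N. v \<omega> y * \<psi> y)) = (LINT y|N. (LINT \<omega>|M. v \<omega> y * F \<omega>) * \<psi> y)"
proof -
  interpret N: sigma_finite_measure N by fact
  interpret pair_sigma_finite M N ..
  note [measurable] = v
  have Fm [measurable]: "F \<in> borel_measurable M" and \<psi>m [measurable]: "\<psi> \<in> borel_measurable N" using F \<psi> by auto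
  have vm: "v \<omega> \<in> borel_measurable N" if "\<omega> \<in> space M" for \<omega>
    using measurable_compose[OF measurable_Pair1'[OF that] v] by simp
  have A: "AE \<omega> in M. integrable N (\<lambda>y. v \<omega> y * \<psi> y) \<and> (LINT y|N. \<bar>v \<omega> y * \<psi> y\<bar>) \<le> C * (LINT y|N. \<bar>\<psi> y\<bar>)"
    using bd AE_space
  proof eventually_elim
    case (elim \<omega>)
    note [measurable] = vm[OF elim(2)]
    have le: "AE y in N. \<bar>v \<omega> y * \<psi> y\<bar> \<le> C * \<bar>\<psi> y\<bar>"
      using elim(1) by eventually_elim (auto simp: abs_mult intro: mult_right_mono)
    have i: "integrable N (\<lambda>y. v \<omega> y * \<psi> y)"
    proof (rule Bochner_Integration.integrable_bound)
      show "integrable N (\<lambda>y. C * \<bar>\<psi> y\<bar>)" using \<psi> by auto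
      show "AE y in N. norm (v \<omega> y * \<psi> y) \<le> norm (C * \<bar>\<psi> y\<bar>)"
        using le by eventually_elim (auto intro: order_trans[OF _ abs_ge_self])
    qed measurable
    have "(LINT y|N. \<bar>v \<omega> y * \<psi> y\<bar>) \<le> (LINT y|N. C * \<bar>\<psi> y\<bar>)"
      by (rule integral_mono_AE) (use i \<psi> le in auto)
    with i show ?case by simp
  qed
  then show "AE \<omega> in M. integrable N (\<lambda>y. v \<omega> y * \<psi> y) \<and> \<bar>LINT y|N. v \<omega> y * \<psi> y\<bar> \<le> C * (LINT y|N. \<bar>\<psi> y\<bar>)"
    by eventually_elim (auto intro: order_trans[OF integral_abs_bound])
  have int: "integrable (M \<Otimes>\<^sub>M N) (\<lambda>(\<omega>, y). F \<omega> * (v \<omega> y * \<psi> y))"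
  proof (rule Fubini_integrable)
    show "(\<lambda>(\<omega>, y). F \<omega> * (v \<omega> y * \<psi> y)) \<in> borel_measurable (M \<Otimes>\<^sub>M N)" by measurable
    show "AE \<omega> in M. integrable N (\<lambda>y. (\<lambda>(\<omega>, y). F \<omega> * (v \<omega> y * \<psi> y)) (\<omega>, y))"
      using A by eventually_elim auto
    show "integrable M (\<lambda>\<omega>. LINT y|N. norm ((\<lambda>(\<omega>, y). F \<omega> * (v \<omega> y * \<psi> y)) (\<omega>, y)))"
    proof (rule Bochner_Integration.integrable_bound)
      show "integrable M (\<lambda>\<omega>. C * (LINT y|N. \<bar>\<psi> y\<bar>) * \<bar>F \<omega>\<bar>)" using F by auto
      show "(\<lambda>\<omega>. LINT y|N. norm ((\<lambda>(\<omega>, y). F \<omega> * (v \<omega> y * \<psi> y)) (\<omega>, y))) \<in> borel_measurable M"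
        by measurable
      show "AE \<omega> in M. norm (LINT y|N. norm ((\<lambda>(\<omega>, y). F \<omega> * (v \<omega> y * \<psi> y)) (\<omega>, y))) \<le> norm (C * (LINT y|N. \<bar>\<psi> y\<bar>) * \<bar>F \<omega>\<bar>)"
        using A
      proof eventually_elim
        case (elim \<omega>)
        have eq: "(LINT y|N. norm ((\<lambda>(\<omega>, y). F \<omega> * (v \<omega> y * \<psi> y)) (\<omega>, y))) = \<bar>F \<omega>\<bar> * (LINT y|N. \<bar>v \<omega> y * \<psi> y\<bar>)"
          by (simp add: abs_mult[of "F \<omega>"])
        define P where "P = C * (LINT y|N. \<bar>\<psi> y\<bar>)"
        define Q where "Q = (LINT y|N. \<bar>v \<omega> y * \<psi> y\<bar>)"
        have "0 \<le> Q" "Q \<le> P" using elim unfolding P_def Q_def by auto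
        then have "\<bar>F \<omega>\<bar> * Q \<le> \<bar>F \<omega>\<bar> * P" "0 \<le> \<bar>F \<omega>\<bar> * Q" by (auto intro: mult_left_mono)
        then have "norm (\<bar>F \<omega>\<bar> * Q) \<le> norm (P * \<bar>F \<omega>\<bar>)" by (simp only: mult.commute real_norm_def)
        then show ?case unfolding eq P_def Q_def .
      qed
    qed
  qed
  have i1: "integrable N (\<lambda>y. LINT \<omega>|M. F \<omega> * (v \<omega> y * \<psi> y))" by (rule integrable_snd[OF int])
  have i2: "integrable M (\<lambda>\<omega>. LINT y|N. F \<omega> * (v \<omega> y * \<psi> y))" by (rule integrable_fst[OF int])
  have e1: "(LINT \<omega>|M. F \<omega> * (v \<omega> y * \<psi> y)) = (LINT \<omega>|M. v \<omega> y * F \<omega>) * \<psi> y" for y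
  proof -
    have "(LINT \<omega>|M. F \<omega> * (v \<omega> y * \<psi> y)) = (LINT \<omega>|M. (v \<omega> y * F \<omega>) * \<psi> y)" by (simp only: mult_ac)
    then show ?thesis by simp
  qed
  show "integrable N (\<lambda>y. (LINT \<omega>|M. v \<omega> y * F \<omega>) * \<psi> y)" using i1 unfolding e1 .
  show "integrable M (\<lambda>\<omega>. F \<omega> * (LINT y|N. v \<omega> y * \<psi> y))" using i2 by simp
  show "(LINT \<omega>|M. F \<omega> * (LINT y|N. v \<omega> y * \<psi> y)) = (LINT y|N. (LINT \<omega>|M. v \<omega> y * F \<omega>) * \<psi> y)"
    using Fubini_integral[OF int] unfolding e1 by simp
qed

end

text \<open>
The preimages differ only inside a null set.
\<close>

lemma (in complete_measure) measurable_if_AE_eq: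
  assumes g: "g \<in> borel_measurable M" and eq: "AE \<omega> in M. f \<omega> = g \<omega>"
  shows "f \<in> borel_measurable M"
proof (rule measurableI)
  fix A :: "'b set" assume A: "A \<in> sets borel"
  from eq obtain N where N: "{\<omega>\<in>space M. f \<omega> \<noteq> g \<omega>} \<subseteq> N" "N \<in> null_sets M"
    by (auto elim!: AE_E simp: null_sets_def)
  have split: "f -` A \<inter> space M = (g -` A \<inter> space M - N) \<union> (f -` A \<inter> space M \<inter> N)" using N(1) by auto
  have "f -` A \<inter> space M \<inter> N \<in> null_sets M" by (rule complete2[OF _ N(2)]) auto
  moreover have "g -` A \<inter> space M \<in> sets M" using g A by (rule measurable_sets)
  ultimately have "(g -` A \<inter> space M - N) \<union> (f -` A \<inter> space M \<inter> N) \<in> sets M"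
    by (intro sets.Un sets.Diff null_setsD2[OF N(2)] null_setsD2[of "f -` A \<inter> space M \<inter> N"])
  then show "f -` A \<inter> space M \<in> sets M" by (simp only: split[symmetric])
qed simp

lemma set_integral_singleton: "(LINT s:{a..a}|lborel. f s :: real) = 0" for a :: real
proof -
  have "AE s in lborel. s \<noteq> a" by (rule AE_lborel_singleton)
  then have "AE s in lborel. indicator {a..a} s *\<^sub>R f s = 0" by eventually_elim auto
  then show ?thesis unfolding set_lebesgue_integral_def by (rule integral_eq_zero_AE)
qed

lemma sigma_finite_time_space: "sigma_finite_measure (time T \<Otimes>\<^sub>M (lborel :: (real^'n) measure))"
proof -
  interpret t: finite_measure "time T" by (rule finite_measure_time)
  interpret pair_sigma_finite "time T" "lborel :: (real^'n) measure" ..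
  show ?thesis by (rule sigma_finite_pair_measure[OF t.sigma_finite_measure_axioms lborel.sigma_finite_measure_axioms])
qed

text \<open>
A set of full measure is dense. This gives access to exceptional times by continuity.
\<close>

lemma AE_time_approx:
  assumes "0 < T" and P: "AE s in time T. P s" and s: "s \<in> {0..T}"
  obtains x where "\<And>n. x n \<in> {0..T}" "\<And>n. P (x n)" "x \<longlonglongrightarrow> s"
proof -
  have AE: "AE r in lborel. r \<in> {0..T} \<longrightarrow> P r"
    using P unfolding time_def by (subst (asm) AE_restrict_space_iff) auto
  have "\<exists>r. r \<in> {0..T} \<and> P r \<and> \<bar>r - s\<bar> < 1 / real (Suc n)" for n
  proof (rule ccontr)
    assume neg: "\<not> ?thesis"
    define d where "d = 1 / real (Suc n)"
    have d: "0 < d" by (simp add: d_def)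
    \<comment> \<open>An interval of positive length, whatever the position of \<open>s\<close> in \<open>[0, T]\<close>.\<close>
    define a b where "a = max 0 (s - d)" "b = min T (s + d)"
    have ab: "a < b" using d s \<open>0 < T\<close> by (auto simp: a_b_def)
    have "AE r in lborel. r \<notin> {a<..<b}"
      using AE
    proof eventually_elim
      case (elim r)
      show ?case
      proof
        assume r: "r \<in> {a<..<b}"
        then have "r \<in> {0..T}" "\<bar>r - s\<bar> < d" by (auto simp: a_b_def)
        with elim neg show False unfolding d_def by blast
      qed
    qed
    then have "emeasure lborel {a<..<b} = 0"
      by (subst (asm) AE_iff_null_sets[symmetric]) auto
    then show False using ab by simp
  qed
  then obtain x where x: "\<And>n. x n \<in> {0..T}" "\<And>n. P (x n)" "\<And>n. \<bar>x n - s\<bar> < 1 / real (Suc n)" by metis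
  have "(\<lambda>n. dist (x n) s) \<longlonglongrightarrow> 0"
  proof (rule tendsto_sandwich[OF _ _ tendsto_const LIMSEQ_inverse_real_of_nat])
    have "dist (x n) s \<le> inverse (real (Suc n))" for n
      using less_imp_le[OF x(3)[of n]] by (simp only: dist_real_def inverse_eq_divide)
    then show "eventually (\<lambda>n. dist (x n) s \<le> inverse (real (Suc n))) sequentially"
      by (intro always_eventually allI)
  qed simp
  then have "x \<longlonglongrightarrow> s" by (simp add: tendsto_dist_iff[symmetric])
  with x(1,2) that show thesis by blast
qed

text \<open>
The joint measurability and the almost everywhere bound of the solution, isolated from the equation.
\<close>

locale bounded_field = brownian_space M B T
  for M :: "'w measure" and B :: "real \<Rightarrow> 'w \<Rightarrow> real^'n" and T :: real +
  fixes u :: "real \<Rightarrow> real^'n \<Rightarrow> 'w \<Rightarrow> real" and C :: real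
  assumes T_pos: "0 < T" and C_nonneg: "0 \<le> C"
    and u_measurable: "(\<lambda>(\<omega>, t, x). u t x \<omega>) \<in> borel_measurable (M \<Otimes>\<^sub>M (time T \<Otimes>\<^sub>M lborel))"
    and u_bounded: "AE p in M \<Otimes>\<^sub>M (time T \<Otimes>\<^sub>M lborel). \<bar>case p of (\<omega>, t, x) \<Rightarrow> u t x \<omega>\<bar> \<le> C"
begin

abbreviation time_space :: "(real \<times> (real^'n)) measure" where
  "time_space \<equiv> time T \<Otimes>\<^sub>M lborel"

definition field :: "'w \<Rightarrow> real \<times> (real^'n) \<Rightarrow> real" where
  "field \<omega> y = u (fst y) (snd y) \<omega>"

definition observable :: "(real^'n \<Rightarrow> real) \<Rightarrow> real \<Rightarrow> 'w \<Rightarrow> real" where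
  "observable \<eta> s \<omega> = (LINT x|lborel. u s x \<omega> * \<eta> x)"

text \<open>
For the equation, \<open>\<psi>\<close> is \<open>b \<bullet> \<nabla>\<phi> + \<phi> div b\<close>. The iterated integral is the one that occurs in the weak form; it
is compared with an integral over the product space in \<open>drift_eq\<close>.
\<close>

definition drift :: "(real \<times> (real^'n) \<Rightarrow> real) \<Rightarrow> real \<Rightarrow> 'w \<Rightarrow> real" where
  "drift \<psi> t \<omega> = (LINT s:{0..t}|lborel. LINT x|lborel. u s x \<omega> * \<psi> (s, x))"

lemma field_measurable: "(\<lambda>(\<omega>, y). field \<omega> y) \<in> borel_measurable (M \<Otimes>\<^sub>M time_space)"
  using u_measurable by (simp add: field_def case_prod_beta')

lemma u_at_measurable:
  assumes "s \<in> {0..T}"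
  shows "(\<lambda>(\<omega>, x). u s x \<omega>) \<in> borel_measurable (M \<Otimes>\<^sub>M lborel)"
proof -
  have "(\<lambda>(\<omega>, x). (\<omega>, s, x)) \<in> (M \<Otimes>\<^sub>M lborel) \<rightarrow>\<^sub>M (M \<Otimes>\<^sub>M time_space)"
    using assms by (intro measurable_split_conv[THEN iffD2] measurable_Pair) (auto simp: case_prod_beta')
  from measurable_compose[OF this u_measurable] show ?thesis by (simp add: case_prod_beta')
qed

lemma field_bounded: "AE \<omega> in M. AE y in time_space. \<bar>field \<omega> y\<bar> \<le> C"
proof -
  interpret N: sigma_finite_measure time_space by (rule sigma_finite_time_space)
  interpret P: pair_sigma_finite M time_space ..
  show ?thesis using P.AE_pair[OF u_bounded] by (simp add: field_def case_prod_beta')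
qed

text \<open>
The bound on \<open>u\<close> is known almost everywhere on the product of all three spaces. Exchanging null sets gives a
bound for almost every fixed time.
\<close>

lemma good_times: "AE s in time T. AE \<omega> in M. AE x in lborel. \<bar>u s x \<omega>\<bar> \<le> C"
proof -
  interpret N: sigma_finite_measure time_space by (rule sigma_finite_time_space)
  interpret P: pair_sigma_finite M time_space ..
  interpret t: finite_measure "time T" by (rule finite_measure_time)
  interpret Q: pair_sigma_finite "time T" "lborel :: (real^'n) measure" ..
  interpret R: pair_sigma_finite M "lborel :: (real^'n) measure" ..
  have "{p \<in> space (M \<Otimes>\<^sub>M time_space). \<bar>field (fst p) (snd p)\<bar> \<le> C} \<in> sets (M \<Otimes>\<^sub>M time_space)"
    using field_measurable by (intro borel_measurable_le) (auto simp: case_prod_beta')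
  from P.AE_commute[OF this] field_bounded
  have "AE y in time_space. AE \<omega> in M. \<bar>field \<omega> y\<bar> \<le> C" by simp
  from Q.AE_pair[OF this] have "AE s in time T. AE x in lborel. AE \<omega> in M. \<bar>u s x \<omega>\<bar> \<le> C" by (simp add: field_def)
  then show ?thesis
    using AE_space
  proof eventually_elim
    case (elim s)
    have "{p \<in> space (M \<Otimes>\<^sub>M (lborel :: (real^'n) measure)). \<bar>u s (snd p) (fst p)\<bar> \<le> C} \<in> sets (M \<Otimes>\<^sub>M lborel)"
      using u_at_measurable[of s] elim(2) by (intro borel_measurable_le) (auto simp: case_prod_beta')
    from R.AE_commute[OF this] elim(1) show ?case by simp
  qed
qed

lemma observable_measurable:
  assumes "s \<in> {0..T}" "\<eta> \<in> borel_measurable borel"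
  shows "observable \<eta> s \<in> borel_measurable M"
proof -
  have "(\<lambda>p. u s (snd p) (fst p)) \<in> borel_measurable (M \<Otimes>\<^sub>M lborel)"
    using u_at_measurable[OF assms(1)] by (simp add: case_prod_beta')
  moreover have "(\<lambda>p. \<eta> (snd p)) \<in> borel_measurable (M \<Otimes>\<^sub>M lborel)" using assms(2) by measurable
  ultimately have "(\<lambda>(\<omega>, x). u s x \<omega> * \<eta> x) \<in> borel_measurable (M \<Otimes>\<^sub>M lborel)"
    by (simp add: case_prod_beta')
  from lborel.borel_measurable_lebesgue_integral[OF this] show ?thesis unfolding observable_def[abs_def] .
qed

lemma observable_at_good_time:
  assumes s: "s \<in> {0..T}" and good: "AE \<omega> in M. AE x in lborel. \<bar>u s x \<omega>\<bar> \<le> C"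
    and F: "integrable M F" and \<eta>: "integrable lborel \<eta>"
  shows "AE \<omega> in M. \<bar>observable \<eta> s \<omega>\<bar> \<le> C * (LINT x|lborel. \<bar>\<eta> x\<bar>)"
    "expectation (\<lambda>\<omega>. F \<omega> * observable \<eta> s \<omega>) = (LINT x|lborel. (LINT \<omega>|M. u s x \<omega> * F \<omega>) * \<eta> x)"
proof -
  note fub = weighted_fubini[OF lborel.sigma_finite_measure_axioms u_at_measurable[OF s] good F \<eta>]
  show "AE \<omega> in M. \<bar>observable \<eta> s \<omega>\<bar> \<le> C * (LINT x|lborel. \<bar>\<eta> x\<bar>)"
    using fub(1) unfolding observable_def by eventually_elim auto
  show "expectation (\<lambda>\<omega>. F \<omega> * observable \<eta> s \<omega>) = (LINT x|lborel. (LINT \<omega>|M. u s x \<omega> * F \<omega>) * \<eta> x)"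
    using fub(4) unfolding observable_def .
qed

lemma integrable_indicator_time:
  fixes \<psi> :: "real \<times> (real^'n) \<Rightarrow> real"
  assumes \<psi>: "integrable time_space \<psi>" and A: "A \<in> sets borel"
  shows "integrable time_space (\<lambda>y. indicator A (fst y) * \<psi> y)"
proof (rule Bochner_Integration.integrable_bound[OF \<psi>])
  have "(indicator A :: real \<Rightarrow> real) \<in> borel_measurable (time T)" using A by (intro borel_measurable_time) auto
  then have "(\<lambda>y. indicator A (fst y) :: real) \<in> borel_measurable time_space" by (rule measurable_compose[OF measurable_fst])
  then show "(\<lambda>y. indicator A (fst y) * \<psi> y) \<in> borel_measurable time_space" using \<psi> by auto
qed (auto split: split_indicator)

lemma iterated_integral:
  fixes g :: "real \<times> (real^'n) \<Rightarrow> real"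
  assumes t: "0 \<le> t" "t \<le> T" and g: "integrable time_space (\<lambda>y. indicator {0..t} (fst y) * g y)"
  shows "(LINT s:{0..t}|lborel. LINT x|lborel. g (s, x)) = (LINT y|time_space. indicator {0..t} (fst y) * g y)"
proof -
  interpret tm: finite_measure "time T" by (rule finite_measure_time)
  interpret Q: pair_sigma_finite "time T" "lborel :: (real^'n) measure" ..
  have "(LINT s:{0..t}|lborel. LINT x|lborel. g (s, x)) = (LINT s|time T. LINT x|lborel. indicator {0..t} s * g (s, x))"
    by (subst set_integral_time[of _ T]) (use t in auto)
  also have "\<dots> = (LINT y|time_space. indicator {0..t} (fst y) * g y)"
    using Q.integral_fst'[OF g] by simp
  finally show ?thesis .
qed

lemma drift_eq:
  assumes \<psi>: "integrable time_space \<psi>" and t: "0 \<le> t" "t \<le> T"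
  shows "AE \<omega> in M. drift \<psi> t \<omega> = (LINT y|time_space. field \<omega> y * (indicator {0..t} (fst y) * \<psi> y)) \<and>
     integrable time_space (\<lambda>y. field \<omega> y * (indicator {0..t} (fst y) * \<psi> y))"
proof -
  have i: "integrable time_space (\<lambda>y. indicator {0..t} (fst y) * \<psi> y)"
    by (rule integrable_indicator_time[OF \<psi>]) auto
  have F1: "integrable M (\<lambda>_. 1 :: real)" by simp
  from weighted_fubini(1)[OF sigma_finite_time_space field_measurable field_bounded F1 i] show ?thesis
  proof eventually_elim
    case (elim \<omega>)
    then have i2: "integrable time_space (\<lambda>y. indicator {0..t} (fst y) * (field \<omega> y * \<psi> y))" by (simp only: mult.left_commute)
    have "drift \<psi> t \<omega> = (LINT y|time_space. indicator {0..t} (fst y) * (field \<omega> y * \<psi> y))"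
      using iterated_integral[OF t i2] unfolding drift_def field_def by simp
    with elim show ?case by (simp only: mult.left_commute)
  qed
qed

text \<open>
Since \<open>u\<close> is bounded, the variation of the drift is dominated by a deterministic nondecreasing function.
\<close>

lemma drift_increment:
  assumes \<psi>: "integrable time_space \<psi>" and rt: "0 \<le> r" "r \<le> t" "t \<le> T"
  defines "\<alpha> \<equiv> \<lambda>t. C * (LINT y|time_space. indicator {0..t} (fst y) * \<bar>\<psi> y\<bar>)"
  shows "AE \<omega> in M. \<bar>drift \<psi> t \<omega> - drift \<psi> r \<omega>\<bar> \<le> \<alpha> t - \<alpha> r"
proof -
  have i: "integrable time_space (\<lambda>y. indicator {r<..t} (fst y) * \<psi> y)"
    by (rule integrable_indicator_time[OF \<psi>]) auto
  have split: "indicator {r<..t} (s::real) = (indicator {0..t} s - indicator {0..r} s :: real)" for s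
    using rt by (auto split: split_indicator)
  have F1: "integrable M (\<lambda>_. 1 :: real)" by simp
  have t: "0 \<le> t" "r \<le> T" using rt by auto
  have ia: "integrable time_space (\<lambda>y. indicator {0..t} (fst y) * \<bar>\<psi> y\<bar>)" for t
    by (rule integrable_indicator_time) (use \<psi> in auto)
  have \<alpha>: "C * (LINT y|time_space. \<bar>indicator {r<..t} (fst y) * \<psi> y\<bar>) = \<alpha> t - \<alpha> r"
  proof -
    have "\<bar>indicator {r<..t} (fst y) * \<psi> y\<bar> = indicator {0..t} (fst y) * \<bar>\<psi> y\<bar> - indicator {0..r} (fst y) * \<bar>\<psi> y\<bar>" for y
      unfolding left_diff_distrib[symmetric] split[symmetric] by (simp add: abs_mult)
    then show ?thesis unfolding \<alpha>_def using ia by (simp add: right_diff_distrib)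
  qed
  show ?thesis
    using weighted_fubini(1)[OF sigma_finite_time_space field_measurable field_bounded F1 i]
      drift_eq[OF \<psi> t(1) rt(3)] drift_eq[OF \<psi> rt(1) t(2)]
  proof eventually_elim
    case (elim \<omega>)
    have "drift \<psi> t \<omega> - drift \<psi> r \<omega> =
      (LINT y|time_space. field \<omega> y * (indicator {0..t} (fst y) * \<psi> y) - field \<omega> y * (indicator {0..r} (fst y) * \<psi> y))"
      using elim by simp
    also have "\<dots> = (LINT y|time_space. field \<omega> y * (indicator {r<..t} (fst y) * \<psi> y))"
      unfolding split by (simp add: algebra_simps)
    finally show ?case using elim(1) unfolding \<alpha> by simp
  qed
qed

lemma drift_zero: "drift \<psi> 0 \<omega> = 0"
  unfolding drift_def using set_integral_singleton[of 0] by simp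

lemma drift_expectation:
  assumes \<psi>: "integrable time_space \<psi>" and t: "0 \<le> t" "t \<le> T" and F: "integrable M F"
  shows "integrable M (\<lambda>\<omega>. F \<omega> * drift \<psi> t \<omega>)"
    "expectation (\<lambda>\<omega>. F \<omega> * drift \<psi> t \<omega>) = (LINT s:{0..t}|lborel. LINT x|lborel. (LINT \<omega>|M. u s x \<omega> * F \<omega>) * \<psi> (s, x))"
    (is "_ = ?R")
proof -
  have i: "integrable time_space (\<lambda>y. indicator {0..t} (fst y) * \<psi> y)"
    by (rule integrable_indicator_time[OF \<psi>]) auto
  note fub = weighted_fubini[OF sigma_finite_time_space field_measurable field_bounded F i]
  have Fm: "F \<in> borel_measurable M" using F by auto
  have "integrable time_space (\<lambda>y. indicator {0..t} (fst y) * ((LINT \<omega>|M. field \<omega> y * F \<omega>) * \<psi> y))"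
    using fub(2) by (simp only: mult.left_commute)
  from iterated_integral[OF t this]
  have R: "?R = (LINT y|time_space. (LINT \<omega>|M. field \<omega> y * F \<omega>) * (indicator {0..t} (fst y) * \<psi> y))"
    unfolding field_def by (simp add: mult.left_commute)
  have m: "(\<lambda>\<omega>. F \<omega> * (LINT y|time_space. field \<omega> y * (indicator {0..t} (fst y) * \<psi> y))) \<in> borel_measurable M"
    using fub(3) by auto
  have ae: "AE \<omega> in M. F \<omega> * drift \<psi> t \<omega> = F \<omega> * (LINT y|time_space. field \<omega> y * (indicator {0..t} (fst y) * \<psi> y))"
    using drift_eq[OF \<psi> t] by eventually_elim simp
  have m': "(\<lambda>\<omega>. F \<omega> * drift \<psi> t \<omega>) \<in> borel_measurable M" by (rule measurable_if_AE_eq[OF m ae])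
  show "integrable M (\<lambda>\<omega>. F \<omega> * drift \<psi> t \<omega>)"
    using fub(3) integrable_cong_AE[OF m' m ae] by simp
  have "expectation (\<lambda>\<omega>. F \<omega> * drift \<psi> t \<omega>) = expectation (\<lambda>\<omega>. F \<omega> * (LINT y|time_space. field \<omega> y * (indicator {0..t} (fst y) * \<psi> y)))"
    by (rule Bochner_Integration.integral_cong_AE[OF m' m ae])
  also have "\<dots> = ?R" unfolding R by (rule fub(4))
  finally show "expectation (\<lambda>\<omega>. F \<omega> * drift \<psi> t \<omega>) = ?R" .
qed

lemma drift_add:
  assumes "integrable time_space \<psi>" "integrable time_space \<psi>'" and t: "0 \<le> t" "t \<le> T"
  shows "AE \<omega> in M. drift (\<lambda>y. \<psi> y + \<psi>' y) t \<omega> = drift \<psi> t \<omega> + drift \<psi>' t \<omega>"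
  using drift_eq[OF Bochner_Integration.integrable_add[OF assms(1,2)] t] drift_eq[OF assms(1) t] drift_eq[OF assms(2) t]
proof eventually_elim
  case (elim \<omega>)
  then show ?case by (simp add: distrib_left)
qed

text \<open>
At good times the average is bounded by \<open>K\<close>, and by continuity so is the modification \<open>Y\<close> at every time.
Truncating \<open>Y\<close> at \<open>K\<close> therefore changes it only on null sets, and does not increase squared increments.
\<close>

lemma tame_modification:
  assumes Y: "continuous_semimartingale M past T Y"
    and mod: "\<And>t. t \<in> {0..T} \<Longrightarrow> AE \<omega> in M. Y t \<omega> = observable \<eta> t \<omega>"
    and \<eta>: "integrable lborel \<eta>"
  shows "\<exists>Z. tame_process (C * (LINT x|lborel. \<bar>\<eta> x\<bar>)) Z \<and> (\<forall>t\<in>{0..T}. AE \<omega> in M. Z t \<omega> = observable \<eta> t \<omega>)"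
proof -
  define K where "K = C * (LINT x|lborel. \<bar>\<eta> x\<bar>)"
  have K: "0 \<le> K" unfolding K_def using C_nonneg by auto
  define Z where "Z t \<omega> = max (- K) (min K (Y t \<omega>))" for t \<omega>
  have Yad: "adapted past T Y" and Yc: "continuous_paths M T Y"
    using Y unfolding continuous_semimartingale_def by auto
  have F1: "integrable M (\<lambda>_. 1 :: real)" by simp
  have Yb: "AE \<omega> in M. \<bar>Y s \<omega>\<bar> \<le> K" if s: "s \<in> {0..T}" for s
  proof -
    from AE_time_approx[OF T_pos good_times s] obtain x where x: "\<And>n. x n \<in> {0..T}"
      "\<And>n. AE \<omega> in M. AE y in lborel. \<bar>u (x n) y \<omega>\<bar> \<le> C" "x \<longlonglongrightarrow> s" by blast
    have "AE \<omega> in M. \<bar>Y (x n) \<omega>\<bar> \<le> K" for n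
      using observable_at_good_time(1)[OF x(1,2) F1 \<eta>, of n] mod[OF x(1), of n]
      unfolding K_def by eventually_elim simp
    then have "AE \<omega> in M. \<forall>n. \<bar>Y (x n) \<omega>\<bar> \<le> K" by (simp add: AE_all_countable)
    with Yc show ?thesis
      unfolding continuous_paths_def
    proof eventually_elim
      case (elim \<omega>)
      then have "(\<lambda>n. Y (x n) \<omega>) \<longlonglongrightarrow> Y s \<omega>"
        using s x(1,3) unfolding continuous_on_sequentially o_def by blast
      then have "(\<lambda>n. \<bar>Y (x n) \<omega>\<bar>) \<longlonglongrightarrow> \<bar>Y s \<omega>\<bar>" by (rule tendsto_rabs)
      then show ?case using elim by (intro LIMSEQ_le_const2) auto
    qed
  qed
  have ZX: "AE \<omega> in M. Z t \<omega> = observable \<eta> t \<omega>" if "t \<in> {0..T}" for t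
    using Yb[OF that] mod[OF that] by eventually_elim (auto simp: Z_def)
  have "tame_process K Z"
    unfolding tame_process_def
  proof (intro conjI ballI allI)
    show "adapted past T Z"
      using Yad unfolding adapted_def Z_def by (auto intro!: borel_measurable_max borel_measurable_min)
    show "\<bar>Z s \<omega>\<bar> \<le> K" for s \<omega> unfolding Z_def using K by auto
    show "continuous_paths M T Z"
      using Yc unfolding continuous_paths_def Z_def by eventually_elim (auto intro!: continuous_intros)
    fix t assume t: "t \<in> {0..T}"
    have le: "qvar t n Z \<omega> \<le> qvar t n Y \<omega>" for n \<omega>
      unfolding qvar_def
    proof (rule sum_mono)
      fix k
      have "\<bar>max (- K) (min K a) - max (- K) (min K b)\<bar> \<le> \<bar>a - b\<bar>" for a b using K by auto
      then have "\<bar>Z (grid t n (Suc k)) \<omega> - Z (grid t n k) \<omega>\<bar> \<le> \<bar>Y (grid t n (Suc k)) \<omega> - Y (grid t n k) \<omega>\<bar>" unfolding Z_def .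
      then show "(Z (grid t n (Suc k)) \<omega> - Z (grid t n k) \<omega>)\<^sup>2 \<le> (Y (grid t n (Suc k)) \<omega> - Y (grid t n k) \<omega>)\<^sup>2"
        by (simp add: abs_le_square_iff)
    qed
    show "tight_family UNIV (\<lambda>n. qvar t n Z)"
    proof (rule tight_family_mono[OF _ _ tight_qvar_semimartingale[OF Y]])
      show "qvar t n Y \<in> borel_measurable M" for n
        by (rule qvar_measurable) (use t adapted_measurable[OF Yad] in auto)
      show "AE \<omega> in M. \<bar>qvar t n Z \<omega>\<bar> \<le> \<bar>qvar t n Y \<omega>\<bar>" for n
      proof (rule AE_I2)
        fix \<omega>
        show "\<bar>qvar t n Z \<omega>\<bar> \<le> \<bar>qvar t n Y \<omega>\<bar>"
          using le[of n \<omega>] qvar_nonneg[of t n Z \<omega>] by linarith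
      qed
    qed (use t in auto)
  qed
  with ZX show ?thesis unfolding K_def by blast
qed

text \<open>
Each symmetric sum involves only finitely many times.
\<close>

lemma (in prob_space) stratonovich_integral_modification:
  assumes X: "\<And>r. r \<in> {0..s} \<Longrightarrow> AE \<omega> in M. X r \<omega> = Z r \<omega>"
    and m: "\<And>r. r \<in> {0..s} \<Longrightarrow> X r \<in> borel_measurable M" "\<And>r. r \<in> {0..s} \<Longrightarrow> Z r \<in> borel_measurable M"
      "\<And>r. r \<in> {0..s} \<Longrightarrow> Y r \<in> borel_measurable M"
    and I: "stratonovich_integral M X Y s I"
  shows "stratonovich_integral M Z Y s I"
proof -
  let ?S = "\<lambda>X n p \<omega>. (\<Sum>k<n. (X (p (Suc k)) \<omega> + X (p k) \<omega>) / 2 * (Y (p (Suc k)) \<omega> - Y (p k) \<omega>)) :: real"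
  have Im: "I \<in> borel_measurable M" using I by (rule stratonovich_integral_measurable)
  have eq: "prob {\<omega>\<in>space M. \<bar>?S Z n p \<omega> - I \<omega>\<bar> > e} = prob {\<omega>\<in>space M. \<bar>?S X n p \<omega> - I \<omega>\<bar> > e}"
    if p: "is_partition 0 s n p" for n p e
  proof -
    have pr: "p k \<in> {0..s}" if "k \<le> n" for k using partition_range[OF p that] by simp
    have Sm: "?S X n p \<in> borel_measurable M" if "\<And>r. r \<in> {0..s} \<Longrightarrow> X r \<in> borel_measurable M" for X
    proof (rule borel_measurable_sum)
      fix k assume "k \<in> {..<n}"
      then have "p k \<in> {0..s}" "p (Suc k) \<in> {0..s}" using pr by auto
      then show "(\<lambda>\<omega>. (X (p (Suc k)) \<omega> + X (p k) \<omega>) / 2 * (Y (p (Suc k)) \<omega> - Y (p k) \<omega>)) \<in> borel_measurable M"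
        using that m(3) by auto
    qed
    have "AE \<omega> in M. \<forall>k\<in>{..n}. X (p k) \<omega> = Z (p k) \<omega>"
      using X pr by (intro AE_finite_allI) auto
    then have "AE \<omega> in M. ?S X n p \<omega> = ?S Z n p \<omega>"
      by eventually_elim (intro sum.cong refl, simp)
    then have ae: "AE \<omega> in M. \<omega> \<in> {\<omega>\<in>space M. \<bar>?S Z n p \<omega> - I \<omega>\<bar> > e} \<longleftrightarrow> \<omega> \<in> {\<omega>\<in>space M. \<bar>?S X n p \<omega> - I \<omega>\<bar> > e}"
      by eventually_elim auto
    have ev: "{\<omega>\<in>space M. \<bar>?S X n p \<omega> - I \<omega>\<bar> > e} \<in> events" if "\<And>r. r \<in> {0..s} \<Longrightarrow> X r \<in> borel_measurable M" for X
      using Sm[OF that] Im by (intro borel_measurable_less borel_measurable_abs borel_measurable_diff borel_measurable_const) auto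
    show ?thesis by (rule measure_eq_AE[OF ae ev[OF m(2)] ev[OF m(1)]])
  qed
  show ?thesis
    unfolding stratonovich_integral_def
  proof (intro conjI allI impI)
    fix e :: real assume "0 < e"
    from conjunct2[OF I[unfolded stratonovich_integral_def], THEN spec, THEN mp, OF this]
    obtain d where d: "d > 0" "\<And>n p. is_partition 0 s n p \<and> (\<forall>k<n. p (Suc k) - p k < d) \<Longrightarrow>
      prob {\<omega>\<in>space M. \<bar>?S X n p \<omega> - I \<omega>\<bar> > e} < e" by blast
    then show "\<exists>d>0. \<forall>n p. is_partition 0 s n p \<and> (\<forall>k<n. p (Suc k) - p k < d) \<longrightarrow>
      prob {\<omega>\<in>space M. \<bar>?S Z n p \<omega> - I \<omega>\<bar> > e} < e"
      using eq by (intro exI[of _ d]) simp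
  qed (rule Im)
qed

text \<open>
For good times this is Fubini's theorem. The left side is continuous in time because the paths of \<open>Z\<close> are, the
right side because \<open>V\<close> is continuous in \<open>L\<^sup>2\<close>.
\<close>

lemma weighted_mean_observable:
  assumes F: "integrable M F" and \<eta>: "test_function UNIV \<eta>"
    and Z: "tame_process K Z" "\<And>t. t \<in> {0..T} \<Longrightarrow> AE \<omega> in M. Z t \<omega> = observable \<eta> t \<omega>"
    and V: "continuous_in_L2 T (\<lambda>t x. LINT \<omega>|M. u t x \<omega> * F \<omega>)" and s: "s \<in> {0..T}"
  shows "expectation (\<lambda>\<omega>. F \<omega> * Z s \<omega>) = (LINT x|lborel. (LINT \<omega>|M. u s x \<omega> * F \<omega>) * \<eta> x)"
proof -
  define V where "V t x = (LINT \<omega>|M. u t x \<omega> * F \<omega>)" for t x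
  from AE_time_approx[OF T_pos good_times s] obtain x where x: "\<And>n. x n \<in> {0..T}"
    "\<And>n. AE \<omega> in M. AE y in lborel. \<bar>u (x n) y \<omega>\<bar> \<le> C" "x \<longlonglongrightarrow> s" by blast
  note \<eta>i = test_function_integrable[OF \<eta>] and \<eta>m = test_functionD(2)[OF \<eta>]
  have eq: "expectation (\<lambda>\<omega>. F \<omega> * Z (x n) \<omega>) = (LINT y|lborel. V (x n) y * \<eta> y)" for n
  proof -
    have "expectation (\<lambda>\<omega>. F \<omega> * Z (x n) \<omega>) = expectation (\<lambda>\<omega>. F \<omega> * observable \<eta> (x n) \<omega>)"
    proof (rule Bochner_Integration.integral_cong_AE)
      show "AE \<omega> in M. F \<omega> * Z (x n) \<omega> = F \<omega> * observable \<eta> (x n) \<omega>"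
        using Z(2)[OF x(1)[of n]] by eventually_elim simp
    qed (use F x(1) tame_processD(6)[OF Z(1)] observable_measurable[OF x(1) \<eta>m] in auto)
    then show ?thesis using observable_at_good_time(2)[OF x(1,2) F \<eta>i(1)] unfolding V_def by simp
  qed
  have l1: "(\<lambda>n. expectation (\<lambda>\<omega>. F \<omega> * Z (x n) \<omega>)) \<longlonglongrightarrow> expectation (\<lambda>\<omega>. F \<omega> * Z s \<omega>)"
    using weighted_mean_continuous[OF F Z(1)] s x(1,3) unfolding continuous_on_sequentially o_def by blast
  have Vm: "V t \<in> borel_measurable lborel" "integrable lborel (\<lambda>y. (V t y)\<^sup>2)" if "t \<in> {0..T}" for t
    using V that unfolding continuous_in_L2_def square_integrable_def V_def by auto
  have Vs: "integrable lborel (\<lambda>y. (V t y - V s y)\<^sup>2)" if "t \<in> {0..T}" for t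
  proof -
    have e: "(V t y - V s y)\<^sup>2 = (V t y)\<^sup>2 + (V s y)\<^sup>2 - 2 * (V t y * V s y)" for y
      by (simp add: power2_eq_square algebra_simps)
    show ?thesis unfolding e
      using Vm[OF that] Vm[OF s] integrable_square_product[OF Vm(1)[OF that] Vm(1)[OF s] Vm(2)[OF that] Vm(2)[OF s]]
      by (intro Bochner_Integration.integrable_diff Bochner_Integration.integrable_add Bochner_Integration.integrable_mult_right) auto
  qed
  have V\<eta>: "integrable lborel (\<lambda>y. V t y * \<eta> y)" if "t \<in> {0..T}" for t
    by (rule integrable_square_product) (use Vm[OF that] \<eta>m \<eta>i in auto)
  have "(\<lambda>n. LINT y|lborel. (V (x n) y - V s y)\<^sup>2) \<longlonglongrightarrow> 0"
  proof -
    have "((\<lambda>t. LINT y|lborel. (V t y - V s y)\<^sup>2) \<longlongrightarrow> 0) (at s within {0..T})"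
      using V s unfolding continuous_in_L2_def V_def by blast
    then have "continuous (at s within {0..T}) (\<lambda>t. LINT y|lborel. (V t y - V s y)\<^sup>2)"
      by (simp add: continuous_within)
    from continuous_within_tendsto_compose'[OF this x(1,3)] show ?thesis by simp
  qed
  then have e0: "(\<lambda>n. LINT y|lborel. (V (x n) y - V s y)\<^sup>2) \<longlonglongrightarrow> 0" .
  have "(\<lambda>n. (LINT y|lborel. V (x n) y * \<eta> y) - (LINT y|lborel. V s y * \<eta> y)) \<longlonglongrightarrow> 0"
  proof (rule tendsto_0_if_young_bound[OF _ e0])
    fix n and l :: real assume l: "0 < l" "l < 1"
    have pw: "\<bar>V (x n) y * \<eta> y - V s y * \<eta> y\<bar> \<le> (V (x n) y - V s y)\<^sup>2 / l + l * (\<eta> y)\<^sup>2" for y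
    proof -
      define a b where "a = \<bar>V (x n) y - V s y\<bar>" "b = \<bar>\<eta> y\<bar>"
      have "2 * a * (l * b) \<le> a\<^sup>2 + (l * b)\<^sup>2" by (rule sum_squares_bound)
      then have "2 * (a * b) \<le> a\<^sup>2 / l + l * b\<^sup>2" using l by (simp add: field_simps power2_eq_square)
      moreover have "0 \<le> a * b" by (simp add: a_b_def)
      ultimately have "a * b \<le> a\<^sup>2 / l + l * b\<^sup>2" by linarith
      then show ?thesis unfolding a_b_def power2_abs by (simp add: abs_mult[symmetric] left_diff_distrib)
    qed
    have "\<bar>(LINT y|lborel. V (x n) y * \<eta> y) - (LINT y|lborel. V s y * \<eta> y)\<bar> = \<bar>LINT y|lborel. V (x n) y * \<eta> y - V s y * \<eta> y\<bar>"
      using V\<eta>[OF x(1)] V\<eta>[OF s] by simp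
    also have "\<dots> \<le> (LINT y|lborel. \<bar>V (x n) y * \<eta> y - V s y * \<eta> y\<bar>)" by (rule integral_abs_bound)
    also have "\<dots> \<le> (LINT y|lborel. (V (x n) y - V s y)\<^sup>2 / l + l * (\<eta> y)\<^sup>2)"
      using pw V\<eta>[OF x(1)] V\<eta>[OF s] Vs[OF x(1)] \<eta>i by (intro integral_mono) auto
    also have "\<dots> = (LINT y|lborel. (V (x n) y - V s y)\<^sup>2) / l + l * (LINT y|lborel. (\<eta> y)\<^sup>2)"
      using Vs[OF x(1)] \<eta>i by simp
    finally show "\<bar>(LINT y|lborel. V (x n) y * \<eta> y) - (LINT y|lborel. V s y * \<eta> y)\<bar> \<le>
      (LINT y|lborel. (V (x n) y - V s y)\<^sup>2) / l + l * (LINT y|lborel. (\<eta> y)\<^sup>2)" .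
  qed simp
  then have "(\<lambda>n. LINT y|lborel. V (x n) y * \<eta> y) \<longlonglongrightarrow> (LINT y|lborel. V s y * \<eta> y)" by (simp add: LIM_zero_iff)
  with l1 show ?thesis unfolding eq V_def by (rule LIMSEQ_unique)
qed

end

section \<open>The averaged equation\<close>

lemma integrable_space_function:
  fixes g :: "real^'n \<Rightarrow> real"
  assumes g: "integrable lborel g"
  shows "integrable (time T \<Otimes>\<^sub>M lborel) (\<lambda>y. g (snd y))"
proof -
  interpret tm: finite_measure "time T" by (rule finite_measure_time)
  interpret Q: pair_sigma_finite "time T" "lborel :: (real^'n) measure" ..
  show ?thesis
    by (rule Q.Fubini_integrable) (use g in auto)
qed

text \<open>
Local square integrability of \<open>b\<close> suffices because the gradient has compact support:
\<open>|b \<bullet> \<nabla>\<phi>| \<le> |b|\<^sup>2 + |\<nabla>\<phi>|\<^sup>2\<close> on the support.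
\<close>

lemma integrable_transport_term:
  fixes b :: "real \<Rightarrow> real^'n \<Rightarrow> real^'n" and \<phi> :: "real^'n \<Rightarrow> real"
  assumes b: "L2_loc T b" and \<phi>: "test_function UNIV \<phi>"
  shows "integrable (time T \<Otimes>\<^sub>M lborel) (\<lambda>y. b (fst y) (snd y) \<bullet> gradient \<phi> (snd y))"
proof -
  let ?N = "time T \<Otimes>\<^sub>M (lborel :: (real^'n) measure)"
  define S where "S = closure {x. \<phi> x \<noteq> 0}"
  have S: "compact S" unfolding S_def by (rule test_functionD(3)[OF \<phi>])
  note p = test_function_partial[OF \<phi>]
  have bm: "(\<lambda>y. b (fst y) (snd y)) \<in> borel_measurable ?N"
    using b unfolding L2_loc_def by (simp add: case_prod_beta')
  have eq: "b (fst y) (snd y) \<bullet> gradient \<phi> (snd y) = (\<Sum>i\<in>UNIV. b (fst y) (snd y) $ i * partial i \<phi> (snd y))" for y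
    by (simp add: inner_vec_def gradient_def)
  have "compact ({0..T} \<times> S)" by (intro compact_Times S) simp
  with b have "set_integrable ?N ({0..T} \<times> S) (\<lambda>(t, x). (norm (b t x))\<^sup>2)" unfolding L2_loc_def by blast
  then have i1: "integrable ?N (\<lambda>y. indicator ({0..T} \<times> S) y * (norm (b (fst y) (snd y)))\<^sup>2)"
    unfolding set_integrable_def by (simp add: case_prod_beta')
  have i2: "integrable ?N (\<lambda>y. \<Sum>i\<in>UNIV. (partial i \<phi> (snd y))\<^sup>2)"
    using integrable_space_function[OF test_function_integrable(2)[OF p]] by (intro Bochner_Integration.integrable_sum)
  show ?thesis
  proof (rule Bochner_Integration.integrable_bound[OF Bochner_Integration.integrable_add[OF i1 i2]])
    show "(\<lambda>y. b (fst y) (snd y) \<bullet> gradient \<phi> (snd y)) \<in> borel_measurable ?N"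
      unfolding eq using measurable_component[OF bm] test_functionD(2)[OF p]
      by (intro borel_measurable_sum borel_measurable_times) auto
    have "\<bar>b (fst y) (snd y) \<bullet> gradient \<phi> (snd y)\<bar> \<le>
      indicator ({0..T} \<times> S) y * (norm (b (fst y) (snd y)))\<^sup>2 + (\<Sum>i\<in>UNIV. (partial i \<phi> (snd y))\<^sup>2)" if y: "fst y \<in> {0..T}" for y
    proof (cases "snd y \<in> S")
      case True
      let ?b = "b (fst y) (snd y)"
      have "\<bar>?b \<bullet> gradient \<phi> (snd y)\<bar> \<le> (\<Sum>i\<in>UNIV. (?b $ i)\<^sup>2 + (partial i \<phi> (snd y))\<^sup>2)"
        unfolding eq
      proof (rule order_trans[OF sum_abs sum_mono])
        fix i
        have "2 * \<bar>?b $ i\<bar> * \<bar>partial i \<phi> (snd y)\<bar> \<le> \<bar>?b $ i\<bar>\<^sup>2 + \<bar>partial i \<phi> (snd y)\<bar>\<^sup>2" by (rule sum_squares_bound)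
        moreover have "0 \<le> \<bar>?b $ i\<bar> * \<bar>partial i \<phi> (snd y)\<bar>" by simp
        ultimately show "\<bar>?b $ i * partial i \<phi> (snd y)\<bar> \<le> (?b $ i)\<^sup>2 + (partial i \<phi> (snd y))\<^sup>2"
          unfolding abs_mult power2_abs by linarith
      qed
      also have "\<dots> = (norm ?b)\<^sup>2 + (\<Sum>i\<in>UNIV. (partial i \<phi> (snd y))\<^sup>2)"
        unfolding power2_norm_eq_inner inner_vec_def by (simp add: sum.distrib power2_eq_square)
      also have "(norm ?b)\<^sup>2 = indicator ({0..T} \<times> S) y * (norm ?b)\<^sup>2"
        using True y by (simp add: indicator_def mem_Times_iff)
      finally show ?thesis .
    next
      case False
      then have "partial i \<phi> (snd y) = 0" for i unfolding S_def by (rule partial_eq_0_off_support)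
      then show ?thesis unfolding eq by simp
    qed
    then show "AE y in ?N. norm (b (fst y) (snd y) \<bullet> gradient \<phi> (snd y)) \<le>
      norm (indicator ({0..T} \<times> S) y * (norm (b (fst y) (snd y)))\<^sup>2 + (\<Sum>i\<in>UNIV. (partial i \<phi> (snd y))\<^sup>2))"
      by (intro AE_I2) (auto simp: space_pair_measure intro: order_trans[OF _ abs_ge_self])
  qed
qed

text \<open>
For fixed time the spatial integral is at most the essential supremum times \<open>c\<close>. The essential supremum is not
known to be measurable in time, so the bound is divided by \<open>c\<close> first and the constant is pulled out of the
integral on the side of the measurable function \<open>J\<close>.
\<close>

lemma integrable_divergence_term:
  fixes divb :: "real \<Rightarrow> real^'n \<Rightarrow> real" and \<phi> :: "real^'n \<Rightarrow> real"
  assumes d: "L1_Linfty T divb" and \<phi>: "integrable lborel \<phi>"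
  shows "integrable (time T \<Otimes>\<^sub>M lborel) (\<lambda>y. divb (fst y) (snd y) * \<phi> (snd y))"
proof -
  let ?N = "time T \<Otimes>\<^sub>M (lborel :: (real^'n) measure)"
  have dm [measurable]: "(\<lambda>y. divb (fst y) (snd y)) \<in> borel_measurable ?N"
    using d unfolding L1_Linfty_def by (simp add: case_prod_beta')
  have \<phi>m [measurable]: "\<phi> \<in> borel_measurable borel" using \<phi> by (simp add: borel_measurable_integrable)
  define c where "c = (LINT x|lborel. \<bar>\<phi> x\<bar>) + 1"
  have c: "0 < c" unfolding c_def by (simp add: add_nonneg_pos)
  \<comment> \<open>Adding 1 keeps \<open>c\<close> positive when \<open>\<phi>\<close> vanishes.\<close>
  define J where "J s = (\<integral>\<^sup>+x. ennreal \<bar>divb s x * \<phi> x\<bar> \<partial>lborel)" for s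
  have mm: "(\<lambda>y. ennreal \<bar>divb (fst y) (snd y) * \<phi> (snd y)\<bar>) \<in> borel_measurable ?N"
    by measurable
  have Jm: "J \<in> borel_measurable (time T)"
    using lborel.borel_measurable_nn_integral_fst[OF mm] unfolding J_def[abs_def] by simp
  have J: "J s * ennreal (1 / c) \<le> esssup lborel (\<lambda>x. ennreal \<bar>divb s x\<bar>)" if "s \<in> {0..T}" for s
  proof -
    let ?E = "esssup lborel (\<lambda>x. ennreal \<bar>divb s x\<bar>)"
    have "J s \<le> (\<integral>\<^sup>+x. ?E * ennreal \<bar>\<phi> x\<bar> \<partial>lborel)"
      unfolding J_def
    proof (rule nn_integral_mono_AE)
      show "AE x in lborel. ennreal \<bar>divb s x * \<phi> x\<bar> \<le> ?E * ennreal \<bar>\<phi> x\<bar>"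
        using esssup_AE[of "\<lambda>x. ennreal \<bar>divb s x\<bar>" lborel]
      proof eventually_elim
        case (elim x)
        have "ennreal \<bar>divb s x * \<phi> x\<bar> = ennreal \<bar>divb s x\<bar> * ennreal \<bar>\<phi> x\<bar>" by (simp add: abs_mult ennreal_mult)
        also have "\<dots> \<le> ?E * ennreal \<bar>\<phi> x\<bar>" using elim by (rule mult_right_mono) simp
        finally show ?case .
      qed
    qed
    also have "\<dots> = ?E * (\<integral>\<^sup>+x. ennreal \<bar>\<phi> x\<bar> \<partial>lborel)" by (rule nn_integral_cmult) measurable
    also have "(\<integral>\<^sup>+x. ennreal \<bar>\<phi> x\<bar> \<partial>lborel) = ennreal (LINT x|lborel. \<bar>\<phi> x\<bar>)"
      using \<phi> by (intro nn_integral_eq_integral) auto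
    also have "?E * \<dots> \<le> ?E * ennreal c" unfolding c_def by (intro mult_left_mono ennreal_leI) auto
    finally have "J s * ennreal (1 / c) \<le> ?E * ennreal c * ennreal (1 / c)" by (rule mult_right_mono) simp
    also have "\<dots> = ?E * ennreal (c * (1 / c))" using c by (simp only: mult.assoc ennreal_mult'[symmetric] less_imp_le)
    also have "\<dots> = ?E" using c by simp
    finally show ?thesis .
  qed
  have "(\<integral>\<^sup>+s. J s \<partial>time T) * ennreal (1 / c) = (\<integral>\<^sup>+s. J s * ennreal (1 / c) \<partial>time T)"
    by (rule nn_integral_multc[symmetric, OF Jm])
  also have "\<dots> \<le> (\<integral>\<^sup>+s. esssup lborel (\<lambda>x. ennreal \<bar>divb s x\<bar>) \<partial>time T)"
    by (rule nn_integral_mono) (use J in auto)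
  also have "\<dots> < \<infinity>" using d unfolding L1_Linfty_def by blast
  finally have fin: "(\<integral>\<^sup>+s. J s \<partial>time T) < \<infinity>"
    using c by (auto simp: ennreal_mult_less_top)
  have "(\<integral>\<^sup>+y. ennreal \<bar>divb (fst y) (snd y) * \<phi> (snd y)\<bar> \<partial>?N) = (\<integral>\<^sup>+s. J s \<partial>time T)"
    using lborel.nn_integral_fst[OF mm] unfolding J_def by simp
  with fin show ?thesis by (intro integrableI_bounded) auto
qed

lemma integral_half_open_time:
  assumes "(f :: real \<Rightarrow> real) \<in> borel_measurable (time T)" and t: "0 \<le> t" "t \<le> T"
  shows "(LINT s|time T. indicator {0<..t} s * f s) = (LINT s:{0..t}|lborel. f s)"
proof -
  have m: "(indicator A :: real \<Rightarrow> real) \<in> borel_measurable (time T)" if "A \<in> sets borel" for A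
    using that by (intro borel_measurable_time) auto
  have "AE s in lborel. s \<noteq> (0::real)" by (rule AE_lborel_singleton)
  then have "AE s in time T. s \<noteq> (0::real)"
    unfolding time_def by (subst AE_restrict_space_iff) auto
  then have "AE s in time T. indicator {0<..t} s * f s = indicator {0..t} s * f s"
    by eventually_elim (auto split: split_indicator)
  then have "(LINT s|time T. indicator {0<..t} s * f s) = (LINT s|time T. indicator {0..t} s * f s)"
    using assms(1) m by (intro Bochner_Integration.integral_cong_AE borel_measurable_times) auto
  then show ?thesis by (subst set_integral_time[of _ T]) (use t in auto)
qed

context bounded_field
begin

text \<open>
The weak form is used twice: for \<open>\<phi>\<close> it gives the equation to be averaged and the bound on the sum of its
Stratonovich integrals, and for each \<open>\<partial>\<^sub>i\<phi>\<close> it gives the covariation with \<open>B\<^sup>i\<close>, which involves the averages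
against \<open>\<partial>\<^sub>i\<partial>\<^sub>i\<phi>\<close>. The resulting term with second derivatives is integrated by parts once with the weak
gradient \<open>G\<close>.
\<close>

lemma mean_equation:
  fixes b :: "real \<Rightarrow> real^'n \<Rightarrow> real^'n" and h :: "real \<Rightarrow> real^'n"
  assumes b: "L2_loc T b" and divb: "L1_Linfty T divb"
    and sol: "weak_solution M B T b divb u0 u"
    and h: "square_integrable (time T) h" and W: "wiener_integral M B T h W"
  defines "F \<equiv> stochastic_exponential T h W"
  defines "V \<equiv> \<lambda>t x. LINT \<omega>|M. u t x \<omega> * F \<omega>"
  assumes V: "continuous_in_L2 T V" and G: "L2_H1_gradient T V G"
    and \<phi>: "test_function UNIV \<phi>" and t: "t \<in> {0..T}"
  shows "(LINT x|lborel. V t x * \<phi> x) = (LINT x|lborel. u0 x * \<phi> x)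
     + (LINT s:{0..t}|lborel. LINT x|lborel. V s x * (b s x \<bullet> gradient \<phi> x + \<phi> x * divb s x))
     + (LINT s:{0..t}|lborel. LINT x|lborel. V s x * (h s \<bullet> gradient \<phi> x))
     - 1/2 * (LINT s:{0..t}|lborel. LINT x|lborel. G s x \<bullet> gradient \<phi> x)"
proof -
  note gir = girsanov[OF h W, folded F_def]
  have Fi: "integrable M F" by (rule integrable_if_fourth_power[OF gir(1,2)])
  have t': "0 \<le> t" "t \<le> T" using t by auto
  define c where "c \<eta> = (LINT x|lborel. u0 x * \<eta> x)" for \<eta>
  define \<psi> where "\<psi> \<eta> y = b (fst y) (snd y) \<bullet> gradient \<eta> (snd y) + divb (fst y) (snd y) * \<eta> (snd y)" for \<eta> and y :: "real \<times> (real^'n)"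
  define \<alpha> where "\<alpha> \<eta> r = C * (LINT y|time_space. indicator {0..r} (fst y) * \<bar>\<psi> \<eta> y\<bar>)" for \<eta> r
  have \<psi>1: "integrable time_space (\<lambda>y. b (fst y) (snd y) \<bullet> gradient \<eta> (snd y))"
    and \<psi>2: "integrable time_space (\<lambda>y. divb (fst y) (snd y) * \<eta> (snd y))" if "test_function UNIV \<eta>" for \<eta>
    using integrable_transport_term[OF b that] integrable_divergence_term[OF divb test_function_integrable(1)[OF that]] by auto
  have \<psi>i: "integrable time_space (\<psi> \<eta>)" if "test_function UNIV \<eta>" for \<eta>
    unfolding \<psi>_def using \<psi>1[OF that] \<psi>2[OF that] by (rule Bochner_Integration.integrable_add)

  \<comment> \<open>One truncated continuous modification is fixed for each test function, so that the first and second derivatives of \<open>\<phi>\<close> can share them.\<close>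
  define Z where "Z \<eta> = (SOME Z. tame_process (C * (LINT x|lborel. \<bar>\<eta> x\<bar>)) Z \<and> (\<forall>t\<in>{0..T}. AE \<omega> in M. Z t \<omega> = observable \<eta> t \<omega>))" for \<eta>
  define K where "K \<eta> = C * (LINT x|lborel. \<bar>\<eta> x\<bar>)" for \<eta> :: "real^'n \<Rightarrow> real"
  have Z: "tame_process (K \<eta>) (Z \<eta>)" "r \<in> {0..T} \<Longrightarrow> AE \<omega> in M. Z \<eta> r \<omega> = observable \<eta> r \<omega>"
    if \<eta>: "test_function UNIV \<eta>" for \<eta> r
  proof -
    from sol \<eta> obtain Y where Y: "continuous_semimartingale M past T Y"
      "\<forall>t\<in>{0..T}. AE \<omega> in M. Y t \<omega> = observable \<eta> t \<omega>"
      unfolding weak_solution_def observable_def by blast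
    have "\<exists>Z. tame_process (C * (LINT x|lborel. \<bar>\<eta> x\<bar>)) Z \<and> (\<forall>t\<in>{0..T}. AE \<omega> in M. Z t \<omega> = observable \<eta> t \<omega>)"
      by (rule tame_modification[OF Y(1) _ test_function_integrable(1)[OF \<eta>]]) (use Y(2) in blast)
    from someI_ex[OF this] show "tame_process (K \<eta>) (Z \<eta>)" "r \<in> {0..T} \<Longrightarrow> AE \<omega> in M. Z \<eta> r \<omega> = observable \<eta> r \<omega>"
      unfolding Z_def K_def by blast+
  qed
  define sol_at where "sol_at \<eta> r I \<longleftrightarrow> (\<forall>i. stratonovich_integral M (observable (partial i \<eta>)) (\<lambda>s \<omega>. B s \<omega> $ i) r (I i)) \<and>
      (AE \<omega> in M. observable \<eta> r \<omega> = c \<eta> + drift (\<lambda>y. b (fst y) (snd y) \<bullet> gradient \<eta> (snd y)) r \<omega>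
         + drift (\<lambda>y. divb (fst y) (snd y) * \<eta> (snd y)) r \<omega> + (\<Sum>i\<in>UNIV. I i \<omega>))" for \<eta> r and I :: "'n \<Rightarrow> 'w \<Rightarrow> real"
  define I where "I \<eta> r = (SOME I. sol_at \<eta> r I)" for \<eta> r
  have I0: "sol_at \<eta> r (I \<eta> r)" if \<eta>: "test_function UNIV \<eta>" and r: "r \<in> {0..T}" for \<eta> r
  proof -
    have "\<exists>I. sol_at \<eta> r I"
    proof -
      have d2: "(LINT s:{0..r}|lborel. LINT x|lborel. divb s x * u s x \<omega> * \<eta> x) = drift (\<lambda>y. divb (fst y) (snd y) * \<eta> (snd y)) r \<omega>" for \<omega>
        unfolding drift_def by (simp add: mult_ac)
      have d1: "(LINT s:{0..r}|lborel. LINT x|lborel. u s x \<omega> * (b s x \<bullet> gradient \<eta> x)) = drift (\<lambda>y. b (fst y) (snd y) \<bullet> gradient \<eta> (snd y)) r \<omega>" for \<omega>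
        unfolding drift_def by simp
      from sol \<eta> r obtain I where
        "\<forall>i. stratonovich_integral M (\<lambda>s \<omega>. LINT x|lborel. u s x \<omega> * partial i \<eta> x) (\<lambda>s \<omega>. B s \<omega> $ i) r (I i)"
        "AE \<omega> in M. (LINT x|lborel. u r x \<omega> * \<eta> x) = (LINT x|lborel. u0 x * \<eta> x)
          + (LINT s:{0..r}|lborel. LINT x|lborel. u s x \<omega> * (b s x \<bullet> gradient \<eta> x))
          + (LINT s:{0..r}|lborel. LINT x|lborel. divb s x * u s x \<omega> * \<eta> x) + (\<Sum>i\<in>UNIV. I i \<omega>)"
        unfolding weak_solution_def by blast
      then have "sol_at \<eta> r I" unfolding sol_at_def observable_def[abs_def] c_def d1 d2 by blast
      then show ?thesis by blast
    qed
    then show ?thesis unfolding I_def by (rule someI_ex)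
  qed
  have strat: "stratonovich_integral M (Z (partial i \<eta>)) (\<lambda>s \<omega>. B s \<omega> $ i) r (I \<eta> r i)"
    if \<eta>: "test_function UNIV \<eta>" and r: "r \<in> {0..T}" for \<eta> r i
  proof (rule stratonovich_integral_modification)
    note p = test_function_partial[OF \<eta>, of i]
    show "stratonovich_integral M (observable (partial i \<eta>)) (\<lambda>s \<omega>. B s \<omega> $ i) r (I \<eta> r i)"
      using I0[OF \<eta> r] unfolding sol_at_def by blast
    fix q assume "q \<in> {0..r}"
    then have q: "q \<in> {0..T}" using r by auto
    show "AE \<omega> in M. observable (partial i \<eta>) q \<omega> = Z (partial i \<eta>) q \<omega>"
      using Z(2)[OF p q] by eventually_elim simp
    show "observable (partial i \<eta>) q \<in> borel_measurable M" by (rule observable_measurable[OF q test_functionD(2)[OF p]])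
    show "Z (partial i \<eta>) q \<in> borel_measurable M" using tame_processD(6)[OF Z(1)[OF p]] q by simp
    show "(\<lambda>\<omega>. B q \<omega> $ i) \<in> borel_measurable M" by (rule measurable_component[OF B_measurable[OF q]])
  qed
  have Zeq: "AE \<omega> in M. Z \<eta> r \<omega> = c \<eta> + drift (\<psi> \<eta>) r \<omega> + (\<Sum>i\<in>UNIV. I \<eta> r i \<omega>)"
    if \<eta>: "test_function UNIV \<eta>" and r: "r \<in> {0..T}" for \<eta> r
  proof -
    have r': "0 \<le> r" "r \<le> T" using r by auto
    from I0[OF \<eta> r] have "AE \<omega> in M. observable \<eta> r \<omega> = c \<eta> + drift (\<lambda>y. b (fst y) (snd y) \<bullet> gradient \<eta> (snd y)) r \<omega>
         + drift (\<lambda>y. divb (fst y) (snd y) * \<eta> (snd y)) r \<omega> + (\<Sum>i\<in>UNIV. I \<eta> r i \<omega>)" unfolding sol_at_def by blast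
    with Z(2)[OF \<eta> r] drift_add[OF \<psi>1[OF \<eta>] \<psi>2[OF \<eta>] r'] show ?thesis
      unfolding \<psi>_def[abs_def] by eventually_elim simp
  qed
  have increments: "AE \<omega> in M. \<bar>(Z \<eta> s \<omega> - Z \<eta> r \<omega>) - (\<Sum>j\<in>UNIV. I \<eta> s j \<omega> - I \<eta> r j \<omega>)\<bar> \<le> \<alpha> \<eta> s - \<alpha> \<eta> r"
    if \<eta>: "test_function UNIV \<eta>" and rs: "0 \<le> r" "r \<le> s" "s \<le> T" for \<eta> r s
  proof -
    have "r \<in> {0..T}" "s \<in> {0..T}" using rs by auto
    from Zeq[OF \<eta> this(1)] Zeq[OF \<eta> this(2)] drift_increment[OF \<psi>i[OF \<eta>] rs] show ?thesis
      unfolding \<alpha>_def by eventually_elim (simp add: sum_subtractf algebra_simps)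
  qed

  note p1 = test_function_partial[OF \<phi>] and p2 = test_function_partial[OF test_function_partial[OF \<phi>]]
  define D2 where "D2 i = partial i (partial i \<phi>)" for i
  have D2: "test_function UNIV (D2 i)" for i unfolding D2_def by (rule p2)
  have cov: "(\<lambda>n. prob_size (\<lambda>\<omega>.
      (\<Sum>k<n. (Z (partial i \<phi>) (grid t n (Suc k)) \<omega> - Z (partial i \<phi>) (grid t n k) \<omega>) * incr (grid t n k) (grid t n (Suc k)) i \<omega>)
      - (\<Sum>k<n. Z (D2 i) (grid t n k) \<omega> * (t / n)))) \<longlonglongrightarrow> 0" for i
    unfolding D2_def
  proof (rule covariation_tendsto[OF t', where Z = "\<lambda>j. Z (partial j (partial i \<phi>))" and I = "\<lambda>j r. I (partial i \<phi>) r j"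
        and \<alpha> = "\<alpha> (partial i \<phi>)" and C = "\<lambda>j. K (partial j (partial i \<phi>))"])
    show "Z (partial i \<phi>) s \<in> borel_measurable M" if "0 \<le> s" "s \<le> t" for s
      using tame_processD(6)[OF Z(1)[OF p1]] that t' by simp
    show "tame_process (K (partial j (partial i \<phi>))) (Z (partial j (partial i \<phi>)))" for j by (rule Z(1)[OF p2])
    show "stratonovich_integral M (Z (partial j (partial i \<phi>))) (\<lambda>s \<omega>. B s \<omega> $ j) s (I (partial i \<phi>) s j)"
      if "0 \<le> s" "s \<le> t" for j s using strat[OF p1] that t' by simp
    show "AE \<omega> in M. \<bar>Z (partial i \<phi>) s \<omega> - Z (partial i \<phi>) r \<omega> - (\<Sum>j\<in>UNIV. I (partial i \<phi>) s j \<omega> - I (partial i \<phi>) r j \<omega>)\<bar>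
        \<le> \<alpha> (partial i \<phi>) s - \<alpha> (partial i \<phi>) r" if "0 \<le> r" "r \<le> s" "s \<le> t" for s r
      by (rule increments[OF p1]) (use that t' in auto)
  qed
  have drift_bd: "AE \<omega> in M. \<bar>drift (\<psi> \<phi>) t \<omega>\<bar> \<le> \<alpha> \<phi> t - \<alpha> \<phi> 0"
    using drift_increment[OF \<psi>i[OF \<phi>] order_refl t'] unfolding drift_zero \<alpha>_def by simp
  have bdd: "AE \<omega> in M. \<bar>\<Sum>i\<in>UNIV. I \<phi> t i \<omega>\<bar> \<le> K \<phi> + \<bar>c \<phi>\<bar> + (\<alpha> \<phi> t - \<alpha> \<phi> 0)"
    using Zeq[OF \<phi> t] drift_bd
  proof eventually_elim
    case (elim \<omega>)
    then show ?case using tame_processD(2)[OF Z(1)[OF \<phi>], of t \<omega>] by linarith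
  qed
  note main = expectation_stratonovich_integral[OF h W t' Z(1)[OF p1] Z(1)[OF D2] strat[OF \<phi> t] cov bdd, folded F_def]

  have FZ: "integrable M (\<lambda>\<omega>. F \<omega> * Z \<phi> t \<omega>)"
  proof (rule Bochner_Integration.integrable_bound)
    show "integrable M (\<lambda>\<omega>. K \<phi> * F \<omega>)" using Fi by auto
    have "\<bar>F \<omega>\<bar> * \<bar>Z \<phi> t \<omega>\<bar> \<le> \<bar>F \<omega>\<bar> * \<bar>K \<phi>\<bar>" for \<omega>
      by (intro mult_left_mono order_trans[OF tame_processD(2)[OF Z(1)[OF \<phi>]] abs_ge_self]) auto
    then show "AE \<omega> in M. norm (F \<omega> * Z \<phi> t \<omega>) \<le> norm (K \<phi> * F \<omega>)" by (auto simp: abs_mult mult.commute)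
  qed (use gir(1) tame_processD(6)[OF Z(1)[OF \<phi>] t'] in auto)
  note Fd = drift_expectation[OF \<psi>i[OF \<phi>] t' Fi]
  have Im: "I \<phi> t i \<in> borel_measurable M" for i using strat[OF \<phi> t] by (rule stratonovich_integral_measurable)
  have "expectation (\<lambda>\<omega>. F \<omega> * (\<Sum>i\<in>UNIV. I \<phi> t i \<omega>)) = expectation (\<lambda>\<omega>. F \<omega> * Z \<phi> t \<omega> - c \<phi> * F \<omega> - F \<omega> * drift (\<psi> \<phi>) t \<omega>)"
  proof (rule Bochner_Integration.integral_cong_AE)
    show "AE \<omega> in M. F \<omega> * (\<Sum>i\<in>UNIV. I \<phi> t i \<omega>) = F \<omega> * Z \<phi> t \<omega> - c \<phi> * F \<omega> - F \<omega> * drift (\<psi> \<phi>) t \<omega>"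
      using Zeq[OF \<phi> t] by eventually_elim (simp add: algebra_simps)
  qed (use gir(1) Im FZ Fd(1) Fi in auto)
  also have "\<dots> = expectation (\<lambda>\<omega>. F \<omega> * Z \<phi> t \<omega>) - c \<phi> - expectation (\<lambda>\<omega>. F \<omega> * drift (\<psi> \<phi>) t \<omega>)"
    using FZ Fd(1) Fi gir(3) by simp
  finally have balance: "expectation (\<lambda>\<omega>. F \<omega> * Z \<phi> t \<omega>) = c \<phi> + expectation (\<lambda>\<omega>. F \<omega> * drift (\<psi> \<phi>) t \<omega>)
      + expectation (\<lambda>\<omega>. F \<omega> * (\<Sum>i\<in>UNIV. I \<phi> t i \<omega>))" by simp

  have mean: "expectation (\<lambda>\<omega>. F \<omega> * Z \<eta> s \<omega>) = (LINT x|lborel. V s x * \<eta> x)"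
    if \<eta>: "test_function UNIV \<eta>" and s: "s \<in> {0..T}" for \<eta> s
    unfolding V_def by (rule weighted_mean_observable[OF Fi \<eta> Z(1)[OF \<eta>] Z(2)[OF \<eta>] V[unfolded V_def] s])
  have mean_cont: "continuous_on {0..T} (\<lambda>s. expectation (\<lambda>\<omega>. F \<omega> * Z \<eta> s \<omega>))" if \<eta>: "test_function UNIV \<eta>" for \<eta>
    by (rule weighted_mean_continuous[OF Fi Z(1)[OF \<eta>]])
  have V\<eta>: "integrable lborel (\<lambda>x. V s x * \<eta> x)" if \<eta>: "test_function UNIV \<eta>" and s: "s \<in> {0..T}" for \<eta> s
    by (rule integrable_square_product)
      (use V s test_functionD(2)[OF \<eta>] test_function_integrable[OF \<eta>] in \<open>auto simp: continuous_in_L2_def square_integrable_def\<close>)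
  have sub: "{0..t} \<subseteq> {0..T}" using t' by auto

  have term_drift: "expectation (\<lambda>\<omega>. F \<omega> * drift (\<psi> \<phi>) t \<omega>) =
      (LINT s:{0..t}|lborel. LINT x|lborel. V s x * (b s x \<bullet> gradient \<phi> x + \<phi> x * divb s x))"
    unfolding Fd(2) V_def \<psi>_def by (simp add: mult.commute)

  define g1 where "g1 i s = expectation (\<lambda>\<omega>. F \<omega> * Z (partial i \<phi>) s \<omega>)" for i s
  define g2 where "g2 i s = expectation (\<lambda>\<omega>. F \<omega> * Z (D2 i) s \<omega>)" for i s
  have g1c: "continuous_on {0..T} (g1 i)" and g2c: "continuous_on {0..T} (g2 i)" for i
    unfolding g1_def[abs_def] g2_def[abs_def] by (rule mean_cont[OF p1] mean_cont[OF D2])+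
  have indm: "(indicator A :: real \<Rightarrow> real) \<in> borel_measurable (time T)" if "A \<in> sets borel" for A
    using that by (intro borel_measurable_time) auto
  have ind_int: "integrable (time T) (\<lambda>s. indicator {0<..t} s * f s)" if "integrable (time T) f" for f :: "real \<Rightarrow> real"
    by (rule Bochner_Integration.integrable_bound[OF that]) (use that indm in \<open>auto split: split_indicator\<close>)
  have hg: "integrable (time T) (\<lambda>s. h s $ i * g1 i s)" for i
    by (rule integrable_times_continuous[OF integrable_component[OF h] g1c])

  have term_h: "(\<Sum>i\<in>UNIV. LINT s|time T. indicator {0<..t} s * (h s $ i * g1 i s)) =
      (LINT s:{0..t}|lborel. LINT x|lborel. V s x * (h s \<bullet> gradient \<phi> x))"
  proof -
    have "(\<Sum>i\<in>UNIV. LINT s|time T. indicator {0<..t} s * (h s $ i * g1 i s)) =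
        (LINT s|time T. indicator {0<..t} s * (\<Sum>i\<in>UNIV. h s $ i * g1 i s))"
      unfolding sum_distrib_left by (rule Bochner_Integration.integral_sum[symmetric]) (rule ind_int[OF hg])
    also have "\<dots> = (LINT s:{0..t}|lborel. (\<Sum>i\<in>UNIV. h s $ i * g1 i s))"
      using hg by (intro integral_half_open_time t' borel_measurable_sum) auto
    also have "\<dots> = (LINT s:{0..t}|lborel. LINT x|lborel. V s x * (h s \<bullet> gradient \<phi> x))"
    proof (rule set_lebesgue_integral_cong)
      show "\<forall>s. s \<in> {0..t} \<longrightarrow> (\<Sum>i\<in>UNIV. h s $ i * g1 i s) = (LINT x|lborel. V s x * (h s \<bullet> gradient \<phi> x))"
      proof (intro allI impI)
        fix s assume "s \<in> {0..t}"
        then have s: "s \<in> {0..T}" using sub by blast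
        have "(LINT x|lborel. V s x * (h s \<bullet> gradient \<phi> x)) = (LINT x|lborel. (\<Sum>i\<in>UNIV. h s $ i * (V s x * partial i \<phi> x)))"
          by (simp add: inner_vec_def gradient_def sum_distrib_left mult_ac)
        also have "\<dots> = (\<Sum>i\<in>UNIV. LINT x|lborel. h s $ i * (V s x * partial i \<phi> x))"
          by (rule Bochner_Integration.integral_sum) (intro Bochner_Integration.integrable_mult_right V\<eta>[OF p1 s])
        also have "\<dots> = (\<Sum>i\<in>UNIV. h s $ i * g1 i s)"
          unfolding g1_def mean[OF p1 s] by simp
        finally show "(\<Sum>i\<in>UNIV. h s $ i * g1 i s) = (LINT x|lborel. V s x * (h s \<bullet> gradient \<phi> x))" ..
      qed
    qed simp
    finally show ?thesis .
  qed

  have term_G: "(\<Sum>i\<in>UNIV. LINT s|time T. indicator {0<..t} s * g2 i s) =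
      - (LINT s:{0..t}|lborel. LINT x|lborel. G s x \<bullet> gradient \<phi> x)"
  proof -
    interpret tm: finite_measure "time T" by (rule finite_measure_time)
    have g2i: "integrable (time T) (g2 i)" for i
      using integrable_times_continuous[of T "\<lambda>_. 1", OF _ g2c] by simp
    have Gm: "(\<lambda>y. G (fst y) (snd y)) \<in> borel_measurable time_space"
      using G unfolding L2_H1_gradient_def square_integrable_def by (simp add: case_prod_beta')
    define q where "q s = (LINT x|lborel. G s x \<bullet> gradient \<phi> x)" for s
    have qm: "q \<in> borel_measurable (time T)"
    proof -
      have "(\<lambda>y. \<Sum>i\<in>UNIV. G (fst y) (snd y) $ i * partial i \<phi> (snd y)) \<in> borel_measurable time_space"
        using measurable_component[OF Gm] test_functionD(2)[OF p1]
        by (intro borel_measurable_sum borel_measurable_times) auto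
      then have "(\<lambda>(s, x). G s x \<bullet> gradient \<phi> x) \<in> borel_measurable time_space"
        by (simp add: inner_vec_def gradient_def case_prod_beta')
      from lborel.borel_measurable_lebesgue_integral[OF this] show ?thesis unfolding q_def[abs_def] .
    qed
    have ae: "AE s in time T. (\<Sum>i\<in>UNIV. g2 i s) = - q s"
    proof -
      have "AE s in time T. H1_gradient (V s) (G s)" using G unfolding L2_H1_gradient_def by blast
      then show ?thesis
        using AE_space
      proof eventually_elim
        case (elim s)
        then have s: "s \<in> {0..T}" by simp
        have Gs: "G s \<in> borel_measurable lborel" "integrable lborel (\<lambda>x. (norm (G s x))\<^sup>2)"
          and parts: "\<And>i. (LINT x|lborel. V s x * partial i (partial i \<phi>) x) = - (LINT x|lborel. G s x $ i * partial i \<phi> x)"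
          using elim(1) p1 unfolding H1_gradient_def square_integrable_def by auto
        have Gi: "integrable lborel (\<lambda>x. G s x $ i * partial i \<phi> x)" for i
        proof (rule integrable_square_product)
          show c: "(\<lambda>x. G s x $ i) \<in> borel_measurable lborel" by (rule measurable_component[OF Gs(1)])
          show "integrable lborel (\<lambda>x. (G s x $ i)\<^sup>2)"
          proof (rule Bochner_Integration.integrable_bound[OF Gs(2)])
            have "(y $ i)\<^sup>2 \<le> (norm y)\<^sup>2" for y :: "real^'n"
              using power_mono[OF component_le_norm_cart[of y i], of 2] by simp
            then show "AE x in lborel. norm ((G s x $ i)\<^sup>2) \<le> norm ((norm (G s x))\<^sup>2)" by simp
          qed (use c in auto)
        qed (use test_functionD(2)[OF p1] test_function_integrable[OF p1] in auto)
        have "q s = (LINT x|lborel. (\<Sum>i\<in>UNIV. G s x $ i * partial i \<phi> x))"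
          unfolding q_def by (simp add: inner_vec_def gradient_def)
        also have "\<dots> = (\<Sum>i\<in>UNIV. LINT x|lborel. G s x $ i * partial i \<phi> x)"
          by (rule Bochner_Integration.integral_sum) (rule Gi)
        also have "\<dots> = - (\<Sum>i\<in>UNIV. g2 i s)"
          unfolding g2_def mean[OF D2 s] unfolding D2_def parts by (simp add: sum_negf)
        finally show ?case by simp
      qed
    qed
    have "(\<Sum>i\<in>UNIV. LINT s|time T. indicator {0<..t} s * g2 i s) =
        (LINT s|time T. indicator {0<..t} s * (\<Sum>i\<in>UNIV. g2 i s))"
      unfolding sum_distrib_left by (rule Bochner_Integration.integral_sum[symmetric]) (rule ind_int[OF g2i])
    also have "\<dots> = (LINT s|time T. indicator {0<..t} s * - q s)"
    proof (rule Bochner_Integration.integral_cong_AE)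
      show "AE s in time T. indicator {0<..t} s * (\<Sum>i\<in>UNIV. g2 i s) = indicator {0<..t} s * - q s"
        using ae by eventually_elim simp
      show "(\<lambda>s. indicator {0<..t} s * (\<Sum>i\<in>UNIV. g2 i s)) \<in> borel_measurable (time T)"
        using continuous_on_time(1)[OF g2c] indm by (intro borel_measurable_times borel_measurable_sum) auto
      show "(\<lambda>s. indicator {0<..t} s * - q s) \<in> borel_measurable (time T)"
        using qm indm by (intro borel_measurable_times borel_measurable_uminus) auto
    qed
    also have "\<dots> = - (LINT s|time T. indicator {0<..t} s * q s)" by simp
    also have "(LINT s|time T. indicator {0<..t} s * q s) = (LINT s:{0..t}|lborel. q s)"
      by (rule integral_half_open_time[OF qm t'])
    finally show ?thesis unfolding q_def .
  qed

  show ?thesis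
    using balance main mean[OF \<phi> t] term_drift term_h term_G unfolding g1_def g2_def c_def by simp
qed

end

theorem lemma2p6:
  fixes M :: "'w measure" and B :: "real \<Rightarrow> 'w \<Rightarrow> real^'n" and T :: real
    and b :: "real \<Rightarrow> real^'n \<Rightarrow> real^'n" and divb :: "real \<Rightarrow> real^'n \<Rightarrow> real"
    and u0 :: "real^'n \<Rightarrow> real" and u :: "real \<Rightarrow> real^'n \<Rightarrow> 'w \<Rightarrow> real"
    and h :: "real \<Rightarrow> real^'n" and W :: "'w \<Rightarrow> real"
  assumes "0 < T"
    and "brownian_space M B T"
    and "L2_loc T b"
    and "distributional_divergence T b divb"
    and "L1_Linfty T divb"
    and "square_integrable lborel u0"
    and "essentially_bounded lborel u0"
    and "quasiregular_weak_solution M B T b divb u0 u"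
    and "square_integrable (time T) h"
    and "wiener_integral M B T h W"
  shows "let V = (\<lambda>t x. LINT \<omega>|M. u t x \<omega> * stochastic_exponential T h W \<omega>) in
           parabolic_weak_solution T b divb h V \<and> (AE x in lborel. V 0 x = u0 x)"
proof -
  define V where "V = (\<lambda>t x. LINT \<omega>|M. u t x \<omega> * stochastic_exponential T h W \<omega>)"
  from assms(8) have um: "(\<lambda>(\<omega>, t, x). u t x \<omega>) \<in> borel_measurable (M \<Otimes>\<^sub>M (time T \<Otimes>\<^sub>M lborel))"
    and ub: "\<exists>C. AE p in M \<Otimes>\<^sub>M (time T \<Otimes>\<^sub>M lborel). \<bar>case p of (\<omega>, t, x) \<Rightarrow> u t x \<omega>\<bar> \<le> C"
    and sol: "weak_solution M B T b divb u0 u" and reg: "regular_in_mean M B T u"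
    unfolding quasiregular_weak_solution_def essentially_bounded_def by auto
  from ub obtain C where C: "AE p in M \<Otimes>\<^sub>M (time T \<Otimes>\<^sub>M lborel). \<bar>case p of (\<omega>, t, x) \<Rightarrow> u t x \<omega>\<bar> \<le> C" by blast
  interpret brownian_space M B T by fact
  interpret bounded_field M B T u "\<bar>C\<bar>"
  proof unfold_locales
    show "AE p in M \<Otimes>\<^sub>M (time T \<Otimes>\<^sub>M lborel). \<bar>case p of (\<omega>, t, x) \<Rightarrow> u t x \<omega>\<bar> \<le> \<bar>C\<bar>"
      using C by eventually_elim linarith
  qed (use assms(1) um in auto)
  have "stochastic_exponential T h W \<in> stochastic_exponentials M B T"
    using assms(9,10) unfolding stochastic_exponentials_def by blast
  with reg obtain G where G: "L2_H1_gradient T V G" and VL2: "continuous_in_L2 T V"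
    unfolding regular_in_mean_def V_def Let_def by blast
  have eq: "(LINT x|lborel. V t x * \<phi> x) = (LINT x|lborel. u0 x * \<phi> x)
     + (LINT s:{0..t}|lborel. LINT x|lborel. V s x * (b s x \<bullet> gradient \<phi> x + \<phi> x * divb s x))
     + (LINT s:{0..t}|lborel. LINT x|lborel. V s x * (h s \<bullet> gradient \<phi> x))
     - 1/2 * (LINT s:{0..t}|lborel. LINT x|lborel. G s x \<bullet> gradient \<phi> x)"
    if "test_function UNIV \<phi>" "t \<in> {0..T}" for \<phi> t
    unfolding V_def
    by (rule mean_equation[OF assms(3,5) sol assms(9,10) VL2[unfolded V_def] G[unfolded V_def] that])
  have zero: "0 \<in> {0..T}" using assms(1) by simp
  \<comment> \<open>At time 0 all time integrals are over a single point.\<close>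
  have init: "(LINT x|lborel. V 0 x * \<phi> x) = (LINT x|lborel. u0 x * \<phi> x)" if "test_function UNIV \<phi>" for \<phi>
    using eq[OF that zero] unfolding set_integral_singleton by simp
  have "parabolic_weak_solution T b divb h V"
    unfolding parabolic_weak_solution_def
    using G eq init by (intro exI[of _ G] conjI allI impI ballI) auto
  moreover have "AE x in lborel. V 0 x = u0 x"
  proof -
    have V0: "V 0 \<in> borel_measurable lborel" "integrable lborel (\<lambda>x. (V 0 x)\<^sup>2)"
      using VL2 zero unfolding continuous_in_L2_def square_integrable_def by auto
    have U0: "u0 \<in> borel_measurable lborel" "integrable lborel (\<lambda>x. (u0 x)\<^sup>2)"
      using assms(6) unfolding square_integrable_def by auto
    have "AE x in lborel. V 0 x - u0 x = 0"
    proof (rule AE_zero_if_orthogonal_to_test_functions)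
      show "(\<lambda>x. V 0 x - u0 x) \<in> borel_measurable lborel" using V0 U0 by auto
      have e: "(V 0 x - u0 x)\<^sup>2 = (V 0 x)\<^sup>2 + (u0 x)\<^sup>2 - 2 * (V 0 x * u0 x)" for x
        by (simp add: power2_eq_square algebra_simps)
      show "integrable lborel (\<lambda>x. (V 0 x - u0 x)\<^sup>2)"
        unfolding e using V0 U0 integrable_square_product[OF V0(1) U0(1) V0(2) U0(2)]
        by (intro Bochner_Integration.integrable_diff Bochner_Integration.integrable_add Bochner_Integration.integrable_mult_right) auto
      fix \<phi> :: "real^'n \<Rightarrow> real" assume \<phi>: "test_function UNIV \<phi>"
      have i: "integrable lborel (\<lambda>x. f x * \<phi> x)" if "f \<in> borel_measurable lborel" "integrable lborel (\<lambda>x. (f x)\<^sup>2)" for f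
        by (rule integrable_square_product[OF that(1) _ that(2)])
          (use test_functionD(2)[OF \<phi>] test_function_integrable[OF \<phi>] in auto)
      show "(LINT x|lborel. (V 0 x - u0 x) * \<phi> x) = 0"
        using i[OF V0] i[OF U0] init[OF \<phi>] by (simp add: left_diff_distrib)
    qed
    then show ?thesis by eventually_elim simp
  qed
  ultimately show ?thesis unfolding V_def Let_def by blast
qed

end
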